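(* Let $(U,\mathcal{U})$ be a measurable space and let $r,g,l$ satisfy: (a) $r:[0,T]\times K\times K\times U\to\mathbb{R}$ is $\mathcal{B}([0,T])\otimes\mathcal{K}\otimes\mathcal{K}\otimes\mathcal{U}$-measurable and there is a constant $C_r>0$ with $0\le r(t,x,y,u)\le C_r$ for all $t\in[0,T]$, $x,y\in K$, $u\in U$; (b) $g:K\to\mathbb{R}$ is $\mathcal{K}$-measurable and $\mathbb{E}^{t,x}|g(X_T)|^2<\infty$ for all $t\in[0,T]$, $x\in K$; (c) $l:[0,T]\times K\times U\to\mathbb{R}$ is $\mathcal{B}([0,T])\otimes\mathcal{K}\otimes\mathcal{U}$-measurable and there exists $\alpha>1$ such that for every $t\in[0,T]$, $x\in K$, $u(\cdot)\in\mathcal{A}^t$, $$\inf_{u\in U}l(t,x,u)>-\infty,\qquad \mathbb{E}^{t,x}\int_t^T\Big|\inf_{u\in U}l(s,X_s,u)\Big|^2ds<\infty,\qquad \mathbb{E}^{t,x}\Big(\int_t^T|l(s,X_s,u_s)|\,ds\Big)^\alpha<\infty.$$ Define, for $s\in[0,T]$, $x\in K$, $z\in L^2(K,\mathcal{K},\nu(s,x,dy))$, $$f(s,x,z(\cdot))=\inf_{u\in U}\Big\{l(s,x,u)+\int_K z(y)\,(r(s,x,y,u)-1)\,\nu(s,x,dy)\Big\},$$ and let $\Gamma(s,x,z(\cdot))$ be the set of $u\in U$ attaining this infimum. Let $v$ be the unique solution (in the sense defined in the context) of the Hamilton-Jacobi-Bellman equation $$v(t,x)=g(x)+\int_t^T\mathcal{L}_sv(s,x)\,ds+\int_t^Tf\big(s,x,v(s,\cdot)-v(s,x)\big)\,ds,\qquad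 t\in[0,T],\ x\in K.$$ Assume that the sets $\Gamma(s,x,z(\cdot))$ are nonempty and that for every $t\in[0,T]$, $x\in K$ one can find an $\mathbb{F}^t$-predictable $U$-valued process $u^{*,t,x}$ with $u^{*,t,x}_s\in\Gamma(s,X_{s-},v(s,\cdot)-v(s,X_{s-}))$, $\mathbb{P}^{t,x}$-a.s. for almost all $s\in[t,T]$. For $(t,x)\in[0,T]\times K$ let $(Y^{t,x},Z^{t,x})$ be the unique solution in $\mathbb{M}^{t,x}$ of the BSDE: $\mathbb{P}^{t,x}$-a.s., $$Y^{t,x}_s+\int_s^T\int_KZ^{t,x}_r(y)\,q^t(dr\,dy)=g(X_T)+\int_s^Tf(r,X_r,Z^{t,x}_r(\cdot))\,dr,\qquad s\in[t,T].$$ Then for every $(t,x)\in[0,T]\times K$ $$Y^{t,x}_s=v(s,X_s),\qquad Z^{t,x}_s(y)=v(s,y)-v(s,X_{s-}),$$ where the first equality means that, $\mathbb{P}^{t,x}$-a.s., it holds for all $s\in[t,T]$, and the second means that it holds for almost all $(\omega,s,y)$ with respect to $\nu(s,X_{s-}(\omega),dy)\,\mathbb{P}^{t,x}(d\omega)\,ds$, i.e. $\mathbb{E}^{t,x}\int_t^T\int_K|Z^{t,x}_s(y)-v(s,y)+v(s,X_{s-})|^2\,\nu(s,X_{s-},dy)\,ds=0$. In particular, the value function and an optimal control are given by the formulae $$v(t,x)=Y^{t,x}_t,\qquad u^{*,t,x}_s=\underline{u}(s,X_{s-},Z^{t,x}_s(\cdot)),$$ where $\underline{u}(s,x,z(\cdot))$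 denotes an element of $\Gamma(s,x,z(\cdot))$, i.e. a minimizer in the definition of $f(s,x,z(\cdot))$.
   Context: Setting. $T>0$ is fixed. $(K,\mathcal{K})$ is a measurable space such that $\mathcal{K}$ contains all one-point sets. $\nu(t,x,A)$ ($t\in[0,\infty)$, $x\in K$, $A\in\mathcal{K}$) is a rate measure: $A\mapsto\nu(t,x,A)$ is a positive measure on $\mathcal{K}$, $(t,x)\mapsto\nu(t,x,A)$ is $\mathcal{B}([0,\infty))\otimes\mathcal{K}$-measurable, $\sup_{t\in[0,T],x\in K}\nu(t,x,K)<\infty$, and $\nu(t,x,\{x\})=0$ for all $t,x$. Put $\lambda(t,x)=\nu(t,x,K)$, and $\pi(t,x,A)=\nu(t,x,A)/\lambda(t,x)$ if $\lambda(t,x)>0$, $\pi(t,x,A)=1_A(x)$ if $\lambda(t,x)=0$. Markov process. $X:\Omega\times[0,\infty)\to K$ is a function on a set $\Omega$; for $I\subset[0,\infty)$, $\mathcal{F}_I=\sigma(X_t,\ t\in I)$; for each $(t,x)\in[0,\infty)\times K$ a probability $\mathbb{P}^{t,x}$ (expectation $\mathbb{E}^{t,x}$) is given on $(\Omega,\mathcal{F}_{[t,\infty)})$ such that: $\mathbb{P}^{t,x}(X_t=x)=1$; for $0\le t\le s$ and $A\in\mathcal{K}$ the map $x\mapsto\mathbb{P}^{t,x}(X_s\in A)$ is $\mathcal{K}$-measurable; for $0\le u\le t\le s$, $A\in\mathcal{K}$, $\mathbb{P}^{u,x}(X_s\in A\,|\,\mathcal{F}_{[u,t]})=\mathbb{P}^{t,X_t}(X_s\in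 A)$, $\mathbb{P}^{u,x}$-a.s.; for every $\omega$ and $t\ge0$ there is $\delta>0$ with $X_s(\omega)=X_t(\omega)$ for $s\in[t,t+\delta]$; every trajectory has finitely many jumps on every bounded interval. Moreover, with $T_1=\inf\{s>t: X_s\ne X_t\}$ ($\inf\emptyset=\infty$), for $0\le t\le a<b\le\infty$, $x\in K$, $A\in\mathcal{K}$, $$\mathbb{P}^{t,x}(T_1\in(a,b),\,X_{T_1}\in A)=\int_a^b\pi(s,x,A)\,\lambda(s,x)\exp\Big(-\int_t^s\lambda(r,x)\,dr\Big)ds.$$ $X_{s-}$ denotes the left limit of the piecewise constant trajectory at $s$. Random measures. For fixed $t$: $\mathbb{F}^t=(\mathcal{F}_{[t,s]})_{s\ge t}$; $\mathcal{P}^t$ and $Prog^t$ are the $\mathbb{F}^t$-predictable and $\mathbb{F}^t$-progressive $\sigma$-algebras on $\Omega\times[t,T]$; $T_0^t=t$, $T_{n+1}^t=\inf\{s>T_n^t: X_s\neq X_{T_n^t}\}$ ($\inf\emptyset=\infty$); $p^t(ds\,dy)=\sum_{n\ge1,\,T_n^t<\infty}\delta_{(T_n^t,X_{T_n^t})}(ds\,dy)$ on $(t,\infty)\times K$. Its compensator under $\mathbb{P}^{t,x}$ is $\nu(s,X_{s-},dy)\,ds$, and $q^t(ds\,dy)=p^t(ds\,dy)-\nu(s,X_{s-},dy)\,ds$; integrals with respect to $q^t$ are differences of ordinary (pathwise) integrals, defined for $\mathcal{P}^t\otimes\mathcal{K}$-measurable $H$ with $\int_t^T\int_K|H_s(y)|\,\nu(s,X_s,dy)\,ds<\infty$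 a.s.; $\int_a^b$ means integration over $(a,b]$. Space $\mathbb{M}^{t,x}$: pairs $(Y,Z)$ on $[t,T]$ with $Y$ real-valued and $Prog^t$-measurable, $Z:\Omega\times[t,T]\times K\to\mathbb{R}$ $\mathcal{P}^t\otimes\mathcal{K}$-measurable, and $$\|(Y,Z)\|^2_{\mathbb{M}^{t,x}}=\mathbb{E}^{t,x}\int_t^T|Y_s|^2ds+\mathbb{E}^{t,x}\int_t^T\int_K|Z_s(y)|^2\,\nu(s,X_s,dy)\,ds<\infty;$$ pairs whose difference has norm zero are identified. Under the stated conditions the BSDE has a unique solution in $\mathbb{M}^{t,x}$ and the HJB equation has a unique solution. Generator of $X$: $\mathcal{L}_t\psi(x)=\int_K(\psi(y)-\psi(x))\,\nu(t,x,dy)$ for measurable $\psi:K\to\mathbb{R}$ for which the integral is well defined. Control problem. $\mathcal{A}^t$ is the set of admissible controls: $\mathbb{F}^t$-predictable processes $(u_s)_{s\in[t,T]}$ with values in $U$. For $u(\cdot)\in\mathcal{A}^t$ and $s\in[t,T]$ let $$L^t_s=\exp\Big(\int_t^s\int_K(1-r(z,X_z,y,u_z))\,\nu(z,X_z,dy)\,dz\Big)\prod_{n\ge1:\,T^t_n\le s}r(T^t_n,X_{T^t_n-},X_{T^t_n},u_{T^t_n})$$ (empty product equal to $1$). Under (a), $L^t$ is a $\mathbb{P}^{t,x}$-martingale with $\mathbb{E}^{t,x}L^t_T=1$; set $\mathbb{P}^{t,x}_u(d\omega)=L^t_T(\omega)\,\mathbb{P}^{t,x}(d\omega)$, with expectation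 $\mathbb{E}^{t,x}_u$. The cost is $$J(t,x,u(\cdot))=\mathbb{E}^{t,x}_u\Big[\int_t^Tl(s,X_s,u_s)\,ds+g(X_T)\Big],$$ which is finite for every admissible control; the value function is $(t,x)\mapsto\inf_{u(\cdot)\in\mathcal{A}^t}J(t,x,u(\cdot))$ (under the stated assumptions it coincides with $v$); a control attaining the infimum is optimal. Solution of the HJB equation: a measurable function $v:[0,T]\times K\to\mathbb{R}$ such that for every $t\in[0,T]$, $x\in K$: (1) $\mathbb{E}^{t,x}\int_t^T\int_K|v(s,y)-v(s,X_s)|^2\,\nu(s,X_s,dy)\,ds<\infty$; (2) $\mathbb{E}^{t,x}\int_t^T|v(s,X_s)|^2\,ds<\infty$; (3) the equation is satisfied at $(t,x)$. *)

theory Defs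
  imports "HOL-Probability.Probability"
begin

text \<open>A measurable space is a value of type \<open>measure\<close> of which only \<open>space\<close> and \<open>sets\<close> are used.
  The process is \<open>X s \<omega>\<close> with \<open>s \<ge> 0\<close> and \<open>\<omega> \<in> \<Omega>\<close>.\<close>

definition path_algebra ::
  "'w set \<Rightarrow> 'k measure \<Rightarrow> (real \<Rightarrow> 'w \<Rightarrow> 'k) \<Rightarrow> real set \<Rightarrow> 'w measure" where
  "path_algebra \<Omega> K X I = sigma \<Omega> {X s -` A \<inter> \<Omega> |s A. s \<in> I \<and> A \<in> sets K}"

text \<open>If the \<open>n\<close>-th time is infinite, the set below is empty and its infimum is again \<open>\<infinity>\<close>.\<close>

primrec jump_time :: "(real \<Rightarrow> 'w \<Rightarrow> 'k) \<Rightarrow> real \<Rightarrow> nat \<Rightarrow> 'w \<Rightarrow> ereal" where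
  "jump_time X t 0 \<omega> = ereal t"
| "jump_time X t (Suc n) \<omega> =
     Inf (ereal ` {s. jump_time X t n \<omega> < ereal s
                      \<and> X s \<omega> \<noteq> X (real_of_ereal (jump_time X t n \<omega>)) \<omega>})"

text \<open>Left limit of a piecewise constant path, in the discrete sense; only used for \<open>s > 0\<close>.\<close>

definition left_lim :: "(real \<Rightarrow> 'w \<Rightarrow> 'k) \<Rightarrow> real \<Rightarrow> 'w \<Rightarrow> 'k" where
  "left_lim X s \<omega> = (THE c. \<forall>\<^sub>F q in at_left s. X q \<omega> = c)"

definition jump_rate :: "'k measure \<Rightarrow> (real \<Rightarrow> 'k \<Rightarrow> 'k measure) \<Rightarrow> real \<Rightarrow> 'k \<Rightarrow> ennreal" where
  "jump_rate K \<nu> t x = emeasure (\<nu> t x) (space K)"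

definition jump_kernel ::
  "'k measure \<Rightarrow> (real \<Rightarrow> 'k \<Rightarrow> 'k measure) \<Rightarrow> real \<Rightarrow> 'k \<Rightarrow> 'k set \<Rightarrow> ennreal" where
  "jump_kernel K \<nu> t x A =
     (if jump_rate K \<nu> t x > 0 then emeasure (\<nu> t x) A / jump_rate K \<nu> t x else indicator A x)"

definition exp_neg :: "ennreal \<Rightarrow> ennreal" where
  "exp_neg c = (if c = \<infinity> then 0 else ennreal (exp (- enn2real c)))"

text \<open>
  The rates are bounded on \<open>[0, T]\<close> only, so the law of the first jump time is written with extended
  values; up to time \<open>T\<close> all of them are finite.

  \<open>jumps_finite\<close>: given \<open>right_const\<close>, a path jumps at \<open>s > 0\<close> iff it is not constant on any
  interval \<open>(s - \<delta>, s]\<close>.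

  \<open>stopping\<close>: the first jump time after \<open>t\<close> is a stopping time of the filtration
  \<open>\<sigma>(X q, q \<in> [t, s])\<close>, \<open>s \<ge> t\<close>. This is what makes the law of the first jump, the adapted random
  measure of the jumps and its compensator meaningful. It holds automatically if the diagonal of
  \<open>K \<times> K\<close> is product measurable, but measurability of one-point sets alone does not imply it.
  The same property of the later jump times follows.\<close>

locale markov_jump_process =
  fixes T :: real
    and K :: "'k measure"
    and \<nu> :: "real \<Rightarrow> 'k \<Rightarrow> 'k measure"
    and \<Omega> :: "'w set"
    and X :: "real \<Rightarrow> 'w \<Rightarrow> 'k"
    and P :: "real \<Rightarrow> 'k \<Rightarrow> 'w measure"
  assumes T_pos: "0 < T"
    and singletons: "\<And>x. x \<in> space K \<Longrightarrow> {x} \<in> sets K"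
    and rate_sets: "\<And>t x. 0 \<le> t \<Longrightarrow> x \<in> space K \<Longrightarrow> sets (\<nu> t x) = sets K"
    and rate_measurable: "\<And>A. A \<in> sets K \<Longrightarrow>
      (\<lambda>(t, x). emeasure (\<nu> t x) A) \<in> borel_measurable (restrict_space borel {0..} \<Otimes>\<^sub>M K)"
    and rate_bounded: "(SUP (t, x) \<in> {0..T} \<times> space K. emeasure (\<nu> t x) (space K)) < \<infinity>"
    and rate_no_self: "\<And>t x. 0 \<le> t \<Longrightarrow> x \<in> space K \<Longrightarrow> emeasure (\<nu> t x) {x} = 0"
    and path_range: "\<And>t \<omega>. 0 \<le> t \<Longrightarrow> \<omega> \<in> \<Omega> \<Longrightarrow> X t \<omega> \<in> space K"
    and prob: "\<And>t x. 0 \<le> t \<Longrightarrow> x \<in> space K \<Longrightarrow> prob_space (P t x)"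
    and prob_algebra: "\<And>t x. 0 \<le> t \<Longrightarrow> x \<in> space K \<Longrightarrow>
      sets (P t x) = sets (path_algebra \<Omega> K X {t..})"
    and start: "\<And>t x. 0 \<le> t \<Longrightarrow> x \<in> space K \<Longrightarrow> measure (P t x) {\<omega> \<in> \<Omega>. X t \<omega> = x} = 1"
    and transition_measurable: "\<And>t s A. 0 \<le> t \<Longrightarrow> t \<le> s \<Longrightarrow> A \<in> sets K \<Longrightarrow>
      (\<lambda>x. measure (P t x) {\<omega> \<in> \<Omega>. X s \<omega> \<in> A}) \<in> borel_measurable K"
    and markov: "\<And>q t s x A. 0 \<le> q \<Longrightarrow> q \<le> t \<Longrightarrow> t \<le> s \<Longrightarrow> x \<in> space K \<Longrightarrow> A \<in> sets K \<Longrightarrow>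
      AE \<omega> in P q x.
        real_cond_exp (P q x) (path_algebra \<Omega> K X {q..t}) (indicator {\<omega> \<in> \<Omega>. X s \<omega> \<in> A}) \<omega>
        = measure (P t (X t \<omega>)) {\<omega>' \<in> \<Omega>. X s \<omega>' \<in> A}"
    and right_const: "\<And>\<omega> t. \<omega> \<in> \<Omega> \<Longrightarrow> 0 \<le> t \<Longrightarrow> \<exists>\<delta>>0. \<forall>s\<in>{t..t + \<delta>}. X s \<omega> = X t \<omega>"
    and jumps_finite: "\<And>\<omega> b. \<omega> \<in> \<Omega> \<Longrightarrow>
      finite {s. 0 < s \<and> s \<le> b \<and> \<not> (\<forall>\<^sub>F q in at_left s. X q \<omega> = X s \<omega>)}"
    and stopping: "\<And>t s. 0 \<le> t \<Longrightarrow> t \<le> s \<Longrightarrow>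
      {\<omega> \<in> \<Omega>. jump_time X t 1 \<omega> \<le> ereal s} \<in> sets (path_algebra \<Omega> K X {t..s})"
    and first_jump: "\<And>t a b x A. 0 \<le> t \<Longrightarrow> t \<le> a \<Longrightarrow> ereal a < b \<Longrightarrow> x \<in> space K \<Longrightarrow> A \<in> sets K \<Longrightarrow>
      emeasure (P t x) {\<omega> \<in> \<Omega>. ereal a < jump_time X t 1 \<omega> \<and> jump_time X t 1 \<omega> < b
                              \<and> X (real_of_ereal (jump_time X t 1 \<omega>)) \<omega> \<in> A}
      = (\<integral>\<^sup>+s\<in>{s. a < s \<and> ereal s < b}.
           jump_kernel K \<nu> s x A * jump_rate K \<nu> s x
           * exp_neg (\<integral>\<^sup>+q\<in>{t<..s}. jump_rate K \<nu> q x \<partial>lborel) \<partial>lborel)"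

text \<open>Both \<open>\<sigma>\<close>-algebras live on \<open>\<Omega> \<times> [t, T]\<close>. The generating set of \<open>progressive\<close> is already a
  \<open>\<sigma>\<close>-algebra.\<close>

definition predictable ::
  "real \<Rightarrow> 'k measure \<Rightarrow> 'w set \<Rightarrow> (real \<Rightarrow> 'w \<Rightarrow> 'k) \<Rightarrow> real \<Rightarrow> ('w \<times> real) measure" where
  "predictable T K \<Omega> X t = sigma (\<Omega> \<times> {t..T})
     ({B \<times> {t} |B. B \<in> sets (path_algebra \<Omega> K X {t..t})}
      \<union> {B \<times> {a<..b} |B a b. t \<le> a \<and> a < b \<and> b \<le> T \<and> B \<in> sets (path_algebra \<Omega> K X {t..a})})"

definition progressive ::
  "real \<Rightarrow> 'k measure \<Rightarrow> 'w set \<Rightarrow> (real \<Rightarrow> 'w \<Rightarrow> 'k) \<Rightarrow> real \<Rightarrow> ('w \<times> real) measure" where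
  "progressive T K \<Omega> X t = sigma (\<Omega> \<times> {t..T})
     {A. A \<subseteq> \<Omega> \<times> {t..T} \<and>
         (\<forall>s\<in>{t..T}. A \<inter> (\<Omega> \<times> {t..s})
            \<in> sets (path_algebra \<Omega> K X {t..s} \<Otimes>\<^sub>M restrict_space borel {t..s}))}"

text \<open>The sum of the unit masses at the points \<open>(T\<^sub>n, X\<^sub>T\<^sub>n)\<close> is the image of the counting measure.\<close>

definition jump_measure ::
  "'k measure \<Rightarrow> (real \<Rightarrow> 'w \<Rightarrow> 'k) \<Rightarrow> real \<Rightarrow> 'w \<Rightarrow> (real \<times> 'k) measure" where
  "jump_measure K X t \<omega> =
     distr (count_space {n. 1 \<le> n \<and> jump_time X t n \<omega> < \<infinity>}) (restrict_space borel {t<..} \<Otimes>\<^sub>M K)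
       (\<lambda>n. (real_of_ereal (jump_time X t n \<omega>), X (real_of_ereal (jump_time X t n \<omega>)) \<omega>))"

definition compensated_integral ::
  "'k measure \<Rightarrow> (real \<Rightarrow> 'k \<Rightarrow> 'k measure) \<Rightarrow> (real \<Rightarrow> 'w \<Rightarrow> 'k) \<Rightarrow> real \<Rightarrow> real \<Rightarrow> real
     \<Rightarrow> (real \<Rightarrow> 'k \<Rightarrow> real) \<Rightarrow> 'w \<Rightarrow> real" where
  "compensated_integral K \<nu> X t a b H \<omega> =
     (LINT p:{a<..b} \<times> space K|jump_measure K X t \<omega>. H (fst p) (snd p))
     - (LINT s:{a<..b}|lborel. LINT y|\<nu> s (left_lim X s \<omega>). H s y)"

definition bsde_norm_sq ::
  "real \<Rightarrow> (real \<Rightarrow> 'k \<Rightarrow> 'k measure) \<Rightarrow> (real \<Rightarrow> 'w \<Rightarrow> 'k) \<Rightarrow> (real \<Rightarrow> 'k \<Rightarrow> 'w measure)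
     \<Rightarrow> real \<Rightarrow> 'k \<Rightarrow> (real \<Rightarrow> 'w \<Rightarrow> real) \<Rightarrow> (real \<Rightarrow> 'w \<Rightarrow> 'k \<Rightarrow> real) \<Rightarrow> ennreal" where
  "bsde_norm_sq T \<nu> X P t x Y Z =
     (\<integral>\<^sup>+\<omega>. (\<integral>\<^sup>+s\<in>{t<..T}. ennreal (\<bar>Y s \<omega>\<bar>\<^sup>2) \<partial>lborel) \<partial>P t x)
     + (\<integral>\<^sup>+\<omega>. (\<integral>\<^sup>+s\<in>{t<..T}. (\<integral>\<^sup>+y. ennreal (\<bar>Z s \<omega> y\<bar>\<^sup>2) \<partial>\<nu> s (X s \<omega>)) \<partial>lborel) \<partial>P t x)"

text \<open>Representatives of the elements of the space of pairs with finite norm.\<close>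

definition bsde_space ::
  "real \<Rightarrow> 'k measure \<Rightarrow> (real \<Rightarrow> 'k \<Rightarrow> 'k measure) \<Rightarrow> 'w set \<Rightarrow> (real \<Rightarrow> 'w \<Rightarrow> 'k)
     \<Rightarrow> (real \<Rightarrow> 'k \<Rightarrow> 'w measure) \<Rightarrow> real \<Rightarrow> 'k
     \<Rightarrow> ((real \<Rightarrow> 'w \<Rightarrow> real) \<times> (real \<Rightarrow> 'w \<Rightarrow> 'k \<Rightarrow> real)) set" where
  "bsde_space T K \<nu> \<Omega> X P t x =
     {(Y, Z). (\<lambda>(\<omega>, s). Y s \<omega>) \<in> borel_measurable (progressive T K \<Omega> X t)
            \<and> (\<lambda>((\<omega>, s), y). Z s \<omega> y) \<in> borel_measurable (predictable T K \<Omega> X t \<Otimes>\<^sub>M K)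
            \<and> bsde_norm_sq T \<nu> X P t x Y Z < \<infinity>}"

text \<open>
  Time integrals of the driver \<open>f\<close> are taken with respect to \<^const>\<open>lebesgue\<close>: \<open>f\<close> will be an
  infimum over an arbitrary set and need not be Borel measurable in time. Since the Bochner integral
  of a non-integrable function is \<open>0\<close>, both equations include the integrability of their terms.\<close>

definition bsde_solution ::
  "real \<Rightarrow> 'k measure \<Rightarrow> (real \<Rightarrow> 'k \<Rightarrow> 'k measure) \<Rightarrow> 'w set \<Rightarrow> (real \<Rightarrow> 'w \<Rightarrow> 'k)
     \<Rightarrow> (real \<Rightarrow> 'k \<Rightarrow> 'w measure) \<Rightarrow> ('k \<Rightarrow> real) \<Rightarrow> (real \<Rightarrow> 'k \<Rightarrow> ('k \<Rightarrow> real) \<Rightarrow> real)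
     \<Rightarrow> real \<Rightarrow> 'k \<Rightarrow> (real \<Rightarrow> 'w \<Rightarrow> real) \<Rightarrow> (real \<Rightarrow> 'w \<Rightarrow> 'k \<Rightarrow> real) \<Rightarrow> bool" where
  "bsde_solution T K \<nu> \<Omega> X P g f t x Y Z \<longleftrightarrow>
     (Y, Z) \<in> bsde_space T K \<nu> \<Omega> X P t x \<and>
     (AE \<omega> in P t x.
        set_integrable lebesgue {t<..T} (\<lambda>q. f q (X q \<omega>) (Z q \<omega>)) \<and>
        (\<forall>s\<in>{t..T}.
           Y s \<omega> + compensated_integral K \<nu> X t s T (\<lambda>q. Z q \<omega>) \<omega>
           = g (X T \<omega>) + (LINT q:{s<..T}|lebesgue. f q (X q \<omega>) (Z q \<omega>))))"

definition generator ::
  "(real \<Rightarrow> 'k \<Rightarrow> 'k measure) \<Rightarrow> real \<Rightarrow> ('k \<Rightarrow> real) \<Rightarrow> 'k \<Rightarrow> real" where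
  "generator \<nu> t \<psi> x = (LINT y|\<nu> t x. \<psi> y - \<psi> x)"

definition hjb_solution ::
  "real \<Rightarrow> 'k measure \<Rightarrow> (real \<Rightarrow> 'k \<Rightarrow> 'k measure) \<Rightarrow> (real \<Rightarrow> 'w \<Rightarrow> 'k)
     \<Rightarrow> (real \<Rightarrow> 'k \<Rightarrow> 'w measure) \<Rightarrow> ('k \<Rightarrow> real) \<Rightarrow> (real \<Rightarrow> 'k \<Rightarrow> ('k \<Rightarrow> real) \<Rightarrow> real)
     \<Rightarrow> (real \<Rightarrow> 'k \<Rightarrow> real) \<Rightarrow> bool" where
  "hjb_solution T K \<nu> X P g f v \<longleftrightarrow>
     (\<lambda>(t, x). v t x) \<in> borel_measurable (restrict_space borel {0..T} \<Otimes>\<^sub>M K) \<and>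
     (\<forall>t\<in>{0..T}. \<forall>x\<in>space K.
        (\<integral>\<^sup>+\<omega>. (\<integral>\<^sup>+s\<in>{t<..T}.
            (\<integral>\<^sup>+y. ennreal (\<bar>v s y - v s (X s \<omega>)\<bar>\<^sup>2) \<partial>\<nu> s (X s \<omega>)) \<partial>lborel) \<partial>P t x) < \<infinity> \<and>
        (\<integral>\<^sup>+\<omega>. (\<integral>\<^sup>+s\<in>{t<..T}. ennreal (\<bar>v s (X s \<omega>)\<bar>\<^sup>2) \<partial>lborel) \<partial>P t x) < \<infinity> \<and>
        (AE s in lebesgue. s \<in> {t..T} \<longrightarrow> integrable (\<nu> s x) (\<lambda>y. v s y - v s x)) \<and>
        set_integrable lebesgue {t<..T} (\<lambda>s. generator \<nu> s (v s) x) \<and>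
        set_integrable lebesgue {t<..T} (\<lambda>s. f s x (\<lambda>y. v s y - v s x)) \<and>
        v t x = g x + (LINT s:{t<..T}|lebesgue. generator \<nu> s (v s) x)
                    + (LINT s:{t<..T}|lebesgue. f s x (\<lambda>y. v s y - v s x)))"

definition square_integrable :: "'k measure \<Rightarrow> ('k \<Rightarrow> real) set" where
  "square_integrable N = {z \<in> borel_measurable N. (\<integral>\<^sup>+y. ennreal (\<bar>z y\<bar>\<^sup>2) \<partial>N) < \<infinity>}"

text \<open>For \<open>z\<close> in \<open>L\<^sup>2\<close>, bounded \<open>r\<close>, \<open>l s x\<close> bounded below and nonempty \<open>U\<close>, the
  infimum in \<open>hamiltonian\<close> is one of a nonempty set of reals that is bounded below.\<close>

definition controlled_drift ::
  "(real \<Rightarrow> 'k \<Rightarrow> 'k measure) \<Rightarrow> (real \<Rightarrow> 'k \<Rightarrow> 'k \<Rightarrow> 'u \<Rightarrow> real) \<Rightarrow> (real \<Rightarrow> 'k \<Rightarrow> 'u \<Rightarrow> real)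
     \<Rightarrow> real \<Rightarrow> 'k \<Rightarrow> ('k \<Rightarrow> real) \<Rightarrow> 'u \<Rightarrow> real" where
  "controlled_drift \<nu> r l s x z u = l s x u + (LINT y|\<nu> s x. z y * (r s x y u - 1))"

definition hamiltonian ::
  "'u measure \<Rightarrow> (real \<Rightarrow> 'k \<Rightarrow> 'k measure) \<Rightarrow> (real \<Rightarrow> 'k \<Rightarrow> 'k \<Rightarrow> 'u \<Rightarrow> real)
     \<Rightarrow> (real \<Rightarrow> 'k \<Rightarrow> 'u \<Rightarrow> real) \<Rightarrow> real \<Rightarrow> 'k \<Rightarrow> ('k \<Rightarrow> real) \<Rightarrow> real" where
  "hamiltonian U \<nu> r l s x z = (INF u\<in>space U. controlled_drift \<nu> r l s x z u)"

definition minimizers ::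
  "'u measure \<Rightarrow> (real \<Rightarrow> 'k \<Rightarrow> 'k measure) \<Rightarrow> (real \<Rightarrow> 'k \<Rightarrow> 'k \<Rightarrow> 'u \<Rightarrow> real)
     \<Rightarrow> (real \<Rightarrow> 'k \<Rightarrow> 'u \<Rightarrow> real) \<Rightarrow> real \<Rightarrow> 'k \<Rightarrow> ('k \<Rightarrow> real) \<Rightarrow> 'u set" where
  "minimizers U \<nu> r l s x z =
     {u \<in> space U. controlled_drift \<nu> r l s x z u = hamiltonian U \<nu> r l s x z}"

definition admissible ::
  "real \<Rightarrow> 'k measure \<Rightarrow> 'w set \<Rightarrow> (real \<Rightarrow> 'w \<Rightarrow> 'k) \<Rightarrow> 'u measure \<Rightarrow> real
     \<Rightarrow> (real \<Rightarrow> 'w \<Rightarrow> 'u) set" where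
  "admissible T K \<Omega> X U t = {u. (\<lambda>(\<omega>, s). u s \<omega>) \<in> predictable T K \<Omega> X t \<rightarrow>\<^sub>M U}"

definition girsanov ::
  "(real \<Rightarrow> 'k \<Rightarrow> 'k measure) \<Rightarrow> (real \<Rightarrow> 'w \<Rightarrow> 'k) \<Rightarrow> (real \<Rightarrow> 'k \<Rightarrow> 'k \<Rightarrow> 'u \<Rightarrow> real)
     \<Rightarrow> real \<Rightarrow> (real \<Rightarrow> 'w \<Rightarrow> 'u) \<Rightarrow> real \<Rightarrow> 'w \<Rightarrow> real" where
  "girsanov \<nu> X r t u s \<omega> =
     exp (LINT q:{t<..s}|lborel. LINT y|\<nu> q (X q \<omega>). 1 - r q (X q \<omega>) y (u q \<omega>))
     * (\<Prod>n\<in>{n. 1 \<le> n \<and> jump_time X t n \<omega> \<le> ereal s}.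
          let \<tau> = real_of_ereal (jump_time X t n \<omega>)
          in r \<tau> (left_lim X \<tau> \<omega>) (X \<tau> \<omega>) (u \<tau> \<omega>))"

definition controlled_prob ::
  "real \<Rightarrow> (real \<Rightarrow> 'k \<Rightarrow> 'k measure) \<Rightarrow> (real \<Rightarrow> 'w \<Rightarrow> 'k) \<Rightarrow> (real \<Rightarrow> 'k \<Rightarrow> 'w measure)
     \<Rightarrow> (real \<Rightarrow> 'k \<Rightarrow> 'k \<Rightarrow> 'u \<Rightarrow> real) \<Rightarrow> real \<Rightarrow> 'k \<Rightarrow> (real \<Rightarrow> 'w \<Rightarrow> 'u) \<Rightarrow> 'w measure" where
  "controlled_prob T \<nu> X P r t x u = density (P t x) (\<lambda>\<omega>. ennreal (girsanov \<nu> X r t u T \<omega>))"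

definition cost ::
  "real \<Rightarrow> (real \<Rightarrow> 'k \<Rightarrow> 'k measure) \<Rightarrow> (real \<Rightarrow> 'w \<Rightarrow> 'k) \<Rightarrow> (real \<Rightarrow> 'k \<Rightarrow> 'w measure)
     \<Rightarrow> (real \<Rightarrow> 'k \<Rightarrow> 'k \<Rightarrow> 'u \<Rightarrow> real) \<Rightarrow> (real \<Rightarrow> 'k \<Rightarrow> 'u \<Rightarrow> real) \<Rightarrow> ('k \<Rightarrow> real)
     \<Rightarrow> real \<Rightarrow> 'k \<Rightarrow> (real \<Rightarrow> 'w \<Rightarrow> 'u) \<Rightarrow> real" where
  "cost T \<nu> X P r l g t x u =
     (LINT \<omega>|controlled_prob T \<nu> X P r t x u.
        (LINT s:{t<..T}|lborel. l s (X s \<omega>) (u s \<omega>)) + g (X T \<omega>))"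

definition value_fun ::
  "real \<Rightarrow> 'k measure \<Rightarrow> (real \<Rightarrow> 'k \<Rightarrow> 'k measure) \<Rightarrow> 'w set \<Rightarrow> (real \<Rightarrow> 'w \<Rightarrow> 'k)
     \<Rightarrow> (real \<Rightarrow> 'k \<Rightarrow> 'w measure) \<Rightarrow> 'u measure
     \<Rightarrow> (real \<Rightarrow> 'k \<Rightarrow> 'k \<Rightarrow> 'u \<Rightarrow> real) \<Rightarrow> (real \<Rightarrow> 'k \<Rightarrow> 'u \<Rightarrow> real) \<Rightarrow> ('k \<Rightarrow> real)
     \<Rightarrow> real \<Rightarrow> 'k \<Rightarrow> ereal" where
  "value_fun T K \<nu> \<Omega> X P U r l g t x =
     (INF u\<in>admissible T K \<Omega> X U t. ereal (cost T \<nu> X P r l g t x u))"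

definition optimal_control ::
  "real \<Rightarrow> 'k measure \<Rightarrow> (real \<Rightarrow> 'k \<Rightarrow> 'k measure) \<Rightarrow> 'w set \<Rightarrow> (real \<Rightarrow> 'w \<Rightarrow> 'k)
     \<Rightarrow> (real \<Rightarrow> 'k \<Rightarrow> 'w measure) \<Rightarrow> 'u measure
     \<Rightarrow> (real \<Rightarrow> 'k \<Rightarrow> 'k \<Rightarrow> 'u \<Rightarrow> real) \<Rightarrow> (real \<Rightarrow> 'k \<Rightarrow> 'u \<Rightarrow> real) \<Rightarrow> ('k \<Rightarrow> real)
     \<Rightarrow> real \<Rightarrow> 'k \<Rightarrow> (real \<Rightarrow> 'w \<Rightarrow> 'u) \<Rightarrow> bool" where
  "optimal_control T K \<nu> \<Omega> X P U r l g t x u \<longleftrightarrow>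
     u \<in> admissible T K \<Omega> X U t \<and>
     ereal (cost T \<nu> X P r l g t x u) = value_fun T K \<nu> \<Omega> X P U r l g t x"

definition ennreal_powr :: "ennreal \<Rightarrow> real \<Rightarrow> ennreal" where
  "ennreal_powr c \<alpha> = (if c = \<infinity> then \<infinity> else ennreal (enn2real c powr \<alpha>))"

end

theory Submission
  imports Defs
begin

text \<open>
  The random measure of the jumps has compensator \<open>\<nu> s (X s w) ds\<close>: on a fine grid, the number of jumps in
  a cell is governed, by the Markov property, by the law of the first jump after its left end.

  Along a path, \<open>v s (X s w)\<close> and \<open>Y s\<close> are absolutely continuous up to finitely many jumps, by the two
  equations. Hence the pairs \<open>(v s (X s), v s \<cdot> - v s (X s-))\<close> and \<open>(Y, Z)\<close> solve the same backward equation,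
  whose driver is Lipschitz in \<open>L\<^sup>1(\<nu>)\<close>. The product rule for the squared difference, the compensator and
  Gronwall's inequality show that they agree.

  For a control \<open>u\<close> with density process \<open>L\<close> and running cost \<open>A\<close>, the product rule for
  \<open>L (v s (X s) + A)\<close> and the compensator give \<open>J(u) = v t x + E \<integral> L (c(u) - c(u*)) ds\<close>, where
  \<open>c\<close> is the quantity minimised in the Hamiltonian. The integrand is nonnegative, and zero for a minimiser.
  All powers of \<open>L\<close> are integrable because the number of jumps has exponential moments.
\<close>

section \<open>Functions that are absolutely continuous up to finitely many jumps\<close>

text \<open>Hence the equations containing it are treated path by path with respect to
  \<open>lebesgue\<close>, and before expectations are taken the driver gives way to something
  jointly measurable: its Lipschitz bound in the uniqueness argument, the minimised quantity of an
  optimal control in the cost formula. Product and chain rules cannot rest on differentiability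
  either; they come from the fact that an additive remainder with a quadratic bound vanishes. The
  state space carries no topology and its diagonal need not be measurable: limits of states mean
  eventual constancy, left limits are taken along grids of times, and the measurability of jumps
  rests on the stopping property of first jump times after deterministic times. Finally, the density
  process is dominated by a function of the number of jumps that is the same for all controls, so
  that integrability obtained for one control can be used for another.\<close>

lemma interval_gluing [consumes 1, case_names trans refl left right]:
  fixes a b :: real
  assumes "a \<le> b"
    and trans: "\<And>x y z. a \<le> x \<Longrightarrow> x \<le> y \<Longrightarrow> y \<le> z \<Longrightarrow> z \<le> b \<Longrightarrow> Q x y \<Longrightarrow> Q y z \<Longrightarrow> Q x z"
    and refl: "\<And>p. a \<le> p \<Longrightarrow> p \<le> b \<Longrightarrow> Q p p"
    and left: "\<And>p. a < p \<Longrightarrow> p \<le> b \<Longrightarrow> \<exists>d>0. \<forall>x. a \<le> x \<and> p - d < x \<and> x < p \<longrightarrow> Q x p"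
    and right: "\<And>p. a \<le> p \<Longrightarrow> p < b \<Longrightarrow> \<exists>d>0. \<forall>y. p < y \<and> y < p + d \<and> y \<le> b \<longrightarrow> Q p y"
  shows "Q a b"
proof -
  \<comment> \<open>Compactness by bisection: a transitive relation that holds from each point a
    little to the left and a little to the right holds over the whole interval. With the bounds
    moved into the predicate it may range over all reals.\<close>
  let ?Q = "\<lambda>x y. a \<le> x \<longrightarrow> x \<le> y \<longrightarrow> y \<le> b \<longrightarrow> Q x y"
  have "?Q a b"
  proof (rule Bolzano[OF assms(1), where P = "?Q"])
    fix x y z assume "?Q x y" "?Q y z" "x \<le> y" "y \<le> z"
    then show "?Q x z" using trans by (meson order_trans)
  next
    fix p assume p: "a \<le> p" "p \<le> b"
    obtain d1 where d1: "d1 > 0" "\<And>x. a \<le> x \<Longrightarrow> p - d1 < x \<Longrightarrow> x < p \<Longrightarrow> Q x p"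
    proof (cases "a < p")
      case True then show ?thesis using left[of p] p that by blast
    next
      case False then show ?thesis using that[of 1] by auto
    qed
    obtain d2 where d2: "d2 > 0" "\<And>y. p < y \<Longrightarrow> y < p + d2 \<Longrightarrow> y \<le> b \<Longrightarrow> Q p y"
    proof (cases "p < b")
      case True then show ?thesis using right[of p] p that by blast
    next
      case False then show ?thesis using that[of 1] by auto
    qed
    have d1': "Q x p" if "a \<le> x" "p - d1 < x" "x \<le> p" for x
      using that d1(2)[of x] refl p by (cases "x = p") auto
    have d2': "Q p y" if "p \<le> y" "y < p + d2" "y \<le> b" for y
      using that d2(2)[of y] refl p by (cases "y = p") auto
    show "\<exists>d>0. \<forall>x y. x \<le> p \<and> p \<le> y \<and> y - x < d \<longrightarrow> ?Q x y"
    proof (intro exI[of _ "min d1 d2"] conjI allI impI)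
      show "0 < min d1 d2" using d1 d2 by simp
      fix x y assume "x \<le> p \<and> p \<le> y \<and> y - x < min d1 d2" "a \<le> x" "x \<le> y" "y \<le> b"
      then show "Q x y" using trans[of x p y] d1'[of x] d2'[of y] by auto
    qed
  qed
  then show ?thesis using assms(1) by simp
qed

lemma set_integral_Ioc_split:
  fixes k :: "real \<Rightarrow> real"
  assumes "set_integrable lebesgue {a<..b} k" "a \<le> x" "x \<le> y" "y \<le> z" "z \<le> b"
  shows "(LINT q:{x<..z}|lebesgue. k q) = (LINT q:{x<..y}|lebesgue. k q) + (LINT q:{y<..z}|lebesgue. k q)"
proof -
  have "{x<..z} = {x<..y} \<union> {y<..z}" using assms by auto
  moreover have "set_integrable lebesgue {x<..y} k" "set_integrable lebesgue {y<..z} k"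
    by (rule set_integrable_subset[OF assms(1)], use assms in auto)+
  ultimately show ?thesis by (simp add: set_integral_Un)
qed

lemma continuous_on_set_integral_Ioc:
  fixes k :: "real \<Rightarrow> real"
  assumes "set_integrable lebesgue {a<..b} k"
  shows "continuous_on {a..b} (\<lambda>s. LINT q:{a<..s}|lebesgue. k q)"
proof -
  define h where "h q = indicator {a<..b} q * k q" for q
  have h: "integrable lebesgue h"
    using assms unfolding set_integrable_def h_def by simp
  have hs: "set_integrable lebesgue {a..s} h" for s
    unfolding set_integrable_def using h by (intro integrable_mult_indicator) auto
  have "(LINT q:{a<..s}|lebesgue. k q) = integral {a..s} h" if "s \<in> {a..b}" for s
  proof -
    have "(LINT q:{a<..s}|lebesgue. k q) = (LINT q:{a..s}|lebesgue. h q)"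
      unfolding set_lebesgue_integral_def h_def
      by (rule Bochner_Integration.integral_cong) (use that in \<open>auto simp: indicator_def\<close>)
    then show ?thesis using set_lebesgue_integral_eq_integral(2)[OF hs] by simp
  qed
  moreover have "continuous_on {a..b} (\<lambda>s. integral {a..s} h)"
    using hs[of b] set_lebesgue_integral_eq_integral(1) by (intro indefinite_integral_continuous_1) blast
  ultimately show ?thesis
    using continuous_on_cong[of "{a..b}" "{a..b}" "\<lambda>s. LINT q:{a<..s}|lebesgue. k q" "\<lambda>s. integral {a..s} h"]
    by simp
qed

text \<open>Continuity of the indefinite integral at \<open>p\<close>, split into the two one-sided
  forms that the cases \<open>left\<close> and \<open>right\<close> of
  \<open>interval_gluing\<close> ask for.\<close>

lemma set_integral_Ioc_small:
  fixes k :: "real \<Rightarrow> real"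
  assumes k: "set_integrable lebesgue {a<..b} k" and p: "a \<le> p" "p \<le> b" and e: "e > 0"
  shows "\<exists>d>0. (\<forall>x. a \<le> x \<longrightarrow> p - d < x \<longrightarrow> x \<le> p \<longrightarrow> \<bar>LINT q:{x<..p}|lebesgue. k q\<bar> < e)
    \<and> (\<forall>y. p \<le> y \<longrightarrow> y < p + d \<longrightarrow> y \<le> b \<longrightarrow> \<bar>LINT q:{p<..y}|lebesgue. k q\<bar> < e)"
proof -
  let ?I = "\<lambda>s. LINT q:{a<..s}|lebesgue. k q"
  obtain d where d: "d > 0" "\<And>s. s \<in> {a..b} \<Longrightarrow> dist s p < d \<Longrightarrow> dist (?I s) (?I p) < e"
    using continuous_on_set_integral_Ioc[OF k] p e
    unfolding continuous_on_iff by (metis atLeastAtMost_iff)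
  show ?thesis
  proof (intro exI[of _ d] conjI allI impI d(1))
    fix x assume x: "a \<le> x" "p - d < x" "x \<le> p"
    have "?I p = ?I x + (LINT q:{x<..p}|lebesgue. k q)"
      using set_integral_Ioc_split[OF k, of a x p] x p by simp
    then show "\<bar>LINT q:{x<..p}|lebesgue. k q\<bar> < e"
      using d(2)[of x] x p by (simp add: dist_real_def)
  next
    fix y assume y: "p \<le> y" "y < p + d" "y \<le> b"
    have "?I y = ?I p + (LINT q:{p<..y}|lebesgue. k q)"
      using set_integral_Ioc_split[OF k, of a p y] y p by simp
    then show "\<bar>LINT q:{p<..y}|lebesgue. k q\<bar> < e"
      using d(2)[of y] y p by (simp add: dist_real_def)
  qed
qed

lemma set_integral_Ioc_nonneg:
  fixes k :: "real \<Rightarrow> real"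
  assumes "\<And>q. x < q \<Longrightarrow> q \<le> y \<Longrightarrow> 0 \<le> k q"
  shows "0 \<le> (LINT q:{x<..y}|lebesgue. k q)"
  unfolding set_lebesgue_integral_def
  by (rule integral_nonneg_AE) (use assms in \<open>auto simp: indicator_def\<close>)

text \<open>The quadratic bound makes \<open>\<bar>R\<bar>\<close> smaller than \<open>e\<close> times the integral of \<open>k\<close> on short
  intervals, and this estimate is additive.\<close>

lemma additive_quadratic_bound_zero:
  fixes k :: "real \<Rightarrow> real" and R :: "real \<Rightarrow> real \<Rightarrow> real"
  assumes ab: "a \<le> b"
    and k: "set_integrable lebesgue {a<..b} k" "\<And>q. a < q \<Longrightarrow> q \<le> b \<Longrightarrow> 0 \<le> k q"
    and add: "\<And>x y z. a \<le> x \<Longrightarrow> x \<le> y \<Longrightarrow> y \<le> z \<Longrightarrow> z \<le> b \<Longrightarrow> R x z = R x y + R y z"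
    and bound: "\<And>x y. a \<le> x \<Longrightarrow> x \<le> y \<Longrightarrow> y \<le> b \<Longrightarrow> \<bar>R x y\<bar> \<le> C * (LINT q:{x<..y}|lebesgue. k q)\<^sup>2"
  shows "R a b = 0"
proof -
  let ?I = "\<lambda>x y. LINT q:{x<..y}|lebesgue. k q"
  have nn: "0 \<le> ?I x y" if "a \<le> x" "y \<le> b" for x y
    using that k(2) by (intro set_integral_Ioc_nonneg) auto
  have "\<bar>R a b\<bar> \<le> e * ?I a b" if e: "e > 0" for e
  proof -
    \<comment> \<open>The threshold makes \<bar>C\<bar> times the integral at most \<open>e\<close>,
      which turns the quadratic bound into a linear one; adding 1 keeps the quotient meaningful for
      \<open>C = 0\<close>.\<close>
    have small: "\<bar>R x y\<bar> \<le> e * ?I x y"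
      if "a \<le> x" "x \<le> y" "y \<le> b" "\<bar>?I x y\<bar> < e / (1 + \<bar>C\<bar>)" for x y
    proof -
      have "\<bar>C\<bar> * ?I x y \<le> e"
      proof -
        have "?I x y * (1 + \<bar>C\<bar>) \<le> e" using that(4) nn[of x y] that by (simp add: pos_less_divide_eq)
        then show ?thesis using nn[of x y] that by (simp add: algebra_simps)
      qed
      then have "\<bar>C\<bar> * ?I x y * ?I x y \<le> e * ?I x y"
        using nn[of x y] that by (intro mult_right_mono) auto
      moreover have "C * (?I x y)\<^sup>2 \<le> \<bar>C\<bar> * ?I x y * ?I x y"
        by (simp add: power2_eq_square mult.assoc mult_right_mono)
      ultimately show ?thesis using bound[of x y] that by linarith
    qed
    have ep: "0 < e / (1 + \<bar>C\<bar>)" using e by simp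
    show ?thesis using ab
    proof (induct rule: interval_gluing)
      case (trans x y z)
      then show ?case
        using add[of x y z] set_integral_Ioc_split[OF k(1), of x y z] by (simp add: algebra_simps)
    next
      case (refl p)
      have "R p p = R p p + R p p" using add[of p p p] refl by simp
      then show ?case by (simp add: set_lebesgue_integral_def)
    next
      case (left p)
      obtain d where "d > 0" "\<And>x. a \<le> x \<Longrightarrow> p - d < x \<Longrightarrow> x \<le> p \<Longrightarrow> \<bar>?I x p\<bar> < e / (1 + \<bar>C\<bar>)"
        using set_integral_Ioc_small[OF k(1) _ _ ep, of p] left by auto
      then show ?case using left small[of _ p] by (intro exI[of _ d]) auto
    next
      case (right p)
      obtain d where "d > 0" "\<And>x. p \<le> x \<Longrightarrow> x < p + d \<Longrightarrow> x \<le> b \<Longrightarrow> \<bar>?I p x\<bar> < e / (1 + \<bar>C\<bar>)"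
        using set_integral_Ioc_small[OF k(1) _ _ ep, of p] right by auto
      then show ?case using right small[of p] by (intro exI[of _ d]) auto
    qed
  qed
  then have "\<bar>R a b\<bar> \<le> 0 + e" if "e > 0" for e
  proof -
    have "0 < e / (1 + ?I a b)" using that nn[of a b] by simp
    from \<open>\<And>e. e > 0 \<Longrightarrow> \<bar>R a b\<bar> \<le> e * ?I a b\<close>[OF this]
    have "\<bar>R a b\<bar> \<le> e / (1 + ?I a b) * ?I a b" .
    also have "\<dots> \<le> e * 1" using that nn[of a b] by (simp add: field_simps)
    finally show ?thesis by simp
  qed
  then show ?thesis using field_le_epsilon[of "\<bar>R a b\<bar>" 0] by simp
qed

text \<open>\<open>J\<close> may be infinite outside (a, b]. The sum includes a jump at
  \<open>s\<close> itself, so \<open>h\<close> is right continuous and \<open>h s - j s\<close> is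
  its left limit at a jump. The density is taken with respect to \<open>lebesgue\<close> because
  drivers need not be Borel in time.\<close>

definition piecewise_ac ::
  "real \<Rightarrow> real \<Rightarrow> real set \<Rightarrow> (real \<Rightarrow> real) \<Rightarrow> (real \<Rightarrow> real) \<Rightarrow> (real \<Rightarrow> real) \<Rightarrow> bool" where
  "piecewise_ac a b J h \<psi> j \<longleftrightarrow> finite (J \<inter> {a<..b}) \<and> set_integrable lebesgue {a<..b} \<psi> \<and>
     (\<forall>s\<in>{a..b}. h s = h a + (LINT q:{a<..s}|lebesgue. \<psi> q) + (\<Sum>\<tau>\<in>J \<inter> {a<..s}. j \<tau>))"

lemma sum_Ioc_split:
  fixes j :: "real \<Rightarrow> real"
  assumes "finite (J \<inter> {a<..b})" "a \<le> x" "x \<le> y" "y \<le> z" "z \<le> b"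
  shows "(\<Sum>\<tau>\<in>J \<inter> {x<..z}. j \<tau>) = (\<Sum>\<tau>\<in>J \<inter> {x<..y}. j \<tau>) + (\<Sum>\<tau>\<in>J \<inter> {y<..z}. j \<tau>)"
proof -
  have "J \<inter> {x<..z} = (J \<inter> {x<..y}) \<union> (J \<inter> {y<..z})" using assms by auto
  moreover have "finite (J \<inter> {x<..y})" "finite (J \<inter> {y<..z})"
    by (rule finite_subset[OF _ assms(1)], use assms in auto)+
  moreover have "(J \<inter> {x<..y}) \<inter> (J \<inter> {y<..z}) = {}" by auto
  ultimately show ?thesis by (simp add: sum.union_disjoint)
qed

lemma piecewise_ac_increment:
  assumes "piecewise_ac a b J h \<psi> j" "a \<le> x" "x \<le> y" "y \<le> b"
  shows "h y = h x + (LINT q:{x<..y}|lebesgue. \<psi> q) + (\<Sum>\<tau>\<in>J \<inter> {x<..y}. j \<tau>)"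
proof -
  have "set_integrable lebesgue {a<..b} \<psi>" "finite (J \<inter> {a<..b})"
    using assms(1) by (auto simp: piecewise_ac_def)
  note split = set_integral_Ioc_split[OF this(1), of a x y] sum_Ioc_split[OF this(2), of a x y j]
  have "h x = h a + (LINT q:{a<..x}|lebesgue. \<psi> q) + (\<Sum>\<tau>\<in>J \<inter> {a<..x}. j \<tau>)"
    "h y = h a + (LINT q:{a<..y}|lebesgue. \<psi> q) + (\<Sum>\<tau>\<in>J \<inter> {a<..y}. j \<tau>)"
    using assms unfolding piecewise_ac_def by (meson atLeastAtMost_iff order_trans)+
  with split assms(2-4) show ?thesis by linarith
qed

lemma piecewise_acI:
  assumes "finite (J \<inter> {a<..b})" "set_integrable lebesgue {a<..b} \<psi>"
    "\<And>s. a \<le> s \<Longrightarrow> s \<le> b \<Longrightarrow> h s - h a = (LINT q:{a<..s}|lebesgue. \<psi> q) + (\<Sum>\<tau>\<in>J \<inter> {a<..s}. j \<tau>)"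
  shows "piecewise_ac a b J h \<psi> j"
  unfolding piecewise_ac_def
proof (intro conjI ballI assms(1,2))
  fix s assume "s \<in> {a..b}"
  then show "h s = h a + (LINT q:{a<..s}|lebesgue. \<psi> q) + (\<Sum>\<tau>\<in>J \<inter> {a<..s}. j \<tau>)"
    using assms(3)[of s] by simp
qed

text \<open>Stated for sequences approaching strictly from below because predictable left limits are
  built along grid times. Close to \<open>s\<close> no other point of \<open>J\<close> remains, so
  exactly the jump at \<open>s\<close> is lost.\<close>

lemma piecewise_ac_left_limit:
  assumes h: "piecewise_ac a b J h \<psi> j" and s: "a < s" "s \<le> b"
    and c: "\<And>n. a \<le> c n" "\<And>n. c n < s" "c \<longlonglongrightarrow> s"
  shows "(\<lambda>n. h (c n)) \<longlonglongrightarrow> h s - (if s \<in> J then j s else 0)"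
proof -
  have \<psi>: "set_integrable lebesgue {a<..b} \<psi>" and J: "finite (J \<inter> {a<..b})"
    using h by (auto simp: piecewise_ac_def)
  have "finite (J \<inter> {a<..<s})" by (rule finite_subset[OF _ J]) (use s in auto)
  \<comment> \<open>All earlier jumps lie at or before this maximum; the extra element
    \<open>s - 1\<close> covers the case that there is none.\<close>
  then have "Max (insert (s - 1) (J \<inter> {a<..<s})) < s"
    "\<And>\<tau>. \<tau> \<in> J \<inter> {a<..<s} \<Longrightarrow> \<tau> \<le> Max (insert (s - 1) (J \<inter> {a<..<s}))"
    by auto
  then obtain e where e: "e < s" "\<And>\<tau>. \<tau> \<in> J \<inter> {a<..<s} \<Longrightarrow> \<tau> \<le> e" by blast
  have 1: "\<forall>\<^sub>F n in sequentially. h (c n) = h s - (LINT q:{c n<..s}|lebesgue. \<psi> q) - (if s \<in> J then j s else 0)"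
    using order_tendstoD(1)[OF c(3) e(1)]
  proof eventually_elim
    case (elim n)
    have "J \<inter> {c n<..s} = (if s \<in> J then {s} else {})"
    proof -
      have "\<tau> = s" if "\<tau> \<in> J" "c n < \<tau>" "\<tau> \<le> s" for \<tau>
        using e(2)[of \<tau>] that elim c(1)[of n] by (cases "\<tau> = s") auto
      then have "\<tau> \<in> J \<inter> {c n<..s} \<longleftrightarrow> s \<in> J \<and> \<tau> = s" for \<tau>
        using c(2)[of n] by auto
      then show ?thesis by (cases "s \<in> J", simp_all only: if_True if_False) blast+
    qed
    then show ?case using piecewise_ac_increment[OF h, of "c n" s] s c(1,2)[of n] by auto
  qed
  have "(\<lambda>n. LINT q:{c n<..s}|lebesgue. \<psi> q) \<longlonglongrightarrow> 0"
  proof (rule LIMSEQ_I)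
    fix r :: real assume "r > 0"
    then obtain d where
      d: "d > 0" "\<And>x. a \<le> x \<Longrightarrow> s - d < x \<Longrightarrow> x \<le> s \<Longrightarrow> \<bar>LINT q:{x<..s}|lebesgue. \<psi> q\<bar> < r"
      using set_integral_Ioc_small[OF \<psi>, of s r] s by auto
    have "\<forall>\<^sub>F n in sequentially. s - d < c n" using order_tendstoD(1)[OF c(3)] d by simp
    then show "\<exists>no. \<forall>n\<ge>no. norm ((LINT q:{c n<..s}|lebesgue. \<psi> q) - 0) < r"
      unfolding eventually_sequentially using d(2) c(1,2) by (metis diff_zero less_imp_le real_norm_def)
  qed
  then have "(\<lambda>n. h s - (LINT q:{c n<..s}|lebesgue. \<psi> q) - (if s \<in> J then j s else 0))
      \<longlonglongrightarrow> h s - 0 - (if s \<in> J then j s else 0)"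
    by (intro tendsto_intros)
  then show ?thesis using tendsto_cong[OF 1] by simp
qed

lemma piecewise_ac_bounded:
  assumes h: "piecewise_ac a b J h \<psi> j"
  obtains M where "M \<ge> 0" "\<And>s. a \<le> s \<Longrightarrow> s \<le> b \<Longrightarrow> \<bar>h s\<bar> \<le> M"
proof -
  have \<psi>: "set_integrable lebesgue {a<..b} \<psi>" and J: "finite (J \<inter> {a<..b})"
    using h by (auto simp: piecewise_ac_def)
  obtain B where B: "\<And>s. s \<in> {a..b} \<Longrightarrow> \<bar>LINT q:{a<..s}|lebesgue. \<psi> q\<bar> \<le> B"
    using compact_imp_bounded[OF compact_continuous_image[OF continuous_on_set_integral_Ioc[OF \<psi>]]]
    unfolding bounded_iff by fastforce
  have S: "\<bar>\<Sum>\<tau>\<in>J \<inter> {a<..s}. j \<tau>\<bar> \<le> (\<Sum>\<tau>\<in>J \<inter> {a<..b}. \<bar>j \<tau>\<bar>)" if "s \<le> b" for s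
    using that by (intro order_trans[OF sum_abs] sum_mono2[OF J]) auto
  show ?thesis
  proof (rule that[of "\<bar>h a\<bar> + \<bar>B\<bar> + (\<Sum>\<tau>\<in>J \<inter> {a<..b}. \<bar>j \<tau>\<bar>)"])
    show "0 \<le> \<bar>h a\<bar> + \<bar>B\<bar> + (\<Sum>\<tau>\<in>J \<inter> {a<..b}. \<bar>j \<tau>\<bar>)" by (simp add: sum_nonneg)
    fix s assume s: "a \<le> s" "s \<le> b"
    have "h s = h a + (LINT q:{a<..s}|lebesgue. \<psi> q) + (\<Sum>\<tau>\<in>J \<inter> {a<..s}. j \<tau>)"
      using h s unfolding piecewise_ac_def by (meson atLeastAtMost_iff)
    then show "\<bar>h s\<bar> \<le> \<bar>h a\<bar> + \<bar>B\<bar> + (\<Sum>\<tau>\<in>J \<inter> {a<..b}. \<bar>j \<tau>\<bar>)"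
      using B[of s] S[of s] s by auto
  qed
qed

text \<open>Borel rather than Lebesgue measurability: the integral part is continuous in
  \<open>s\<close>, and the jump part is a finite combination of step functions
  \<open>indicator {\<tau>..}\<close>.\<close>

lemma piecewise_ac_borel:
  assumes h: "piecewise_ac a b J h \<psi> j" and "a \<le> b"
  shows "set_borel_measurable borel {a<..b} h"
proof -
  have \<psi>: "set_integrable lebesgue {a<..b} \<psi>" and J: "finite (J \<inter> {a<..b})"
    using h by (auto simp: piecewise_ac_def)
  let ?I = "\<lambda>s. LINT q:{a<..s}|lebesgue. \<psi> q"
  have "(\<lambda>s. indicator {a..b} s *\<^sub>R ?I s) \<in> borel_measurable borel"
    by (rule borel_measurable_continuous_on_indicator[OF _ continuous_on_set_integral_Ioc[OF \<psi>]]) simp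
  then have "(\<lambda>s. indicator {a<..b} s * (h a + indicator {a..b} s *\<^sub>R ?I s +
      (\<Sum>\<tau>\<in>J \<inter> {a<..b}. indicator {\<tau>..} s * j \<tau>))) \<in> borel_measurable borel"
    by measurable
  moreover have "indicator {a<..b} s * (h a + indicator {a..b} s *\<^sub>R ?I s +
      (\<Sum>\<tau>\<in>J \<inter> {a<..b}. indicator {\<tau>..} s * j \<tau>)) = indicator {a<..b} s *\<^sub>R h s" for s
  proof (cases "a < s \<and> s \<le> b")
    case True
    have "(\<Sum>\<tau>\<in>J \<inter> {a<..b}. indicator {\<tau>..} s * j \<tau>) = (\<Sum>\<tau>\<in>J \<inter> {a<..s}. j \<tau>)"
      by (rule sum.mono_neutral_cong_right[OF J]) (use True in \<open>auto simp: indicator_def\<close>)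
    moreover have "h s = h a + ?I s + (\<Sum>\<tau>\<in>J \<inter> {a<..s}. j \<tau>)"
      using piecewise_ac_increment[OF h, of a s] True by simp
    ultimately show ?thesis using True by simp
  qed (auto simp: indicator_def)
  ultimately show ?thesis unfolding set_borel_measurable_def by (simp only:)
qed

lemma set_integrable_piecewise_ac_mult:
  assumes h: "piecewise_ac a b J h \<psi> j" and ab: "a \<le> b"
    and k: "set_integrable lebesgue {a<..b} k"
  shows "set_integrable lebesgue {a<..b} (\<lambda>q. h q * k q)"
proof -
  obtain M where M: "M \<ge> 0" "\<And>s. a \<le> s \<Longrightarrow> s \<le> b \<Longrightarrow> \<bar>h s\<bar> \<le> M"
    using piecewise_ac_bounded[OF h] by blast
  have hm: "(\<lambda>s. indicator {a<..b} s *\<^sub>R h s) \<in> borel_measurable lebesgue"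
    using piecewise_ac_borel[OF h ab] unfolding set_borel_measurable_def
    by (intro measurable_completion) simp
  have kI: "integrable lebesgue (\<lambda>q. indicator {a<..b} q *\<^sub>R k q)"
    using k by (simp add: set_integrable_def)
  have "integrable lebesgue (\<lambda>q. (indicator {a<..b} q *\<^sub>R h q) * (indicator {a<..b} q *\<^sub>R k q))"
  proof (rule Bochner_Integration.integrable_bound[where f = "\<lambda>q. M * (indicator {a<..b} q *\<^sub>R k q)"])
    show "integrable lebesgue (\<lambda>q. M * (indicator {a<..b} q *\<^sub>R k q))" using kI by simp
    show "(\<lambda>q. (indicator {a<..b} q *\<^sub>R h q) * (indicator {a<..b} q *\<^sub>R k q)) \<in> borel_measurable lebesgue"
      using hm borel_measurable_integrable[OF kI] by (rule borel_measurable_times)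
    show "AE q in lebesgue. norm ((indicator {a<..b} q *\<^sub>R h q) * (indicator {a<..b} q *\<^sub>R k q))
        \<le> norm (M * (indicator {a<..b} q *\<^sub>R k q))"
      using M by (intro AE_I2) (auto simp: indicator_def abs_mult intro!: mult_right_mono)
  qed
  moreover have "(indicator {a<..b} q *\<^sub>R h q) * (indicator {a<..b} q *\<^sub>R k q)
      = indicator {a<..b} q *\<^sub>R (h q * k q)" for q
    by (simp add: indicator_def)
  ultimately show ?thesis unfolding set_integrable_def by (simp only:)
qed

lemma set_integrable_Ioc_subset:
  fixes k :: "real \<Rightarrow> real"
  assumes "set_integrable lebesgue {a<..b} k" "a \<le> x" "y \<le> b"
  shows "set_integrable lebesgue {x<..y} k"
  by (rule set_integrable_subset[OF assms(1)]) (use assms in auto)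

lemma piecewise_ac_add:
  assumes h: "piecewise_ac a b J h1 \<psi>1 j1" "piecewise_ac a b J h2 \<psi>2 j2"
  shows "piecewise_ac a b J (\<lambda>s. h1 s + h2 s) (\<lambda>s. \<psi>1 s + \<psi>2 s) (\<lambda>s. j1 s + j2 s)"
proof (rule piecewise_acI)
  note I = h[unfolded piecewise_ac_def]
  show "finite (J \<inter> {a<..b})" "set_integrable lebesgue {a<..b} (\<lambda>s. \<psi>1 s + \<psi>2 s)"
    using I by (auto intro: set_integral_add)
  fix s assume s: "a \<le> s" "s \<le> b"
  have "set_integrable lebesgue {a<..s} \<psi>1" "set_integrable lebesgue {a<..s} \<psi>2"
    using I s set_integrable_Ioc_subset by blast+
  then show "h1 s + h2 s - (h1 a + h2 a)
      = (LINT q:{a<..s}|lebesgue. \<psi>1 q + \<psi>2 q) + (\<Sum>\<tau>\<in>J \<inter> {a<..s}. j1 \<tau> + j2 \<tau>)"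
    using piecewise_ac_increment[OF h(1), of a s] piecewise_ac_increment[OF h(2), of a s] s
    by (simp add: set_integral_add sum.distrib)
qed

lemma piecewise_ac_minus:
  assumes h: "piecewise_ac a b J h \<psi> j"
  shows "piecewise_ac a b J (\<lambda>s. - h s) (\<lambda>s. - \<psi> s) (\<lambda>s. - j s)"
proof (rule piecewise_acI)
  note I = h[unfolded piecewise_ac_def]
  show "finite (J \<inter> {a<..b})" "set_integrable lebesgue {a<..b} (\<lambda>s. - \<psi> s)"
    using I by (auto simp: set_integrable_def)
  fix s assume s: "a \<le> s" "s \<le> b"
  then show "- h s - - h a = (LINT q:{a<..s}|lebesgue. - \<psi> q) + (\<Sum>\<tau>\<in>J \<inter> {a<..s}. - j \<tau>)"
    using piecewise_ac_increment[OF h(1), of a s]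
    by (simp add: sum_negf set_lebesgue_integral_def)
qed

lemma set_integral_Ioc_abs_le:
  fixes k :: "real \<Rightarrow> real"
  assumes "set_integrable lebesgue {x<..y} m" "\<And>q. x < q \<Longrightarrow> q \<le> y \<Longrightarrow> \<bar>k q\<bar> \<le> m q"
  shows "\<bar>LINT q:{x<..y}|lebesgue. k q\<bar> \<le> (LINT q:{x<..y}|lebesgue. m q)"
proof (cases "set_integrable lebesgue {x<..y} k")
  case True
  have "\<bar>LINT q:{x<..y}|lebesgue. k q\<bar> \<le> (LINT q:{x<..y}|lebesgue. \<bar>k q\<bar>)"
    using set_integral_norm_bound[OF True] by simp
  also have "\<dots> \<le> (LINT q:{x<..y}|lebesgue. m q)"
    by (rule set_integral_mono) (use assms True in \<open>auto intro: set_integrable_abs\<close>)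
  finally show ?thesis .
next
  \<comment> \<open>By convention the integral of a non-integrable \<open>k\<close> is 0, and the
    majorant is nonnegative.\<close>
  case False
  then have "(LINT q:{x<..y}|lebesgue. k q) = 0"
    by (simp add: set_integrable_def set_lebesgue_integral_def not_integrable_integral_eq)
  moreover have "0 \<le> (LINT q:{x<..y}|lebesgue. m q)"
    using assms(2) by (intro set_integral_Ioc_nonneg) (meson abs_ge_zero order_trans)
  ultimately show ?thesis by simp
qed

text \<open>Uniform over \<open>q\<close> in [x, y]: the second-order remainders below need all
  increments inside the interval bounded by one number.\<close>

lemma ac_increment_bound:
  fixes k :: "real \<Rightarrow> real"
  assumes h: "piecewise_ac a b {} h \<psi> j" and k: "set_integrable lebesgue {a<..b} k"
    and le: "\<And>q. a < q \<Longrightarrow> q \<le> b \<Longrightarrow> \<bar>\<psi> q\<bar> \<le> k q"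
    and xy: "a \<le> x" "x \<le> q" "q \<le> y" "y \<le> b"
  shows "\<bar>h q - h x\<bar> \<le> (LINT q:{x<..y}|lebesgue. k q)"
proof -
  have "\<bar>h q - h x\<bar> = \<bar>LINT q:{x<..q}|lebesgue. \<psi> q\<bar>"
    using piecewise_ac_increment[OF h, of x q] xy by simp
  also have "\<dots> \<le> (LINT q:{x<..q}|lebesgue. k q)"
    by (rule set_integral_Ioc_abs_le[OF set_integrable_Ioc_subset[OF k]]) (use xy le in auto)
  also have "\<dots> \<le> (LINT q:{x<..y}|lebesgue. k q)"
  proof -
    have "0 \<le> (LINT q:{q<..y}|lebesgue. k q)"
      by (rule set_integral_Ioc_nonneg) (use le[THEN order_trans[OF abs_ge_zero]] xy in auto)
    then show ?thesis using set_integral_Ioc_split[OF k, of x q y] xy by simp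
  qed
  finally show ?thesis .
qed

text \<open>After subtracting the values at \<open>x\<close>, the remainder of integration by parts
  is the product of the two increments minus an integral of increments against the densities. Either
  is at most the square of the integral of \<open>k\<close>, so
  \<open>additive_quadratic_bound_zero\<close> applies.\<close>

lemma ac_mult:
  assumes h1: "piecewise_ac a b {} h1 \<psi>1 j1" and h2: "piecewise_ac a b {} h2 \<psi>2 j2" and ab: "a \<le> b"
  shows "h1 b * h2 b - h1 a * h2 a = (LINT q:{a<..b}|lebesgue. h1 q * \<psi>2 q + h2 q * \<psi>1 q)"
proof -
  define k where "k q = \<bar>\<psi>1 q\<bar> + \<bar>\<psi>2 q\<bar>" for q
  have \<psi>: "set_integrable lebesgue {a<..b} \<psi>1" "set_integrable lebesgue {a<..b} \<psi>2"
    using h1 h2 by (auto simp: piecewise_ac_def)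
  then have k: "set_integrable lebesgue {a<..b} k"
    unfolding k_def by (intro set_integral_add set_integrable_abs)
  have m: "set_integrable lebesgue {a<..b} (\<lambda>q. h1 q * \<psi>2 q)"
    "set_integrable lebesgue {a<..b} (\<lambda>q. h2 q * \<psi>1 q)"
    using set_integrable_piecewise_ac_mult[OF h1 ab \<psi>(2)] set_integrable_piecewise_ac_mult[OF h2 ab \<psi>(1)] by auto
  then have m': "set_integrable lebesgue {a<..b} (\<lambda>q. h1 q * \<psi>2 q + h2 q * \<psi>1 q)" by simp
  define R where "R x y = h1 y * h2 y - h1 x * h2 x - (LINT q:{x<..y}|lebesgue. h1 q * \<psi>2 q + h2 q * \<psi>1 q)" for x y
  have "R a b = 0"
  proof (rule additive_quadratic_bound_zero[OF ab k, where C = 3])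
    fix x y z assume "a \<le> x" "x \<le> y" "y \<le> z" "z \<le> b"
    from set_integral_Ioc_split[OF m' this] show "R x z = R x y + R y z" by (simp add: R_def)
  next
    fix x y assume xy: "a \<le> x" "x \<le> y" "y \<le> b"
    let ?I = "LINT q:{x<..y}|lebesgue. k q"
    have d1: "\<bar>h1 q - h1 x\<bar> \<le> ?I" if "x \<le> q" "q \<le> y" for q
      by (rule ac_increment_bound[OF h1 k]) (use that xy in \<open>auto simp: k_def\<close>)
    have d2: "\<bar>h2 q - h2 x\<bar> \<le> ?I" if "x \<le> q" "q \<le> y" for q
      by (rule ac_increment_bound[OF h2 k]) (use that xy in \<open>auto simp: k_def\<close>)
    have int: "set_integrable lebesgue {x<..y} f" if "set_integrable lebesgue {a<..b} f" for f :: "real \<Rightarrow> real"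
      using set_integrable_Ioc_subset[OF that] xy by auto
    have e1: "h1 y - h1 x = (LINT q:{x<..y}|lebesgue. \<psi>1 q)"
      and e2: "h2 y - h2 x = (LINT q:{x<..y}|lebesgue. \<psi>2 q)"
      using piecewise_ac_increment[OF h1, of x y] piecewise_ac_increment[OF h2, of x y] xy by auto
    have I1: "set_integrable lebesgue {x<..y} (\<lambda>q. (h1 q - h1 x) * \<psi>2 q + (h2 q - h2 x) * \<psi>1 q)"
      using int[OF m(1)] int[OF m(2)] int[OF \<psi>(1)] int[OF \<psi>(2)]
      by (simp add: left_diff_distrib)
    have "R x y = (h1 y - h1 x) * (h2 y - h2 x)
        - (LINT q:{x<..y}|lebesgue. (h1 q - h1 x) * \<psi>2 q + (h2 q - h2 x) * \<psi>1 q)"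
      using int[OF m(1)] int[OF m(2)] int[OF \<psi>(1)] int[OF \<psi>(2)]
      by (simp add: R_def left_diff_distrib set_integral_add set_integral_diff flip: e1 e2) (simp add: algebra_simps)
    moreover have "\<bar>(h1 y - h1 x) * (h2 y - h2 x)\<bar> \<le> ?I * ?I"
      unfolding abs_mult using d1[of y] d2[of y] xy by (intro mult_mono) auto
    moreover have "\<bar>LINT q:{x<..y}|lebesgue. (h1 q - h1 x) * \<psi>2 q + (h2 q - h2 x) * \<psi>1 q\<bar>
        \<le> (LINT q:{x<..y}|lebesgue. ?I * k q)"
    proof (rule set_integral_Ioc_abs_le)
      show "set_integrable lebesgue {x<..y} (\<lambda>q. ?I * k q)" using int[OF k] by simp
      fix q assume q: "x < q" "q \<le> y"
      have "\<bar>(h1 q - h1 x) * \<psi>2 q\<bar> \<le> ?I * \<bar>\<psi>2 q\<bar>" "\<bar>(h2 q - h2 x) * \<psi>1 q\<bar> \<le> ?I * \<bar>\<psi>1 q\<bar>"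
        unfolding abs_mult using d1[of q] d2[of q] q by (auto intro!: mult_right_mono)
      then show "\<bar>(h1 q - h1 x) * \<psi>2 q + (h2 q - h2 x) * \<psi>1 q\<bar> \<le> ?I * k q"
        by (simp add: k_def algebra_simps)
    qed
    ultimately show "\<bar>R x y\<bar> \<le> 3 * ?I\<^sup>2" by (simp add: power2_eq_square)
  qed (simp add: k_def)
  then show ?thesis by (simp add: R_def)
qed

text \<open>Away from jumps this is \<open>ac_mult\<close>; at a jump it is applied to the functions modified at the
  right endpoint to be left continuous there.\<close>

lemma piecewise_ac_mult:
  assumes h1: "piecewise_ac a b J h1 \<psi>1 j1" and h2: "piecewise_ac a b J h2 \<psi>2 j2" and ab: "a \<le> b"
  shows "piecewise_ac a b J (\<lambda>s. h1 s * h2 s) (\<lambda>s. h1 s * \<psi>2 s + h2 s * \<psi>1 s)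
    (\<lambda>\<tau>. h1 \<tau> * h2 \<tau> - (h1 \<tau> - j1 \<tau>) * (h2 \<tau> - j2 \<tau>))"
proof (rule piecewise_acI)
  let ?\<psi> = "\<lambda>s. h1 s * \<psi>2 s + h2 s * \<psi>1 s"
  \<comment> \<open>\<open>h1 \<tau> - j1 \<tau>\<close> and \<open>h2 \<tau> - j2 \<tau>\<close>
    are the left limits, so this is the jump of the product.\<close>
  let ?j = "\<lambda>\<tau>. h1 \<tau> * h2 \<tau> - (h1 \<tau> - j1 \<tau>) * (h2 \<tau> - j2 \<tau>)"
  show J: "finite (J \<inter> {a<..b})" using h1 by (simp add: piecewise_ac_def)
  have \<psi>: "set_integrable lebesgue {a<..b} \<psi>1" "set_integrable lebesgue {a<..b} \<psi>2"
    using h1 h2 by (auto simp: piecewise_ac_def)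
  show I: "set_integrable lebesgue {a<..b} ?\<psi>"
    using set_integrable_piecewise_ac_mult[OF h1 ab \<psi>(2)] set_integrable_piecewise_ac_mult[OF h2 ab \<psi>(1)]
    by simp
  \<comment> \<open>Intervals whose interior contains no point of \<open>J\<close>. A jump at the
    right end \<open>y\<close> is allowed, and \<open>c\<close> below records whether there is
    one.\<close>
  have none: "h1 y * h2 y - h1 x * h2 x = (LINT q:{x<..y}|lebesgue. ?\<psi> q) + (\<Sum>\<tau>\<in>J \<inter> {x<..y}. ?j \<tau>)"
    if xy: "a \<le> x" "x \<le> y" "y \<le> b" and no: "J \<inter> {x<..<y} = {}" for x y
  proof (cases "x < y")
    case True
    define c :: real where "c = (if y \<in> J then 1 else 0)"
    have Jy: "J \<inter> {x<..y} = (if y \<in> J then {y} else {})"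
    proof -
      have "\<tau> \<in> J \<inter> {x<..y} \<longleftrightarrow> y \<in> J \<and> \<tau> = y" for \<tau>
        using no True by (cases "\<tau> < y") auto
      then show ?thesis by (cases "y \<in> J", simp_all only: if_True if_False) blast+
    qed
    define g1 g2 where "g1 = h1(y := h1 y - c * j1 y)" and "g2 = h2(y := h2 y - c * j2 y)"
    have ac: "piecewise_ac x y {} (h(y := h y - c * j y)) \<psi> (\<lambda>_. 0)"
      if h: "piecewise_ac a b J h \<psi> j" for h \<psi> j
    proof (rule piecewise_acI)
      show "set_integrable lebesgue {x<..y} \<psi>"
        using h set_integrable_Ioc_subset xy unfolding piecewise_ac_def by blast
      fix s assume s: "x \<le> s" "s \<le> y"
      have "J \<inter> {x<..s} = {}" if "s < y" using no that by auto
      then show "(h(y := h y - c * j y)) s - (h(y := h y - c * j y)) x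
          = (LINT q:{x<..s}|lebesgue. \<psi> q) + (\<Sum>\<tau>\<in>{} \<inter> {x<..s}. 0)"
        using piecewise_ac_increment[OF h, of x s] s xy True Jy
        by (cases "s = y") (auto simp: c_def)
    qed simp
    have "g1 y * g2 y - g1 x * g2 x = (LINT q:{x<..y}|lebesgue. g1 q * \<psi>2 q + g2 q * \<psi>1 q)"
      using ac_mult[OF ac[OF h1] ac[OF h2] xy(2)] by (simp add: g1_def g2_def)
    also have "\<dots> = (LINT q:{x<..y}|lebesgue. ?\<psi> q)"
      unfolding set_lebesgue_integral_def
    proof (rule integral_cong_AE)
      have "AE q in lebesgue. q \<noteq> y" using AE_completion[OF AE_lborel_singleton] by auto
      then show *: "AE q in lebesgue. indicat_real {x<..y} q *\<^sub>R (g1 q * \<psi>2 q + g2 q * \<psi>1 q)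
          = indicat_real {x<..y} q *\<^sub>R ?\<psi> q"
        by eventually_elim (simp add: g1_def g2_def)
      show M: "(\<lambda>q. indicat_real {x<..y} q *\<^sub>R ?\<psi> q) \<in> borel_measurable lebesgue"
        using set_integrable_Ioc_subset[OF I xy(1) xy(3)]
        unfolding set_integrable_def by (rule borel_measurable_integrable)
      show "(\<lambda>q. indicat_real {x<..y} q *\<^sub>R (g1 q * \<psi>2 q + g2 q * \<psi>1 q)) \<in> borel_measurable lebesgue"
        using set_integrable_piecewise_ac_mult[OF ac[OF h1] xy(2), of \<psi>2]
          set_integrable_piecewise_ac_mult[OF ac[OF h2] xy(2), of \<psi>1]
          set_integrable_Ioc_subset[OF \<psi>(1) xy(1) xy(3)] set_integrable_Ioc_subset[OF \<psi>(2) xy(1) xy(3)]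
        unfolding g1_def g2_def
        by (intro borel_measurable_integrable) (simp add: set_integrable_def distrib_left)
    qed
    finally show ?thesis
      using True by (cases "y \<in> J") (simp_all add: g1_def g2_def Jy c_def)
  next
    case False
    then have "{x<..y} = {}" "x = y" using xy by auto
    then show ?thesis by (simp add: set_lebesgue_integral_def)
  qed
  fix s assume s: "a \<le> s" "s \<le> b"
  have "a \<le> s" by fact
  then show "h1 s * h2 s - h1 a * h2 a = (LINT q:{a<..s}|lebesgue. ?\<psi> q) + (\<Sum>\<tau>\<in>J \<inter> {a<..s}. ?j \<tau>)"
  proof (induct rule: interval_gluing)
    case (trans x y z)
    then show ?case
      using set_integral_Ioc_split[OF I, of x y z] sum_Ioc_split[OF J, of x y z ?j] s by simp
  next
    case (refl p)
    then show ?case by (simp add: set_lebesgue_integral_def)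
  next
    case (left p)
    have "finite (J \<inter> {a<..<p})" by (rule finite_subset[OF _ J]) (use left s in auto)
    then have fin: "Max (insert (p - 1) (J \<inter> {a<..<p})) < p"
      "\<And>\<tau>. \<tau> \<in> J \<inter> {a<..<p} \<Longrightarrow> \<tau> \<le> Max (insert (p - 1) (J \<inter> {a<..<p}))" by auto
    then obtain e where e: "e < p" "\<And>\<tau>. \<tau> \<in> J \<inter> {a<..<p} \<Longrightarrow> \<tau> \<le> e" by blast
    show ?case
    proof (intro exI[of _ "p - e"] conjI allI impI)
      fix x assume x: "a \<le> x \<and> p - (p - e) < x \<and> x < p"
      then have "J \<inter> {x<..<p} = {}" using e(2) by force
      then show "h1 p * h2 p - h1 x * h2 x = (LINT q:{x<..p}|lebesgue. ?\<psi> q) + (\<Sum>\<tau>\<in>J \<inter> {x<..p}. ?j \<tau>)"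
        using none[of x p] x left s by auto
    qed (use e in simp)
  next
    case (right p)
    have "finite (J \<inter> {p<..s})" by (rule finite_subset[OF _ J]) (use right s in auto)
    then have fin: "Min (insert (p + 1) (J \<inter> {p<..s})) > p"
      "\<And>\<tau>. \<tau> \<in> J \<inter> {p<..s} \<Longrightarrow> \<tau> \<ge> Min (insert (p + 1) (J \<inter> {p<..s}))" by auto
    then obtain e where e: "e > p" "\<And>\<tau>. \<tau> \<in> J \<inter> {p<..s} \<Longrightarrow> \<tau> \<ge> e" by blast
    show ?case
    proof (intro exI[of _ "e - p"] conjI allI impI)
      fix y assume y: "p < y \<and> y < p + (e - p) \<and> y \<le> s"
      then have "J \<inter> {p<..<y} = {}" using e(2) by force
      then show "h1 y * h2 y - h1 p * h2 p = (LINT q:{p<..y}|lebesgue. ?\<psi> q) + (\<Sum>\<tau>\<in>J \<inter> {p<..y}. ?j \<tau>)"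
        using none[of p y] y right s by auto
    qed (use e in simp)
  qed
qed

text \<open>The chain rule follows by the argument of \<open>ac_mult\<close>. The two halves of the
  constant \<open>2 * exp M\<close> bound the second-order Taylor error and the variation of
  \<open>exp (h q)\<close> under the integral; both come from convexity of the exponential and the
  bound \<open>M\<close> of \<open>h\<close>.\<close>

lemma exp_ac:
  assumes h: "piecewise_ac a b {} h \<psi> j" and ab: "a \<le> b"
  shows "piecewise_ac a b {} (\<lambda>s. exp (h s)) (\<lambda>s. exp (h s) * \<psi> s) (\<lambda>_. 0)"
proof (rule piecewise_acI)
  obtain M where M: "M \<ge> 0" "\<And>s. a \<le> s \<Longrightarrow> s \<le> b \<Longrightarrow> \<bar>h s\<bar> \<le> M"
    using piecewise_ac_bounded[OF h] by blast
  have \<psi>: "set_integrable lebesgue {a<..b} \<psi>" using h by (simp add: piecewise_ac_def)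
  let ?k = "\<lambda>q. \<bar>\<psi> q\<bar>"
  have k: "set_integrable lebesgue {a<..b} ?k" using \<psi> by (rule set_integrable_abs)
  have e_le: "exp (h q) \<le> exp M" if "a \<le> q" "q \<le> b" for q using M(2)[of q] that by simp
  have mvt: "\<bar>exp u - exp w\<bar> \<le> exp M * \<bar>u - w\<bar>" if "u \<le> M" "w \<le> M" for u w :: real
  proof -
    have "exp u - exp w \<le> exp u * (u - w)" for u w :: real
      using exp_ge_add_one_self[of "w - u"] mult_left_mono[of "1 + (w - u)" "exp (w - u)" "exp u"]
      by (simp add: algebra_simps flip: exp_add)
    from this[of u w] this[of w u] have
      "exp u - exp w \<le> exp u * (u - w)" "exp w - exp u \<le> exp w * (w - u)" .
    moreover have "exp u * (u - w) \<le> exp M * \<bar>u - w\<bar>" if "u \<le> M" for u w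
      by (rule order_trans[OF mult_left_mono[OF abs_ge_self, of "exp u"] mult_right_mono]) (use that in auto)
    from this[of u w] this[of w u] have "exp u * (u - w) \<le> exp M * \<bar>u - w\<bar>" "exp w * (w - u) \<le> exp M * \<bar>u - w\<bar>"
      using that by (simp_all add: abs_minus_commute)
    ultimately show ?thesis by linarith
  qed
  have em: "set_integrable lebesgue {a<..b} (\<lambda>s. exp (h s) * \<psi> s)"
  proof -
    have "(\<lambda>q. exp (indicator {a<..b} q *\<^sub>R h q) * (indicator {a<..b} q *\<^sub>R \<psi> q)) \<in> borel_measurable lebesgue"
    proof (intro borel_measurable_times borel_measurable_exp[THEN measurable_compose[rotated]])
      show "(\<lambda>q. indicator {a<..b} q *\<^sub>R h q) \<in> borel_measurable lebesgue"
        using piecewise_ac_borel[OF h ab] unfolding set_borel_measurable_def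
        by (intro measurable_completion) simp
      show "(\<lambda>q. indicator {a<..b} q *\<^sub>R \<psi> q) \<in> borel_measurable lebesgue"
        using \<psi> unfolding set_integrable_def by (rule borel_measurable_integrable)
    qed
    moreover have "exp (indicator {a<..b} q *\<^sub>R h q) * (indicator {a<..b} q *\<^sub>R \<psi> q)
       = indicator {a<..b} q *\<^sub>R (exp (h q) * \<psi> q)" for q by (simp add: indicator_def)
    ultimately have "(\<lambda>q. indicator {a<..b} q *\<^sub>R (exp (h q) * \<psi> q)) \<in> borel_measurable lebesgue" by (simp only:)
    moreover have "AE q in lebesgue. norm (indicator {a<..b} q *\<^sub>R (exp (h q) * \<psi> q))
        \<le> norm (exp M * (indicator {a<..b} q *\<^sub>R \<psi> q))"
      using e_le by (intro AE_I2) (auto simp: indicator_def abs_mult intro!: mult_right_mono)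
    ultimately show ?thesis unfolding set_integrable_def
      by (rule Bochner_Integration.integrable_bound[rotated])
        (use \<psi> in \<open>simp add: set_integrable_def\<close>)
  qed
  then show "set_integrable lebesgue {a<..b} (\<lambda>s. exp (h s) * \<psi> s)" .
  fix s assume s: "a \<le> s" "s \<le> b"
  define R where "R x y = exp (h y) - exp (h x) - (LINT q:{x<..y}|lebesgue. exp (h q) * \<psi> q)" for x y
  have "R a s = 0"
  proof (rule additive_quadratic_bound_zero[OF s(1), where k = ?k and C = "2 * exp M"])
    show "set_integrable lebesgue {a<..s} ?k" using set_integrable_Ioc_subset[OF k] s by simp
    fix x y z assume "a \<le> x" "x \<le> y" "y \<le> z" "z \<le> s"
    then show "R x z = R x y + R y z"
      using set_integral_Ioc_split[OF em, of x y z] s by (simp add: R_def)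
  next
    fix x y assume xy: "a \<le> x" "x \<le> y" "y \<le> s"
    let ?I = "LINT q:{x<..y}|lebesgue. ?k q"
    have d: "\<bar>h q - h x\<bar> \<le> ?I" if "x \<le> q" "q \<le> y" for q
      by (rule ac_increment_bound[OF h k]) (use that xy s in auto)
    have int: "set_integrable lebesgue {x<..y} f" if "set_integrable lebesgue {a<..b} f" for f :: "real \<Rightarrow> real"
      using set_integrable_Ioc_subset[OF that] xy s by auto
    have e1: "h y - h x = (LINT q:{x<..y}|lebesgue. \<psi> q)"
      using piecewise_ac_increment[OF h, of x y] xy s by auto
    have "(LINT q:{x<..y}|lebesgue. (exp (h q) - exp (h x)) * \<psi> q)
        = (LINT q:{x<..y}|lebesgue. exp (h q) * \<psi> q) - exp (h x) * (h y - h x)"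
      using int[OF em] int[OF \<psi>] by (simp add: e1 left_diff_distrib set_integral_diff)
    then have "R x y = (exp (h y) - exp (h x) - exp (h x) * (h y - h x))
        - (LINT q:{x<..y}|lebesgue. (exp (h q) - exp (h x)) * \<psi> q)"
      by (simp add: R_def)
    moreover have "\<bar>LINT q:{x<..y}|lebesgue. (exp (h q) - exp (h x)) * \<psi> q\<bar>
        \<le> (LINT q:{x<..y}|lebesgue. exp M * ?I * ?k q)"
    proof (rule set_integral_Ioc_abs_le)
      show "set_integrable lebesgue {x<..y} (\<lambda>q. exp M * ?I * ?k q)" using int[OF k] by simp
      fix q assume q: "x < q" "q \<le> y"
      have "\<bar>exp (h q) - exp (h x)\<bar> \<le> exp M * \<bar>h q - h x\<bar>"
        using mvt[of "h q" "h x"] M(2)[of q] M(2)[of x] q xy s by auto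
      also have "\<dots> \<le> exp M * ?I" using d[of q] q by simp
      finally show "\<bar>(exp (h q) - exp (h x)) * \<psi> q\<bar> \<le> exp M * ?I * ?k q"
        unfolding abs_mult by (rule mult_right_mono) simp
    qed
    moreover have "\<bar>exp (h y) - exp (h x) - exp (h x) * (h y - h x)\<bar> \<le> exp M * (?I * ?I)"
    proof -
      let ?u = "h y" and ?w = "h x"
      have 1: "0 \<le> exp ?u - exp ?w - exp ?w * (?u - ?w)"
        using exp_ge_add_one_self[of "?u - ?w"] mult_left_mono[of "1 + (?u - ?w)" "exp (?u - ?w)" "exp ?w"]
        by (simp add: algebra_simps flip: exp_add)
      have "exp ?u - exp ?w \<le> exp ?u * (?u - ?w)"
        using exp_ge_add_one_self[of "?w - ?u"] mult_left_mono[of "1 + (?w - ?u)" "exp (?w - ?u)" "exp ?u"]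
        by (simp add: algebra_simps flip: exp_add)
      then have "exp ?u - exp ?w - exp ?w * (?u - ?w) \<le> (exp ?u - exp ?w) * (?u - ?w)"
        by (simp add: algebra_simps)
      also have "\<dots> \<le> \<bar>exp ?u - exp ?w\<bar> * \<bar>?u - ?w\<bar>" by (simp flip: abs_mult)
      also have "\<dots> \<le> (exp M * \<bar>?u - ?w\<bar>) * \<bar>?u - ?w\<bar>"
        using mvt[of ?u ?w] M(2)[of y] M(2)[of x] xy s by (intro mult_right_mono) auto
      also have "\<dots> \<le> (exp M * ?I) * ?I"
        using d[of y] xy by (intro mult_mono) auto
      finally show ?thesis using 1 by (simp add: mult.assoc)
    qed
    ultimately show "\<bar>R x y\<bar> \<le> 2 * exp M * ?I\<^sup>2" by (simp add: power2_eq_square mult.assoc)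
  qed simp
  then show "exp (h s) - exp (h a) = (LINT q:{a<..s}|lebesgue. exp (h q) * \<psi> q) + (\<Sum>\<tau>\<in>{} \<inter> {a<..s}. 0)"
    by (simp add: R_def)
qed simp

text \<open>Telescoping over the points of \<open>F\<close> in increasing order, adding one at a
  time; \<open>F \<inter> {..\<tau>}\<close> and \<open>F \<inter> {..<\<tau>}\<close> are the
  stages just after and just before \<open>\<tau>\<close>.\<close>

lemma sum_increments_finite:
  fixes G :: "real set \<Rightarrow> real"
  assumes "finite F"
  shows "G F = G {} + (\<Sum>\<tau>\<in>F. G (F \<inter> {..\<tau>}) - G (F \<inter> {..<\<tau>}))"
  using assms
proof (induct F rule: finite_linorder_max_induct)
  case (insert b A)
  have "b \<notin> A" using insert by auto
  moreover have "insert b A \<inter> {..b} = insert b A" "insert b A \<inter> {..<b} = A" using insert by auto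
  moreover have "insert b A \<inter> {..\<tau>} = A \<inter> {..\<tau>}" "insert b A \<inter> {..<\<tau>} = A \<inter> {..<\<tau>}" if "\<tau> \<in> A" for \<tau>
    using insert that by force+
  ultimately show ?case using insert by simp
qed simp

text \<open>\<open>G\<close> is an arbitrary functional of the set of past jumps. It is used for the
  product of the density factors and for binomial coefficients of the number of jumps.\<close>

lemma piecewise_constant:
  fixes G :: "real set \<Rightarrow> real"
  assumes J: "finite (J \<inter> {a<..b})"
  shows "piecewise_ac a b J (\<lambda>s. G (J \<inter> {a<..s})) (\<lambda>_. 0) (\<lambda>\<tau>. G (J \<inter> {a<..\<tau>}) - G (J \<inter> {a<..<\<tau>}))"
proof (rule piecewise_acI[OF J])
  fix s assume s: "a \<le> s" "s \<le> b"
  have "finite (J \<inter> {a<..s})" by (rule finite_subset[OF _ J]) (use s in auto)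
  from sum_increments_finite[OF this, of G]
  have "G (J \<inter> {a<..s}) = G {} + (\<Sum>\<tau>\<in>J \<inter> {a<..s}. G (J \<inter> {a<..s} \<inter> {..\<tau>}) - G (J \<inter> {a<..s} \<inter> {..<\<tau>}))" .
  also have "(\<Sum>\<tau>\<in>J \<inter> {a<..s}. G (J \<inter> {a<..s} \<inter> {..\<tau>}) - G (J \<inter> {a<..s} \<inter> {..<\<tau>}))
     = (\<Sum>\<tau>\<in>J \<inter> {a<..s}. G (J \<inter> {a<..\<tau>}) - G (J \<inter> {a<..<\<tau>}))"
  proof (rule sum.cong[OF HOL.refl])
    fix \<tau> assume "\<tau> \<in> J \<inter> {a<..s}"
    then have "J \<inter> {a<..s} \<inter> {..\<tau>} = J \<inter> {a<..\<tau>}" "J \<inter> {a<..s} \<inter> {..<\<tau>} = J \<inter> {a<..<\<tau>}" by auto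
    then show "G (J \<inter> {a<..s} \<inter> {..\<tau>}) - G (J \<inter> {a<..s} \<inter> {..<\<tau>}) = G (J \<inter> {a<..\<tau>}) - G (J \<inter> {a<..<\<tau>})"
      by simp
  qed
  finally show "G (J \<inter> {a<..s}) - G (J \<inter> {a<..a})
      = (LINT q:{a<..s}|lebesgue. 0) + (\<Sum>\<tau>\<in>J \<inter> {a<..s}. G (J \<inter> {a<..\<tau>}) - G (J \<inter> {a<..<\<tau>}))"
    by (simp add: set_lebesgue_integral_def)
qed (simp add: set_integrable_def)

section \<open>Piecewise constant paths\<close>

lemma finite_gap_left:
  fixes p :: real
  assumes "finite (B \<inter> {a<..<p})" "a < p"
  obtains e where "a \<le> e" "e < p" "B \<inter> {e<..<p} = {}"
proof -
  have "Max (insert a (B \<inter> {a<..<p})) < p" "a \<le> Max (insert a (B \<inter> {a<..<p}))"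
    "\<And>\<tau>. \<tau> \<in> B \<inter> {a<..<p} \<Longrightarrow> \<tau> \<le> Max (insert a (B \<inter> {a<..<p}))"
    using assms by auto
  then show ?thesis using that[of "Max (insert a (B \<inter> {a<..<p}))"] by force
qed

context markov_jump_process
begin

text \<open>All jumps in positive time, independently of the starting time; those seen from
  \<open>t\<close> are \<open>jumps w \<inter> {t<..}\<close>. Sums over this set replace sums over
  the indices of the jump times.\<close>

definition jumps :: "'w \<Rightarrow> real set" where
  "jumps w = {s. 0 < s \<and> left_lim X s w \<noteq> X s w}"

text \<open>The hypothesis gives constancy a little to the left of each point,
  \<open>right_const\<close> a little to the right, and \<open>interval_gluing\<close> combines
  them.\<close>

lemma path_const:
  assumes w: "w \<in> \<Omega>" and ab: "0 \<le> a" "a \<le> b"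
    and "\<And>s. a < s \<Longrightarrow> s \<le> b \<Longrightarrow> \<forall>\<^sub>F q in at_left s. X q w = X s w"
  shows "X b w = X a w"
  using ab(2)
proof (induct rule: interval_gluing)
  case (left p)
  then have "\<forall>\<^sub>F q in at_left p. X q w = X p w" using assms(4) by simp
  then obtain e where "e < p" "\<And>q. e < q \<Longrightarrow> q < p \<Longrightarrow> X q w = X p w"
    unfolding eventually_at_left_field by blast
  then show ?case by (intro exI[of _ "p - e"]) (metis diff_diff_eq2 diff_gt_0_iff_gt add_diff_cancel_left')
next
  case (right p)
  then obtain d where "d > 0" "\<forall>s\<in>{p..p + d}. X s w = X p w"
    using right_const[OF w, of p] ab(1) by (meson order_trans)
  then show ?case by (intro exI[of _ d]) (meson atLeastAtMost_iff less_imp_le)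
qed simp_all

text \<open>Finitely many jumps leave an interval before \<open>s\<close> without jumps, on which
  the path has one value, read off at the midpoint. Hence the description in \<open>left_lim\<close>
  is satisfied by exactly one state.\<close>

lemma left_lim_eventually:
  assumes w: "w \<in> \<Omega>" and s: "0 < s"
  shows "\<forall>\<^sub>F q in at_left s. X q w = left_lim X s w"
proof -
  let ?B = "{q. 0 < q \<and> q \<le> s \<and> \<not> (\<forall>\<^sub>F q' in at_left q. X q' w = X q w)}"
  obtain e where e: "0 \<le> e" "e < s" "?B \<inter> {e<..<s} = {}"
    using finite_gap_left[of ?B 0 s] finite_subset[OF _ jumps_finite[OF w, of s]] s by blast
  let ?c = "X ((e + s) / 2) w"
  have const: "X q w = X p w" if "e < p" "p \<le> q" "q < s" for p q
  proof (rule path_const[OF w])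
    fix x assume "p < x" "x \<le> q"
    then have "x \<in> {e<..<s}" "0 < x" using that e by auto
    then show "\<forall>\<^sub>F q in at_left x. X q w = X x w" using e(3) by auto
  qed (use that e in auto)
  have "X q w = ?c" if "e < q" "q < s" for q
    using that e(2) const[of q "(e + s) / 2"] const[of "(e + s) / 2" q]
    by (cases "q \<le> (e + s) / 2") simp_all
  then have ev: "\<forall>\<^sub>F q in at_left s. X q w = ?c"
    using e(2) eventually_at_left_field by blast
  have "c = ?c" if "\<forall>\<^sub>F q in at_left s. X q w = c" for c
  proof -
    have "\<forall>\<^sub>F q in at_left s. c = ?c" using ev that by eventually_elim simp
    then show ?thesis by (simp add: trivial_limit_at_left_real)
  qed
  then have "left_lim X s w = ?c" unfolding left_lim_def using ev by blast
  then show ?thesis using ev by simp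
qed

lemma left_lim_eqI:
  assumes w: "w \<in> \<Omega>" and s: "0 < s" and ev: "\<forall>\<^sub>F q in at_left s. X q w = c"
  shows "left_lim X s w = c"
proof -
  have "\<forall>\<^sub>F q in at_left s. left_lim X s w = c"
    using ev left_lim_eventually[OF w s] by eventually_elim simp
  then show ?thesis by (simp add: trivial_limit_at_left_real)
qed

lemma jumps_iff:
  assumes w: "w \<in> \<Omega>"
  shows "s \<in> jumps w \<longleftrightarrow> 0 < s \<and> \<not> (\<forall>\<^sub>F q in at_left s. X q w = X s w)"
  using left_lim_eventually[OF w, of s] left_lim_eqI[OF w, of s "X s w"]
  by (auto simp: jumps_def)

lemma finite_jumps: "w \<in> \<Omega> \<Longrightarrow> finite (jumps w \<inter> {..b})"
  by (rule finite_subset[OF _ jumps_finite[of w b]]) (auto simp: jumps_iff)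

lemma finite_jumps_Ioc [simp]: "w \<in> \<Omega> \<Longrightarrow> finite (jumps w \<inter> {a<..b})"
  by (rule finite_subset[OF _ finite_jumps[of w b]]) auto

lemma finite_jumps_Ioo [simp]: "w \<in> \<Omega> \<Longrightarrow> finite (jumps w \<inter> {a<..<b})"
  by (rule finite_subset[OF _ finite_jumps[of w b]]) auto

lemma path_const_no_jump:
  assumes w: "w \<in> \<Omega>" and "0 \<le> a" "a \<le> b" "jumps w \<inter> {a<..b} = {}"
  shows "X b w = X a w"
proof (rule path_const[OF w assms(2,3)])
  fix s assume "a < s" "s \<le> b"
  then have "s \<notin> jumps w" "0 < s" using assms by auto
  then show "\<forall>\<^sub>F q in at_left s. X q w = X s w" using jumps_iff[OF w] by blast
qed

lemma left_lim_no_jump: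
  assumes w: "w \<in> \<Omega>" and "0 \<le> a" "a < s" "jumps w \<inter> {a<..<s} = {}"
  shows "left_lim X s w = X a w"
proof (rule left_lim_eqI[OF w])
  have "X q w = X a w" if "a < q" "q < s" for q
    by (rule path_const_no_jump[OF w]) (use assms that in auto)
  then show "\<forall>\<^sub>F q in at_left s. X q w = X a w"
    using assms(3) unfolding eventually_at_left_field by blast
qed (use assms in simp)

lemma left_lim_seq:
  assumes w: "w \<in> \<Omega>" and s: "0 < s" and c: "\<And>n. c n < s" "c \<longlonglongrightarrow> s"
  shows "\<forall>\<^sub>F n in sequentially. X (c n) w = left_lim X s w"
proof -
  obtain e where e: "e < s" "\<And>q. e < q \<Longrightarrow> q < s \<Longrightarrow> X q w = left_lim X s w"
    using left_lim_eventually[OF w s] unfolding eventually_at_left_field by blast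
  show ?thesis using order_tendstoD(1)[OF c(2) e(1)] by eventually_elim (use e c in auto)
qed

lemma left_lim_in_space:
  assumes w: "w \<in> \<Omega>" and s: "0 < s"
  shows "left_lim X s w \<in> space K"
proof -
  obtain e where e: "e < s" "\<And>q. e < q \<Longrightarrow> q < s \<Longrightarrow> X q w = left_lim X s w"
    using left_lim_eventually[OF w s] unfolding eventually_at_left_field by blast
  let ?q = "(max 0 e + s) / 2"
  have "left_lim X s w = X ?q w" "0 \<le> ?q" using e s by auto
  then show ?thesis using path_range[OF _ w] by simp
qed

text \<open>This is what allows the current state to replace the left limit in time integrals up to
  \<open>T\<close>.\<close>

lemma left_lim_AE:
  assumes w: "w \<in> \<Omega>"
  shows "AE s in lborel. 0 < s \<longrightarrow> s \<le> T \<longrightarrow> left_lim X s w = X s w"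
proof -
  have "AE s in lborel. s \<notin> jumps w \<inter> {..T}"
    by (intro AE_not_in finite_imp_null_set_lborel finite_jumps[OF w])
  then show ?thesis by eventually_elim (auto simp: jumps_def)
qed

section \<open>Jump times as an enumeration of the set of jumps\<close>

lemma next_jump_exists:
  assumes w: "w \<in> \<Omega>" and s: "s \<in> jumps w" "c < s"
  obtains \<tau> where "\<tau> \<in> jumps w" "c < \<tau>" "\<tau> \<le> s" "jumps w \<inter> {c<..<\<tau>} = {}"
proof -
  let ?\<tau> = "Min (jumps w \<inter> {c<..s})"
  have fin: "finite (jumps w \<inter> {c<..s})" using w by simp
  have ne: "jumps w \<inter> {c<..s} \<noteq> {}" using s by auto
  have 1: "?\<tau> \<in> jumps w \<inter> {c<..s}" by (rule Min_in[OF fin ne])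
  have "r \<notin> jumps w" if "c < r" "r < ?\<tau>" for r
  proof
    assume "r \<in> jumps w"
    then have "?\<tau> \<le> r" using that 1 by (intro Min_le[OF fin]) auto
    then show False using that by simp
  qed
  then have 2: "jumps w \<inter> {c<..<?\<tau>} = {}"
    unfolding disjoint_iff greaterThanLessThan_iff by blast
  have 3: "?\<tau> \<in> jumps w" "c < ?\<tau>" "?\<tau> \<le> s"
    using 1 unfolding Int_iff greaterThanAtMost_iff by blast+
  show ?thesis by (rule that[OF 3 2])
qed

lemma Inf_leave_none:
  assumes w: "w \<in> \<Omega>" and "0 \<le> c" and "jumps w \<inter> {c<..} = {}"
  shows "Inf (ereal ` {s. ereal c < ereal s \<and> X s w \<noteq> X c w}) = \<infinity>"
proof -
  have "X s w = X c w" if "c < s" for s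
    by (rule path_const_no_jump[OF w]) (use assms that in auto)
  then have "{s. ereal c < ereal s \<and> X s w \<noteq> X c w} = {}" by auto
  then show ?thesis by (simp only: image_empty Inf_empty top_ereal_def)
qed

text \<open>A jump time is defined as the first exit from the current state. The path stays in that
  state up to the next point of \<open>jumps\<close>, and there it differs from its left limit,
  which is that state.\<close>

lemma Inf_leave_next:
  assumes w: "w \<in> \<Omega>" and c: "0 \<le> c" "c < \<tau>" and \<tau>: "\<tau> \<in> jumps w" "jumps w \<inter> {c<..<\<tau>} = {}"
  shows "Inf (ereal ` {s. ereal c < ereal s \<and> X s w \<noteq> X c w}) = ereal \<tau>"
proof (rule cInf_eq_minimum)
  have "X \<tau> w \<noteq> X c w" using \<tau>(1) left_lim_no_jump[OF w c \<tau>(2)] by (auto simp: jumps_def)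
  then show "ereal \<tau> \<in> ereal ` {s. ereal c < ereal s \<and> X s w \<noteq> X c w}" using c by auto
  fix x assume "x \<in> ereal ` {s. ereal c < ereal s \<and> X s w \<noteq> X c w}"
  then obtain s where s: "x = ereal s" "c < s" "X s w \<noteq> X c w" by auto
  have "\<not> s < \<tau>"
  proof
    assume "s < \<tau>"
    then have "X s w = X c w" by (intro path_const_no_jump[OF w]) (use c s \<tau> in auto)
    then show False using s by simp
  qed
  then show "ereal \<tau> \<le> x" using s by simp
qed

lemma jump_time_Suc_none:
  assumes "w \<in> \<Omega>" "jump_time X t n w = ereal c" "0 \<le> c" "jumps w \<inter> {c<..} = {}"
  shows "jump_time X t (Suc n) w = \<infinity>"
  using Inf_leave_none[OF assms(1,3,4)] assms(2) by simp

lemma jump_time_Suc_next: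
  assumes "w \<in> \<Omega>" "jump_time X t n w = ereal c" "0 \<le> c" "c < \<tau>" "\<tau> \<in> jumps w" "jumps w \<inter> {c<..<\<tau>} = {}"
  shows "jump_time X t (Suc n) w = ereal \<tau>"
  using Inf_leave_next[OF assms(1,3-6)] assms(2) by simp

lemma jump_time_Suc_infinite: "jump_time X t n w = \<infinity> \<Longrightarrow> jump_time X t (Suc n) w = \<infinity>"
  by (simp add: top_ereal_def)

lemma jump_time_Suc_cases:
  assumes w: "w \<in> \<Omega>" and c: "jump_time X t n w = ereal c" "0 \<le> c"
  obtains (none) "jumps w \<inter> {c<..} = {}" "jump_time X t (Suc n) w = \<infinity>"
  | ("next") \<tau> where "c < \<tau>" "\<tau> \<in> jumps w" "jumps w \<inter> {c<..<\<tau>} = {}" "jump_time X t (Suc n) w = ereal \<tau>"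
proof (cases "jumps w \<inter> {c<..} = {}")
  case True
  then show ?thesis using none jump_time_Suc_none[OF w c] by simp
next
  case False
  then obtain s where "s \<in> jumps w" "c < s" by auto
  then obtain \<tau> where "\<tau> \<in> jumps w" "c < \<tau>" "\<tau> \<le> s" "jumps w \<inter> {c<..<\<tau>} = {}"
    by (rule next_jump_exists[OF w])
  then show ?thesis using "next" jump_time_Suc_next[OF w c] by simp
qed

text \<open>Apart from \<open>t\<close> itself, a finite jump time is always a genuine jump after
  \<open>t\<close>; this case rule does away with most arithmetic in the extended reals
  below.\<close>

lemma jump_time_finite_cases:
  assumes w: "w \<in> \<Omega>" and t: "0 \<le> t"
  obtains (inf) "0 < n" "jump_time X t n w = \<infinity>"
  | (zero) "n = 0" "jump_time X t n w = ereal t"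
  | (fin) \<tau> where "0 < n" "jump_time X t n w = ereal \<tau>" "t < \<tau>" "\<tau> \<in> jumps w"
proof -
  have "(n = 0 \<and> jump_time X t n w = ereal t) \<or> (0 < n \<and> jump_time X t n w = \<infinity>)
    \<or> (0 < n \<and> (\<exists>\<tau>. jump_time X t n w = ereal \<tau> \<and> t < \<tau> \<and> \<tau> \<in> jumps w))"
  proof (induct n)
    case (Suc n)
    then consider "jump_time X t n w = \<infinity>" | c where "jump_time X t n w = ereal c" "t \<le> c"
      by (auto simp: less_imp_le)
    then show ?case
    proof cases
      case 1 then show ?thesis using jump_time_Suc_infinite by simp
    next
      case 2
      then show ?thesis using t by (cases rule: jump_time_Suc_cases[OF w 2(1)]) auto
    qed
  qed simp
  then show ?thesis using that by blast
qed

lemma jump_time_strict: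
  assumes w: "w \<in> \<Omega>" and t: "0 \<le> t" and "m < n" "jump_time X t n w < \<infinity>"
  shows "jump_time X t m w < jump_time X t n w"
  using assms(3,4)
proof (induct n)
  case (Suc n)
  have *: "jump_time X t n w < jump_time X t (Suc n) w"
    using w t
  proof (cases rule: jump_time_finite_cases[where n = n])
    case inf then show ?thesis using Suc.prems jump_time_Suc_infinite[of t n w] by simp
  next
    case zero
    then show ?thesis using Suc.prems t
      by (cases rule: jump_time_Suc_cases[OF w zero(2)]) (simp_all del: jump_time.simps)
  next
    case (fin \<tau>)
    have "0 \<le> \<tau>" using fin t by simp
    then show ?thesis using Suc.prems fin
      by (cases rule: jump_time_Suc_cases[OF w fin(2)]) (simp_all del: jump_time.simps)
  qed
  show ?case
  proof (cases "m = n")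
    case False
    then have "jump_time X t m w < jump_time X t n w"
      using Suc * by (metis less_SucE less_trans)
    then show ?thesis using * by (rule less_trans)
  qed (use * in simp)
qed simp

text \<open>If \<open>\<tau>\<close> were missed, all jump times would be finite and below it; being
  strictly increasing, they would produce infinitely many jumps before
  \<open>\<tau>\<close>.\<close>

lemma jump_time_surj:
  assumes w: "w \<in> \<Omega>" and t: "0 \<le> t" and \<tau>: "\<tau> \<in> jumps w" "t < \<tau>"
  shows "\<exists>n\<ge>1. jump_time X t n w = ereal \<tau>"
proof (rule ccontr)
  assume "\<not> ?thesis"
  then have ne: "\<And>n. n \<ge> 1 \<Longrightarrow> jump_time X t n w \<noteq> ereal \<tau>" by blast
  have lt: "\<exists>c. jump_time X t n w = ereal c \<and> t \<le> c \<and> c < \<tau>" for n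
  proof (induct n)
    case (Suc n)
    then obtain c where c: "jump_time X t n w = ereal c" "t \<le> c" "c < \<tau>" by blast
    have "0 \<le> c" using c t by simp
    with w c(1) show ?case
    proof (cases rule: jump_time_Suc_cases)
      case none then show ?thesis using c \<tau> by auto
    next
      case ("next" \<sigma>)
      then have "\<not> \<tau> < \<sigma>" "\<tau> \<noteq> \<sigma>" using c \<tau> ne[of "Suc n"] by auto
      then show ?thesis using "next" c by (intro exI[of _ \<sigma>]) auto
    qed
  qed (use \<tau> in simp)
  define f where "f n = real_of_ereal (jump_time X t (Suc n) w)" for n
  have f: "jump_time X t (Suc n) w = ereal (f n)" for n
    using lt[of "Suc n"] unfolding f_def by auto
  have "f n \<in> jumps w \<inter> {..\<tau>}" for n
    using lt[of "Suc n"] f[of n] by (cases rule: jump_time_finite_cases[OF w t, of "Suc n"]) (auto simp del: jump_time.simps)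
  moreover have "inj f"
  proof (rule linorder_injI)
    fix m n :: nat assume "m < n"
    then have "jump_time X t (Suc m) w < jump_time X t (Suc n) w"
      by (intro jump_time_strict[OF w t]) (simp_all only: f, simp_all)
    then show "f m \<noteq> f n" by (simp only: f) simp
  qed
  ultimately have "infinite (jumps w \<inter> {..\<tau>})"
    using finite_subset[of "range f"] range_inj_infinite by blast
  then show False using finite_jumps[OF w] by simp
qed

text \<open>Turns sums and products over the index \<open>n\<close>, as they occur in the jump
  measure and the density process, into sums and products over the finite set of jumps up to
  \<open>s\<close>.\<close>

lemma bij_betw_jump_time:
  assumes w: "w \<in> \<Omega>" and t: "0 \<le> t"
  shows "bij_betw (\<lambda>n. real_of_ereal (jump_time X t n w)) {n. 1 \<le> n \<and> jump_time X t n w \<le> ereal s}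
    (jumps w \<inter> {t<..s})"
  unfolding bij_betw_def
proof
  have val: "\<exists>\<tau>. jump_time X t n w = ereal \<tau> \<and> t < \<tau> \<and> \<tau> \<in> jumps w \<and> \<tau> \<le> s"
    if "1 \<le> n" "jump_time X t n w \<le> ereal s" for n
    using that by (cases rule: jump_time_finite_cases[OF w t, of n]) auto
  show "inj_on (\<lambda>n. real_of_ereal (jump_time X t n w)) {n. 1 \<le> n \<and> jump_time X t n w \<le> ereal s}"
  proof (rule linorder_inj_onI)
    fix m n assume *: "m < n" "m \<in> {n. 1 \<le> n \<and> jump_time X t n w \<le> ereal s}"
      "n \<in> {n. 1 \<le> n \<and> jump_time X t n w \<le> ereal s}"
    then obtain a b where "jump_time X t m w = ereal a" "jump_time X t n w = ereal b" using val by blast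
    then show "real_of_ereal (jump_time X t m w) \<noteq> real_of_ereal (jump_time X t n w)"
      using jump_time_strict[OF w t *(1)] by simp
  qed auto
  show "(\<lambda>n. real_of_ereal (jump_time X t n w)) ` {n. 1 \<le> n \<and> jump_time X t n w \<le> ereal s} = jumps w \<inter> {t<..s}"
  proof (intro set_eqI iffI)
    fix \<tau> assume "\<tau> \<in> jumps w \<inter> {t<..s}"
    then obtain n where "1 \<le> n" "jump_time X t n w = ereal \<tau>" "\<tau> \<le> s"
      using jump_time_surj[OF w t, of \<tau>] by auto
    then show "\<tau> \<in> (\<lambda>n. real_of_ereal (jump_time X t n w)) ` {n. 1 \<le> n \<and> jump_time X t n w \<le> ereal s}"
      by (intro image_eqI[of _ _ n]) auto
  qed (use val in force)
qed

lemmas sum_jump_time = sum.reindex_bij_betw[OF bij_betw_jump_time]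
lemmas prod_jump_time = prod.reindex_bij_betw[OF bij_betw_jump_time]

lemma finite_jump_time: "w \<in> \<Omega> \<Longrightarrow> 0 \<le> t \<Longrightarrow> finite {n. 1 \<le> n \<and> jump_time X t n w \<le> ereal s}"
  using bij_betw_finite[OF bij_betw_jump_time] by simp

lemma first_jump_le_iff:
  assumes w: "w \<in> \<Omega>" and c: "0 \<le> c"
  shows "jump_time X c 1 w \<le> ereal s \<longleftrightarrow> jumps w \<inter> {c<..s} \<noteq> {}"
proof -
  have "jump_time X c 0 w = ereal c" by simp
  then show ?thesis using c
    by (cases rule: jump_time_Suc_cases[OF w, of c 0 c]) (force simp del: jump_time.simps)+
qed

lemma first_jump_properties:
  assumes w: "w \<in> \<Omega>" and c: "0 \<le> c" and "jump_time X c 1 w \<le> ereal s"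
  obtains \<tau> where "jump_time X c 1 w = ereal \<tau>" "c < \<tau>" "\<tau> \<le> s" "\<tau> \<in> jumps w" "jumps w \<inter> {c<..<\<tau>} = {}"
proof -
  have "jump_time X c 0 w = ereal c" by simp
  then show ?thesis using c assms(3) that
    by (cases rule: jump_time_Suc_cases[OF w, of c 0 c]) (auto simp del: jump_time.simps)
qed

lemma first_jump_greater:
  assumes w: "w \<in> \<Omega>" and c: "0 \<le> c"
  shows "ereal c < jump_time X c 1 w"
proof -
  have "jump_time X c 0 w = ereal c" by simp
  then show ?thesis using c
    by (cases rule: jump_time_Suc_cases[OF w, of c 0 c]) (auto simp del: jump_time.simps)
qed

text \<open>A rational \<open>q\<close> fits between the jump number \<open>n\<close> and the next
  one. This expresses a later jump time through first jump times after countably many deterministic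
  times, the ones to which \<open>stopping\<close> applies.\<close>

lemma jump_time_Suc_le_iff:
  assumes w: "w \<in> \<Omega>" and t: "0 \<le> t"
  shows "jump_time X t (Suc n) w \<le> ereal s \<longleftrightarrow>
    (\<exists>q\<in>\<rat> \<inter> {t..s}. jump_time X t n w \<le> ereal q \<and> jump_time X q 1 w \<le> ereal s)"
proof
  assume le: "jump_time X t (Suc n) w \<le> ereal s"
  then have "jump_time X t n w \<noteq> \<infinity>" using jump_time_Suc_infinite[of t n w] by auto
  then obtain c where c: "jump_time X t n w = ereal c" "t \<le> c" "0 \<le> c"
    using t by (cases rule: jump_time_finite_cases[OF w t, of n]) auto
  from c le obtain \<tau> where \<tau>: "c < \<tau>" "\<tau> \<in> jumps w" "\<tau> \<le> s"
    by (cases rule: jump_time_Suc_cases[OF w c(1)]) (auto simp del: jump_time.simps)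
  obtain q where q: "q \<in> \<rat>" "c < q" "q < \<tau>" using Rats_dense_in_real[OF \<tau>(1)] by blast
  then have "jump_time X q 1 w \<le> ereal s" using first_jump_le_iff[OF w, of q s] c \<tau> by auto
  then show "\<exists>q\<in>\<rat> \<inter> {t..s}. jump_time X t n w \<le> ereal q \<and> jump_time X q 1 w \<le> ereal s"
    using q c \<tau> by (intro bexI[of _ q]) auto
next
  assume "\<exists>q\<in>\<rat> \<inter> {t..s}. jump_time X t n w \<le> ereal q \<and> jump_time X q 1 w \<le> ereal s"
  then obtain q where q: "t \<le> q" "q \<le> s" "jump_time X t n w \<le> ereal q" "jump_time X q 1 w \<le> ereal s" by auto
  then obtain c where c: "jump_time X t n w = ereal c" "t \<le> c" "0 \<le> c" "c \<le> q"
    using t by (cases rule: jump_time_finite_cases[OF w t, of n]) auto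
  obtain \<sigma> where \<sigma>: "\<sigma> \<in> jumps w" "q < \<sigma>" "\<sigma> \<le> s"
    using q first_jump_le_iff[OF w, of q s] t by auto
  show "jump_time X t (Suc n) w \<le> ereal s" using w c(1,3)
  proof (cases rule: jump_time_Suc_cases)
    case none then show ?thesis using \<sigma> c by auto
  next
    case ("next" \<tau>)
    then have "\<tau> \<le> \<sigma>" using \<sigma> c by force
    then show ?thesis using "next" \<sigma> by (simp del: jump_time.simps)
  qed
qed

end

section \<open>Measurability along paths\<close>

text \<open>The state space has no topology, so convergence in it can only mean eventual constancy;
  the preimage under the limit is the lower limit of the preimages.\<close>

lemma measurable_eventually_const:
  assumes f: "\<And>n::nat. f n \<in> measurable M N"
    and ev: "\<And>x. x \<in> space M \<Longrightarrow> \<forall>\<^sub>F n in sequentially. f n x = g x"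
  shows "g \<in> measurable M N"
proof (rule measurableI)
  fix x assume x: "x \<in> space M"
  then obtain n where "f n x = g x" using ev[OF x] unfolding eventually_sequentially by blast
  then show "g x \<in> space N" using measurable_space[OF f x, of n] by simp
next
  fix A assume A: "A \<in> sets N"
  have "g -` A \<inter> space M = (\<Union>m. \<Inter>n\<in>{m..}. f n -` A \<inter> space M)"
  proof (intro set_eqI iffI)
    fix x assume x: "x \<in> g -` A \<inter> space M"
    then obtain m where "\<And>n. n \<ge> m \<Longrightarrow> f n x = g x" using ev[of x] unfolding eventually_sequentially by blast
    then have "x \<in> (\<Inter>n\<in>{m..}. f n -` A \<inter> space M)" using x by auto
    then show "x \<in> (\<Union>m. \<Inter>n\<in>{m..}. f n -` A \<inter> space M)" by blast
  next
    fix x assume "x \<in> (\<Union>m. \<Inter>n\<in>{m..}. f n -` A \<inter> space M)"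
    then obtain m where m: "\<And>n. n \<ge> m \<Longrightarrow> f n x \<in> A" "x \<in> space M" by auto
    then obtain m' where "\<And>n. n \<ge> m' \<Longrightarrow> f n x = g x" using ev[of x] unfolding eventually_sequentially by blast
    from this[of "max m m'"] m(1)[of "max m m'"] have "g x \<in> A" by simp
    then show "x \<in> g -` A \<inter> space M" using m by simp
  qed
  moreover have "(\<Union>m. \<Inter>n\<in>{m..}. f n -` A \<inter> space M) \<in> sets M"
    using measurable_sets[OF f A] by (intro sets.countable_UN'' sets.countable_INT' image_subsetI) simp_all
  ultimately show "g -` A \<inter> space M \<in> sets M" by simp
qed

text \<open>For \<open>t \<le> d\<close> the projection of the line onto [t, d]. It turns functions
  of a time in [t, d] into functions on the whole line, so that products with \<open>borel\<close>
  can be used throughout.\<close>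

definition clamp_to :: "real \<Rightarrow> real \<Rightarrow> real \<Rightarrow> real" where
  "clamp_to t d s = max t (min d s)"

lemma clamp_to_bounds [simp]: "t \<le> clamp_to t d s" "t \<le> d \<Longrightarrow> clamp_to t d s \<le> d"
  by (auto simp: clamp_to_def)

lemma clamp_to_id [simp]: "t \<le> s \<Longrightarrow> s \<le> d \<Longrightarrow> clamp_to t d s = s"
  by (simp add: clamp_to_def)

lemma measurable_clamp_to [measurable]: "clamp_to t d \<in> borel_measurable borel"
  unfolding clamp_to_def by measurable

text \<open>Left end of the cell ((k - 1) / (n + 1), k / (n + 1)] containing \<open>s\<close>, cut
  off at \<open>t\<close>. For \<open>t < s\<close> it lies strictly before \<open>s\<close>, so a
  process evaluated there uses only the past; this is the source of all predictable left limits
  below.\<close>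

definition grid_left :: "real \<Rightarrow> nat \<Rightarrow> real \<Rightarrow> real" where
  "grid_left t n s = max t ((of_int \<lceil>s * real (Suc n)\<rceil> - 1) / real (Suc n))"

lemma grid_left_ge: "t \<le> grid_left t n s"
  by (simp add: grid_left_def)

lemma grid_left_bounds: "(of_int \<lceil>s * real (Suc n)\<rceil> - 1) / real (Suc n) < s"
  "s - inverse (real (Suc n)) \<le> (of_int \<lceil>s * real (Suc n)\<rceil> - 1) / real (Suc n)"
proof -
  have "of_int \<lceil>s * real (Suc n)\<rceil> - 1 < s * real (Suc n)" "s * real (Suc n) \<le> of_int \<lceil>s * real (Suc n)\<rceil>"
    by linarith+
  then show "(of_int \<lceil>s * real (Suc n)\<rceil> - 1) / real (Suc n) < s"
    "s - inverse (real (Suc n)) \<le> (of_int \<lceil>s * real (Suc n)\<rceil> - 1) / real (Suc n)"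
    by (simp_all add: field_simps del: of_nat_Suc)
qed

lemma grid_left_less: "t < s \<Longrightarrow> grid_left t n s < s"
  using grid_left_bounds(1)[of s n] by (simp add: grid_left_def)

lemma grid_left_start: "grid_left t n t = t"
  using grid_left_bounds(1)[of t n] by (simp add: grid_left_def)

lemma grid_left_tendsto: assumes "t < s" shows "(\<lambda>n. grid_left t n s) \<longlonglongrightarrow> s"
proof (rule tendsto_sandwich[of "\<lambda>n. s - inverse (real (Suc n))" _ _ "\<lambda>_. s"])
  show "(\<lambda>n. s - inverse (real (Suc n))) \<longlonglongrightarrow> s"
    using tendsto_diff[OF tendsto_const LIMSEQ_inverse_real_of_nat, of s] by simp
  show "\<forall>\<^sub>F n in sequentially. s - inverse (real (Suc n)) \<le> grid_left t n s"
    using grid_left_bounds(2)[of s] by (intro always_eventually allI) (auto simp: grid_left_def intro: max.coboundedI2)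
  show "\<forall>\<^sub>F n in sequentially. grid_left t n s \<le> s"
    by (intro always_eventually allI less_imp_le grid_left_less[OF assms])
qed simp

context markov_jump_process
begin

abbreviation \<F> :: "real set \<Rightarrow> 'w measure" where
  "\<F> I \<equiv> path_algebra \<Omega> K X I"

abbreviation Pred :: "real \<Rightarrow> ('w \<times> real) measure" where
  "Pred t \<equiv> predictable T K \<Omega> X t"

abbreviation Prog :: "real \<Rightarrow> ('w \<times> real) measure" where
  "Prog t \<equiv> progressive T K \<Omega> X t"

lemma path_algebra_Pow: "{X s -` A \<inter> \<Omega> |s A. s \<in> I \<and> A \<in> sets K} \<subseteq> Pow \<Omega>"
  by auto

lemma space_path_algebra [simp]: "space (\<F> I) = \<Omega>"
  unfolding path_algebra_def by (rule space_measure_of[OF path_algebra_Pow])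

lemma sets_path_algebra: "sets (\<F> I) = sigma_sets \<Omega> {X s -` A \<inter> \<Omega> |s A. s \<in> I \<and> A \<in> sets K}"
  unfolding path_algebra_def by (rule sets_measure_of[OF path_algebra_Pow])

lemma path_algebra_mono: "I \<subseteq> I' \<Longrightarrow> sets (\<F> I) \<subseteq> sets (\<F> I')"
  unfolding sets_path_algebra by (rule sigma_sets_mono') blast

lemma path_algebra_measurable_mono: "f \<in> \<F> I \<rightarrow>\<^sub>M N \<Longrightarrow> I \<subseteq> I' \<Longrightarrow> f \<in> \<F> I' \<rightarrow>\<^sub>M N"
  using path_algebra_mono[of I I'] by (auto simp: measurable_def)

lemma measurable_path: "s \<in> I \<Longrightarrow> 0 \<le> s \<Longrightarrow> X s \<in> \<F> I \<rightarrow>\<^sub>M K"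
  by (rule measurableI) (auto simp: path_range sets_path_algebra)

lemma space_P [simp]: "0 \<le> t \<Longrightarrow> x \<in> space K \<Longrightarrow> space (P t x) = \<Omega>"
  using sets_eq_imp_space_eq[OF prob_algebra[of t x]] by simp

lemma measurable_P_eq: "0 \<le> t \<Longrightarrow> x \<in> space K \<Longrightarrow> P t x \<rightarrow>\<^sub>M N = \<F> {t..} \<rightarrow>\<^sub>M N"
  by (rule measurable_cong_sets[OF prob_algebra refl])

lemma measurable_P: "f \<in> \<F> I \<rightarrow>\<^sub>M N \<Longrightarrow> I \<subseteq> {t..} \<Longrightarrow> 0 \<le> t \<Longrightarrow> x \<in> space K \<Longrightarrow> f \<in> P t x \<rightarrow>\<^sub>M N"
  unfolding measurable_P_eq by (rule path_algebra_measurable_mono)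

text \<open>The path is approximated from the right, where it is locally constant.\<close>

lemma measurable_joint_path:
  assumes t: "0 \<le> t" "t \<le> d"
  shows "(\<lambda>(w, s). X (clamp_to t d s) w) \<in> \<F> {t..d} \<Otimes>\<^sub>M borel \<rightarrow>\<^sub>M K"
proof (rule measurable_eventually_const)
  let ?k = "\<lambda>(n::nat) (s::real). \<lfloor>clamp_to t d s * real (Suc n)\<rfloor>"
  let ?c = "\<lambda>(n::nat) (k::int). clamp_to t d ((of_int k + 1) / real (Suc n))"
  fix n :: nat
  have "(\<lambda>p. X (?c n (?k n (snd p))) (fst p)) \<in> \<F> {t..d} \<Otimes>\<^sub>M borel \<rightarrow>\<^sub>M K"
  proof (rule measurable_compose_countable[where f = "\<lambda>k p. X (?c n k) (fst p)" and g = "\<lambda>p. ?k n (snd p)"])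
    fix k :: int
    have "X (?c n k) \<in> \<F> {t..d} \<rightarrow>\<^sub>M K"
      using t by (intro measurable_path) (auto intro: order_trans[OF t(1)])
    then show "(\<lambda>p. X (?c n k) (fst p)) \<in> \<F> {t..d} \<Otimes>\<^sub>M borel \<rightarrow>\<^sub>M K"
      by (rule measurable_compose[OF measurable_fst])
  qed measurable
  then show "(\<lambda>(w, s). X (?c n (?k n s)) w) \<in> \<F> {t..d} \<Otimes>\<^sub>M borel \<rightarrow>\<^sub>M K"
    by (simp add: case_prod_beta')
next
  let ?k = "\<lambda>(n::nat) (s::real). \<lfloor>clamp_to t d s * real (Suc n)\<rfloor>"
  let ?c = "\<lambda>(n::nat) (k::int). clamp_to t d ((of_int k + 1) / real (Suc n))"
  fix p assume "p \<in> space (\<F> {t..d} \<Otimes>\<^sub>M (borel :: real measure))"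
  then obtain w s where p: "p = (w, s)" "w \<in> \<Omega>" by (auto simp: space_pair_measure)
  let ?u = "clamp_to t d s"
  have "0 \<le> ?u" by (rule order_trans[OF t(1)]) simp
  from right_const[OF p(2) this] obtain \<delta> where \<delta>: "\<delta> > 0" "\<And>q. ?u \<le> q \<Longrightarrow> q \<le> ?u + \<delta> \<Longrightarrow> X q w = X ?u w"
    by (meson atLeastAtMost_iff)
  have "\<forall>\<^sub>F n in sequentially. inverse (real (Suc n)) < \<delta>"
    using order_tendstoD(2)[OF LIMSEQ_inverse_real_of_nat \<delta>(1)] .
  then have "\<forall>\<^sub>F n in sequentially. X (?c n (?k n s)) w = X ?u w"
  proof eventually_elim
    case (elim n)
    let ?q = "(of_int (?k n s) + 1) / real (Suc n)"
    have "?u * real (Suc n) < of_int (?k n s) + 1" "of_int (?k n s) \<le> ?u * real (Suc n)" by linarith+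
    then have "?u < ?q" "?q \<le> ?u + inverse (real (Suc n))"
      by (simp_all add: field_simps del: of_nat_Suc)
    then have "?u \<le> clamp_to t d ?q" "clamp_to t d ?q \<le> ?u + \<delta>"
      using elim t by (auto simp: clamp_to_def)
    then show ?case by (rule \<delta>(2))
  qed
  then show "\<forall>\<^sub>F n in sequentially. (case p of (w, s) \<Rightarrow> X (?c n (?k n s)) w)
      = (case p of (w, s) \<Rightarrow> X (clamp_to t d s) w)"
    by (simp add: p)
qed

section \<open>Progressive and predictable processes\<close>

lemma space_progressive [simp]: "space (Prog t) = \<Omega> \<times> {t..T}"
  unfolding progressive_def by (rule space_measure_of) auto

lemma predictable_Pow: "{B \<times> {t} |B. B \<in> sets (\<F> {t..t})}
      \<union> {B \<times> {a<..b} |B a b. t \<le> a \<and> a < b \<and> b \<le> T \<and> B \<in> sets (\<F> {t..a})} \<subseteq> Pow (\<Omega> \<times> {t..T})"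
  if "t \<le> T"
  using that sets.sets_into_space[of _ "\<F> _"] by fastforce

lemma space_predictable [simp]: "t \<le> T \<Longrightarrow> space (Pred t) = \<Omega> \<times> {t..T}"
  unfolding predictable_def by (rule space_measure_of) (rule predictable_Pow)

lemma sets_predictable: "t \<le> T \<Longrightarrow> sets (Pred t) = sigma_sets (\<Omega> \<times> {t..T})
   ({B \<times> {t} |B. B \<in> sets (\<F> {t..t})}
      \<union> {B \<times> {a<..b} |B a b. t \<le> a \<and> a < b \<and> b \<le> T \<and> B \<in> sets (\<F> {t..a})})"
  unfolding predictable_def by (rule sets_measure_of) (rule predictable_Pow)

lemma predictable_start: "t \<le> T \<Longrightarrow> B \<in> sets (\<F> {t..t}) \<Longrightarrow> B \<times> {t} \<in> sets (Pred t)"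
  unfolding sets_predictable by (rule sigma_sets.Basic) blast

lemma predictable_Ioc:
  assumes "t \<le> T" "t \<le> a" "B \<in> sets (\<F> {t..a})" "b \<le> T"
  shows "B \<times> {a<..b} \<in> sets (Pred t)"
proof (cases "a < b")
  case True
  then show ?thesis using assms unfolding sets_predictable[OF assms(1)]
    by (intro sigma_sets.Basic) blast
qed simp

text \<open>The clamped time never exceeds \<open>d\<close>, so only the trace of a progressive set
  on [t, d] matters, and this belongs to the product \<sigma>-algebra by definition.\<close>

lemma measurable_clamp_progressive:
  assumes t: "t \<le> d" "d \<le> T"
  shows "(\<lambda>(w, s). (w, clamp_to t d s)) \<in> \<F> {t..d} \<Otimes>\<^sub>M borel \<rightarrow>\<^sub>M Prog t"
  unfolding progressive_def
proof (rule measurable_measure_of)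
  let ?h = "\<lambda>(w::'w, s). (w, clamp_to t d s)"
  let ?M = "\<F> {t..d} \<Otimes>\<^sub>M restrict_space borel {t..d}"
  show "?h \<in> space (\<F> {t..d} \<Otimes>\<^sub>M borel) \<rightarrow> \<Omega> \<times> {t..T}"
    using t by (auto simp: space_pair_measure intro: order_trans[OF clamp_to_bounds(2)])
  have h: "?h \<in> \<F> {t..d} \<Otimes>\<^sub>M borel \<rightarrow>\<^sub>M ?M"
  proof -
    have "clamp_to t d \<in> borel \<rightarrow>\<^sub>M restrict_space borel {t..d}"
      using t by (intro measurable_restrict_space2) auto
    then have "(\<lambda>p. (fst p, clamp_to t d (snd p))) \<in> \<F> {t..d} \<Otimes>\<^sub>M borel \<rightarrow>\<^sub>M ?M" by measurable
    then show ?thesis by (simp add: case_prod_beta')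
  qed
  fix A assume "A \<in> {A. A \<subseteq> \<Omega> \<times> {t..T} \<and> (\<forall>s\<in>{t..T}. A \<inter> (\<Omega> \<times> {t..s})
            \<in> sets (\<F> {t..s} \<Otimes>\<^sub>M restrict_space borel {t..s}))}"
  then have "A \<inter> (\<Omega> \<times> {t..d}) \<in> sets ?M" using t by auto
  from measurable_sets[OF h this] have "?h -` (A \<inter> (\<Omega> \<times> {t..d})) \<inter> space (\<F> {t..d} \<Otimes>\<^sub>M borel)
      \<in> sets (\<F> {t..d} \<Otimes>\<^sub>M borel)" .
  also have "?h -` (A \<inter> (\<Omega> \<times> {t..d})) \<inter> space (\<F> {t..d} \<Otimes>\<^sub>M borel) = ?h -` A \<inter> space (\<F> {t..d} \<Otimes>\<^sub>M borel)"
    using t by (auto simp: space_pair_measure)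
  finally show "?h -` A \<inter> space (\<F> {t..d} \<Otimes>\<^sub>M borel) \<in> sets (\<F> {t..d} \<Otimes>\<^sub>M borel)" .
qed auto

lemma measurable_clamp_predictable:
  assumes t: "t \<le> d" "d \<le> T"
  shows "(\<lambda>(w, s). (w, clamp_to t d s)) \<in> \<F> {t..d} \<Otimes>\<^sub>M borel \<rightarrow>\<^sub>M Pred t"
  unfolding predictable_def
proof (rule measurable_measure_of)
  let ?h = "\<lambda>(w::'w, s). (w, clamp_to t d s)"
  have tT: "t \<le> T" using t by simp
  show "?h \<in> space (\<F> {t..d} \<Otimes>\<^sub>M borel) \<rightarrow> \<Omega> \<times> {t..T}"
    using t by (auto simp: space_pair_measure intro: order_trans[OF clamp_to_bounds(2)])
  show "{B \<times> {t} |B. B \<in> sets (\<F> {t..t})}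
      \<union> {B \<times> {a<..b} |B a b. t \<le> a \<and> a < b \<and> b \<le> T \<and> B \<in> sets (\<F> {t..a})} \<subseteq> Pow (\<Omega> \<times> {t..T})"
    by (rule predictable_Pow[OF tT])
  have rect: "?h -` (B \<times> I) \<inter> space (\<F> {t..d} \<Otimes>\<^sub>M borel) \<in> sets (\<F> {t..d} \<Otimes>\<^sub>M borel)"
    if "B \<in> sets (\<F> {t..d})" "I \<in> sets borel" for B I
  proof -
    have "?h -` (B \<times> I) \<inter> space (\<F> {t..d} \<Otimes>\<^sub>M borel) = B \<times> (clamp_to t d -` I \<inter> space borel)"
      using sets.sets_into_space[OF that(1)] by (auto simp: space_pair_measure)
    then show ?thesis using that measurable_sets[OF measurable_clamp_to that(2)] by (auto intro!: pair_measureI)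
  qed
  fix A assume "A \<in> {B \<times> {t} |B. B \<in> sets (\<F> {t..t})}
      \<union> {B \<times> {a<..b} |B a b. t \<le> a \<and> a < b \<and> b \<le> T \<and> B \<in> sets (\<F> {t..a})}"
  then consider B where "A = B \<times> {t}" "B \<in> sets (\<F> {t..t})"
    | B a b where "A = B \<times> {a<..b}" "t \<le> a" "B \<in> sets (\<F> {t..a})" by auto
  then show "?h -` A \<inter> space (\<F> {t..d} \<Otimes>\<^sub>M borel) \<in> sets (\<F> {t..d} \<Otimes>\<^sub>M borel)"
  proof cases
    case 1
    then show ?thesis using rect[of B "{t}"] path_algebra_mono[of "{t..t}" "{t..d}"] t by auto
  next
    case 2
    show ?thesis
    proof (cases "a \<le> d")
      case True
      then show ?thesis using 2 rect[of B "{a<..b}"] path_algebra_mono[of "{t..a}" "{t..d}"] t by auto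
    next
      \<comment> \<open>A generator that begins after \<open>d\<close> is not met by the clamped
        time.\<close>
      case False
      then have "?h -` A \<inter> space (\<F> {t..d} \<Otimes>\<^sub>M borel) = {}"
        using 2 t by (auto simp: clamp_to_def)
      then show ?thesis by (simp only: sets.empty_sets)
    qed
  qed
qed

text \<open>On each grid cell the process is constant in time, with a value known at the left end of
  the cell; preimages are therefore countable unions of predictable rectangles.\<close>

lemma predictable_grid:
  assumes t: "0 \<le> t" "t \<le> T" and W: "\<And>s. t \<le> s \<Longrightarrow> s \<le> T \<Longrightarrow> W s \<in> \<F> {t..s} \<rightarrow>\<^sub>M N"
  shows "(\<lambda>(w, s). W (grid_left t n s) w) \<in> Pred t \<rightarrow>\<^sub>M N"
proof (rule measurableI)
  have gT: "grid_left t n s \<le> T" if "t \<le> s" "s \<le> T" for s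
    using that grid_left_less[of t s n] grid_left_start[of t n] by (cases "s = t") auto
  fix p assume "p \<in> space (Pred t)"
  then show "(case p of (w, s) \<Rightarrow> W (grid_left t n s) w) \<in> space N"
    using t gT W[OF grid_left_ge[of t n "snd p"], THEN measurable_space] by auto
next
  fix A assume A: "A \<in> sets N"
  let ?c = "\<lambda>k::int. (of_int k - 1) / real (Suc n)" and ?d = "\<lambda>k::int. of_int k / real (Suc n)"
  let ?B = "\<lambda>k. W (max t (?c k)) -` A \<inter> \<Omega>"
  have k_iff: "k = \<lceil>s * real (Suc n)\<rceil> \<longleftrightarrow> ?c k < s \<and> s \<le> ?d k" for k s
  proof -
    have "k = \<lceil>s * real (Suc n)\<rceil> \<longleftrightarrow> of_int k - 1 < s * real (Suc n) \<and> s * real (Suc n) \<le> of_int k"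
      using ceiling_eq_iff[of "s * real (Suc n)" k] by auto
    then show ?thesis by (simp add: field_simps del: of_nat_Suc)
  qed
  have "(\<lambda>(w, s). W (grid_left t n s) w) -` A \<inter> space (Pred t)
     = (\<Union>k\<in>{k. max t (?c k) \<le> T}. ?B k \<times> ({?c k<..?d k} \<inter> {t..T}))" (is "?L = ?R")
  proof (intro set_eqI iffI)
    fix p assume "p \<in> ?L"
    then obtain w s where p: "p = (w, s)" "w \<in> \<Omega>" "t \<le> s" "s \<le> T" "W (grid_left t n s) w \<in> A"
      using t by auto
    let ?k = "\<lceil>s * real (Suc n)\<rceil>"
    have "?c ?k < s" "s \<le> ?d ?k" using k_iff[of ?k s] by auto
    then have "?k \<in> {k. max t (?c k) \<le> T}" "p \<in> ?B ?k \<times> ({?c ?k<..?d ?k} \<inter> {t..T})"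
      using p t by (auto simp: grid_left_def)
    then show "p \<in> ?R" by (rule UN_I)
  next
    fix p assume "p \<in> ?R"
    then obtain k w s where p: "p = (w, s)" "w \<in> \<Omega>" "t \<le> s" "s \<le> T" "?c k < s" "s \<le> ?d k" "W (max t (?c k)) w \<in> A"
      by auto
    then have "k = \<lceil>s * real (Suc n)\<rceil>" using k_iff by blast
    then show "p \<in> ?L" using p t by (auto simp: grid_left_def)
  qed
  moreover have "?R \<in> sets (Pred t)"
  proof (rule sets.countable_UN'')
    fix k assume "k \<in> {k. max t (?c k) \<le> T}"
    then have kT: "max t (?c k) \<le> T" by simp
    have B: "?B k \<in> sets (\<F> {t..max t (?c k)})"
      using measurable_sets[OF W[OF _ kT] A] by simp
    have 1: "?B k \<times> {max t (?c k)<..min (?d k) T} \<in> sets (Pred t)"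
      by (rule predictable_Ioc[OF t(2) _ B]) auto
    show "?B k \<times> ({?c k<..?d k} \<inter> {t..T}) \<in> sets (Pred t)"
    \<comment> \<open>Only the cell containing \<open>t\<close> includes the time \<open>t\<close>
      itself, whose slice is a separate kind of generator.\<close>
    proof (cases "?c k < t \<and> t \<le> ?d k")
      case True
      then have "?B k \<times> {t} \<in> sets (Pred t)"
        using B by (intro predictable_start[OF t(2)]) (simp add: max_def)
      moreover have "?B k \<times> ({?c k<..?d k} \<inter> {t..T}) = ?B k \<times> {t} \<union> ?B k \<times> {max t (?c k)<..min (?d k) T}"
        using True t by auto
      ultimately show ?thesis using 1 by simp
    next
      case False
      have "?c k < ?d k" by (simp add: divide_strict_right_mono)
      then have "{?c k<..?d k} \<inter> {t..T} = {max t (?c k)<..min (?d k) T}"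
        using False t by (auto simp: max_def)
      then show ?thesis using 1 by simp
    qed
  qed simp
  ultimately show "(\<lambda>(w, s). W (grid_left t n s) w) -` A \<inter> space (Pred t) \<in> sets (Pred t)" by simp
qed

lemma predictable_left_limit:
  fixes W :: "real \<Rightarrow> 'w \<Rightarrow> real"
  assumes t: "0 \<le> t" "t \<le> T" and W: "\<And>s. t \<le> s \<Longrightarrow> s \<le> T \<Longrightarrow> W s \<in> borel_measurable (\<F> {t..s})"
    and start: "\<And>w. w \<in> \<Omega> \<Longrightarrow> V w t = W t w"
    and lim: "\<And>w s c. w \<in> \<Omega> \<Longrightarrow> t < s \<Longrightarrow> s \<le> T \<Longrightarrow> (\<And>n. t \<le> c n) \<Longrightarrow> (\<And>n. c n < s) \<Longrightarrow> c \<longlonglongrightarrow> s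
      \<Longrightarrow> (\<lambda>n. W (c n) w) \<longlonglongrightarrow> V w s"
  shows "(\<lambda>(w, s). V w s) \<in> borel_measurable (Pred t)"
proof (rule borel_measurable_LIMSEQ_real)
  show "(\<lambda>(w, s). W (grid_left t n s) w) \<in> borel_measurable (Pred t)" for n
    by (rule predictable_grid[OF t W])
  fix p assume "p \<in> space (Pred t)"
  then obtain w s where p: "p = (w, s)" "w \<in> \<Omega>" "t \<le> s" "s \<le> T" using t by auto
  show "(\<lambda>n. case p of (w, s) \<Rightarrow> W (grid_left t n s) w) \<longlonglongrightarrow> (case p of (w, s) \<Rightarrow> V w s)"
  proof (cases "s = t")
    case True then show ?thesis using p start by (simp add: grid_left_start)
  next
    case False
    then have "(\<lambda>n. W (grid_left t n s) w) \<longlonglongrightarrow> V w s"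
      using p by (intro lim grid_left_ge grid_left_less grid_left_tendsto) auto
    then show ?thesis by (simp add: p)
  qed
qed

text \<open>Predictable processes also have a value at time \<open>t\<close>, where the left limit
  would look into the past before \<open>t\<close>; the current state is used there instead.\<close>

definition left_path :: "real \<Rightarrow> real \<Rightarrow> 'w \<Rightarrow> 'k" where
  "left_path t s w = (if s \<le> t then X t w else left_lim X s w)"

lemma predictable_left_path:
  assumes t: "0 \<le> t" "t \<le> T"
  shows "(\<lambda>(w, s). left_path t s w) \<in> Pred t \<rightarrow>\<^sub>M K"
proof (rule measurable_eventually_const)
  show "(\<lambda>(w, s). X (grid_left t n s) w) \<in> Pred t \<rightarrow>\<^sub>M K" for n
    by (rule predictable_grid[OF t]) (use t in \<open>auto intro: measurable_path\<close>)
  fix p assume "p \<in> space (Pred t)"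
  then obtain w s where p: "p = (w, s)" "w \<in> \<Omega>" "t \<le> s" "s \<le> T" using t by auto
  show "\<forall>\<^sub>F n in sequentially. (case p of (w, s) \<Rightarrow> X (grid_left t n s) w) = (case p of (w, s) \<Rightarrow> left_path t s w)"
  proof (cases "s = t")
    case True then show ?thesis using p by (simp add: grid_left_start left_path_def)
  next
    case False
    then show ?thesis
      using left_lim_seq[OF p(2), of s "\<lambda>n. grid_left t n s"] grid_left_less[of t s] grid_left_tendsto[of t s] p t
      by (simp add: left_path_def)
  qed
qed

lemma jump_time_stopping:
  assumes t: "0 \<le> t" "t \<le> s"
  shows "{w \<in> \<Omega>. jump_time X t n w \<le> ereal s} \<in> sets (\<F> {t..s})"
  using t(2)
proof (induct n arbitrary: s)
  case 0
  then show ?case using sets.top[of "\<F> {t..s}"] by simp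
next
  case (Suc n)
  have "{w \<in> \<Omega>. jump_time X t (Suc n) w \<le> ereal s} = (\<Union>q\<in>\<rat> \<inter> {t..s}.
      {w \<in> \<Omega>. jump_time X t n w \<le> ereal q} \<inter> {w \<in> \<Omega>. jump_time X q 1 w \<le> ereal s})"
    using jump_time_Suc_le_iff[OF _ t(1)] by (auto simp del: jump_time.simps)
  also have "\<dots> \<in> sets (\<F> {t..s})"
  proof (intro sets.countable_UN'' sets.Int)
    show "countable (\<rat> \<inter> {t..s})" using countable_rat by (rule countable_Int1)
    fix q assume q: "q \<in> \<rat> \<inter> {t..s}"
    then show "{w \<in> \<Omega>. jump_time X t n w \<le> ereal q} \<in> sets (\<F> {t..s})"
      using Suc(1)[of q] path_algebra_mono[of "{t..q}" "{t..s}"] by auto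
    have "{w \<in> \<Omega>. jump_time X q 1 w \<le> ereal s} \<in> sets (\<F> {q..s})"
      using q t by (intro stopping) auto
    then show "{w \<in> \<Omega>. jump_time X q 1 w \<le> ereal s} \<in> sets (\<F> {t..s})"
      using path_algebra_mono[of "{q..s}" "{t..s}"] q by auto
  qed
  finally show ?case .
qed

text \<open>Capped at \<open>d\<close>, the jump time becomes a real random time in [t, d], known at
  time \<open>d\<close>, at which paths and predictable processes can be evaluated by
  composition.\<close>

definition stopped_time :: "real \<Rightarrow> real \<Rightarrow> nat \<Rightarrow> 'w \<Rightarrow> real" where
  "stopped_time t d n w = (if jump_time X t n w \<le> ereal d then real_of_ereal (jump_time X t n w) else d)"

lemma stopped_time_bounds:
  assumes "w \<in> \<Omega>" "0 \<le> t" "t \<le> d"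
  shows "t \<le> stopped_time t d n w" "stopped_time t d n w \<le> d"
  using assms by (cases rule: jump_time_finite_cases[OF assms(1,2), of n]; simp add: stopped_time_def)+

lemma measurable_stopped_time:
  assumes t: "0 \<le> t" "t \<le> d"
  shows "stopped_time t d n \<in> borel_measurable (\<F> {t..d})"
proof (rule borel_measurableI_le)
  fix a
  consider "a < t" | "t \<le> a" "a < d" | "d \<le> a" by linarith
  then show "{w \<in> space (\<F> {t..d}). stopped_time t d n w \<le> a} \<in> sets (\<F> {t..d})"
  proof cases
    case 1
    then have "{w \<in> space (\<F> {t..d}). stopped_time t d n w \<le> a} = {}"
      using stopped_time_bounds(1)[OF _ t, of _ n] by force
    then show ?thesis by (simp only: sets.empty_sets)
  next
    case 2
    have "stopped_time t d n w \<le> a \<longleftrightarrow> jump_time X t n w \<le> ereal a" if "w \<in> \<Omega>" for w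
      using 2 that by (cases rule: jump_time_finite_cases[OF that t(1), of n]) (auto simp: stopped_time_def)
    then have "{w \<in> space (\<F> {t..d}). stopped_time t d n w \<le> a} = {w \<in> \<Omega>. jump_time X t n w \<le> ereal a}" by auto
    then show ?thesis using jump_time_stopping[OF t(1) 2(1), of n] path_algebra_mono[of "{t..a}" "{t..d}"] 2 by auto
  next
    case 3
    then have "{w \<in> space (\<F> {t..d}). stopped_time t d n w \<le> a} = \<Omega>"
      using stopped_time_bounds(2)[OF _ t, of _ n] by force
    then show ?thesis using sets.top[of "\<F> {t..d}"] by (simp del: sets.top)
  qed
qed

text \<open>The stopped time lies in [t, d], so clamping leaves it alone, and joint measurability of
  the path gives measurability at a random time.\<close>

lemma measurable_at_stopped_time:
  assumes t: "0 \<le> t" "t \<le> d" "d \<le> T"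
  shows "(\<lambda>w. ((w, stopped_time t d n w), X (stopped_time t d n w) w)) \<in> \<F> {t..d} \<rightarrow>\<^sub>M Pred t \<Otimes>\<^sub>M K"
proof -
  have 1: "(\<lambda>w. (w, stopped_time t d n w)) \<in> \<F> {t..d} \<rightarrow>\<^sub>M \<F> {t..d} \<Otimes>\<^sub>M borel"
    using measurable_stopped_time[OF t(1,2)] by measurable
  have cl: "clamp_to t d (stopped_time t d n w) = stopped_time t d n w" if "w \<in> \<Omega>" for w
    using stopped_time_bounds[OF that t(1,2)] by simp
  have "(\<lambda>w. (w, stopped_time t d n w)) \<in> \<F> {t..d} \<rightarrow>\<^sub>M Pred t"
    using measurable_compose[OF 1 measurable_clamp_predictable[OF t(2,3)]]
    by (rule measurable_cong[THEN iffD1, rotated]) (simp add: cl)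
  moreover have "(\<lambda>w. X (stopped_time t d n w) w) \<in> \<F> {t..d} \<rightarrow>\<^sub>M K"
    using measurable_compose[OF 1 measurable_joint_path[OF t(1,2)]]
    by (rule measurable_cong[THEN iffD1, rotated]) (simp add: cl)
  ultimately show ?thesis by (rule measurable_Pair)
qed

lemma measurable_jump_term:
  assumes t: "0 \<le> t" "t \<le> d" "d \<le> T" and H: "H \<in> Pred t \<Otimes>\<^sub>M K \<rightarrow>\<^sub>M N" and z: "z \<in> space N"
  shows "(\<lambda>w. if jump_time X t n w \<le> ereal d
      then H ((w, real_of_ereal (jump_time X t n w)), X (real_of_ereal (jump_time X t n w)) w) else z)
    \<in> \<F> {t..d} \<rightarrow>\<^sub>M N"
proof -
  have "(\<lambda>w. if jump_time X t n w \<le> ereal d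
      then H ((w, stopped_time t d n w), X (stopped_time t d n w) w) else z) \<in> \<F> {t..d} \<rightarrow>\<^sub>M N"
    using jump_time_stopping[OF t(1,2), of n] z
    by (intro measurable_If measurable_compose[OF measurable_at_stopped_time[OF t] H]) auto
  then show ?thesis
    by (rule measurable_cong[THEN iffD1, rotated]) (simp add: stopped_time_def)
qed

lemma eventually_partial_index_set:
  assumes "w \<in> \<Omega>" "0 \<le> t"
  shows "\<forall>\<^sub>F N in sequentially. {n. 1 \<le> n \<and> jump_time X t n w \<le> ereal d} \<subseteq> {1..<N}"
proof -
  have "finite {n. 1 \<le> n \<and> jump_time X t n w \<le> ereal d}" by (rule finite_jump_time[OF assms])
  then obtain m where m: "\<forall>n\<in>{n. 1 \<le> n \<and> jump_time X t n w \<le> ereal d}. n < m"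
    using finite_nat_set_iff_bounded by blast
  show ?thesis using eventually_ge_at_top[of m] by eventually_elim (use m in force)
qed

text \<open>The random index set is exhausted by \<open>{1..<N}\<close>: on each path the partial
  sums over the measurable jump terms become constant in \<open>N\<close>.\<close>

lemma measurable_jump_sum:
  fixes H :: "('w \<times> real) \<times> 'k \<Rightarrow> 'b :: {second_countable_topology, topological_comm_monoid_add}"
  assumes t: "0 \<le> t" "t \<le> d" "d \<le> T" and H: "H \<in> borel_measurable (Pred t \<Otimes>\<^sub>M K)"
  shows "(\<lambda>w. \<Sum>\<tau>\<in>jumps w \<inter> {t<..d}. H ((w, \<tau>), X \<tau> w)) \<in> borel_measurable (\<F> {t..d})"
proof (rule measurable_eventually_const)
  let ?D = "\<lambda>n w. if jump_time X t n w \<le> ereal d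
      then H ((w, real_of_ereal (jump_time X t n w)), X (real_of_ereal (jump_time X t n w)) w) else 0"
  show "(\<lambda>w. \<Sum>n\<in>{1..<N}. ?D n w) \<in> borel_measurable (\<F> {t..d})" for N
    by (intro borel_measurable_sum measurable_jump_term t H) simp
  fix w assume "w \<in> space (\<F> {t..d})"
  then have w: "w \<in> \<Omega>" by simp
  show "\<forall>\<^sub>F N in sequentially. (\<Sum>n\<in>{1..<N}. ?D n w) = (\<Sum>\<tau>\<in>jumps w \<inter> {t<..d}. H ((w, \<tau>), X \<tau> w))"
    using eventually_partial_index_set[OF w t(1), of d]
  proof eventually_elim
    case (elim N)
    have "(\<Sum>n\<in>{1..<N}. ?D n w) = (\<Sum>n\<in>{n. 1 \<le> n \<and> jump_time X t n w \<le> ereal d}. ?D n w)"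
      by (rule sum.mono_neutral_right) (use elim in auto)
    also have "\<dots> = (\<Sum>n\<in>{n. 1 \<le> n \<and> jump_time X t n w \<le> ereal d}.
        H ((w, real_of_ereal (jump_time X t n w)), X (real_of_ereal (jump_time X t n w)) w))"
      by (rule sum.cong) auto
    also have "\<dots> = (\<Sum>\<tau>\<in>jumps w \<inter> {t<..d}. H ((w, \<tau>), X \<tau> w))"
      by (rule sum_jump_time[OF w t(1)])
    finally show ?case .
  qed
qed

lemma measurable_jump_prod:
  fixes H :: "('w \<times> real) \<times> 'k \<Rightarrow> real"
  assumes t: "0 \<le> t" "t \<le> d" "d \<le> T" and H: "H \<in> borel_measurable (Pred t \<Otimes>\<^sub>M K)"
  shows "(\<lambda>w. \<Prod>\<tau>\<in>jumps w \<inter> {t<..d}. H ((w, \<tau>), X \<tau> w)) \<in> borel_measurable (\<F> {t..d})"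
proof (rule measurable_eventually_const)
  let ?D = "\<lambda>n w. if jump_time X t n w \<le> ereal d
      then H ((w, real_of_ereal (jump_time X t n w)), X (real_of_ereal (jump_time X t n w)) w) else 1"
  show "(\<lambda>w. \<Prod>n\<in>{1..<N}. ?D n w) \<in> borel_measurable (\<F> {t..d})" for N
    by (intro borel_measurable_prod measurable_jump_term t H) simp
  fix w assume "w \<in> space (\<F> {t..d})"
  then have w: "w \<in> \<Omega>" by simp
  show "\<forall>\<^sub>F N in sequentially. (\<Prod>n\<in>{1..<N}. ?D n w) = (\<Prod>\<tau>\<in>jumps w \<inter> {t<..d}. H ((w, \<tau>), X \<tau> w))"
    using eventually_partial_index_set[OF w t(1), of d]
  proof eventually_elim
    case (elim N)
    have "(\<Prod>n\<in>{1..<N}. ?D n w) = (\<Prod>n\<in>{n. 1 \<le> n \<and> jump_time X t n w \<le> ereal d}. ?D n w)"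
      by (rule prod.mono_neutral_right) (use elim in auto)
    also have "\<dots> = (\<Prod>n\<in>{n. 1 \<le> n \<and> jump_time X t n w \<le> ereal d}.
        H ((w, real_of_ereal (jump_time X t n w)), X (real_of_ereal (jump_time X t n w)) w))"
      by (rule prod.cong) auto
    also have "\<dots> = (\<Prod>\<tau>\<in>jumps w \<inter> {t<..d}. H ((w, \<tau>), X \<tau> w))"
      by (rule prod_jump_time[OF w t(1)])
    finally show ?case .
  qed
qed

end

section \<open>Rates and the Markov property\<close>

lemma emeasure_density_indicator:
  "B \<in> sets M \<Longrightarrow> E \<in> sets M \<Longrightarrow> emeasure (density M (indicator B)) E = emeasure M (B \<inter> E)"
  by (simp add: emeasure_density flip: indicator_inter_arith)

context markov_jump_process
begin

text \<open>The summand 1 makes the bound strictly positive, as its inverse is used to normalise the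
  rate kernels.\<close>

definition rate_bound :: real ("\<Lambda>") where
  "rate_bound = enn2real (SUP (t, x) \<in> {0..T} \<times> space K. emeasure (\<nu> t x) (space K)) + 1"

lemma rate_bound_pos: "0 < \<Lambda>"
  unfolding rate_bound_def by (simp add: add_nonneg_pos)

lemma space_rate: "0 \<le> t \<Longrightarrow> x \<in> space K \<Longrightarrow> space (\<nu> t x) = space K"
  by (rule sets_eq_imp_space_eq[OF rate_sets])

lemma rate_le_bound:
  assumes "0 \<le> t" "t \<le> T" "x \<in> space K"
  shows "emeasure (\<nu> t x) A \<le> ennreal \<Lambda>"
proof -
  let ?S = "SUP (t, x) \<in> {0..T} \<times> space K. emeasure (\<nu> t x) (space K)"
  have "emeasure (\<nu> t x) A \<le> emeasure (\<nu> t x) (space K)"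
    using emeasure_space[of "\<nu> t x" A] space_rate assms by simp
  also have "\<dots> \<le> ?S"
    using assms by (intro SUP_upper2[of "(t, x)"]) auto
  also have "?S = ennreal (enn2real ?S)" using rate_bounded by simp
  also have "\<dots> \<le> ennreal \<Lambda>" unfolding rate_bound_def by (intro ennreal_leI) simp
  finally show ?thesis .
qed

lemma finite_measure_rate:
  assumes "0 \<le> t" "t \<le> T" "x \<in> space K"
  shows "finite_measure (\<nu> t x)"
  by (rule finite_measureI) (use rate_le_bound[OF assms, of "space (\<nu> t x)"] in \<open>auto simp: top_unique\<close>)

lemma measurable_rate_emeasure:
  assumes s: "s \<in> borel_measurable N" and x: "x \<in> N \<rightarrow>\<^sub>M K" and nn: "\<And>w. w \<in> space N \<Longrightarrow> 0 \<le> s w"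
    and A: "A \<in> sets K"
  shows "(\<lambda>w. emeasure (\<nu> (s w) (x w)) A) \<in> borel_measurable N"
proof -
  have "s \<in> N \<rightarrow>\<^sub>M restrict_space borel {0..}"
    using nn s by (intro measurable_restrict_space2) auto
  then have "(\<lambda>w. (s w, x w)) \<in> N \<rightarrow>\<^sub>M restrict_space borel {0..} \<Otimes>\<^sub>M K"
    using x by measurable
  from measurable_compose[OF this rate_measurable[OF A]] show ?thesis by simp
qed

text \<open>Divided by \<Lambda> the rates form a sub-probability kernel, for which integrals of
  jointly measurable functions are measurable. The times have to stay in [0, T], where the bound
  holds.\<close>

lemma measurable_nn_integral_rate:
  assumes s: "s \<in> borel_measurable N" and x: "x \<in> N \<rightarrow>\<^sub>M K"
    and b: "\<And>w. w \<in> space N \<Longrightarrow> 0 \<le> s w" "\<And>w. w \<in> space N \<Longrightarrow> s w \<le> T"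
    and f: "(\<lambda>(w, y). f w y) \<in> borel_measurable (N \<Otimes>\<^sub>M K)"
  shows "(\<lambda>w. \<integral>\<^sup>+y. f w y \<partial>\<nu> (s w) (x w)) \<in> borel_measurable N"
proof -
  let ?k = "\<lambda>w. scale_measure (ennreal (1 / \<Lambda>)) (\<nu> (s w) (x w))"
  have xs: "x w \<in> space K" if "w \<in> space N" for w using measurable_space[OF x that] .
  have "?k \<in> N \<rightarrow>\<^sub>M subprob_algebra K"
  proof (rule measurable_subprob_algebra)
    fix w assume w: "w \<in> space N"
    show "sets (?k w) = sets K" using rate_sets b(1)[OF w] xs[OF w] by simp
    show "subprob_space (?k w)"
    proof (rule subprob_spaceI)
      have "emeasure (?k w) (space (?k w)) = ennreal (1 / \<Lambda>) * emeasure (\<nu> (s w) (x w)) (space (\<nu> (s w) (x w)))"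
        by (simp add: space_scale_measure)
      also have "\<dots> \<le> ennreal (1 / \<Lambda>) * ennreal \<Lambda>"
        using rate_le_bound b[OF w] xs[OF w] by (intro mult_left_mono) auto
      also have "\<dots> = 1" using rate_bound_pos by (simp flip: ennreal_mult)
      finally show "emeasure (?k w) (space (?k w)) \<le> 1" .
      show "space (?k w) \<noteq> {}" using b[OF w] xs[OF w] by (auto simp: space_scale_measure space_rate)
    qed
  next
    fix A assume "A \<in> sets K"
    from measurable_rate_emeasure[OF s x b(1) this]
    show "(\<lambda>w. emeasure (?k w) A) \<in> borel_measurable N" by simp
  qed
  note [measurable] = nn_integral_measurable_subprob_algebra2[OF f this]
  have "(\<lambda>w. ennreal \<Lambda> * (\<integral>\<^sup>+y. f w y \<partial>?k w)) \<in> borel_measurable N"  by measurable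
  then show ?thesis
  proof (rule measurable_cong[THEN iffD1, rotated])
    fix w assume w: "w \<in> space N"
    have "f w \<in> borel_measurable K"
      using measurable_Pair2[OF f w] by simp
    then have "f w \<in> borel_measurable (\<nu> (s w) (x w))"
      using measurable_cong_sets[OF rate_sets refl] b(1)[OF w] xs[OF w] by blast
    from nn_integral_scale_measure[OF this]
    have "ennreal \<Lambda> * (\<integral>\<^sup>+y. f w y \<partial>?k w) = (ennreal \<Lambda> * ennreal (1 / \<Lambda>)) * (\<integral>\<^sup>+y. f w y \<partial>\<nu> (s w) (x w))"
      by (simp add: mult.assoc)
    also have "ennreal \<Lambda> * ennreal (1 / \<Lambda>) = 1" using rate_bound_pos by (simp flip: ennreal_mult)
    finally show "ennreal \<Lambda> * (\<integral>\<^sup>+y. f w y \<partial>?k w) = (\<integral>\<^sup>+y. f w y \<partial>\<nu> (s w) (x w))" by simp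
  qed
qed

text \<open>Explicit also in the non-integrable case, where the Bochner integral is 0, so that
  measurability in a parameter can be read off from three nonnegative integrals.\<close>

lemma integral_eq_enn2real_diff:
  fixes f :: "'b \<Rightarrow> real"
  assumes "f \<in> borel_measurable M"
  shows "integral\<^sup>L M f = (if (\<integral>\<^sup>+x. ennreal \<bar>f x\<bar> \<partial>M) < \<infinity>
    then enn2real (\<integral>\<^sup>+x. ennreal (f x) \<partial>M) - enn2real (\<integral>\<^sup>+x. ennreal (- f x) \<partial>M) else 0)"
  using assms real_lebesgue_integral_def[of M f] not_integrable_integral_eq[of M f]
  by (auto simp: integrable_iff_bounded)

lemma measurable_integral_rate:
  assumes s: "s \<in> borel_measurable N" and x: "x \<in> N \<rightarrow>\<^sub>M K"
    and b: "\<And>w. w \<in> space N \<Longrightarrow> 0 \<le> s w" "\<And>w. w \<in> space N \<Longrightarrow> s w \<le> T"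
    and f: "(\<lambda>(w, y). f w y) \<in> borel_measurable (N \<Otimes>\<^sub>M K)"
  shows "(\<lambda>w. LINT y|\<nu> (s w) (x w). f w y :: real) \<in> borel_measurable N"
proof -
  have xs: "x w \<in> space K" if "w \<in> space N" for w using measurable_space[OF x that] .
  have [measurable]: "(\<lambda>w. \<integral>\<^sup>+y. ennreal \<bar>f w y\<bar> \<partial>\<nu> (s w) (x w)) \<in> borel_measurable N"
    "(\<lambda>w. \<integral>\<^sup>+y. ennreal (f w y) \<partial>\<nu> (s w) (x w)) \<in> borel_measurable N"
    "(\<lambda>w. \<integral>\<^sup>+y. ennreal (- f w y) \<partial>\<nu> (s w) (x w)) \<in> borel_measurable N"
    by (rule measurable_nn_integral_rate[OF s x b], assumption+,
        use f in \<open>simp add: case_prod_beta' measurable_split_conv\<close>)+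
  have "(\<lambda>w. if (\<integral>\<^sup>+y. ennreal \<bar>f w y\<bar> \<partial>\<nu> (s w) (x w)) < \<infinity>
    then enn2real (\<integral>\<^sup>+y. ennreal (f w y) \<partial>\<nu> (s w) (x w)) - enn2real (\<integral>\<^sup>+y. ennreal (- f w y) \<partial>\<nu> (s w) (x w)) else 0)
    \<in> borel_measurable N"
    by measurable
  then show ?thesis
  proof (rule measurable_cong[THEN iffD1, rotated])
    fix w assume w: "w \<in> space N"
    have "f w \<in> borel_measurable K"
      using measurable_Pair2[OF f w] by simp
    then have "f w \<in> borel_measurable (\<nu> (s w) (x w))"
      using measurable_cong_sets[OF rate_sets refl] b(1)[OF w] xs[OF w] by blast
    from integral_eq_enn2real_diff[OF this]
    show "(if (\<integral>\<^sup>+y. ennreal \<bar>f w y\<bar> \<partial>\<nu> (s w) (x w)) < \<infinity>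
      then enn2real (\<integral>\<^sup>+y. ennreal (f w y) \<partial>\<nu> (s w) (x w)) - enn2real (\<integral>\<^sup>+y. ennreal (- f w y) \<partial>\<nu> (s w) (x w)) else 0)
      = (LINT y|\<nu> (s w) (x w). f w y)" by simp
  qed
qed

lemma space_nonempty: "0 \<le> (t::real) \<Longrightarrow> x \<in> space K \<Longrightarrow> \<Omega> \<noteq> {}"
  using prob_space.not_empty[OF prob[of t x]] by simp

lemma AE_start:
  assumes "0 \<le> t" "x \<in> space K"
  shows "AE w in P t x. X t w = x"
proof -
  interpret prob_space "P t x" using prob assms .
  show ?thesis using AE_prob_1[OF start[OF assms]] by eventually_elim simp
qed

lemma path_event_sets: "s \<in> I \<Longrightarrow> 0 \<le> s \<Longrightarrow> A \<in> sets K \<Longrightarrow> {w \<in> \<Omega>. X s w \<in> A} \<in> sets (\<F> I)"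
  using measurable_sets[OF measurable_path[of s I], of A] by (simp add: vimage_def Int_def conj_commute)

lemma sets_P_I: "E \<in> sets (\<F> I) \<Longrightarrow> I \<subseteq> {t..} \<Longrightarrow> 0 \<le> t \<Longrightarrow> x \<in> space K \<Longrightarrow> E \<in> sets (P t x)"
  using path_algebra_mono[of I "{t..}"] prob_algebra by auto

section \<open>From the Markov property at one time to events of the whole future\<close>

definition trans_kernel :: "real \<Rightarrow> real \<Rightarrow> 'k \<Rightarrow> 'k measure" where
  "trans_kernel c s y = distr (P c y) K (X s)"

lemma emeasure_trans_kernel:
  assumes "0 \<le> c" "c \<le> s" "y \<in> space K" "A \<in> sets K"
  shows "emeasure (trans_kernel c s y) A = ennreal (measure (P c y) {w \<in> \<Omega>. X s w \<in> A})"
proof -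
  interpret prob_space "P c y" using prob assms by simp
  have "X s \<in> P c y \<rightarrow>\<^sub>M K" using assms by (intro measurable_P[OF measurable_path[of s "{s..s}"]]) auto
  then show ?thesis using assms
    by (simp add: trans_kernel_def emeasure_distr emeasure_eq_measure vimage_def Int_def conj_commute)
qed

lemma measurable_trans_kernel:
  assumes "0 \<le> c" "c \<le> s"
  shows "trans_kernel c s \<in> K \<rightarrow>\<^sub>M subprob_algebra K"
proof (rule measurable_subprob_algebra)
  fix y assume y: "y \<in> space K"
  interpret prob_space "P c y" using prob assms y by simp
  have "X s \<in> P c y \<rightarrow>\<^sub>M K" using assms y by (intro measurable_P[OF measurable_path[of s "{s..s}"]]) auto
  then show "subprob_space (trans_kernel c s y)"
    unfolding trans_kernel_def by (intro prob_space_imp_subprob_space prob_space_distr)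
  show "sets (trans_kernel c s y) = sets K" by (simp add: trans_kernel_def)
next
  fix A assume A: "A \<in> sets K"
  have "(\<lambda>y. ennreal (measure (P c y) {w \<in> \<Omega>. X s w \<in> A})) \<in> borel_measurable K"
    using transition_measurable[OF assms A] by measurable
  then show "(\<lambda>y. emeasure (trans_kernel c s y) A) \<in> borel_measurable K"
    by (rule measurable_cong[THEN iffD1, rotated]) (simp add: emeasure_trans_kernel assms A)
qed

text \<open>The conditional probability in \<open>markov\<close>, integrated over an event
  \<open>B\<close> of the past; in this form it can be read as an identity of measures in
  \<open>A\<close>.\<close>

lemma markov_set:
  assumes q: "0 \<le> q" "q \<le> c" "c \<le> s" and x: "x \<in> space K" and A: "A \<in> sets K" and B: "B \<in> sets (\<F> {q..c})"
  shows "emeasure (P q x) (B \<inter> {w \<in> \<Omega>. X s w \<in> A})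
    = (\<integral>\<^sup>+w. indicator B w * emeasure (trans_kernel c s (X c w)) A \<partial>P q x)"
proof -
  interpret prob_space "P q x" using prob q x by simp
  let ?E = "{w \<in> \<Omega>. X s w \<in> A}"
  let ?m = "\<lambda>y. measure (P c y) ?E"
  have EB[measurable]: "?E \<in> sets (P q x)" "B \<in> sets (P q x)"
    using q x A B by (auto intro: sets_P_I[OF path_event_sets[of s "{s..s}"]] sets_P_I[OF B])
  have sub: "subalgebra (P q x) (\<F> {q..c})"
    unfolding subalgebra_def using q x prob_algebra[OF q(1) x] path_algebra_mono[of "{q..c}" "{q..}"] by auto
  interpret S: finite_measure_subalgebra "P q x" "\<F> {q..c}" by unfold_locales (rule sub)
  have c0: "0 \<le> c" using q by simp
  have [measurable]: "(\<lambda>w. ?m (X c w)) \<in> borel_measurable (P q x)"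
    using q x by (intro measurable_compose[OF measurable_P[OF measurable_path[of c "{c..c}"]] transition_measurable] A) auto
  have int: "integrable (P q x) (\<lambda>w. indicator B w * ?m (X c w))"
  proof (rule integrable_const_bound[of _ 1])
    show "AE w in P q x. norm (indicator B w * ?m (X c w)) \<le> 1"
    proof (rule AE_I2)
      fix w assume "w \<in> space (P q x)"
      then have "X c w \<in> space K" using path_range q x by simp
      then interpret C: prob_space "P c (X c w)" using prob c0 by simp
      show "norm (indicator B w * ?m (X c w)) \<le> 1" by (auto simp: indicator_def)
    qed
  qed measurable
  have "measure (P q x) (B \<inter> ?E) = (LINT w:B|P q x. indicator ?E w)"
    unfolding set_lebesgue_integral_def by (simp flip: indicator_inter_arith)
  also have "\<dots> = (LINT w:B|P q x. real_cond_exp (P q x) (\<F> {q..c}) (indicator ?E) w)"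
    by (rule S.real_cond_exp_intA[OF _ B]) (use EB in \<open>simp add: emeasure_eq_measure\<close>)
  also have "\<dots> = (LINT w|P q x. indicator B w * ?m (X c w))"
    unfolding set_lebesgue_integral_def
  proof (rule integral_cong_AE)
    show "AE w in P q x. indicator B w *\<^sub>R real_cond_exp (P q x) (\<F> {q..c}) (indicator ?E) w = indicator B w * ?m (X c w)"
      using markov[OF q x A] by eventually_elim simp
  qed measurable
  finally have "ennreal (measure (P q x) (B \<inter> ?E)) = ennreal (LINT w|P q x. indicator B w * ?m (X c w))" by simp
  also have "\<dots> = (\<integral>\<^sup>+w. ennreal (indicator B w * ?m (X c w)) \<partial>P q x)"
    by (rule nn_integral_eq_integral[symmetric, OF int]) simp
  also have "\<dots> = (\<integral>\<^sup>+w. indicator B w * emeasure (trans_kernel c s (X c w)) A \<partial>P q x)"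
    using path_range[OF c0] q x A
    by (intro nn_integral_cong) (simp add: emeasure_trans_kernel c0 ennreal_mult ennreal_indicator)
  finally show ?thesis by (simp add: emeasure_eq_measure)
qed

text \<open>As functions of \<open>A\<close>, both sides of \<open>markov_set\<close> are measures:
  the law of \<open>X s\<close> under the restriction of \<open>P q x\<close> to \<open>B\<close>,
  and a mixture of transition kernels. Equal measures have equal integrals.\<close>

lemma markov_nn_integral:
  assumes q: "0 \<le> q" "q \<le> c" "c \<le> s" and x: "x \<in> space K" and h: "h \<in> borel_measurable K" and B: "B \<in> sets (\<F> {q..c})"
  shows "(\<integral>\<^sup>+w. indicator B w * h (X s w) \<partial>P q x)
    = (\<integral>\<^sup>+w. indicator B w * (\<integral>\<^sup>+y. h y \<partial>trans_kernel c s (X c w)) \<partial>P q x)"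
proof -
  let ?D = "density (P q x) (indicator B)"
  have [measurable]: "B \<in> sets (P q x)" using q x by (intro sets_P_I[OF B]) auto
  have Xs[measurable]: "X s \<in> P q x \<rightarrow>\<^sub>M K" "X c \<in> P q x \<rightarrow>\<^sub>M K"
    using q x by (intro measurable_P[OF measurable_path[of s "{s..s}"]] measurable_P[OF measurable_path[of c "{c..c}"]]; auto)+
  have k: "trans_kernel c s \<in> K \<rightarrow>\<^sub>M subprob_algebra K" using q by (intro measurable_trans_kernel) auto
  have kX: "(\<lambda>w. trans_kernel c s (X c w)) \<in> ?D \<rightarrow>\<^sub>M subprob_algebra K"
    using measurable_compose[OF Xs(2) k] by simp
  have ne: "space ?D \<noteq> {}" using space_nonempty q x by simp
  have "distr ?D K (X s) = ?D \<bind> (\<lambda>w. trans_kernel c s (X c w))"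
  proof (rule measure_eqI)
    show "sets (distr ?D K (X s)) = sets (?D \<bind> (\<lambda>w. trans_kernel c s (X c w)))"
      using sets_bind[OF sets_kernel[OF kX] ne] by simp
    fix A assume "A \<in> sets (distr ?D K (X s))"
    then have A: "A \<in> sets K" by simp
    have "emeasure (distr ?D K (X s)) A = emeasure ?D {w \<in> \<Omega>. X s w \<in> A}"
      using A q x by (simp add: emeasure_distr vimage_def Int_def conj_commute)
    also have "\<dots> = emeasure (P q x) (B \<inter> {w \<in> \<Omega>. X s w \<in> A})"
      using q x A by (intro emeasure_density_indicator sets_P_I[OF path_event_sets[of s "{s..s}"]]) auto
    also have "\<dots> = (\<integral>\<^sup>+w. emeasure (trans_kernel c s (X c w)) A \<partial>?D)"
      unfolding markov_set[OF q x A B]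
      using measurable_compose[OF Xs(2) measurable_compose[OF k measurable_emeasure_subprob_algebra[OF A]]]
      by (intro nn_integral_density[symmetric]) auto
    also have "\<dots> = emeasure (?D \<bind> (\<lambda>w. trans_kernel c s (X c w))) A"
      by (rule emeasure_bind[symmetric, OF ne kX A])
    finally show "emeasure (distr ?D K (X s)) A = emeasure (?D \<bind> (\<lambda>w. trans_kernel c s (X c w))) A" .
  qed
  then have "(\<integral>\<^sup>+y. h y \<partial>distr ?D K (X s)) = (\<integral>\<^sup>+y. h y \<partial>(?D \<bind> (\<lambda>w. trans_kernel c s (X c w))))" by simp
  also have "\<dots> = (\<integral>\<^sup>+w. \<integral>\<^sup>+y. h y \<partial>trans_kernel c s (X c w) \<partial>?D)" by (rule nn_integral_bind[OF h kX])
  also have "\<dots> = (\<integral>\<^sup>+w. indicator B w * (\<integral>\<^sup>+y. h y \<partial>trans_kernel c s (X c w)) \<partial>P q x)"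
    using measurable_compose[OF Xs(2) measurable_compose[OF k nn_integral_measurable_subprob_algebra[OF h]]]
    by (intro nn_integral_density) auto
  also have "(\<integral>\<^sup>+y. h y \<partial>distr ?D K (X s)) = (\<integral>\<^sup>+w. h (X s w) \<partial>?D)"
    using h by (intro nn_integral_distr) auto
  also have "\<dots> = (\<integral>\<^sup>+w. indicator B w * h (X s w) \<partial>P q x)"
    using h by (intro nn_integral_density) auto
  finally show ?thesis .
qed

definition cylinder :: "real set \<Rightarrow> (real \<Rightarrow> 'k set) \<Rightarrow> 'w set" where
  "cylinder S A = {w \<in> \<Omega>. \<forall>s\<in>S. X s w \<in> A s}"

lemma cylinder_sets:
  assumes "finite S" "S \<subseteq> I" "\<And>s. s \<in> S \<Longrightarrow> 0 \<le> s" "\<And>s. s \<in> S \<Longrightarrow> A s \<in> sets K"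
  shows "cylinder S A \<in> sets (\<F> I)"
  using assms
proof (induct S rule: finite_induct)
  case empty
  then show ?case using sets.top[of "\<F> I"] by (simp add: cylinder_def)
next
  case (insert s S)
  have "cylinder (insert s S) A = {w \<in> \<Omega>. X s w \<in> A s} \<inter> cylinder S A" by (auto simp: cylinder_def)
  then show ?case using insert path_event_sets[of s I "A s"] by auto
qed

text \<open>Induction that removes the earliest time \<open>b\<close>: the later coordinates are
  absorbed into a function of \<open>X b\<close>, which is then averaged from \<open>b\<close> back
  to \<open>c\<close>. The function \<open>\<Psi>\<close> is the same for all \<open>q\<close>,
  \<open>x\<close> and \<open>B\<close>, so that it can be identified afterwards.\<close>

lemma markov_cylinder:
  assumes "finite S" "S \<subseteq> {c..}" "0 \<le> c" "\<And>s. s \<in> S \<Longrightarrow> A s \<in> sets K"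
  shows "\<exists>\<Psi>\<in>borel_measurable K. \<forall>q x B. 0 \<le> q \<longrightarrow> q \<le> c \<longrightarrow> x \<in> space K \<longrightarrow> B \<in> sets (\<F> {q..c}) \<longrightarrow>
    emeasure (P q x) (B \<inter> cylinder S A) = (\<integral>\<^sup>+w. indicator B w * \<Psi> (X c w) \<partial>P q x)"
  using assms
proof (induct S arbitrary: c rule: finite_linorder_min_induct)
  case empty
  show ?case
  proof (intro bexI[of _ "\<lambda>_. 1"] allI impI)
    fix q x B assume *: "0 \<le> q" "q \<le> c" "x \<in> space K" "B \<in> sets (\<F> {q..c})"
    then have "B \<in> sets (P q x)" by (intro sets_P_I[OF *(4)]) auto
    moreover have "B \<inter> cylinder {} A = B" using sets.sets_into_space[OF *(4)] by (auto simp: cylinder_def)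
    ultimately show "emeasure (P q x) (B \<inter> cylinder {} A) = (\<integral>\<^sup>+w. indicator B w * 1 \<partial>P q x)" by simp
  qed simp
next
  case (insert b S)
  have cb: "c \<le> b" "0 \<le> b" using insert by auto
  have Ab: "A b \<in> sets K" using insert by auto
  have "S \<subseteq> {b..}" using insert by (auto intro: less_imp_le)
  from insert(3)[OF this cb(2)] insert(6) obtain \<Psi> where \<Psi>: "\<Psi> \<in> borel_measurable K"
    "\<And>q x B. 0 \<le> q \<Longrightarrow> q \<le> b \<Longrightarrow> x \<in> space K \<Longrightarrow> B \<in> sets (\<F> {q..b}) \<Longrightarrow>
      emeasure (P q x) (B \<inter> cylinder S A) = (\<integral>\<^sup>+w. indicator B w * \<Psi> (X b w) \<partial>P q x)" by auto
  let ?h = "\<lambda>z. indicator (A b) z * \<Psi> z"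
  have h: "?h \<in> borel_measurable K" using \<Psi>(1) Ab by measurable
  show ?case
  proof (intro bexI[of _ "\<lambda>y. \<integral>\<^sup>+z. ?h z \<partial>trans_kernel c b y"] allI impI)
    fix q x B assume *: "0 \<le> q" "q \<le> c" "x \<in> space K" "B \<in> sets (\<F> {q..c})"
    let ?B = "B \<inter> {w \<in> \<Omega>. X b w \<in> A b}"
    have B: "?B \<in> sets (\<F> {q..b})"
      using * cb Ab path_algebra_mono[of "{q..c}" "{q..b}"] path_event_sets[of b "{q..b}" "A b"] by auto
    have "B \<inter> cylinder (insert b S) A = ?B \<inter> cylinder S A" by (auto simp: cylinder_def)
    then have "emeasure (P q x) (B \<inter> cylinder (insert b S) A) = (\<integral>\<^sup>+w. indicator ?B w * \<Psi> (X b w) \<partial>P q x)"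
      using \<Psi>(2)[OF *(1) _ *(3) B] * cb by simp
    also have "\<dots> = (\<integral>\<^sup>+w. indicator B w * ?h (X b w) \<partial>P q x)"
      using * by (intro nn_integral_cong) (auto simp: indicator_def)
    also have "\<dots> = (\<integral>\<^sup>+w. indicator B w * (\<integral>\<^sup>+z. ?h z \<partial>trans_kernel c b (X c w)) \<partial>P q x)"
      by (rule markov_nn_integral[OF *(1,2) cb(1) *(3) h *(4)])
    finally show "emeasure (P q x) (B \<inter> cylinder (insert b S) A)
      = (\<integral>\<^sup>+w. indicator B w * (\<integral>\<^sup>+z. ?h z \<partial>trans_kernel c b (X c w)) \<partial>P q x)" .
  next
    show "(\<lambda>y. \<integral>\<^sup>+z. ?h z \<partial>trans_kernel c b y) \<in> borel_measurable K"
      using measurable_compose[OF measurable_trans_kernel nn_integral_measurable_subprob_algebra[OF h]] insert(5) cb by simp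
  qed
qed

text \<open>\<open>\<Psi>\<close> is identified by taking \<open>q = c\<close> and
  \<open>B = \<Omega>\<close>: under \<open>P c y\<close> the path is at \<open>y\<close> at time
  \<open>c\<close> almost surely, so \<open>\<Psi> y\<close> is the probability of the
  cylinder.\<close>

lemma markov_cylinder_start:
  assumes S: "finite S" "S \<subseteq> {c..}" and c: "0 \<le> c" and A: "\<And>s. s \<in> S \<Longrightarrow> A s \<in> sets K"
  shows "(\<lambda>y. emeasure (P c y) (cylinder S A)) \<in> borel_measurable K"
    and "0 \<le> q \<Longrightarrow> q \<le> c \<Longrightarrow> x \<in> space K \<Longrightarrow> B \<in> sets (\<F> {q..c}) \<Longrightarrow>
      emeasure (P q x) (B \<inter> cylinder S A) = (\<integral>\<^sup>+w. indicator B w * emeasure (P c (X c w)) (cylinder S A) \<partial>P q x)"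
proof -
  obtain \<Psi> where \<Psi>: "\<Psi> \<in> borel_measurable K"
    "\<And>q x B. 0 \<le> q \<Longrightarrow> q \<le> c \<Longrightarrow> x \<in> space K \<Longrightarrow> B \<in> sets (\<F> {q..c}) \<Longrightarrow>
      emeasure (P q x) (B \<inter> cylinder S A) = (\<integral>\<^sup>+w. indicator B w * \<Psi> (X c w) \<partial>P q x)"
    using markov_cylinder[OF S c, of A] A by blast
  have eq: "emeasure (P c y) (cylinder S A) = \<Psi> y" if y: "y \<in> space K" for y
  proof -
    interpret prob_space "P c y" using prob c y by simp
    have "emeasure (P c y) (\<Omega> \<inter> cylinder S A) = (\<integral>\<^sup>+w. indicator \<Omega> w * \<Psi> (X c w) \<partial>P c y)"
      using \<Psi>(2)[of c y \<Omega>] c y sets.top[of "\<F> {c..c}"] by simp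
    also have "\<dots> = (\<integral>\<^sup>+w. \<Psi> y \<partial>P c y)"
    proof (rule nn_integral_cong_AE)
      show "AE w in P c y. indicator \<Omega> w * \<Psi> (X c w) = \<Psi> y"
        using AE_start[OF c y] AE_space by eventually_elim (use c y in simp)
    qed
    also have "\<Omega> \<inter> cylinder S A = cylinder S A" by (auto simp: cylinder_def)
    finally show ?thesis using emeasure_space_1 by simp
  qed
  show "(\<lambda>y. emeasure (P c y) (cylinder S A)) \<in> borel_measurable K"
    using \<Psi>(1) by (rule measurable_cong[THEN iffD1, rotated]) (simp add: eq)
  assume *: "0 \<le> q" "q \<le> c" "x \<in> space K" "B \<in> sets (\<F> {q..c})"
  show "emeasure (P q x) (B \<inter> cylinder S A) = (\<integral>\<^sup>+w. indicator B w * emeasure (P c (X c w)) (cylinder S A) \<partial>P q x)"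
    unfolding \<Psi>(2)[OF *] using * c path_range by (intro nn_integral_cong) (simp add: eq)
qed

definition cylinders :: "real \<Rightarrow> 'w set set" where
  "cylinders c = {cylinder S A |S A. finite S \<and> S \<subseteq> {c..} \<and> (\<forall>s. A s \<in> sets K)}"

lemma cylinders_generate:
  assumes c: "0 \<le> c"
  shows "sets (\<F> {c..}) = sigma_sets \<Omega> (cylinders c)" "Int_stable (cylinders c)" "cylinders c \<subseteq> Pow \<Omega>"
proof -
  show "cylinders c \<subseteq> Pow \<Omega>" by (auto simp: cylinders_def cylinder_def)
  show "Int_stable (cylinders c)"
  proof (rule Int_stableI)
    fix a b assume "a \<in> cylinders c" "b \<in> cylinders c"
    then obtain S A S' A' where *: "a = cylinder S A" "b = cylinder S' A'" "finite S" "finite S'" "S \<subseteq> {c..}" "S' \<subseteq> {c..}"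
      "\<And>s. A s \<in> sets K" "\<And>s. A' s \<in> sets K" unfolding cylinders_def by blast
    \<comment> \<open>A time occurring in only one of the two cylinders is constrained by the whole
      space in the other.\<close>
    let ?A = "\<lambda>s. (if s \<in> S then A s else space K) \<inter> (if s \<in> S' then A' s else space K)"
    have "a \<inter> b = cylinder (S \<union> S') ?A"
    proof -
      have "z \<in> space K" if "z \<in> A s \<or> z \<in> A' s" for z s
        using that sets.sets_into_space[OF *(7)[of s]] sets.sets_into_space[OF *(8)[of s]] by blast
      then show ?thesis unfolding *(1,2) cylinder_def by (auto split: if_splits)
    qed
    moreover have "cylinder (S \<union> S') ?A \<in> cylinders c"
      unfolding cylinders_def using * by (intro CollectI exI[of _ "S \<union> S'"] exI[of _ ?A]) auto
    ultimately show "a \<inter> b \<in> cylinders c" by simp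
  qed
  show "sets (\<F> {c..}) = sigma_sets \<Omega> (cylinders c)"
    unfolding sets_path_algebra
  proof (rule sigma_sets_eqI)
    fix a assume "a \<in> {X s -` A \<inter> \<Omega> |s A. s \<in> {c..} \<and> A \<in> sets K}"
    then obtain s A where "a = X s -` A \<inter> \<Omega>" "c \<le> s" "A \<in> sets K" by auto
    then have "a = cylinder {s} (\<lambda>_. A)" "cylinder {s} (\<lambda>_. A) \<in> cylinders c"
      unfolding cylinders_def by (auto simp: cylinder_def intro!: exI[of _ "{s}"] exI[of _ "\<lambda>_. A"])
    then show "a \<in> sigma_sets \<Omega> (cylinders c)" by (simp add: sigma_sets.Basic)
  next
    fix b assume "b \<in> cylinders c"
    then have "b \<in> sets (\<F> {c..})" using c by (auto simp: cylinders_def intro!: cylinder_sets)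
    then show "b \<in> sigma_sets \<Omega> {X s -` A \<inter> \<Omega> |s A. s \<in> {c..} \<and> A \<in> sets K}" by (simp add: sets_path_algebra)
  qed
qed

lemma measurable_P_kernel:
  assumes c: "0 \<le> c"
  shows "P c \<in> K \<rightarrow>\<^sub>M subprob_algebra (\<F> {c..})"
proof (rule measurable_prob_algebraD, rule measurable_prob_algebra_generated[OF cylinders_generate[OF c]])
  show "prob_space (P c y)" if "y \<in> space K" for y using prob c that .
  show "sets (P c y) = sets (\<F> {c..})" if "y \<in> space K" for y using prob_algebra c that .
  show "(\<lambda>y. emeasure (P c y) E) \<in> borel_measurable K" if "E \<in> cylinders c" for E
    using that c by (auto simp: cylinders_def intro!: markov_cylinder_start(1))
qed

text \<open>For fixed \<open>B\<close> both sides are finite measures in \<open>E\<close>: the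
  restriction of \<open>P q x\<close> to \<open>B\<close>, and the mixture of the laws
  \<open>P c (X c w)\<close> over \<open>B\<close>. They agree on the cylinders, an
  intersection-stable generator.\<close>

lemma markov_future:
  assumes q: "0 \<le> q" "q \<le> c" and x: "x \<in> space K" and B: "B \<in> sets (\<F> {q..c})" and E: "E \<in> sets (\<F> {c..})"
  shows "emeasure (P q x) (B \<inter> E) = (\<integral>\<^sup>+w. indicator B w * emeasure (P c (X c w)) E \<partial>P q x)"
proof -
  have c: "0 \<le> c" using q by simp
  interpret prob_space "P q x" using prob q x by simp
  let ?D = "density (P q x) (indicator B)"
  have B'[measurable]: "B \<in> sets (P q x)" using q x by (intro sets_P_I[OF B]) auto
  have id: "(\<lambda>w. w) \<in> ?D \<rightarrow>\<^sub>M \<F> {c..}"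
  proof -
    have "(\<lambda>w. w) \<in> P q x \<rightarrow>\<^sub>M \<F> {c..}"
      by (rule measurable_P[of _ "{c..}"]) (use q x in auto)
    then show ?thesis by simp
  qed
  have Xc: "X c \<in> P q x \<rightarrow>\<^sub>M K"
    using q x by (intro measurable_P[OF measurable_path[of c "{c..c}"]]) auto
  have k: "(\<lambda>w. P c (X c w)) \<in> ?D \<rightarrow>\<^sub>M subprob_algebra (\<F> {c..})"
    using measurable_compose[OF Xc measurable_P_kernel[OF c]] by simp
  have ne: "space ?D \<noteq> {}" using space_nonempty q x by simp
  have 1: "emeasure (distr ?D (\<F> {c..}) (\<lambda>w. w)) E = emeasure (P q x) (B \<inter> E)" if E: "E \<in> sets (\<F> {c..})" for E
    using that sets.sets_into_space[OF that] emeasure_density_indicator[OF B' sets_P_I[OF that]] q x id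
    by (simp add: emeasure_distr Int_absorb2)
  have 2: "emeasure (?D \<bind> (\<lambda>w. P c (X c w))) E = (\<integral>\<^sup>+w. indicator B w * emeasure (P c (X c w)) E \<partial>P q x)"
    if E: "E \<in> sets (\<F> {c..})" for E
    unfolding emeasure_bind[OF ne k E]
    using measurable_compose[OF Xc measurable_compose[OF measurable_P_kernel[OF c] measurable_emeasure_subprob_algebra[OF E]]]
    by (intro nn_integral_density) auto
  have "distr ?D (\<F> {c..}) (\<lambda>w. w) = ?D \<bind> (\<lambda>w. P c (X c w))"
  proof (rule measure_eqI_generator_eq[OF cylinders_generate(2,3)[OF c]])
    show "sets (distr ?D (\<F> {c..}) (\<lambda>w. w)) = sigma_sets \<Omega> (cylinders c)"
      using cylinders_generate(1)[OF c] by simp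
    show "sets (?D \<bind> (\<lambda>w. P c (X c w))) = sigma_sets \<Omega> (cylinders c)"
      using sets_bind[OF sets_kernel[OF k] ne] cylinders_generate(1)[OF c] by simp
    show "range (\<lambda>i::nat. \<Omega>) \<subseteq> cylinders c" "(\<Union>i::nat. \<Omega>) = \<Omega>"
      unfolding cylinders_def cylinder_def by (auto intro!: exI[of _ "{}"] exI[of _ "\<lambda>_. {}"])
    show "emeasure (distr ?D (\<F> {c..}) (\<lambda>w. w)) \<Omega> \<noteq> \<infinity>"
      using 1[of \<Omega>] sets.top[of "\<F> {c..}"] by simp
    fix E assume "E \<in> cylinders c"
    then obtain S A where *: "E = cylinder S A" "finite S" "S \<subseteq> {c..}" "\<And>s. A s \<in> sets K" by (auto simp: cylinders_def)
    have "E \<in> sets (\<F> {c..})" using * c by (auto intro!: cylinder_sets)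
    then show "emeasure (distr ?D (\<F> {c..}) (\<lambda>w. w)) E = emeasure (?D \<bind> (\<lambda>w. P c (X c w))) E"
      using 1 2 markov_cylinder_start(2)[OF *(2,3) c *(4) q x B] * by simp
  qed
  then show ?thesis using 1[OF E] 2[OF E] by simp
qed

end

section \<open>The compensator of the jumps\<close>

text \<open>Together with \<open>cell_right\<close> these are the grid cells ((k - 1) / (n + 1), k /
  (n + 1)] cut down to (a, b]; a time \<open>s\<close> in (a, b] belongs to the one with
  \<open>k = \<lceil>s * real (Suc n)\<rceil>\<close>, as for \<open>grid_left\<close>.\<close>

definition cell_left :: "real \<Rightarrow> nat \<Rightarrow> int \<Rightarrow> real" where
  "cell_left a n k = max a ((of_int k - 1) / real (Suc n))"

definition cell_right :: "real \<Rightarrow> nat \<Rightarrow> int \<Rightarrow> real" where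
  "cell_right b n k = min b (of_int k / real (Suc n))"

definition cells :: "real \<Rightarrow> real \<Rightarrow> nat \<Rightarrow> int set" where
  "cells a b n = {\<lfloor>a * real (Suc n)\<rfloor> + 1..\<lceil>b * real (Suc n)\<rceil>}"

lemma finite_cells [simp]: "finite (cells a b n)"
  by (simp add: cells_def)

lemma cell_bounds:
  assumes "a < b" "k \<in> cells a b n"
  shows "a \<le> cell_left a n k" "cell_left a n k < cell_right b n k" "cell_right b n k \<le> b"
    "cell_right b n k - cell_left a n k \<le> inverse (real (Suc n))"
proof -
  have "a * real (Suc n) < of_int k" "of_int k - 1 < b * real (Suc n)"
    using assms(2) unfolding cells_def atLeastAtMost_iff by linarith+
  then have *: "a < of_int k / real (Suc n)" "(of_int k - 1) / real (Suc n) < b"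
    by (simp_all add: field_simps del: of_nat_Suc)
  have "(of_int k - 1) / real (Suc n) < of_int k / real (Suc n)" by (simp add: divide_strict_right_mono)
  then show "cell_left a n k < cell_right b n k"
    using * assms(1) by (auto simp: cell_left_def cell_right_def)
  have "of_int k / real (Suc n) - (of_int k - 1) / real (Suc n) = inverse (real (Suc n))"
    by (simp add: field_simps)
  moreover have "cell_right b n k \<le> of_int k / real (Suc n)" "(of_int k - 1) / real (Suc n) \<le> cell_left a n k"
    by (auto simp: cell_left_def cell_right_def)
  ultimately show "cell_right b n k - cell_left a n k \<le> inverse (real (Suc n))" by linarith
qed (auto simp: cell_left_def cell_right_def)

lemma cell_iff: "cell_left a n k < s \<and> s \<le> cell_right b n k \<longleftrightarrow> a < s \<and> s \<le> b \<and> k = \<lceil>s * real (Suc n)\<rceil>"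
proof -
  have "k = \<lceil>s * real (Suc n)\<rceil> \<longleftrightarrow> of_int k - 1 < s * real (Suc n) \<and> s * real (Suc n) \<le> of_int k"
    using ceiling_eq_iff[of "s * real (Suc n)" k] by auto
  then have "k = \<lceil>s * real (Suc n)\<rceil> \<longleftrightarrow> (of_int k - 1) / real (Suc n) < s \<and> s \<le> of_int k / real (Suc n)"
    by (simp add: field_simps del: of_nat_Suc)
  then show ?thesis by (auto simp: cell_left_def cell_right_def)
qed

lemma ceiling_in_cells: "a < s \<Longrightarrow> s \<le> b \<Longrightarrow> \<lceil>s * real (Suc n)\<rceil> \<in> cells a b n"
  unfolding cells_def atLeastAtMost_iff
proof
  assume "a < s"
  then have "a * real (Suc n) < s * real (Suc n)" by simp
  then show "\<lfloor>a * real (Suc n)\<rfloor> + 1 \<le> \<lceil>s * real (Suc n)\<rceil>" by linarith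
next
  assume "s \<le> b"
  then show "\<lceil>s * real (Suc n)\<rceil> \<le> \<lceil>b * real (Suc n)\<rceil>" by (intro ceiling_mono mult_right_mono) auto
qed

lemma sum_cells:
  fixes f :: "int \<Rightarrow> ennreal"
  shows "(\<Sum>k\<in>cells a b n. indicator {cell_left a n k<..cell_right b n k} s * f k)
    = indicator {a<..b} s * f \<lceil>s * real (Suc n)\<rceil>"
proof (cases "a < s \<and> s \<le> b")
  case True
  have "(\<Sum>k\<in>cells a b n. indicator {cell_left a n k<..cell_right b n k} s * f k)
    = (\<Sum>k\<in>cells a b n. if k = \<lceil>s * real (Suc n)\<rceil> then f k else 0)"
    using True by (intro sum.cong) (auto simp: indicator_def cell_iff)
  then show ?thesis using True ceiling_in_cells[of a s b n] by simp
next
  case False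
  then have "indicator {cell_left a n k<..cell_right b n k} s = (0 :: ennreal)" for k
    by (auto simp: indicator_def cell_iff)
  then show ?thesis using False by (auto simp: indicator_def)
qed

lemma grid_left_cell: "grid_left a n s = cell_left a n \<lceil>s * real (Suc n)\<rceil>"
  by (simp add: grid_left_def cell_left_def)

context markov_jump_process
begin

definition first_jump_event :: "real \<Rightarrow> real \<Rightarrow> 'k set \<Rightarrow> 'w set" where
  "first_jump_event c d A = {w \<in> \<Omega>. jump_time X c 1 w \<le> ereal d \<and> X (real_of_ereal (jump_time X c 1 w)) w \<in> A}"

lemma first_jump_event_sets:
  assumes c: "0 \<le> c" "c \<le> d" "d \<le> T" and A: "A \<in> sets K"
  shows "first_jump_event c d A \<in> sets (\<F> {c..d})"
proof -
  have "(\<lambda>p. snd p \<in> A) \<in> Pred c \<Otimes>\<^sub>M K \<rightarrow>\<^sub>M count_space UNIV"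
    using A by measurable
  from measurable_jump_term[OF c this, of False 1]
  have "Measurable.pred (\<F> {c..d}) (\<lambda>w. if jump_time X c 1 w \<le> ereal d
      then X (real_of_ereal (jump_time X c 1 w)) w \<in> A else False)" by (simp only: snd_conv space_count_space UNIV_I True_implies_equals)
  then have "{w \<in> space (\<F> {c..d}). if jump_time X c 1 w \<le> ereal d
      then X (real_of_ereal (jump_time X c 1 w)) w \<in> A else False} \<in> sets (\<F> {c..d})"
    by (simp only: pred_def)
  also have "{w \<in> space (\<F> {c..d}). if jump_time X c 1 w \<le> ereal d
      then X (real_of_ereal (jump_time X c 1 w)) w \<in> A else False} = first_jump_event c d A"
    by (auto simp: first_jump_event_def simp del: jump_time.simps)
  finally show ?thesis .
qed

lemma path_at_first_jump_in_space:
  assumes "w \<in> \<Omega>" "0 \<le> c" "jump_time X c 1 w < \<infinity>"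
  shows "X (real_of_ereal (jump_time X c 1 w)) w \<in> space K"
  using assms(3) path_range[OF _ assms(1)] assms(2)
  by (cases rule: jump_time_finite_cases[OF assms(1,2), of 1]) auto

text \<open>The time is cut off at 0 only to have a Borel function on the whole line.\<close>

definition rate_at :: "'k \<Rightarrow> real \<Rightarrow> 'k set \<Rightarrow> ennreal" where
  "rate_at y s A = emeasure (\<nu> (max 0 s) y) A"

lemma measurable_rate_at: "y \<in> space K \<Longrightarrow> A \<in> sets K \<Longrightarrow> (\<lambda>s. rate_at y s A) \<in> borel_measurable borel"
  unfolding rate_at_def by (rule measurable_rate_emeasure) auto

text \<open>The law of the first jump is given for open intervals, while a jump by time
  \<open>d\<close> concerns a closed one. The latter event is contained in the events of a jump
  before \<open>d + 1 / (n + 1)\<close>, whose probabilities decrease to an integral in which the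
  point \<open>d\<close> has no mass. These times may pass \<open>T\<close>, where the rates may be
  unbounded, hence the extended values.\<close>

lemma first_jump_no_atom:
  assumes c: "0 \<le> c" "c < d" and y: "y \<in> space K"
  shows "{w \<in> \<Omega>. jump_time X c 1 w = ereal d} \<in> null_sets (P c y)"
proof -
  interpret prob_space "P c y" using prob c y by simp
  let ?g = "\<lambda>s. jump_kernel K \<nu> s y (space K) * jump_rate K \<nu> s y * exp_neg (\<integral>\<^sup>+q\<in>{c<..s}. jump_rate K \<nu> q y \<partial>lborel)"
  let ?R = "\<lambda>s. rate_at y s (space K)"
  \<comment> \<open>\<open>?h\<close> is a Borel version of the density \<open>?g\<close> on the
    whole line; the two agree after \<open>c\<close>.\<close>
  let ?h = "\<lambda>s. (if ?R s > 0 then ?R s / ?R s else 1) * ?R s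
    * exp_neg (\<integral>\<^sup>+q. (if c < q \<and> q \<le> s then ?R q else 0) \<partial>lborel)"
  have R[measurable]: "?R \<in> borel_measurable borel" using measurable_rate_at[OF y] by simp
  have [measurable]: "(\<lambda>s. \<integral>\<^sup>+q. (if c < q \<and> q \<le> s then ?R q else 0) \<partial>lborel) \<in> borel_measurable borel"
    by measurable
  have "exp_neg \<in> borel_measurable borel" unfolding exp_neg_def[abs_def] by measurable
  then have h[measurable]: "?h \<in> borel_measurable borel" by measurable
  have gh: "?g s = ?h s" if "c < s" for s
  proof -
    have "(\<integral>\<^sup>+q\<in>{c<..s}. jump_rate K \<nu> q y \<partial>lborel) = (\<integral>\<^sup>+q. (if c < q \<and> q \<le> s then ?R q else 0) \<partial>lborel)"
      using c by (intro nn_integral_cong) (auto simp: indicator_def rate_at_def jump_rate_def)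
    then show ?thesis using that c y by (simp add: jump_kernel_def jump_rate_def rate_at_def)
  qed
  have S: "{w \<in> \<Omega>. jump_time X c 1 w < ereal b} \<in> sets (P c y)" if "c \<le> b" for b
  proof -
    have "{w \<in> space (\<F> {c..b}). stopped_time c b 1 w < b} \<in> sets (\<F> {c..b})"
      using measurable_stopped_time[OF c(1) that] by measurable
    moreover have "stopped_time c b 1 w < b \<longleftrightarrow> jump_time X c 1 w < ereal b" if "w \<in> \<Omega>" for w
      by (cases rule: jump_time_finite_cases[OF that c(1), of 1]) (auto simp: stopped_time_def simp del: jump_time.simps)
    ultimately have "{w \<in> \<Omega>. jump_time X c 1 w < ereal b} \<in> sets (\<F> {c..b})"
      by (simp cong: conj_cong del: jump_time.simps One_nat_def)
    then show ?thesis using c y by (rule_tac sets_P_I) auto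
  qed
  have law: "emeasure (P c y) {w \<in> \<Omega>. jump_time X c 1 w < ereal b} = (\<integral>\<^sup>+s. ?h s * indicator {c<..<b} s \<partial>lborel)"
    if "c < b" for b
  proof -
    have "{w \<in> \<Omega>. jump_time X c 1 w < ereal b} = {w \<in> \<Omega>. ereal c < jump_time X c 1 w \<and> jump_time X c 1 w < ereal b
        \<and> X (real_of_ereal (jump_time X c 1 w)) w \<in> space K}"
      using first_jump_greater[OF _ c(1)] path_at_first_jump_in_space[OF _ c(1) less_trans[of _ "ereal b" \<infinity>]]
      by (auto simp del: jump_time.simps One_nat_def)
    then have "emeasure (P c y) {w \<in> \<Omega>. jump_time X c 1 w < ereal b} = (\<integral>\<^sup>+s\<in>{s. c < s \<and> ereal s < ereal b}. ?g s \<partial>lborel)"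
      using first_jump[of c c "ereal b" y "space K"] c y that by simp
    also have "\<dots> = (\<integral>\<^sup>+s. ?h s * indicator {c<..<b} s \<partial>lborel)"
    proof (rule nn_integral_cong)
      fix s
      have ind: "indicator {s. c < s \<and> ereal s < ereal b} s = (indicator {c<..<b} s :: ennreal)"
        by (auto simp: indicator_def)
      show "?g s * indicator {s. c < s \<and> ereal s < ereal b} s = ?h s * indicator {c<..<b} s"
      proof (cases "c < s")
        case True
        show ?thesis by (simp only: gh[OF True] ind)
      next
        case False
        then have "indicator {c<..<b} s = (0 :: ennreal)" by simp
        then show ?thesis by (simp only: ind mult_zero_right)
      qed
    qed
    finally show ?thesis .
  qed
  have le_sets: "{w \<in> \<Omega>. jump_time X c 1 w \<le> ereal d} \<in> sets (P c y)"
    using stopping[of c d] c y by (intro sets_P_I[of _ "{c..d}"]) auto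
  let ?u = "\<lambda>n. d + inverse (real (Suc n))"
  have ind: "(INF n. ?h s * indicator {c<..<?u n} s) = ?h s * indicator {c<..d} s" for s
  proof (cases "s \<le> d")
    case True
    have "s < ?u n" for n by (rule le_less_trans[OF True]) (simp del: of_nat_Suc)
    then have "indicator {c<..<?u n} s = (indicator {c<..d} s :: ennreal)" for n
      using True by (simp add: indicator_def del: of_nat_Suc)
    then show ?thesis by simp
  next
    case False
    then obtain n where "inverse (real (Suc n)) < s - d" using reals_Archimedean[of "s - d"] by auto
    then have "?h s * indicator {c<..<?u n} s = 0" by (simp add: indicator_def)
    with INF_lower[of n UNIV "\<lambda>n. ?h s * indicator {c<..<?u n} s"]
    have "(INF n. ?h s * indicator {c<..<?u n} s) \<le> 0" by (simp only: UNIV_I True_implies_equals)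
    moreover have "indicator {c<..d} s = (0 :: ennreal)" using False by simp
    ultimately show ?thesis by (simp only: mult_zero_right le_zero_eq)
  qed
  have "emeasure (P c y) {w \<in> \<Omega>. jump_time X c 1 w \<le> ereal d}
      \<le> (INF n. \<integral>\<^sup>+s. ?h s * indicator {c<..<?u n} s \<partial>lborel)"
  proof (rule INF_greatest)
    fix n :: nat
    have u: "d < ?u n" by (simp del: of_nat_Suc)
    have "emeasure (P c y) {w \<in> \<Omega>. jump_time X c 1 w \<le> ereal d} \<le> emeasure (P c y) {w \<in> \<Omega>. jump_time X c 1 w < ereal (?u n)}"
    proof (rule emeasure_mono)
      show "{w \<in> \<Omega>. jump_time X c 1 w \<le> ereal d} \<subseteq> {w \<in> \<Omega>. jump_time X c 1 w < ereal (?u n)}"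
        using le_less_trans[of _ "ereal d" "ereal (?u n)"] u by auto
      show "{w \<in> \<Omega>. jump_time X c 1 w < ereal (?u n)} \<in> sets (P c y)" by (rule S) (use u c in linarith)
    qed
    also have "\<dots> = (\<integral>\<^sup>+s. ?h s * indicator {c<..<?u n} s \<partial>lborel)" by (rule law) (use u c in linarith)
    finally show "emeasure (P c y) {w \<in> \<Omega>. jump_time X c 1 w \<le> ereal d} \<le> \<dots>" .
  qed
  also have "\<dots> = (\<integral>\<^sup>+s. (INF n. ?h s * indicator {c<..<?u n} s) \<partial>lborel)"
  proof (rule nn_integral_monotone_convergence_INF_decseq[symmetric, where i = 0])
    show "decseq (\<lambda>n s. ?h s * indicator {c<..<?u n} s)"
    proof (intro decseq_SucI le_funI mult_left_mono)
      fix n s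
      have "inverse (real (Suc (Suc n))) \<le> inverse (real (Suc n))" by (rule le_imp_inverse_le) auto
      then have "s \<in> {c<..<?u (Suc n)} \<Longrightarrow> s \<in> {c<..<?u n}"
        unfolding greaterThanLessThan_iff by linarith
      then show "(indicator {c<..<?u (Suc n)} s :: ennreal) \<le> indicator {c<..<?u n} s"
        by (cases "s \<in> {c<..<?u (Suc n)}") (simp_all only: indicator_simps order_refl zero_le simp_thms True_implies_equals)
    qed simp
    show "(\<integral>\<^sup>+s. ?h s * indicator {c<..<?u 0} s \<partial>lborel) < \<infinity>"
    proof -
      \<comment> \<open>The integral is finite because it is a probability, although nothing bounds
        the rates beyond \<open>T\<close>.\<close>
      have "c < ?u 0" using c by simp
      show ?thesis unfolding law[OF \<open>c < ?u 0\<close>, symmetric]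
        by (simp add: less_top[symmetric] del: jump_time.simps)
    qed
  qed measurable
  also have "\<dots> = (\<integral>\<^sup>+s. ?h s * indicator {c<..<d} s \<partial>lborel)"
  proof (rule nn_integral_cong_AE)
    show "AE s in lborel. (INF n. ?h s * indicator {c<..<?u n} s) = ?h s * indicator {c<..<d} s"
      using AE_lborel_singleton[of d] unfolding ind by eventually_elim (auto simp: indicator_def)
  qed
  also have "\<dots> = emeasure (P c y) {w \<in> \<Omega>. jump_time X c 1 w < ereal d}" using law[of d] c by simp
  finally have le: "emeasure (P c y) {w \<in> \<Omega>. jump_time X c 1 w \<le> ereal d} \<le> \<dots>" .
  have "{w \<in> \<Omega>. jump_time X c 1 w = ereal d}
    = {w \<in> \<Omega>. jump_time X c 1 w \<le> ereal d} - {w \<in> \<Omega>. jump_time X c 1 w < ereal d}" by auto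
  moreover have "emeasure (P c y) ({w \<in> \<Omega>. jump_time X c 1 w \<le> ereal d} - {w \<in> \<Omega>. jump_time X c 1 w < ereal d})
    = emeasure (P c y) {w \<in> \<Omega>. jump_time X c 1 w \<le> ereal d} - emeasure (P c y) {w \<in> \<Omega>. jump_time X c 1 w < ereal d}"
    using S[of d] c le_sets by (intro emeasure_Diff) auto
  moreover have "\<dots> = 0" using le by (intro diff_eq_0_ennreal) (simp_all add: less_top[symmetric] del: jump_time.simps One_nat_def)
  ultimately show ?thesis using le_sets S[of d] c by (auto simp: null_sets_def simp del: jump_time.simps One_nat_def)
qed

lemma emeasure_first_jump_event:
  assumes c: "0 \<le> c" "c < d" "d \<le> T" and y: "y \<in> space K" and A: "A \<in> sets K"
  shows "emeasure (P c y) (first_jump_event c d A) = (\<integral>\<^sup>+s\<in>{s. c < s \<and> ereal s < ereal d}.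
           jump_kernel K \<nu> s y A * jump_rate K \<nu> s y
           * exp_neg (\<integral>\<^sup>+q\<in>{c<..s}. jump_rate K \<nu> q y \<partial>lborel) \<partial>lborel)"
proof -
  let ?N = "{w \<in> \<Omega>. jump_time X c 1 w = ereal d}"
  have "first_jump_event c d A \<in> sets (P c y)"
    using first_jump_event_sets[OF c(1) _ c(3) A] c y by (intro sets_P_I[of _ "{c..d}"]) auto
  from emeasure_Diff_null_set[OF first_jump_no_atom[OF c(1,2) y] this]
  have "emeasure (P c y) (first_jump_event c d A) = emeasure (P c y) (first_jump_event c d A - ?N)" by simp
  also have "first_jump_event c d A - ?N = {w \<in> \<Omega>. ereal c < jump_time X c 1 w \<and> jump_time X c 1 w < ereal d
        \<and> X (real_of_ereal (jump_time X c 1 w)) w \<in> A}"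
    using first_jump_greater[OF _ c(1)] by (auto simp: first_jump_event_def simp del: jump_time.simps One_nat_def)
  also have "emeasure (P c y) \<dots> = (\<integral>\<^sup>+s\<in>{s. c < s \<and> ereal s < ereal d}.
           jump_kernel K \<nu> s y A * jump_rate K \<nu> s y
           * exp_neg (\<integral>\<^sup>+q\<in>{c<..s}. jump_rate K \<nu> q y \<partial>lborel) \<partial>lborel)"
    by (rule first_jump) (use c y A in auto)
  finally show ?thesis .
qed

text \<open>If the total rate vanishes so does the rate of \<open>A\<close>, and the convention made
  in \<open>jump_kernel\<close> is multiplied by zero.\<close>

lemma jump_kernel_times_rate:
  assumes "0 \<le> s" "s \<le> T" "y \<in> space K" "A \<in> sets K"
  shows "jump_kernel K \<nu> s y A * jump_rate K \<nu> s y = emeasure (\<nu> s y) A"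
proof -
  have fin: "emeasure (\<nu> s y) (space K) \<noteq> \<infinity>"
    using rate_le_bound[OF assms(1-3), of "space K"] by (auto simp: top_unique)
  have le: "emeasure (\<nu> s y) A \<le> emeasure (\<nu> s y) (space K)"
    using emeasure_space[of "\<nu> s y" A] space_rate assms by simp
  show ?thesis
  proof (cases "emeasure (\<nu> s y) (space K) = 0")
    case True
    then show ?thesis using le by (simp add: jump_rate_def)
  next
    case False
    then have "jump_rate K \<nu> s y > 0" by (simp add: jump_rate_def zero_less_iff_neq_zero)
    then show ?thesis using False fin
      by (simp add: jump_kernel_def jump_rate_def ennreal_divide_times ennreal_divide_self less_top)
  qed
qed

text \<open>The survival factor in the law of the first jump lies between
  \<open>exp (- \<Lambda> * h)\<close> and 1 on a cell of length at most \<open>h\<close>. On a fine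
  grid it is negligible, and the plain time integral of the rates remains.\<close>

lemma first_jump_event_bounds:
  assumes c: "0 \<le> c" "c < d" "d \<le> T" and y: "y \<in> space K" and A: "A \<in> sets K"
  shows "emeasure (P c y) (first_jump_event c d A) \<le> (\<integral>\<^sup>+s. indicator {c<..d} s * rate_at y s A \<partial>lborel)"
    and "d - c \<le> h \<Longrightarrow> ennreal (exp (- \<Lambda> * h)) * (\<integral>\<^sup>+s. indicator {c<..d} s * rate_at y s A \<partial>lborel)
      \<le> emeasure (P c y) (first_jump_event c d A)"
proof -
  let ?e = "\<lambda>s. exp_neg (\<integral>\<^sup>+q\<in>{c<..s}. jump_rate K \<nu> q y \<partial>lborel)"
  have law: "emeasure (P c y) (first_jump_event c d A) = (\<integral>\<^sup>+s. indicator {c<..<d} s * rate_at y s A * ?e s \<partial>lborel)"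
    unfolding emeasure_first_jump_event[OF assms] using c y A
    by (intro nn_integral_cong) (auto simp: indicator_def jump_kernel_times_rate rate_at_def)
  have e1: "?e s \<le> 1" for s by (auto simp: exp_neg_def)
  have "indicator {c<..<d} s * rate_at y s A * ?e s \<le> indicator {c<..d} s * rate_at y s A" for s
    using mult_left_mono[OF e1[of s], of "indicator {c<..<d} s * rate_at y s A"]
    by (auto simp: indicator_def)
  then show "emeasure (P c y) (first_jump_event c d A) \<le> (\<integral>\<^sup>+s. indicator {c<..d} s * rate_at y s A \<partial>lborel)"
    unfolding law by (rule nn_integral_mono)
  assume h: "d - c \<le> h"
  have e2: "ennreal (exp (- \<Lambda> * h)) \<le> ?e s" if "c < s" "s < d" for s
  proof -
    have "(\<integral>\<^sup>+q\<in>{c<..s}. jump_rate K \<nu> q y \<partial>lborel) \<le> (\<integral>\<^sup>+q. ennreal \<Lambda> * indicator {c<..s} q \<partial>lborel)"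
      using c that y by (intro nn_integral_mono) (auto simp: indicator_def jump_rate_def intro!: rate_le_bound)
    also have "\<dots> = ennreal (\<Lambda> * (s - c))"
      using that rate_bound_pos by (simp add: nn_integral_cmult_indicator ennreal_mult)
    also have "\<dots> \<le> ennreal (\<Lambda> * h)"
      using that h rate_bound_pos by (intro ennreal_leI mult_left_mono) auto
    finally have I: "(\<integral>\<^sup>+q\<in>{c<..s}. jump_rate K \<nu> q y \<partial>lborel) \<le> ennreal (\<Lambda> * h)" .
    then have "(\<integral>\<^sup>+q\<in>{c<..s}. jump_rate K \<nu> q y \<partial>lborel) \<noteq> \<infinity>" by (auto simp: top_unique)
    moreover have "enn2real (\<integral>\<^sup>+q\<in>{c<..s}. jump_rate K \<nu> q y \<partial>lborel) \<le> \<Lambda> * h"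
      using I h c rate_bound_pos by (intro enn2real_leI) auto
    ultimately show ?thesis by (auto simp: exp_neg_def intro!: ennreal_leI)
  qed
  have [measurable]: "(\<lambda>s. rate_at y s A) \<in> borel_measurable borel" by (rule measurable_rate_at[OF y A])
  have "ennreal (exp (- \<Lambda> * h)) * (\<integral>\<^sup>+s. indicator {c<..d} s * rate_at y s A \<partial>lborel)
     = (\<integral>\<^sup>+s. ennreal (exp (- \<Lambda> * h)) * (indicator {c<..d} s * rate_at y s A) \<partial>lborel)"
    by (rule nn_integral_cmult[symmetric]) measurable
  also have "\<dots> \<le> (\<integral>\<^sup>+s. indicator {c<..<d} s * rate_at y s A * ?e s \<partial>lborel)"
  proof (rule nn_integral_mono_AE)
    show "AE s in lborel. ennreal (exp (- \<Lambda> * h)) * (indicator {c<..d} s * rate_at y s A)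
        \<le> indicator {c<..<d} s * rate_at y s A * ?e s"
      using AE_lborel_singleton[of d]
    proof eventually_elim
      case (elim s)
      show ?case
      proof (cases "c < s \<and> s < d")
        case True
        then show ?thesis using mult_right_mono[OF e2[of s], of "rate_at y s A"] by (simp add: mult.commute)
      next
        case False
        then have "indicator {c<..d} s = (0::ennreal)" using elim by (auto simp: indicator_def)
        then show ?thesis by simp
      qed
    qed
  qed
  finally show "ennreal (exp (- \<Lambda> * h)) * (\<integral>\<^sup>+s. indicator {c<..d} s * rate_at y s A \<partial>lborel)
      \<le> emeasure (P c y) (first_jump_event c d A)" unfolding law .
qed

lemma indicator_first_jump_le:
  assumes w: "w \<in> \<Omega>" and c: "0 \<le> c"
  shows "indicator (first_jump_event c d A) w \<le> (\<Sum>\<tau>\<in>jumps w \<inter> {c<..d}. indicator A (X \<tau> w) :: ennreal)"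
proof (cases "w \<in> first_jump_event c d A")
  case True
  then have 1: "jump_time X c 1 w \<le> ereal d" "X (real_of_ereal (jump_time X c 1 w)) w \<in> A"
    by (auto simp: first_jump_event_def)
  from w c 1(1) obtain \<tau> where \<tau>: "jump_time X c 1 w = ereal \<tau>" "c < \<tau>" "\<tau> \<le> d" "\<tau> \<in> jumps w"
    by (rule first_jump_properties)
  have "indicator A (X \<tau> w) \<le> (\<Sum>\<tau>\<in>jumps w \<inter> {c<..d}. indicator A (X \<tau> w) :: ennreal)"
    using \<tau> w by (intro member_le_sum) auto
  then show ?thesis using True 1 \<tau>(1) by (simp add: indicator_def)
qed simp

lemma indicator_first_jump_eq:
  assumes w: "w \<in> \<Omega>" and c: "0 \<le> c"
    and one: "\<And>\<tau> \<tau>'. \<tau> \<in> jumps w \<inter> {c<..d} \<Longrightarrow> \<tau>' \<in> jumps w \<inter> {c<..d} \<Longrightarrow> \<tau> = \<tau>'"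
  shows "indicator (first_jump_event c d A) w = (\<Sum>\<tau>\<in>jumps w \<inter> {c<..d}. indicator A (X \<tau> w) :: ennreal)"
proof (cases "jumps w \<inter> {c<..d} = {}")
  case True
  then have "w \<notin> first_jump_event c d A"
    using first_jump_le_iff[OF w c, of d] by (auto simp: first_jump_event_def)
  then show ?thesis using True by simp
next
  case False
  then have le: "jump_time X c 1 w \<le> ereal d" using first_jump_le_iff[OF w c, of d] by simp
  from w c le obtain \<tau> where \<tau>: "jump_time X c 1 w = ereal \<tau>" "c < \<tau>" "\<tau> \<le> d" "\<tau> \<in> jumps w"
    by (rule first_jump_properties)
  then have "\<tau> \<in> jumps w \<inter> {c<..d}" by simp
  then have "jumps w \<inter> {c<..d} = {\<tau>}" using one by blast
  then show ?thesis using \<tau> w by (simp add: first_jump_event_def indicator_def del: jump_time.simps)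
qed

lemma sum_cells_jumps:
  fixes \<phi> :: "real \<Rightarrow> ennreal"
  assumes w: "w \<in> \<Omega>" and ab: "a < b"
  shows "(\<Sum>k\<in>cells a b n. \<Sum>\<tau>\<in>jumps w \<inter> {cell_left a n k<..cell_right b n k}. \<phi> \<tau>)
    = (\<Sum>\<tau>\<in>jumps w \<inter> {a<..b}. \<phi> \<tau>)"
proof -
  have "(\<Sum>\<tau>\<in>jumps w \<inter> {cell_left a n k<..cell_right b n k}. \<phi> \<tau>)
     = (\<Sum>\<tau>\<in>jumps w \<inter> {a<..b}. indicator {cell_left a n k<..cell_right b n k} \<tau> * \<phi> \<tau>)"
    if "k \<in> cells a b n" for k
    using cell_bounds[OF ab that] w
    by (intro sum.mono_neutral_cong_left) (auto simp: indicator_def)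
  then have "(\<Sum>k\<in>cells a b n. \<Sum>\<tau>\<in>jumps w \<inter> {cell_left a n k<..cell_right b n k}. \<phi> \<tau>)
     = (\<Sum>k\<in>cells a b n. \<Sum>\<tau>\<in>jumps w \<inter> {a<..b}. indicator {cell_left a n k<..cell_right b n k} \<tau> * \<phi> \<tau>)"
    by simp
  also have "\<dots> = (\<Sum>\<tau>\<in>jumps w \<inter> {a<..b}. \<Sum>k\<in>cells a b n. indicator {cell_left a n k<..cell_right b n k} \<tau> * \<phi> \<tau>)"
    by (rule sum.swap)
  also have "\<dots> = (\<Sum>\<tau>\<in>jumps w \<inter> {a<..b}. \<phi> \<tau>)"
    unfolding sum_cells by (intro sum.cong) auto
  finally show ?thesis .
qed

lemma jumps_separated:
  assumes w: "w \<in> \<Omega>"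
  obtains \<delta> where "\<delta> > 0" "\<And>\<tau> \<tau>'. \<tau> \<in> jumps w \<inter> {a<..b} \<Longrightarrow> \<tau>' \<in> jumps w \<inter> {a<..b} \<Longrightarrow> \<bar>\<tau> - \<tau>'\<bar> < \<delta> \<Longrightarrow> \<tau> = \<tau>'"
proof -
  let ?D = "(\<lambda>(\<tau>, \<tau>'). \<bar>\<tau> - \<tau>'\<bar>) ` {(\<tau>, \<tau>') \<in> (jumps w \<inter> {a<..b}) \<times> (jumps w \<inter> {a<..b}). \<tau> \<noteq> \<tau>'}"
  \<comment> \<open>The element 1 keeps the minimum defined when there are fewer than two
    jumps.\<close>
  have fin: "finite (insert 1 ?D)"
  proof -
    have "finite ((jumps w \<inter> {a<..b}) \<times> (jumps w \<inter> {a<..b}))" using w by simp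
    then have "finite {(\<tau>, \<tau>') \<in> (jumps w \<inter> {a<..b}) \<times> (jumps w \<inter> {a<..b}). \<tau> \<noteq> \<tau>'}"
      by (rule finite_subset[rotated]) blast
    then show ?thesis by simp
  qed
  show ?thesis
  proof (rule that[of "Min (insert 1 ?D)"])
    have "\<forall>x\<in>insert 1 ?D. 0 < x" by auto
    then show "0 < Min (insert 1 ?D)" using Min_in[OF fin] by blast
    fix \<tau> \<tau>' assume *: "\<tau> \<in> jumps w \<inter> {a<..b}" "\<tau>' \<in> jumps w \<inter> {a<..b}" "\<bar>\<tau> - \<tau>'\<bar> < Min (insert 1 ?D)"
    show "\<tau> = \<tau>'"
    proof (rule ccontr)
      assume "\<tau> \<noteq> \<tau>'"
      then have "\<bar>\<tau> - \<tau>'\<bar> \<in> insert 1 ?D" using * by force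
      from Min_le[OF fin this] show False using * by linarith
    qed
  qed
qed

text \<open>Once the cells are shorter than the smallest gap between jumps, each cell contains at
  most one jump, and counting first jumps counts all of them.\<close>

lemma eventually_sum_first_jump:
  assumes w: "w \<in> \<Omega>" and a: "0 \<le> a" "a < b"
  shows "\<forall>\<^sub>F n in sequentially. (\<Sum>k\<in>cells a b n. indicator (first_jump_event (cell_left a n k) (cell_right b n k) A) w :: ennreal)
    = (\<Sum>\<tau>\<in>jumps w \<inter> {a<..b}. indicator A (X \<tau> w))"
proof -
  obtain \<delta> where \<delta>: "\<delta> > 0" "\<And>\<tau> \<tau>'. \<tau> \<in> jumps w \<inter> {a<..b} \<Longrightarrow> \<tau>' \<in> jumps w \<inter> {a<..b} \<Longrightarrow> \<bar>\<tau> - \<tau>'\<bar> < \<delta> \<Longrightarrow> \<tau> = \<tau>'"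
    using jumps_separated[OF w] by metis
  show ?thesis using order_tendstoD(2)[OF LIMSEQ_inverse_real_of_nat \<delta>(1)]
  proof eventually_elim
    case (elim n)
    have "indicator (first_jump_event (cell_left a n k) (cell_right b n k) A) w
       = (\<Sum>\<tau>\<in>jumps w \<inter> {cell_left a n k<..cell_right b n k}. indicator A (X \<tau> w) :: ennreal)"
      if k: "k \<in> cells a b n" for k
    proof (rule indicator_first_jump_eq[OF w])
      show "0 \<le> cell_left a n k" using cell_bounds(1)[OF a(2) k] a by simp
      fix \<tau> \<tau>' assume *: "\<tau> \<in> jumps w \<inter> {cell_left a n k<..cell_right b n k}" "\<tau>' \<in> jumps w \<inter> {cell_left a n k<..cell_right b n k}"
      then have "\<bar>\<tau> - \<tau>'\<bar> < \<delta>" using cell_bounds(4)[OF a(2) k] elim by auto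
      moreover have "\<tau> \<in> jumps w \<inter> {a<..b}" "\<tau>' \<in> jumps w \<inter> {a<..b}"
        using * cell_bounds[OF a(2) k] by auto
      ultimately show "\<tau> = \<tau>'" using \<delta>(2) by blast
    qed
    then show ?case using sum_cells_jumps[OF w a(2)] by simp
  qed
qed

text \<open>The jumps in \<open>(a, b]\<close> are counted by the first jumps in the cells of a grid. The Markov property
  at the left end points and the law of the first jump give the expectation on each cell up to a
  factor between \<open>exp (- \<Lambda> / (n + 1))\<close> and \<open>1\<close>.\<close>

lemma compensator_rectangle:
  assumes t: "0 \<le> t" "t \<le> a" "a < b" "b \<le> T" and x: "x \<in> space K"
    and B: "B \<in> sets (\<F> {t..a})" and A: "A \<in> sets K"
  shows "(\<integral>\<^sup>+w. indicator B w * (\<Sum>\<tau>\<in>jumps w \<inter> {a<..b}. indicator A (X \<tau> w)) \<partial>P t x)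
    = (\<integral>\<^sup>+w. indicator B w * (\<integral>\<^sup>+s. indicator {a<..b} s * rate_at (X s w) s A \<partial>lborel) \<partial>P t x)"
proof -
  interpret prob_space "P t x" using prob t x by simp
  interpret pair_sigma_finite "P t x" lborel ..
  have a: "0 \<le> a" "a \<le> T" using t by auto
  let ?c = "cell_left a" and ?d = "cell_right b" and ?I = "cells a b" and ?M = "P t x \<Otimes>\<^sub>M (lborel :: real measure)"
  let ?E = "\<lambda>n k. first_jump_event (?c n k) (?d n k) A"
  let ?p = "\<lambda>n k w. emeasure (P (?c n k) (X (?c n k) w)) (?E n k)"
  let ?N = "\<lambda>w. \<Sum>\<tau>\<in>jumps w \<inter> {a<..b}. indicator A (X \<tau> w) :: ennreal"
  let ?D = "\<lambda>n w. \<Sum>k\<in>?I n. indicator (?E n k) w :: ennreal"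
  let ?f = "\<lambda>n (w, s :: real). indicator B w * (indicator {a<..b} s * rate_at (X (grid_left a n s) w) s A)"
  let ?f' = "\<lambda>(w, s :: real). indicator B w * (indicator {a<..b} s * rate_at (left_path a s w) s A)"
  have B'[measurable]: "B \<in> sets (P t x)" using t x by (intro sets_P_I[OF B]) auto
  have cb: "0 \<le> ?c n k" "t \<le> ?c n k" "a \<le> ?c n k" "?c n k < ?d n k" "?d n k \<le> T" "?d n k - ?c n k \<le> inverse (real (Suc n))"
    if "k \<in> ?I n" for n k
    using cell_bounds[OF t(3) that] t a by auto
  have Ev: "?E n k \<in> sets (P t x)" if "k \<in> ?I n" for n k
    using first_jump_event_sets[OF cb(1)[OF that] less_imp_le[OF cb(4)[OF that]] cb(5)[OF that] A] cb[OF that] t x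
    by (intro sets_P_I[of _ "{?c n k..?d n k}"]) auto
  have Dm: "?D n \<in> borel_measurable (P t x)" for n
    using Ev by (intro borel_measurable_sum borel_measurable_indicator)
  have conv: "(\<lambda>n. \<integral>\<^sup>+w. indicator B w * ?D n w \<partial>P t x) \<longlonglongrightarrow> (\<integral>\<^sup>+w. indicator B w * ?N w \<partial>P t x)"
  proof (rule Liminf_eq_Limsup)
    have DN: "?D n w \<le> ?N w" if "w \<in> \<Omega>" for n w
    proof -
      have "?D n w \<le> (\<Sum>k\<in>?I n. \<Sum>\<tau>\<in>jumps w \<inter> {?c n k<..?d n k}. indicator A (X \<tau> w))"
        by (intro sum_mono indicator_first_jump_le[OF that cb(1)])
      also have "\<dots> = ?N w" by (rule sum_cells_jumps[OF that t(3)])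
      finally show ?thesis .
    qed
    have up: "(\<integral>\<^sup>+w. indicator B w * ?D n w \<partial>P t x) \<le> (\<integral>\<^sup>+w. indicator B w * ?N w \<partial>P t x)" for n
      using DN t x by (intro nn_integral_mono mult_left_mono) auto
    have lo: "(\<integral>\<^sup>+w. indicator B w * ?N w \<partial>P t x) \<le> liminf (\<lambda>n. \<integral>\<^sup>+w. indicator B w * ?D n w \<partial>P t x)"
    proof -
      have "(\<integral>\<^sup>+w. indicator B w * ?N w \<partial>P t x) = (\<integral>\<^sup>+w. liminf (\<lambda>n. indicator B w * ?D n w) \<partial>P t x)"
      proof (rule nn_integral_cong)
        fix w assume "w \<in> space (P t x)"
        then have "w \<in> \<Omega>" using t x by simp
        then have "\<forall>\<^sub>F n in sequentially. indicator B w * ?D n w = indicator B w * ?N w"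
          using eventually_sum_first_jump[OF _ a(1) t(3), of w A] by (auto elim: eventually_mono)
        then have "(\<lambda>n. indicator B w * ?D n w) \<longlonglongrightarrow> indicator B w * ?N w" by (rule tendsto_eventually)
        from lim_imp_Liminf[OF _ this] show "indicator B w * ?N w = liminf (\<lambda>n. indicator B w * ?D n w)" by simp
      qed
      also have "\<dots> \<le> liminf (\<lambda>n. \<integral>\<^sup>+w. indicator B w * ?D n w \<partial>P t x)"
      proof (rule nn_integral_liminf)
        have "(\<lambda>w. indicator B w * f w) \<in> borel_measurable (P t x)"
          if [measurable]: "f \<in> borel_measurable (P t x)" for f :: "'w \<Rightarrow> ennreal" by measurable
        from this[OF Dm] show "(\<lambda>w. indicator B w * ?D n w) \<in> borel_measurable (P t x)" for n .
      qed
      finally show ?thesis .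
    qed
    have hi: "limsup (\<lambda>n. \<integral>\<^sup>+w. indicator B w * ?D n w \<partial>P t x) \<le> (\<integral>\<^sup>+w. indicator B w * ?N w \<partial>P t x)"
      by (rule Limsup_bounded) (use up in simp)
    note li = Liminf_le_Limsup[of sequentially "\<lambda>n. \<integral>\<^sup>+w. indicator B w * ?D n w \<partial>P t x", OF sequentially_bot]
    show "sequentially \<noteq> bot" by simp
    show "liminf (\<lambda>n. \<integral>\<^sup>+w. indicator B w * ?D n w \<partial>P t x) = (\<integral>\<^sup>+w. indicator B w * ?N w \<partial>P t x)"
      using lo hi li by (meson antisym order_trans)
    show "limsup (\<lambda>n. \<integral>\<^sup>+w. indicator B w * ?D n w \<partial>P t x) = (\<integral>\<^sup>+w. indicator B w * ?N w \<partial>P t x)"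
      using lo hi li by (meson antisym order_trans)
  qed
  have idp: "(\<lambda>p. p) \<in> ?M \<rightarrow>\<^sub>M \<F> {a..b} \<Otimes>\<^sub>M borel"
  proof -
    have [measurable]: "(\<lambda>w. w) \<in> P t x \<rightarrow>\<^sub>M \<F> {a..b}"
      by (rule measurable_P[of _ "{a..b}"]) (use t x in auto)
    have "(\<lambda>p. (fst p, snd p)) \<in> ?M \<rightarrow>\<^sub>M \<F> {a..b} \<Otimes>\<^sub>M borel" by measurable
    then show ?thesis by simp
  qed
  have meas_f: "(\<lambda>(w, s). indicator B w * (indicator {a<..b} s * rate_at (W (clamp_to a b s) w) s A)) \<in> borel_measurable ?M"
    if W: "(\<lambda>(w, s). W (clamp_to a b s) w) \<in> \<F> {a..b} \<Otimes>\<^sub>M borel \<rightarrow>\<^sub>M K" for W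
  proof -
    have "(\<lambda>p. W (clamp_to a b (snd p)) (fst p)) \<in> ?M \<rightarrow>\<^sub>M K"
      using measurable_compose[OF idp W] by (simp add: case_prod_beta')
    from measurable_rate_emeasure[of "\<lambda>p. max 0 (snd p)", OF _ this _ A]
    have [measurable]: "(\<lambda>p. rate_at (W (clamp_to a b (snd p)) (fst p)) (snd p) A) \<in> borel_measurable ?M"
      unfolding rate_at_def by simp
    show ?thesis unfolding case_prod_beta' by measurable
  qed
  have fm: "?f n \<in> borel_measurable ?M" for n
  proof -
    have "(\<lambda>(w, s). X (grid_left a n (clamp_to a b s)) w) \<in> \<F> {a..b} \<Otimes>\<^sub>M borel \<rightarrow>\<^sub>M K"
      using measurable_compose[OF measurable_clamp_predictable[of a b] predictable_grid[OF a, of X K n]] t a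
      by (simp add: case_prod_beta' measurable_path)
    from meas_f[OF this] show ?thesis
      by (rule measurable_cong[THEN iffD1, rotated]) (auto simp: indicator_def)
  qed
  have f'm: "?f' \<in> borel_measurable ?M"
  proof -
    have "(\<lambda>(w, s). left_path a (clamp_to a b s) w) \<in> \<F> {a..b} \<Otimes>\<^sub>M borel \<rightarrow>\<^sub>M K"
      using measurable_compose[OF measurable_clamp_predictable[of a b] predictable_left_path[OF a]] t a
      by (simp add: case_prod_beta')
    from meas_f[OF this] show ?thesis
      by (rule measurable_cong[THEN iffD1, rotated]) (auto simp: indicator_def)
  qed
  \<comment> \<open>The state frozen at the left end of each cell tends to the left limit; the
    constant \<Lambda> on (a, b] is a majorant.\<close>
  have Jconv: "(\<lambda>n. \<integral>\<^sup>+p. ?f n p \<partial>?M) \<longlonglongrightarrow> (\<integral>\<^sup>+p. ?f' p \<partial>?M)"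
  proof (rule nn_integral_dominated_convergence[where w = "\<lambda>p. ennreal \<Lambda> * indicator (\<Omega> \<times> {a<..b}) p"])
    have sp: "\<Omega> \<in> sets (P t x)" using sets.top[of "P t x"] t x by simp
    have sp2: "emeasure (P t x) \<Omega> = 1" using emeasure_space_1 t x by simp
    have [measurable]: "\<Omega> \<times> {a<..b} \<in> sets ?M" using sp by (intro pair_measureI) auto
    show "(\<lambda>p. ennreal \<Lambda> * indicator (\<Omega> \<times> {a<..b}) p) \<in> borel_measurable ?M" by measurable
    show "(\<integral>\<^sup>+p. ennreal \<Lambda> * indicator (\<Omega> \<times> {a<..b}) p \<partial>?M) < \<infinity>"
      using sp sp2 t by (simp add: nn_integral_cmult_indicator lborel.emeasure_pair_measure_Times ennreal_mult_less_top)
    show "AE p in ?M. ?f n p \<le> ennreal \<Lambda> * indicator (\<Omega> \<times> {a<..b}) p" for n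
    proof (rule AE_I2)
      fix p assume "p \<in> space ?M"
      then obtain w s where p: "p = (w, s)" "w \<in> \<Omega>" using t x by (auto simp: space_pair_measure)
      have "X (grid_left a n s) w \<in> space K"
        using path_range[OF _ p(2)] grid_left_ge[of a n s] a by simp
      then show "?f n p \<le> ennreal \<Lambda> * indicator (\<Omega> \<times> {a<..b}) p"
        using rate_le_bound[of s "X (grid_left a n s) w" A] a t p
        by (auto simp: indicator_def rate_at_def)
    qed
    show "AE p in ?M. (\<lambda>n. ?f n p) \<longlonglongrightarrow> ?f' p"
    proof (rule AE_I2)
      fix p assume "p \<in> space ?M"
      then obtain w s where p: "p = (w, s)" "w \<in> \<Omega>" using t x by (auto simp: space_pair_measure)
      show "(\<lambda>n. ?f n p) \<longlonglongrightarrow> ?f' p"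
      proof (cases "a < s \<and> s \<le> b")
        case True
        then have "\<forall>\<^sub>F n in sequentially. X (grid_left a n s) w = left_lim X s w"
          using a by (intro left_lim_seq[OF p(2)] grid_left_less grid_left_tendsto) auto
        then have "\<forall>\<^sub>F n in sequentially. ?f n p = ?f' p"
          by (rule eventually_mono) (use True in \<open>simp add: p left_path_def\<close>)
        then show ?thesis by (rule tendsto_eventually)
      qed (simp add: p)
    qed
  qed (use fm f'm in auto)
  let ?g = "\<lambda>n k (w, s :: real). indicator B w * (indicator {?c n k<..?d n k} s * rate_at (X (?c n k) w) s A)"
  let ?G = "\<lambda>n k w. indicator B w * (\<integral>\<^sup>+s. indicator {?c n k<..?d n k} s * rate_at (X (?c n k) w) s A \<partial>lborel)"
  have rm: "(\<lambda>p. rate_at (X (?c n k) (fst p)) (snd p) A) \<in> borel_measurable ?M" if k: "k \<in> ?I n" for n k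
  proof -
    have "X (?c n k) \<in> P t x \<rightarrow>\<^sub>M K"
      using cb[OF k] t x by (intro measurable_P[OF measurable_path[of "?c n k" "{t..}"]]) auto
    then show ?thesis unfolding rate_at_def
      by (intro measurable_rate_emeasure[OF _ _ _ A]) auto
  qed
  have gm: "?g n k \<in> borel_measurable ?M" if k: "k \<in> ?I n" for n k
    using rm[OF k] unfolding case_prod_beta' by measurable
  have rs[measurable]: "(\<lambda>s. rate_at y s A) \<in> borel_measurable borel" if "y \<in> space K" for y
    by (rule measurable_rate_at[OF that A])
  have gG: "(\<integral>\<^sup>+p. ?g n k p \<partial>?M) = (\<integral>\<^sup>+w. ?G n k w \<partial>P t x)" if k: "k \<in> ?I n" for n k
  proof -
    have "(\<integral>\<^sup>+p. ?g n k p \<partial>?M) = (\<integral>\<^sup>+w. \<integral>\<^sup>+s. ?g n k (w, s) \<partial>lborel \<partial>P t x)"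
      by (rule lborel.nn_integral_fst[OF gm[OF k], symmetric])
    also have "\<dots> = (\<integral>\<^sup>+w. ?G n k w \<partial>P t x)"
    proof (rule nn_integral_cong)
      fix w assume "w \<in> space (P t x)"
      then have "X (?c n k) w \<in> space K" using path_range[OF cb(1)[OF k]] t x by simp
      note [measurable] = rs[OF this]
      show "(\<integral>\<^sup>+s. ?g n k (w, s) \<partial>lborel) = ?G n k w"
        by (simp add: nn_integral_cmult)
    qed
    finally show ?thesis .
  qed
  have J: "(\<integral>\<^sup>+p. ?f n p \<partial>?M) = (\<Sum>k\<in>?I n. \<integral>\<^sup>+w. ?G n k w \<partial>P t x)" for n
  proof -
    have "?f n p = (\<Sum>k\<in>?I n. ?g n k p)" for p
    proof -
      obtain w s where p: "p = (w, s)" by (cases p)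
      have "(\<Sum>k\<in>?I n. ?g n k p) = indicator B w * (\<Sum>k\<in>?I n. indicator {?c n k<..?d n k} s * rate_at (X (?c n k) w) s A)"
        by (simp only: p split_conv sum_distrib_left)
      also have "\<dots> = ?f n p" unfolding sum_cells grid_left_cell p by simp
      finally show ?thesis ..
    qed
    then have "(\<integral>\<^sup>+p. ?f n p \<partial>?M) = (\<integral>\<^sup>+p. (\<Sum>k\<in>?I n. ?g n k p) \<partial>?M)" by (simp only:)
    also have "\<dots> = (\<Sum>k\<in>?I n. \<integral>\<^sup>+p. ?g n k p \<partial>?M)"
      by (rule nn_integral_sum) (rule gm)
    finally show ?thesis using gG by simp
  qed
  have ED: "(\<integral>\<^sup>+w. indicator B w * ?D n w \<partial>P t x)
    = (\<Sum>k\<in>?I n. \<integral>\<^sup>+w. indicator B w * ?p n k w \<partial>P t x)" for n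
  proof -
    have "(\<integral>\<^sup>+w. indicator B w * ?D n w \<partial>P t x) = (\<integral>\<^sup>+w. (\<Sum>k\<in>?I n. indicator (B \<inter> ?E n k) w) \<partial>P t x)"
      by (simp add: sum_distrib_left indicator_inter_arith)
    also have "\<dots> = (\<Sum>k\<in>?I n. \<integral>\<^sup>+w. indicator (B \<inter> ?E n k) w \<partial>P t x)"
      by (rule nn_integral_sum) (use Ev in auto)
    also have "\<dots> = (\<Sum>k\<in>?I n. \<integral>\<^sup>+w. indicator B w * ?p n k w \<partial>P t x)"
    proof (rule sum.cong[OF refl])
      fix k assume k: "k \<in> ?I n"
      have "B \<in> sets (\<F> {t..?c n k})" using B path_algebra_mono[of "{t..a}" "{t..?c n k}"] cb[OF k] by auto
      moreover have "?E n k \<in> sets (\<F> {?c n k..})"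
        using first_jump_event_sets[OF cb(1)[OF k] less_imp_le[OF cb(4)[OF k]] cb(5)[OF k] A]
          path_algebra_mono[of "{?c n k..?d n k}" "{?c n k..}"] by auto
      ultimately have "emeasure (P t x) (B \<inter> ?E n k)
          = (\<integral>\<^sup>+w. indicator B w * ?p n k w \<partial>P t x)"
        by (rule markov_future[OF t(1) cb(2)[OF k] x])
      then show "(\<integral>\<^sup>+w. indicator (B \<inter> ?E n k) w \<partial>P t x) = \<dots>"
        using Ev[OF k] by simp
    qed
    finally show ?thesis .
  qed
  have up: "(\<integral>\<^sup>+w. indicator B w * ?D n w \<partial>P t x) \<le> (\<integral>\<^sup>+p. ?f n p \<partial>?M)" for n
    unfolding ED J
  proof (intro sum_mono nn_integral_mono mult_left_mono)
    fix k w assume k: "k \<in> ?I n" and "w \<in> space (P t x)"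
    then have "X (?c n k) w \<in> space K" using path_range[OF cb(1)[OF k]] t x by simp
    then show "?p n k w
        \<le> (\<integral>\<^sup>+s. indicator {?c n k<..?d n k} s * rate_at (X (?c n k) w) s A \<partial>lborel)"
      by (rule first_jump_event_bounds(1)[OF cb(1,4,5)[OF k] _ A])
  qed simp
  have lo: "ennreal (exp (- \<Lambda> * inverse (real (Suc n)))) * (\<integral>\<^sup>+p. ?f n p \<partial>?M)
      \<le> (\<integral>\<^sup>+w. indicator B w * ?D n w \<partial>P t x)" for n
    unfolding ED J unfolding sum_distrib_left
  proof (intro sum_mono)
    fix k assume k: "k \<in> ?I n"
    let ?e = "ennreal (exp (- \<Lambda> * inverse (real (Suc n))))"
    have "(\<lambda>w. \<integral>\<^sup>+s. ?g n k (w, s) \<partial>lborel) \<in> borel_measurable (P t x)"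
      by (rule lborel.borel_measurable_nn_integral_fst[OF gm[OF k]])
    then have Gm: "?G n k \<in> borel_measurable (P t x)"
    proof (rule measurable_cong[THEN iffD1, rotated])
      fix w assume "w \<in> space (P t x)"
      then have "X (?c n k) w \<in> space K" using path_range[OF cb(1)[OF k]] t x by simp
      note [measurable] = rs[OF this]
      show "(\<integral>\<^sup>+s. ?g n k (w, s) \<partial>lborel) = ?G n k w"
        by (simp add: nn_integral_cmult)
    qed
    have "?e * (\<integral>\<^sup>+w. ?G n k w \<partial>P t x) = (\<integral>\<^sup>+w. ?e * ?G n k w \<partial>P t x)"
      by (rule nn_integral_cmult[OF Gm, symmetric])
    also have "\<dots> \<le> (\<integral>\<^sup>+w. indicator B w * ?p n k w \<partial>P t x)"
    proof (rule nn_integral_mono)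
      fix w assume "w \<in> space (P t x)"
      then have "X (?c n k) w \<in> space K" using path_range[OF cb(1)[OF k]] t x by simp
      from mult_left_mono[OF first_jump_event_bounds(2)[OF cb(1,4,5)[OF k] this A cb(6)[OF k]], of "indicator B w"]
      show "?e * ?G n k w \<le> indicator B w * ?p n k w"
        by (simp add: mult_ac)
    qed
    finally show "?e * (\<integral>\<^sup>+w. ?G n k w \<partial>P t x)
      \<le> (\<integral>\<^sup>+w. indicator B w * ?p n k w \<partial>P t x)" .
  qed
  have "(\<lambda>n. exp (- \<Lambda> * inverse (real (Suc n)))) \<longlonglongrightarrow> exp (- \<Lambda> * 0)"
    by (intro tendsto_intros LIMSEQ_inverse_real_of_nat)
  then have "(\<lambda>n. ennreal (exp (- \<Lambda> * inverse (real (Suc n))))) \<longlonglongrightarrow> 1"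
    using tendsto_ennrealI by fastforce
  from tendsto_mult_ennreal[OF this Jconv]
  have "(\<lambda>n. ennreal (exp (- \<Lambda> * inverse (real (Suc n)))) * (\<integral>\<^sup>+p. ?f n p \<partial>?M))
      \<longlonglongrightarrow> (\<integral>\<^sup>+p. ?f' p \<partial>?M)" by simp
  from tendsto_sandwich[OF always_eventually always_eventually this Jconv, OF allI allI, OF lo up]
  have "(\<lambda>n. \<integral>\<^sup>+w. indicator B w * ?D n w \<partial>P t x) \<longlonglongrightarrow> (\<integral>\<^sup>+p. ?f' p \<partial>?M)" .
  from LIMSEQ_unique[OF conv this]
  have "(\<integral>\<^sup>+w. indicator B w * ?N w \<partial>P t x) = (\<integral>\<^sup>+p. ?f' p \<partial>?M)" .
  also have "\<dots> = (\<integral>\<^sup>+w. \<integral>\<^sup>+s. ?f' (w, s) \<partial>lborel \<partial>P t x)"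
    by (rule lborel.nn_integral_fst[OF f'm, symmetric])
  also have "\<dots> = (\<integral>\<^sup>+w. indicator B w * (\<integral>\<^sup>+s. indicator {a<..b} s * rate_at (X s w) s A \<partial>lborel) \<partial>P t x)"
  proof (rule nn_integral_cong)
    fix w assume "w \<in> space (P t x)"
    then have w: "w \<in> \<Omega>" using t x by simp
    have AE: "AE s in lborel. indicator {a<..b} s * rate_at (left_path a s w) s A = indicator {a<..b} s * rate_at (X s w) s A"
      using left_lim_AE[OF w] by eventually_elim (use a t in \<open>auto simp: indicator_def left_path_def\<close>)
    show "(\<integral>\<^sup>+s. ?f' (w, s) \<partial>lborel) = indicator B w * (\<integral>\<^sup>+s. indicator {a<..b} s * rate_at (X s w) s A \<partial>lborel)"
      using nn_integral_cong_AE[OF AE] by (cases "w \<in> B") simp_all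
  qed
  finally show ?thesis .
qed

end

text \<open>A functional of this kind is integration with respect to a measure; working with the functional
  avoids constructing the measure.\<close>

definition nn_functional :: "'a measure \<Rightarrow> (('a \<Rightarrow> ennreal) \<Rightarrow> ennreal) \<Rightarrow> bool" where
  "nn_functional N I \<longleftrightarrow>
     (\<forall>f g. (\<forall>x\<in>space N. f x = g x) \<longrightarrow> I f = I g) \<and>
     (\<forall>f\<in>borel_measurable N. \<forall>g\<in>borel_measurable N. I (\<lambda>x. f x + g x) = I f + I g) \<and>
     (\<forall>f\<in>borel_measurable N. \<forall>c. I (\<lambda>x. c * f x) = c * I f) \<and>
     (\<forall>F. (\<forall>i::nat. F i \<in> borel_measurable N) \<longrightarrow> incseq F \<longrightarrow> I (\<lambda>x. SUP i. F i x) = (SUP i. I (F i)))"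

lemma nn_functional_cong: "nn_functional N I \<Longrightarrow> (\<And>x. x \<in> space N \<Longrightarrow> f x = g x) \<Longrightarrow> I f = I g"
  unfolding nn_functional_def by blast

lemma nn_functional_add:
  "nn_functional N I \<Longrightarrow> f \<in> borel_measurable N \<Longrightarrow> g \<in> borel_measurable N \<Longrightarrow> I (\<lambda>x. f x + g x) = I f + I g"
  unfolding nn_functional_def by blast

lemma nn_functional_cmult:
  "nn_functional N I \<Longrightarrow> f \<in> borel_measurable N \<Longrightarrow> I (\<lambda>x. c * f x) = c * I f"
  unfolding nn_functional_def by blast

lemma nn_functional_SUP:
  "nn_functional N I \<Longrightarrow> (\<And>i::nat. F i \<in> borel_measurable N) \<Longrightarrow> incseq F \<Longrightarrow> I (\<lambda>x. SUP i. F i x) = (SUP i. I (F i))"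
  unfolding nn_functional_def by blast

lemma nn_functional_zero: "nn_functional N I \<Longrightarrow> I (\<lambda>_. 0) = 0"
  using nn_functional_cmult[of N I "\<lambda>_. 0" 0] by simp

lemma nn_functional_sum:
  assumes I: "nn_functional N I" and "\<And>i. F i \<in> borel_measurable N" and "finite S"
  shows "I (\<lambda>x. \<Sum>i\<in>S. F i x) = (\<Sum>i\<in>S. I (F i))"
  using assms(3)
proof (induct S rule: finite_induct)
  case empty then show ?case using nn_functional_zero[OF I] by simp
next
  case (insert i S)
  then show ?case using nn_functional_add[OF I assms(2)[of i], of "\<lambda>x. \<Sum>i\<in>S. F i x"] assms(2) by simp
qed

text \<open>Agreement spreads from the generator to all measurable sets by the \<pi>-\<lambda>
  argument, and from indicators to functions by additivity and monotone limits. Finiteness on the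
  whole space is what allows subtraction for complements.\<close>

lemma nn_functional_eqI:
  assumes I: "nn_functional N I1" "nn_functional N I2"
    and G: "Int_stable G" "G \<subseteq> Pow (space N)" "sets N = sigma_sets (space N) G"
    and eq: "\<And>A. A \<in> G \<Longrightarrow> I1 (indicator A) = I2 (indicator A)"
    and sp: "I1 (indicator (space N)) = I2 (indicator (space N))" "I2 (indicator (space N)) \<noteq> \<infinity>"
    and f: "f \<in> borel_measurable N"
  shows "I1 f = I2 f"
proof -
  have sets: "I1 (indicator A) = I2 (indicator A)" if "A \<in> sets N" for A
    using G(1,2) that[unfolded G(3)]
  proof (induct rule: sigma_sets_induct_disjoint)
    case (basic A) then show ?case by (rule eq)
  next
    case empty
    have "indicator {} = (\<lambda>_. 0 :: ennreal)" by (auto simp: fun_eq_iff)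
    then show ?case using nn_functional_zero[OF I(1)] nn_functional_zero[OF I(2)] by simp
  next
    case (compl A)
    then have A: "A \<in> sets N" using G(3) by simp
    have split: "I (indicator (space N)) = I (indicator A) + I (indicator (space N - A))" if "nn_functional N I" for I
    proof -
      have "I (indicator (space N)) = I (\<lambda>x. indicator A x + indicator (space N - A) x)"
        by (rule nn_functional_cong[OF that]) (auto simp: indicator_def)
      then show ?thesis using nn_functional_add[OF that, of "indicator A" "indicator (space N - A)"] A by simp
    qed
    have "I2 (indicator A) \<noteq> \<infinity>" using split[OF I(2)] sp(2) by auto
    then show ?case using split[OF I(1)] split[OF I(2)] sp(1) compl by simp
  next
    case (union A)
    then have A: "A i \<in> sets N" for i using G(3) by auto
    let ?F = "\<lambda>n x. \<Sum>i<n. indicator (A i) x :: ennreal"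
    have ind: "indicator (\<Union>i. A i) = (\<lambda>x. SUP n. ?F n x)"
    proof
      fix x
      show "indicator (\<Union>i. A i) x = (SUP n. ?F n x)"
        using suminf_indicator[OF union(1), of x] by (simp add: suminf_eq_SUP)
    qed
    have val: "I (indicator (\<Union>i. A i)) = (SUP n. \<Sum>i<n. I (indicator (A i)))" if N: "nn_functional N I" for I
    proof -
      have "I (\<lambda>x. SUP n. ?F n x) = (SUP n. I (?F n))"
        by (rule nn_functional_SUP[OF N])
          (use A in \<open>auto intro!: incseq_SucI le_funI\<close>)
      moreover have "I (?F n) = (\<Sum>i<n. I (indicator (A i)))" for n
        by (rule nn_functional_sum[OF N]) (use A in auto)
      ultimately show ?thesis using ind by simp
    qed
    show ?case using val[OF I(1)] val[OF I(2)] union(3) by simp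
  qed
  show ?thesis using f
  proof (induct f rule: borel_measurable_induct)
    case (cong f g)
    then show ?case using nn_functional_cong[OF I(1), of f g] nn_functional_cong[OF I(2), of f g] by simp
  next
    case (set A) then show ?case by (rule sets)
  next
    case (mult u c) then show ?case using nn_functional_cmult[OF I(1)] nn_functional_cmult[OF I(2)] by simp
  next
    case (add u v) then show ?case using nn_functional_add[OF I(1)] nn_functional_add[OF I(2)] by simp
  next
    case (seq U)
    then have "Sup (range U) = (\<lambda>x. SUP i. U i x)" by (auto simp: fun_eq_iff image_comp)
    then show ?case using nn_functional_SUP[OF I(1), of U] nn_functional_SUP[OF I(2), of U] seq by simp
  qed
qed

text \<open>With a fixed set in the second coordinate the functional lives on the first factor
  alone, so uniqueness on the product can be settled one factor at a time.\<close>

lemma nn_functional_section: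
  assumes I: "nn_functional (N \<Otimes>\<^sub>M L) I" and A: "A \<in> sets L"
  shows "nn_functional N (\<lambda>f. I (\<lambda>(p, y). f p * indicator A y))"
  unfolding nn_functional_def
proof (intro conjI allI impI ballI)
  have m: "(\<lambda>(p, y). f p * indicator A y) \<in> borel_measurable (N \<Otimes>\<^sub>M L)"
    if "f \<in> borel_measurable N" for f :: "'a \<Rightarrow> ennreal"
    using that A by measurable
  show "I (\<lambda>(p, y). f p * indicator A y) = I (\<lambda>(p, y). g p * indicator A y)"
    if "\<forall>p\<in>space N. f p = g p" for f g
    by (rule nn_functional_cong[OF I]) (use that in \<open>auto simp: space_pair_measure\<close>)
  show "I (\<lambda>(p, y). (f p + g p) * indicator A y) = I (\<lambda>(p, y). f p * indicator A y) + I (\<lambda>(p, y). g p * indicator A y)"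
    if "f \<in> borel_measurable N" "g \<in> borel_measurable N" for f g
    using nn_functional_add[OF I m[OF that(1)] m[OF that(2)]] by (simp add: case_prod_beta' distrib_right)
  show "I (\<lambda>(p, y). (c * f p) * indicator A y) = c * I (\<lambda>(p, y). f p * indicator A y)"
    if "f \<in> borel_measurable N" for f c
    using nn_functional_cmult[OF I m[OF that], of c] by (simp add: case_prod_beta' mult.assoc)
  fix F :: "nat \<Rightarrow> 'a \<Rightarrow> ennreal" assume F: "\<forall>i. F i \<in> borel_measurable N" "incseq F"
  have "I (\<lambda>x. SUP i. (case x of (p, y) \<Rightarrow> F i p * indicator A y)) = (SUP i. I (\<lambda>(p, y). F i p * indicator A y))"
  proof (rule nn_functional_SUP[OF I])
    show "(\<lambda>(p, y). F i p * indicator A y) \<in> borel_measurable (N \<Otimes>\<^sub>M L)" for i using m F by auto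
    show "incseq (\<lambda>i (p, y). F i p * indicator A y)"
      using F(2) by (auto simp: incseq_def le_fun_def intro!: mult_right_mono)
  qed
  then show "I (\<lambda>(p, y). (SUP i. F i p) * indicator A y) = (SUP i. I (\<lambda>(p, y). F i p * indicator A y))"
    by (simp add: case_prod_beta' SUP_mult_right_ennreal)
qed

context markov_jump_process
begin

section \<open>Paths and time together: the compensator formula\<close>

definition time_measure :: "real \<Rightarrow> real measure" where
  "time_measure t = restrict_space lborel {t<..T}"

definition PT :: "real \<Rightarrow> 'k \<Rightarrow> ('w \<times> real) measure" where
  "PT t x = P t x \<Otimes>\<^sub>M time_measure t"

text \<open>The current state stands in place of the left limit: it is jointly measurable, and on
  each path the two differ only at finitely many times up to \<open>T\<close>.\<close>

abbreviation rate :: "'w \<times> real \<Rightarrow> 'k measure" where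
  "rate p \<equiv> \<nu> (snd p) (X (snd p) (fst p))"

lemma space_time_measure [simp]: "space (time_measure t) = {t<..T}"
  by (simp add: time_measure_def space_restrict_space)

lemma finite_time_measure: "finite_measure (time_measure t)"

  by (rule finite_measureI, cases "t \<le> T") (simp_all add: time_measure_def space_restrict_space emeasure_restrict_space)

lemma space_PT [simp]: "0 \<le> t \<Longrightarrow> x \<in> space K \<Longrightarrow> space (PT t x) = \<Omega> \<times> {t<..T}"
  by (simp add: PT_def space_pair_measure)

lemma measurable_time_measure: "f \<in> borel_measurable borel \<Longrightarrow> f \<in> borel_measurable (time_measure t)"
  unfolding time_measure_def by (intro measurable_restrict_space1) simp

lemma nn_integral_time_measure: "(\<integral>\<^sup>+s. f s \<partial>time_measure t) = (\<integral>\<^sup>+s\<in>{t<..T}. f s \<partial>lborel)"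
  unfolding time_measure_def by (rule nn_integral_restrict_space) simp

lemma AE_time_measure: "(AE s in time_measure t. Q s) \<longleftrightarrow> (AE s in lborel. t < s \<longrightarrow> s \<le> T \<longrightarrow> Q s)"
  unfolding time_measure_def by (subst AE_restrict_space_iff) auto

lemma AE_time_measure_closed: "(AE s in time_measure t. Q s) \<longleftrightarrow> (AE s in lborel. s \<in> {t..T} \<longrightarrow> Q s)"
proof
  assume "AE s in time_measure t. Q s"
  then have "AE s in lborel. t < s \<longrightarrow> s \<le> T \<longrightarrow> Q s" by (simp add: AE_time_measure)
  then show "AE s in lborel. s \<in> {t..T} \<longrightarrow> Q s"
    using AE_lborel_singleton[of t] by eventually_elim auto
next
  assume "AE s in lborel. s \<in> {t..T} \<longrightarrow> Q s"
  then have "AE s in lborel. t < s \<longrightarrow> s \<le> T \<longrightarrow> Q s" by eventually_elim auto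
  then show "AE s in time_measure t. Q s" by (simp add: AE_time_measure)
qed

lemma PT_to_path_algebra:
  assumes "0 \<le> t" "x \<in> space K" "d \<le> T"
  shows "(\<lambda>p. p) \<in> PT t x \<rightarrow>\<^sub>M \<F> {t..d} \<Otimes>\<^sub>M borel"
proof -
  have [measurable]: "(\<lambda>w. w) \<in> P t x \<rightarrow>\<^sub>M \<F> {t..d}"
    by (rule measurable_P[of _ "{t..d}"]) (use assms in auto)
  have [measurable]: "(\<lambda>s. s) \<in> time_measure t \<rightarrow>\<^sub>M borel" by (rule measurable_time_measure) simp
  have "(\<lambda>p. (fst p, snd p)) \<in> PT t x \<rightarrow>\<^sub>M \<F> {t..d} \<Otimes>\<^sub>M borel" unfolding PT_def by measurable
  then show ?thesis by simp
qed

lemma PT_to_predictable: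
  assumes "0 \<le> t" "t \<le> T" "x \<in> space K"
  shows "(\<lambda>p. p) \<in> PT t x \<rightarrow>\<^sub>M Pred t"
  using measurable_compose[OF PT_to_path_algebra[OF assms(1,3) order_refl] measurable_clamp_predictable[OF assms(2) order_refl]]
  by (rule measurable_cong[THEN iffD1, rotated]) (use assms in auto)

lemma PT_to_progressive:
  assumes "0 \<le> t" "t \<le> T" "x \<in> space K"
  shows "(\<lambda>p. p) \<in> PT t x \<rightarrow>\<^sub>M Prog t"
  using measurable_compose[OF PT_to_path_algebra[OF assms(1,3) order_refl] measurable_clamp_progressive[OF assms(2) order_refl]]
  by (rule measurable_cong[THEN iffD1, rotated]) (use assms in auto)

lemma PT_path:
  assumes "0 \<le> t" "t \<le> T" "x \<in> space K"
  shows "(\<lambda>p. X (snd p) (fst p)) \<in> PT t x \<rightarrow>\<^sub>M K"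
  using measurable_compose[OF PT_to_path_algebra[OF assms(1,3) order_refl] measurable_joint_path[OF assms(1,2)]]
  by (rule measurable_cong[THEN iffD1, rotated]) (use assms in auto)

lemma PT_snd: "0 \<le> t \<Longrightarrow> x \<in> space K \<Longrightarrow> snd \<in> borel_measurable (PT t x)"
  using measurable_compose[OF PT_to_path_algebra[of t x T] measurable_snd] by simp

lemma PT_fst: "fst \<in> PT t x \<rightarrow>\<^sub>M P t x"
  unfolding PT_def by simp

lemma PT_pair_predictable:
  assumes "0 \<le> t" "t \<le> T" "x \<in> space K"
  shows "(\<lambda>p. p) \<in> PT t x \<Otimes>\<^sub>M K \<rightarrow>\<^sub>M Pred t \<Otimes>\<^sub>M K"
proof -
  note [measurable] = PT_to_predictable[OF assms]
  have "(\<lambda>p. (fst p, snd p)) \<in> PT t x \<Otimes>\<^sub>M K \<rightarrow>\<^sub>M Pred t \<Otimes>\<^sub>M K" by measurable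
  then show ?thesis by simp
qed

lemma PT_nn_integral_rate:
  assumes "0 \<le> t" "t \<le> T" "x \<in> space K" and H: "H \<in> borel_measurable (PT t x \<Otimes>\<^sub>M K)"
  shows "(\<lambda>p. \<integral>\<^sup>+y. H (p, y) \<partial>rate p) \<in> borel_measurable (PT t x)"
  by (rule measurable_nn_integral_rate[OF PT_snd PT_path]) (use assms in auto)

lemma PT_integral_rate:
  assumes "0 \<le> t" "t \<le> T" "x \<in> space K" and H: "(H :: _ \<Rightarrow> real) \<in> borel_measurable (PT t x \<Otimes>\<^sub>M K)"
  shows "(\<lambda>p. LINT y|rate p. H (p, y)) \<in> borel_measurable (PT t x)"
  by (rule measurable_integral_rate[OF PT_snd PT_path]) (use assms in auto)

lemma PT_measurable: "f \<in> borel_measurable (Pred t \<Otimes>\<^sub>M K) \<Longrightarrow> 0 \<le> t \<Longrightarrow> t \<le> T \<Longrightarrow> x \<in> space K \<Longrightarrow> f \<in> borel_measurable (PT t x \<Otimes>\<^sub>M K)"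
  by (drule measurable_compose[OF PT_pair_predictable]) assumption+

lemma nn_integral_PT:
  assumes "f \<in> borel_measurable (PT t x)"
  shows "(\<integral>\<^sup>+p. f p \<partial>PT t x) = (\<integral>\<^sup>+w. (\<integral>\<^sup>+s\<in>{t<..T}. f (w, s) \<partial>lborel) \<partial>P t x)"
proof -
  interpret finite_measure "time_measure t" by (rule finite_time_measure)
  show ?thesis using nn_integral_fst[of f "P t x"] assms by (simp add: PT_def nn_integral_time_measure)
qed

lemma rate_measurable_sets:
  "f \<in> borel_measurable K \<Longrightarrow> 0 \<le> s \<Longrightarrow> z \<in> space K \<Longrightarrow> f \<in> borel_measurable (\<nu> s z)"
  using measurable_cong_sets[OF rate_sets refl] by blast

lemma PT_section_measurable:
  assumes "H \<in> borel_measurable (PT t x \<Otimes>\<^sub>M K)" "p \<in> space (PT t x)" "0 \<le> t" "x \<in> space K"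
  shows "(\<lambda>y. H (p, y)) \<in> borel_measurable (rate p)"
  using assms path_range measurable_Pair2[OF assms(1,2)]
  by (intro rate_measurable_sets) auto

text \<open>Writing the sum over jumps as an integral with respect to counting measure makes
  monotone convergence available path by path.\<close>

lemma nn_functional_jumps:
  assumes t: "0 \<le> t" "t \<le> T" and x: "x \<in> space K"
  shows "nn_functional (Pred t \<Otimes>\<^sub>M K) (\<lambda>H. \<integral>\<^sup>+w. (\<integral>\<^sup>+\<tau>. H ((w, \<tau>), X \<tau> w) \<partial>count_space (jumps w \<inter> {t<..T})) \<partial>P t x)"
proof -
  have m: "(\<lambda>w. \<integral>\<^sup>+\<tau>. H ((w, \<tau>), X \<tau> w) \<partial>count_space (jumps w \<inter> {t<..T})) \<in> borel_measurable (P t x)"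
    if "H \<in> borel_measurable (Pred t \<Otimes>\<^sub>M K)" for H
  proof -
    have "(\<lambda>w. \<Sum>\<tau>\<in>jumps w \<inter> {t<..T}. H ((w, \<tau>), X \<tau> w)) \<in> borel_measurable (P t x)"
      by (rule measurable_P[OF measurable_jump_sum[OF t(1,2) order_refl that]]) (use t x in auto)
    then show ?thesis
      by (rule measurable_cong[THEN iffD1, rotated]) (use t x in \<open>simp add: nn_integral_count_space_finite\<close>)
  qed
  show ?thesis unfolding nn_functional_def
  proof (intro conjI allI impI ballI)
    fix f g :: "('w \<times> real) \<times> 'k \<Rightarrow> ennreal" assume "\<forall>p\<in>space (Pred t \<Otimes>\<^sub>M K). f p = g p"
    then show "(\<integral>\<^sup>+w. (\<integral>\<^sup>+\<tau>. f ((w, \<tau>), X \<tau> w) \<partial>count_space (jumps w \<inter> {t<..T})) \<partial>P t x)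
      = (\<integral>\<^sup>+w. (\<integral>\<^sup>+\<tau>. g ((w, \<tau>), X \<tau> w) \<partial>count_space (jumps w \<inter> {t<..T})) \<partial>P t x)"
      using t x path_range by (intro nn_integral_cong) (auto simp: space_pair_measure)
  next
    fix f g :: "('w \<times> real) \<times> 'k \<Rightarrow> ennreal" assume "f \<in> borel_measurable (Pred t \<Otimes>\<^sub>M K)" "g \<in> borel_measurable (Pred t \<Otimes>\<^sub>M K)"
    then show "(\<integral>\<^sup>+w. (\<integral>\<^sup>+\<tau>. f ((w, \<tau>), X \<tau> w) + g ((w, \<tau>), X \<tau> w) \<partial>count_space (jumps w \<inter> {t<..T})) \<partial>P t x)
      = (\<integral>\<^sup>+w. (\<integral>\<^sup>+\<tau>. f ((w, \<tau>), X \<tau> w) \<partial>count_space (jumps w \<inter> {t<..T})) \<partial>P t x)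
      + (\<integral>\<^sup>+w. (\<integral>\<^sup>+\<tau>. g ((w, \<tau>), X \<tau> w) \<partial>count_space (jumps w \<inter> {t<..T})) \<partial>P t x)"
      by (simp add: nn_integral_add m)
  next
    fix f :: "('w \<times> real) \<times> 'k \<Rightarrow> ennreal" and c assume "f \<in> borel_measurable (Pred t \<Otimes>\<^sub>M K)"
    then show "(\<integral>\<^sup>+w. (\<integral>\<^sup>+\<tau>. c * f ((w, \<tau>), X \<tau> w) \<partial>count_space (jumps w \<inter> {t<..T})) \<partial>P t x)
      = c * (\<integral>\<^sup>+w. (\<integral>\<^sup>+\<tau>. f ((w, \<tau>), X \<tau> w) \<partial>count_space (jumps w \<inter> {t<..T})) \<partial>P t x)"
      by (simp add: nn_integral_cmult m)
  next
    fix F :: "nat \<Rightarrow> ('w \<times> real) \<times> 'k \<Rightarrow> ennreal" assume F: "\<forall>i. F i \<in> borel_measurable (Pred t \<Otimes>\<^sub>M K)" "incseq F"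
    have "(\<integral>\<^sup>+w. (\<integral>\<^sup>+\<tau>. (SUP i. F i ((w, \<tau>), X \<tau> w)) \<partial>count_space (jumps w \<inter> {t<..T})) \<partial>P t x)
      = (\<integral>\<^sup>+w. (SUP i. \<integral>\<^sup>+\<tau>. F i ((w, \<tau>), X \<tau> w) \<partial>count_space (jumps w \<inter> {t<..T})) \<partial>P t x)"
      using F(2) by (intro nn_integral_cong nn_integral_monotone_convergence_SUP) (auto simp: incseq_def le_fun_def)
    also have "\<dots> = (SUP i. \<integral>\<^sup>+w. (\<integral>\<^sup>+\<tau>. F i ((w, \<tau>), X \<tau> w) \<partial>count_space (jumps w \<inter> {t<..T})) \<partial>P t x)"
      using F m by (intro nn_integral_monotone_convergence_SUP) (auto simp: incseq_def le_fun_def intro!: nn_integral_mono)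
    finally show "(\<integral>\<^sup>+w. (\<integral>\<^sup>+\<tau>. (SUP i. F i ((w, \<tau>), X \<tau> w)) \<partial>count_space (jumps w \<inter> {t<..T})) \<partial>P t x)
      = (SUP i. \<integral>\<^sup>+w. (\<integral>\<^sup>+\<tau>. F i ((w, \<tau>), X \<tau> w) \<partial>count_space (jumps w \<inter> {t<..T})) \<partial>P t x)" .
  qed
qed

lemma nn_functional_rate:
  assumes t: "0 \<le> t" "t \<le> T" and x: "x \<in> space K"
  shows "nn_functional (Pred t \<Otimes>\<^sub>M K) (\<lambda>H. \<integral>\<^sup>+p. (\<integral>\<^sup>+y. H (p, y) \<partial>rate p) \<partial>PT t x)"
proof -
  have m: "(\<lambda>p. \<integral>\<^sup>+y. H (p, y) \<partial>rate p) \<in> borel_measurable (PT t x)"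
    if "H \<in> borel_measurable (Pred t \<Otimes>\<^sub>M K)" for H
    by (intro PT_nn_integral_rate PT_measurable that t x)
  have s: "(\<lambda>y. H (p, y)) \<in> borel_measurable (rate p)"
    if "H \<in> borel_measurable (Pred t \<Otimes>\<^sub>M K)" "p \<in> space (PT t x)" for H p
    by (intro PT_section_measurable[of H t x] PT_measurable that t x)
  show ?thesis unfolding nn_functional_def
  proof (intro conjI allI impI ballI)
    fix f g :: "('w \<times> real) \<times> 'k \<Rightarrow> ennreal" assume "\<forall>p\<in>space (Pred t \<Otimes>\<^sub>M K). f p = g p"
    then show "(\<integral>\<^sup>+p. (\<integral>\<^sup>+y. f (p, y) \<partial>rate p) \<partial>PT t x)
      = (\<integral>\<^sup>+p. (\<integral>\<^sup>+y. g (p, y) \<partial>rate p) \<partial>PT t x)"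
      using t x path_range by (intro nn_integral_cong) (auto simp: space_pair_measure space_rate)
  next
    fix f g :: "('w \<times> real) \<times> 'k \<Rightarrow> ennreal" assume f: "f \<in> borel_measurable (Pred t \<Otimes>\<^sub>M K)" "g \<in> borel_measurable (Pred t \<Otimes>\<^sub>M K)"
    have "(\<integral>\<^sup>+p. (\<integral>\<^sup>+y. f (p, y) + g (p, y) \<partial>rate p) \<partial>PT t x)
      = (\<integral>\<^sup>+p. (\<integral>\<^sup>+y. f (p, y) \<partial>rate p) + (\<integral>\<^sup>+y. g (p, y) \<partial>rate p) \<partial>PT t x)"
      by (intro nn_integral_cong nn_integral_add s f)
    then show "(\<integral>\<^sup>+p. (\<integral>\<^sup>+y. f (p, y) + g (p, y) \<partial>rate p) \<partial>PT t x)
      = (\<integral>\<^sup>+p. (\<integral>\<^sup>+y. f (p, y) \<partial>rate p) \<partial>PT t x)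
      + (\<integral>\<^sup>+p. (\<integral>\<^sup>+y. g (p, y) \<partial>rate p) \<partial>PT t x)"
      by (simp add: nn_integral_add m f)
  next
    fix f :: "('w \<times> real) \<times> 'k \<Rightarrow> ennreal" and c assume f: "f \<in> borel_measurable (Pred t \<Otimes>\<^sub>M K)"
    have "(\<integral>\<^sup>+p. (\<integral>\<^sup>+y. c * f (p, y) \<partial>rate p) \<partial>PT t x)
      = (\<integral>\<^sup>+p. c * (\<integral>\<^sup>+y. f (p, y) \<partial>rate p) \<partial>PT t x)"
      by (intro nn_integral_cong nn_integral_cmult s f)
    then show "(\<integral>\<^sup>+p. (\<integral>\<^sup>+y. c * f (p, y) \<partial>rate p) \<partial>PT t x)
      = c * (\<integral>\<^sup>+p. (\<integral>\<^sup>+y. f (p, y) \<partial>rate p) \<partial>PT t x)"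
      by (simp add: nn_integral_cmult m f)
  next
    fix F :: "nat \<Rightarrow> ('w \<times> real) \<times> 'k \<Rightarrow> ennreal" assume F: "\<forall>i. F i \<in> borel_measurable (Pred t \<Otimes>\<^sub>M K)" "incseq F"
    have "(\<integral>\<^sup>+p. (\<integral>\<^sup>+y. (SUP i. F i (p, y)) \<partial>rate p) \<partial>PT t x)
      = (\<integral>\<^sup>+p. (SUP i. \<integral>\<^sup>+y. F i (p, y) \<partial>rate p) \<partial>PT t x)"
    proof (intro nn_integral_cong nn_integral_monotone_convergence_SUP)
      fix p i assume "p \<in> space (PT t x)"
      then show "(\<lambda>y. F i (p, y)) \<in> borel_measurable (rate p)"
        using s[of "F i" p] F by simp
    next
      show "incseq (\<lambda>i y. F i (p, y))" for p using F(2) unfolding incseq_def le_fun_def by blast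
    qed
    also have "\<dots> = (SUP i. \<integral>\<^sup>+p. (\<integral>\<^sup>+y. F i (p, y) \<partial>rate p) \<partial>PT t x)"
      using F m by (intro nn_integral_monotone_convergence_SUP) (auto simp: incseq_def le_fun_def intro!: nn_integral_mono)
    finally show "(\<integral>\<^sup>+p. (\<integral>\<^sup>+y. (SUP i. F i (p, y)) \<partial>rate p) \<partial>PT t x)
      = (SUP i. \<integral>\<^sup>+p. (\<integral>\<^sup>+y. F i (p, y) \<partial>rate p) \<partial>PT t x)" .
  qed
qed

lemma predictable_Int_stable:
  "Int_stable ({B \<times> {t} |B. B \<in> sets (\<F> {t..t})}
      \<union> {B \<times> {a<..b} |B a b. t \<le> a \<and> a < b \<and> b \<le> T \<and> B \<in> sets (\<F> {t..a})})" (is "Int_stable (?G1 \<union> ?G2)")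
proof -
  have empty: "{} \<in> ?G1" by blast
  have 12: "U \<inter> V \<in> ?G1 \<union> ?G2" if UV: "U \<in> ?G1" "V \<in> ?G2" for U V
  proof -
    have "U \<inter> V = {}" using UV by fastforce
    then show ?thesis using empty by simp
  qed
  have 11: "U \<inter> V \<in> ?G1 \<union> ?G2" if UV: "U \<in> ?G1" "V \<in> ?G1" for U V
  proof -
    obtain B B' where "U = B \<times> {t}" "V = B' \<times> {t}" "B \<in> sets (\<F> {t..t})" "B' \<in> sets (\<F> {t..t})" using UV by blast
    then have "U \<inter> V = (B \<inter> B') \<times> {t}" "B \<inter> B' \<in> sets (\<F> {t..t})" by auto
    then show ?thesis by blast
  qed
  have 22: "U \<inter> V \<in> ?G1 \<union> ?G2" if UV: "U \<in> ?G2" "V \<in> ?G2" for U V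
  proof -
    obtain B a b B' a' b' where *: "U = B \<times> {a<..b}" "V = B' \<times> {a'<..b'}" "t \<le> a" "b \<le> T" "t \<le> a'"
      "B \<in> sets (\<F> {t..a})" "B' \<in> sets (\<F> {t..a'})" using UV by blast
    have UV': "U \<inter> V = (B \<inter> B') \<times> {max a a'<..min b b'}" using * by auto
    show ?thesis
    proof (cases "max a a' < min b b'")
      case True
      have "B \<inter> B' \<in> sets (\<F> {t..max a a'})"
        using * path_algebra_mono[of "{t..a}" "{t..max a a'}"] path_algebra_mono[of "{t..a'}" "{t..max a a'}"] by auto
      then have "t \<le> max a a' \<and> max a a' < min b b' \<and> min b b' \<le> T \<and> B \<inter> B' \<in> sets (\<F> {t..max a a'})"
        using True * by auto
      then show ?thesis unfolding UV' by blast
    next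
      case False
      then have "U \<inter> V = {}" unfolding UV' by simp
      then show ?thesis using empty by simp
    qed
  qed
  show ?thesis
  proof (rule Int_stableI)
    fix U V assume "U \<in> ?G1 \<union> ?G2" "V \<in> ?G1 \<union> ?G2"
    then consider "U \<in> ?G1" "V \<in> ?G1" | "U \<in> ?G1" "V \<in> ?G2" | "U \<in> ?G2" "V \<in> ?G1" | "U \<in> ?G2" "V \<in> ?G2"
      unfolding Un_iff by argo
    then show "U \<inter> V \<in> ?G1 \<union> ?G2"
    proof cases
      case 1 then show ?thesis by (rule 11)
    next
      case 2 then show ?thesis by (rule 12)
    next
      case 3
      from 12[OF 3(2,1)] show ?thesis by (simp only: Int_commute)
    next
      case 4 then show ?thesis by (rule 22)
    qed
  qed
qed

lemma emeasure_time_measure: "t \<le> T \<Longrightarrow> emeasure (time_measure t) {t<..T} = ennreal (T - t)"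
  by (simp add: time_measure_def emeasure_restrict_space)

text \<open>Uniqueness of functionals is used twice: first to pass from the rectangles of
  \<open>compensator_rectangle\<close> to arbitrary predictable sets with a fixed set of states,
  then from such products to all integrands.\<close>

theorem compensator:
  assumes t: "0 \<le> t" "t \<le> T" and x: "x \<in> space K" and H: "H \<in> borel_measurable (Pred t \<Otimes>\<^sub>M K)"
  shows "(\<integral>\<^sup>+w. (\<Sum>\<tau>\<in>jumps w \<inter> {t<..T}. H ((w, \<tau>), X \<tau> w)) \<partial>P t x)
    = (\<integral>\<^sup>+p. (\<integral>\<^sup>+y. H (p, y) \<partial>rate p) \<partial>PT t x)"
proof -
  interpret prob_space "P t x" using prob t x by simp
  let ?I1 = "\<lambda>H. \<integral>\<^sup>+w. (\<integral>\<^sup>+\<tau>. H ((w, \<tau>), X \<tau> w) \<partial>count_space (jumps w \<inter> {t<..T})) \<partial>P t x"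
  let ?I2 = "\<lambda>H. \<integral>\<^sup>+p. (\<integral>\<^sup>+y. H (p, y) \<partial>rate p) \<partial>PT t x"
  let ?G = "{B \<times> {t} |B. B \<in> sets (\<F> {t..t})}
      \<union> {B \<times> {a<..b} |B a b. t \<le> a \<and> a < b \<and> b \<le> T \<and> B \<in> sets (\<F> {t..a})}"
  note F = nn_functional_jumps[OF t x] nn_functional_rate[OF t x]
  have rect: "?I1 (\<lambda>(p, y). indicator S p * indicator A y) = ?I2 (\<lambda>(p, y). indicator S p * indicator A y)"
    if S: "S \<in> ?G" and A: "A \<in> sets K" for S A
  proof -
    consider (start) B where "S = B \<times> {t}" | (Ioc) B a b where "S = B \<times> {a<..b}" "t \<le> a" "a < b" "b \<le> T" "B \<in> sets (\<F> {t..a})"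
      using S by blast
    then show ?thesis
    proof cases
      \<comment> \<open>The slice at time \<open>t\<close> is invisible on both sides, because jumps
        and times are taken in (t, T].\<close>
      case start
      have "?I1 (\<lambda>(p, y). indicator S p * indicator A y) = (\<integral>\<^sup>+w. (\<integral>\<^sup>+\<tau>. 0 \<partial>count_space (jumps w \<inter> {t<..T})) \<partial>P t x)"
        unfolding start by (intro nn_integral_cong) (auto simp: indicator_def)
      moreover have "?I2 (\<lambda>(p, y). indicator S p * indicator A y) = (\<integral>\<^sup>+p. (\<integral>\<^sup>+y. 0 \<partial>rate p) \<partial>PT t x)"
        unfolding start using t x by (intro nn_integral_cong) (auto simp: indicator_def)
      ultimately show ?thesis by simp
    next
      case Ioc
      have "?I1 (\<lambda>(p, y). indicator S p * indicator A y)
         = (\<integral>\<^sup>+w. indicator B w * (\<Sum>\<tau>\<in>jumps w \<inter> {a<..b}. indicator A (X \<tau> w)) \<partial>P t x)"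
      proof (rule nn_integral_cong)
        fix w assume "w \<in> space (P t x)"
        then have w: "w \<in> \<Omega>" using t x by simp
        have "(\<integral>\<^sup>+\<tau>. (case ((w, \<tau>), X \<tau> w) of (p, y) \<Rightarrow> indicator S p * indicator A y) \<partial>count_space (jumps w \<inter> {t<..T}))
          = (\<Sum>\<tau>\<in>jumps w \<inter> {t<..T}. indicator S (w, \<tau>) * indicator A (X \<tau> w))"
          using w by (simp add: nn_integral_count_space_finite)
        also have "\<dots> = (\<Sum>\<tau>\<in>jumps w \<inter> {a<..b}. indicator B w * indicator A (X \<tau> w))"
          using w Ioc by (intro sum.mono_neutral_cong_right) (auto simp: indicator_def)
        finally show "(\<integral>\<^sup>+\<tau>. (case ((w, \<tau>), X \<tau> w) of (p, y) \<Rightarrow> indicator S p * indicator A y) \<partial>count_space (jumps w \<inter> {t<..T}))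
          = indicator B w * (\<Sum>\<tau>\<in>jumps w \<inter> {a<..b}. indicator A (X \<tau> w))"
          by (simp add: sum_distrib_left)
      qed
      also have "\<dots> = (\<integral>\<^sup>+w. indicator B w * (\<integral>\<^sup>+s. indicator {a<..b} s * rate_at (X s w) s A \<partial>lborel) \<partial>P t x)"
        by (rule compensator_rectangle[OF t(1) Ioc(2-4) x Ioc(5) A])
      also have "\<dots> = ?I2 (\<lambda>(p, y). indicator S p * indicator A y)"
      proof -
        have S': "S \<in> sets (Pred t)" using S unfolding sets_predictable[OF t(2)] by (rule sigma_sets.Basic)
        have m: "(\<lambda>p. \<integral>\<^sup>+y. indicator S p * indicator A y \<partial>rate p) \<in> borel_measurable (PT t x)"
        proof -
          have "(\<lambda>(p, y). indicator S p * indicator A y :: ennreal) \<in> borel_measurable (Pred t \<Otimes>\<^sub>M K)"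
            using S' A by measurable
          from PT_nn_integral_rate[OF t x PT_measurable[OF this t x]] show ?thesis by (simp only: split_conv)
        qed
        show ?thesis
          unfolding split_conv nn_integral_PT[OF m]
        proof (rule nn_integral_cong)
          fix w assume "w \<in> space (P t x)"
          then have w: "w \<in> \<Omega>" using t x by simp
          have "(\<integral>\<^sup>+s\<in>{t<..T}. (\<integral>\<^sup>+y. indicator S (w, s) * indicator A y \<partial>\<nu> (snd (w, s)) (X (snd (w, s)) (fst (w, s)))) \<partial>lborel)
            = (\<integral>\<^sup>+s. indicator B w * (indicator {a<..b} s * rate_at (X s w) s A) \<partial>lborel)"
          proof (rule nn_integral_cong)
            fix s
            have "(\<integral>\<^sup>+y. indicator A y \<partial>\<nu> s (X s w)) = emeasure (\<nu> s (X s w)) A" if "0 \<le> s"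
              using A rate_sets[OF that path_range[OF that w]] by (intro nn_integral_indicator) simp
            then show "(\<integral>\<^sup>+y. indicator S (w, s) * indicator A y \<partial>\<nu> (snd (w, s)) (X (snd (w, s)) (fst (w, s)))) * indicator {t<..T} s
              = indicator B w * (indicator {a<..b} s * rate_at (X s w) s A)"
              using Ioc t by (auto simp: indicator_def rate_at_def)
          qed
          also have "\<dots> = indicator B w * (\<integral>\<^sup>+s. indicator {a<..b} s * rate_at (X s w) s A \<partial>lborel)"
            by (cases "w \<in> B") auto
          finally show "indicator B w * (\<integral>\<^sup>+s. indicator {a<..b} s * rate_at (X s w) s A \<partial>lborel)
            = (\<integral>\<^sup>+s\<in>{t<..T}. (\<integral>\<^sup>+y. indicator S (w, s) * indicator A y \<partial>\<nu> (snd (w, s)) (X (snd (w, s)) (fst (w, s)))) \<partial>lborel)" ..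
        qed
      qed
      finally show ?thesis .
    qed
  qed
  \<comment> \<open>The total mass is at most \<open>\<Lambda> * (T - t)\<close>, which supplies the
    finiteness demanded by \<open>nn_functional_eqI\<close>.\<close>
  have fin: "?I2 f \<noteq> \<infinity>" if f: "\<And>p y. f (p, y) \<le> 1" for f
  proof -
    have "?I2 f \<le> (\<integral>\<^sup>+p. ennreal \<Lambda> \<partial>PT t x)"
    proof (rule nn_integral_mono)
      fix p assume "p \<in> space (PT t x)"
      then have p: "0 \<le> snd p" "snd p \<le> T" "X (snd p) (fst p) \<in> space K" using t x path_range by auto
      have "(\<integral>\<^sup>+y. f (p, y) \<partial>rate p) \<le> (\<integral>\<^sup>+y. 1 \<partial>rate p)"
        by (intro nn_integral_mono f)
      also have "\<dots> \<le> ennreal \<Lambda>" using rate_le_bound[OF p] by simp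
      finally show "(\<integral>\<^sup>+y. f (p, y) \<partial>rate p) \<le> ennreal \<Lambda>" .
    qed
    also have "\<dots> = ennreal \<Lambda> * (emeasure (P t x) \<Omega> * emeasure (time_measure t) {t<..T})"
    proof -
      interpret TM: finite_measure "time_measure t" by (rule finite_time_measure)
      have "emeasure (PT t x) (\<Omega> \<times> {t<..T}) = emeasure (P t x) \<Omega> * emeasure (time_measure t) {t<..T}"
        unfolding PT_def using sets.top[of "P t x"] sets.top[of "time_measure t"] t x
        by (intro TM.emeasure_pair_measure_Times) auto
      then show ?thesis using t x by simp
    qed
    also have "\<dots> < \<infinity>" using emeasure_time_measure[OF t(2)] emeasure_space_1 t x by (simp add: ennreal_mult_less_top)
    finally show ?thesis by simp
  qed
  have sp: "?I1 (\<lambda>(p, y). indicator (space (Pred t)) p * indicator A y) = ?I2 (\<lambda>(p, y). indicator (space (Pred t)) p * indicator A y)"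
    if A: "A \<in> sets K" for A
  \<comment> \<open>For \<open>t < T\<close> the whole space differs from a generator only in the
    slice at \<open>t\<close>; otherwise there are no times and no jumps to integrate over.\<close>
  proof (cases "t < T")
    case True
    have 1: "?I1 (\<lambda>(p, y). indicator (space (Pred t)) p * indicator A y) = ?I1 (\<lambda>(p, y). indicator (\<Omega> \<times> {t<..T}) p * indicator A y)"
      using t x by (intro nn_integral_cong) (auto simp: indicator_def)
    have 2: "?I2 (\<lambda>(p, y). indicator (space (Pred t)) p * indicator A y) = ?I2 (\<lambda>(p, y). indicator (\<Omega> \<times> {t<..T}) p * indicator A y)"
      using t x by (intro nn_integral_cong) (auto simp: indicator_def)
    have "\<Omega> \<in> sets (\<F> {t..t})" using sets.top[of "\<F> {t..t}"] by simp
    with True have "t \<le> t \<and> t < T \<and> T \<le> T \<and> \<Omega> \<in> sets (\<F> {t..t})" by simp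
    then have "\<Omega> \<times> {t<..T} \<in> ?G" by blast
    then show ?thesis unfolding 1 2 using A by (rule rect)
  next
    case False
    then have "{t<..T} = {}" by simp
    then have "space (PT t x) = {}" using t x by simp
    then have "?I2 f = 0" for f by (simp add: nn_integral_empty)
    moreover have "?I1 f = 0" for f using \<open>{t<..T} = {}\<close> by (simp add: nn_integral_count_space_finite)
    ultimately show ?thesis by (simp only:)
  qed
  have step1: "?I1 (\<lambda>(p, y). indicator S p * indicator A y) = ?I2 (\<lambda>(p, y). indicator S p * indicator A y)"
    if S: "S \<in> sets (Pred t)" and A: "A \<in> sets K" for S A
  proof (rule nn_functional_eqI[OF nn_functional_section[OF F(1) A] nn_functional_section[OF F(2) A] predictable_Int_stable])
    show "?G \<subseteq> Pow (space (Pred t))" using predictable_Pow[OF t(2)] t by simp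
    show "sets (Pred t) = sigma_sets (space (Pred t)) ?G" using sets_predictable[OF t(2)] t by simp
    show "?I2 (\<lambda>(p, y). indicator (space (Pred t)) p * indicator A y) \<noteq> \<infinity>"
      by (rule fin) (auto simp: indicator_def)
    show "indicator S \<in> borel_measurable (Pred t)" using S by simp
  qed (use rect[OF _ A] sp[OF A] in auto)
  have "?I1 H = ?I2 H"
  proof (rule nn_functional_eqI[OF F Int_stable_pair_measure_generator pair_measure_closed[of "Pred t" K, folded space_pair_measure]])
    show "sets (Pred t \<Otimes>\<^sub>M K) = sigma_sets (space (Pred t \<Otimes>\<^sub>M K)) {a \<times> b |a b. a \<in> sets (Pred t) \<and> b \<in> sets K}"
      by (simp add: sets_pair_measure space_pair_measure)
    have ind: "indicator (S \<times> A) = (\<lambda>(p, y). indicator S p * indicator A y :: ennreal)" for S A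
      by (auto simp: fun_eq_iff indicator_def)
    show "?I1 (indicator C) = ?I2 (indicator C)" if C: "C \<in> {a \<times> b |a b. a \<in> sets (Pred t) \<and> b \<in> sets K}" for C
    proof -
      obtain S A where "C = S \<times> A" "S \<in> sets (Pred t)" "A \<in> sets K" using C by blast
      then show ?thesis using step1[of S A] unfolding \<open>C = S \<times> A\<close> ind by simp
    qed
    show "?I1 (indicator (space (Pred t \<Otimes>\<^sub>M K))) = ?I2 (indicator (space (Pred t \<Otimes>\<^sub>M K)))"
      using sp[OF sets.top] unfolding space_pair_measure ind by simp
    show "?I2 (indicator (space (Pred t \<Otimes>\<^sub>M K))) \<noteq> \<infinity>" by (rule fin) (auto simp: indicator_def)
    show "H \<in> borel_measurable (Pred t \<Otimes>\<^sub>M K)" by (rule H)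
  qed
  moreover have "?I1 H = (\<integral>\<^sup>+w. (\<Sum>\<tau>\<in>jumps w \<inter> {t<..T}. H ((w, \<tau>), X \<tau> w)) \<partial>P t x)"
    using t x by (intro nn_integral_cong) (simp add: nn_integral_count_space_finite)
  ultimately show ?thesis by simp
qed

end

section \<open>Solutions along paths\<close>

text \<open>The right end is exempt because there the path may already have jumped to another state;
  a single point does not affect the integral.\<close>

lemma set_integral_Ioc_cong_Ioo:
  fixes k k' :: "real \<Rightarrow> real"
  assumes k: "set_integrable lebesgue {a<..b} k" and eq: "\<And>s. a < s \<Longrightarrow> s < b \<Longrightarrow> k' s = k s"
  shows "set_integrable lebesgue {a<..b} k'" "(LINT s:{a<..b}|lebesgue. k' s) = (LINT s:{a<..b}|lebesgue. k s)"
proof -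
  let ?c = "indicator {a<..b} b * (k' b - k b)"
  have i: "integrable lebesgue (\<lambda>s. indicator {a<..b} s *\<^sub>R k s)" using k by (simp add: set_integrable_def)
  have "integrable lebesgue (\<lambda>s. ?c * indicator {b} s)" by simp
  from Bochner_Integration.integrable_add[OF i this] Bochner_Integration.integral_add[OF i this]
  have *: "integrable lebesgue (\<lambda>s. indicator {a<..b} s *\<^sub>R k s + ?c * indicator {b} s)"
    "(\<integral>s. indicator {a<..b} s *\<^sub>R k s + ?c * indicator {b} s \<partial>lebesgue) = (\<integral>s. indicator {a<..b} s *\<^sub>R k s \<partial>lebesgue)"
    by simp_all
  have "indicator {a<..b} s *\<^sub>R k s + ?c * indicator {b} s = indicator {a<..b} s *\<^sub>R k' s" for s
    using eq[of s] by (auto simp: indicator_def)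
  with * show "set_integrable lebesgue {a<..b} k'" "(LINT s:{a<..b}|lebesgue. k' s) = (LINT s:{a<..b}|lebesgue. k s)"
    unfolding set_integrable_def set_lebesgue_integral_def by (simp_all only:)
qed

context markov_jump_process
begin

text \<open>Subtract the equations at \<open>(a, x)\<close> and \<open>(b, x)\<close>: for a fixed
  state \<open>v\<close> is absolutely continuous in time, and its density is minus the sum of
  generator and driver.\<close>

lemma hjb_increment:
  assumes v: "hjb_solution T K \<nu> X P g f v" and x: "x \<in> space K" and ab: "0 \<le> a" "a \<le> b" "b \<le> T"
  shows "set_integrable lebesgue {a<..b} (\<lambda>s. - (generator \<nu> s (v s) x + f s x (\<lambda>y. v s y - v s x)))"
    "v b x - v a x = (LINT s:{a<..b}|lebesgue. - (generator \<nu> s (v s) x + f s x (\<lambda>y. v s y - v s x)))"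
proof -
  let ?g = "\<lambda>s. generator \<nu> s (v s) x" and ?f = "\<lambda>s. f s x (\<lambda>y. v s y - v s x)"
  have sol: "set_integrable lebesgue {t<..T} ?g" "set_integrable lebesgue {t<..T} ?f"
    "v t x = g x + (LINT s:{t<..T}|lebesgue. ?g s) + (LINT s:{t<..T}|lebesgue. ?f s)" if "0 \<le> t" "t \<le> T" for t
    using v x that unfolding hjb_solution_def by (simp_all add: Ball_def)
  have i: "set_integrable lebesgue {a<..b} ?g" "set_integrable lebesgue {a<..b} ?f"
    using set_integrable_Ioc_subset[OF sol(1)[of a], of a b] set_integrable_Ioc_subset[OF sol(2)[of a], of a b] ab by auto
  then have s: "set_integrable lebesgue {a<..b} (\<lambda>s. ?g s + ?f s)" by simp
  then show "set_integrable lebesgue {a<..b} (\<lambda>s. - (?g s + ?f s))"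
    using set_integrable_mult_right[of "-1" lebesgue "{a<..b}" "\<lambda>s. ?g s + ?f s"] by simp
  have "(LINT s:{a<..b}|lebesgue. - (?g s + ?f s)) = - (LINT s:{a<..b}|lebesgue. ?g s + ?f s)"
    by (simp only: set_lebesgue_integral_def scaleR_minus_right Bochner_Integration.integral_minus)
  also have "\<dots> = - ((LINT s:{a<..b}|lebesgue. ?g s) + (LINT s:{a<..b}|lebesgue. ?f s))"
    using i by (simp add: set_integral_add)
  also have "\<dots> = v b x - v a x"
    using sol(3)[of a] sol(3)[of b] set_integral_Ioc_split[OF sol(1)[of a], of a b T]
      set_integral_Ioc_split[OF sol(2)[of a], of a b T] ab by simp
  finally show "v b x - v a x = (LINT s:{a<..b}|lebesgue. - (?g s + ?f s))" ..
qed

text \<open>While the path rests in a state, \<open>hjb_increment\<close> applies to that state. To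
  the left of a time \<open>p\<close> the state before a possible jump is used up to
  \<open>p\<close>, and the change of state at the fixed time \<open>p\<close> is the jump
  term.\<close>

lemma value_along_path:
  assumes v: "hjb_solution T K \<nu> X P g f v" and w: "w \<in> \<Omega>" and t: "0 \<le> t" "t \<le> T"
  shows "piecewise_ac t T (jumps w) (\<lambda>s. v s (X s w))
    (\<lambda>s. - (generator \<nu> s (v s) (X s w) + f s (X s w) (\<lambda>y. v s y - v s (X s w))))
    (\<lambda>\<tau>. v \<tau> (X \<tau> w) - v \<tau> (left_lim X \<tau> w))"
proof -
  let ?k = "\<lambda>z s. - (generator \<nu> s (v s) z + f s z (\<lambda>y. v s y - v s z))"
  let ?\<psi> = "\<lambda>s. ?k (X s w) s" and ?j = "\<lambda>\<tau>. v \<tau> (X \<tau> w) - v \<tau> (left_lim X \<tau> w)"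
  have J: "finite (jumps w \<inter> {t<..b})" for b using w by simp
  define Q where "Q a b \<longleftrightarrow> set_integrable lebesgue {a<..b} ?\<psi> \<and>
    v b (X b w) - v a (X a w) = (LINT s:{a<..b}|lebesgue. ?\<psi> s) + (\<Sum>\<tau>\<in>jumps w \<inter> {a<..b}. ?j \<tau>)" for a b
  have Q: "Q t b" if tb: "t \<le> b" "b \<le> T" for b
    using tb(1)
  proof (induct rule: interval_gluing)
    case (trans x y z)
    have "{x<..z} = {x<..y} \<union> {y<..z}" using trans by auto
    then have "set_integrable lebesgue {x<..z} ?\<psi>"
      using trans(5,6) by (auto simp: Q_def intro: set_integrable_Un)
    then show ?case
      using trans set_integral_Ioc_split[of x z ?\<psi> x y z] sum_Ioc_split[OF J[of b], of x y z ?j] by (simp add: Q_def)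
  next
    case (refl p)
    then show ?case by (simp add: Q_def set_lebesgue_integral_def set_integrable_def)
  next
    case (left p)
    have p0: "0 < p" using left t by simp
    obtain e where e: "t \<le> e" "e < p" "jumps w \<inter> {e<..<p} = {}"
      using finite_gap_left[of "jumps w" t p] finite_jumps_Ioo[OF w] left by blast
    show ?case
    proof (intro exI[of _ "p - e"] conjI allI impI)
      fix x assume x: "t \<le> x \<and> p - (p - e) < x \<and> x < p"
      let ?c = "left_lim X p w"
      have Xc: "X s w = ?c" if "x \<le> s" "s < p" for s
      proof -
        have "left_lim X p w = X s w"
          by (rule left_lim_no_jump[OF w]) (use that x e t in auto)
        then show ?thesis ..
      qed
      have c: "?c \<in> space K" by (rule left_lim_in_space[OF w p0])
      have xp: "0 \<le> x" "x \<le> p" "p \<le> T" using x t left that by auto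
      note inc = hjb_increment[OF v c xp]
      have eq: "?\<psi> s = ?k ?c s" if "x < s" "s < p" for s using Xc[of s] that by simp
      note cg = set_integral_Ioc_cong_Ioo[OF inc(1), of ?\<psi>, OF eq]
      have "jumps w \<inter> {x<..p} = (if p \<in> jumps w then {p} else {})"
      proof -
        have "s \<in> jumps w \<inter> {x<..p} \<longleftrightarrow> p \<in> jumps w \<and> s = p" for s
          using e x by (cases "s < p") auto
        then show ?thesis by (cases "p \<in> jumps w", simp_all only: if_True if_False) blast+
      qed
      then have "(\<Sum>\<tau>\<in>jumps w \<inter> {x<..p}. ?j \<tau>) = ?j p" using p0 by (auto simp: jumps_def)
      moreover have "X x w = ?c" using Xc[of x] x by simp
      ultimately show "Q x p" unfolding Q_def using cg inc(2) by simp
    qed (use e in simp)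
  next
    case (right p)
    then have "0 \<le> p" using t by simp
    then obtain d where d: "d > 0" "\<And>s. p \<le> s \<Longrightarrow> s \<le> p + d \<Longrightarrow> X s w = X p w"
      using right_const[OF w, of p] by (meson atLeastAtMost_iff)
    show ?case
    proof (intro exI[of _ d] conjI allI impI d(1))
      fix y assume y: "p < y \<and> y < p + d \<and> y \<le> b"
      have c: "X p w \<in> space K" by (rule path_range[OF \<open>0 \<le> p\<close> w])
      have py: "0 \<le> p" "p \<le> y" "y \<le> T" using y \<open>0 \<le> p\<close> that by auto
      note inc = hjb_increment[OF v c py]
      have eq: "?\<psi> s = ?k (X p w) s" if "p < s" "s < y" for s
        using d(2)[of s] that y by simp
      note cg = set_integral_Ioc_cong_Ioo[OF inc(1), of ?\<psi>, OF eq]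
      have "s \<notin> jumps w" if "p < s" "s \<le> y" for s
      proof -
        have "X q w = X s w" if "p < q" "q < s" for q
          using d(2)[of s] d(2)[of q] that \<open>p < s\<close> \<open>s \<le> y\<close> y by simp
        then have "\<forall>\<^sub>F q in at_left s. X q w = X s w"
          using \<open>p < s\<close> eventually_at_left_field by blast
        then show ?thesis using jumps_iff[OF w] by blast
      qed
      then have "jumps w \<inter> {p<..y} = {}" by auto
      moreover have "X y w = X p w" using d(2)[of y] y by simp
      ultimately show "Q p y" unfolding Q_def using cg inc(2) by simp
    qed
  qed
  show ?thesis
  proof (rule piecewise_acI)
    show "set_integrable lebesgue {t<..T} ?\<psi>" using Q[of T] t by (simp add: Q_def)
  qed (use Q J in \<open>auto simp: Q_def\<close>)
qed

text \<open>The dictionary between path equations, which use \<open>lebesgue\<close>, the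
  definitions with \<open>lborel\<close>, and \<open>time_measure\<close>, to which Fubini's theorem
  is applied.\<close>

lemma time_measure_set_integral:
  fixes k :: "real \<Rightarrow> real"
  assumes k: "integrable (time_measure t) k"
  shows "set_integrable lebesgue {t<..T} k"
    and "\<And>a b. t \<le> a \<Longrightarrow> b \<le> T \<Longrightarrow> (LINT q:{a<..b}|lebesgue. k q) = (\<integral>q. indicator {a<..b} q * k q \<partial>time_measure t)"
    and "\<And>a b. t \<le> a \<Longrightarrow> b \<le> T \<Longrightarrow> (LINT q:{a<..b}|lborel. k q) = (\<integral>q. indicator {a<..b} q * k q \<partial>time_measure t)"
proof -
  have b: "integrable lborel (\<lambda>q. indicator {t<..T} q *\<^sub>R k q)"
    using k unfolding time_measure_def by (subst (asm) integrable_restrict_space) (auto simp: set_integrable_def)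
  then show "set_integrable lebesgue {t<..T} k"
    unfolding set_integrable_def by (subst integrable_completion) auto
  fix a b :: real assume ab: "t \<le> a" "b \<le> T"
  have eq: "indicator {a<..b} q *\<^sub>R k q = indicator {a<..b} q * (indicator {t<..T} q *\<^sub>R k q)" for q
    using ab by (auto simp: indicator_def)
  have eq': "indicator {a<..b} q *\<^sub>R k q = indicator {t<..T} q *\<^sub>R (indicator {a<..b} q * k q)" for q
    using ab by (auto simp: indicator_def)
  have m: "(\<lambda>q. indicator {a<..b} q *\<^sub>R k q) \<in> borel_measurable lborel"
    unfolding eq using borel_measurable_integrable[OF b] by measurable
  show *: "(LINT q:{a<..b}|lborel. k q) = (\<integral>q. indicator {a<..b} q * k q \<partial>time_measure t)"
    unfolding set_lebesgue_integral_def eq' unfolding time_measure_def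
    by (subst integral_restrict_space) (auto simp: set_lebesgue_integral_def)
  show "(LINT q:{a<..b}|lebesgue. k q) = (\<integral>q. indicator {a<..b} q * k q \<partial>time_measure t)"
    using integral_completion[OF m] * by (simp add: set_lebesgue_integral_def)
qed

text \<open>Null sections yield a null set only for measurable sets; hence the measurability premise
  on \<open>Q\<close>.\<close>

lemma PT_AE_I:
  assumes t: "0 \<le> t" "x \<in> space K" and Q: "{p \<in> space (PT t x). Q p} \<in> sets (PT t x)"
    and AE: "AE w in P t x. AE s in lborel. t < s \<longrightarrow> s \<le> T \<longrightarrow> Q (w, s)"
  shows "AE p in PT t x. Q p"
proof -
  interpret P: prob_space "P t x" using prob t by simp
  interpret TM: finite_measure "time_measure t" by (rule finite_time_measure)
  interpret pair_sigma_finite "P t x" "time_measure t" ..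
  show ?thesis using Q AE unfolding PT_def AE_time_measure[symmetric] by (rule AE_pair_measure)
qed

lemma PT_AE_D:
  assumes t: "0 \<le> t" "x \<in> space K" and Q: "AE p in PT t x. Q p"
  shows "AE w in P t x. AE s in lborel. t < s \<longrightarrow> s \<le> T \<longrightarrow> Q (w, s)"
proof -
  interpret P: prob_space "P t x" using prob t by simp
  interpret TM: finite_measure "time_measure t" by (rule finite_time_measure)
  interpret pair_sigma_finite "P t x" "time_measure t" ..
  show ?thesis using AE_pair[OF Q[unfolded PT_def]] by (simp add: AE_time_measure)
qed

lemma PT_AE_left_path:
  fixes f1 f2 :: "'w \<times> real \<Rightarrow> 'c::{second_countable_topology, t2_space}"
  assumes t: "0 \<le> t" "x \<in> space K" and f: "f1 \<in> borel_measurable (PT t x)" "f2 \<in> borel_measurable (PT t x)"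
    and eq: "\<And>w s. w \<in> \<Omega> \<Longrightarrow> t < s \<Longrightarrow> s \<le> T \<Longrightarrow> left_path t s w = X s w \<Longrightarrow> f1 (w, s) = f2 (w, s)"
  shows "AE p in PT t x. f1 p = f2 p"
proof (rule PT_AE_I[OF t])
  show "{p \<in> space (PT t x). f1 p = f2 p} \<in> sets (PT t x)" using f by measurable
  have "AE s in lborel. t < s \<longrightarrow> s \<le> T \<longrightarrow> f1 (w, s) = f2 (w, s)" if "w \<in> \<Omega>" for w
    using left_lim_AE[OF that]
    by eventually_elim (use eq[OF that] t in \<open>auto simp: left_path_def\<close>)
  then show "AE w in P t x. AE s in lborel. t < s \<longrightarrow> s \<le> T \<longrightarrow> f1 (w, s) = f2 (w, s)"
    by (rule_tac AE_I2) (use t in simp)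
qed

lemma PT_integrable_section:
  fixes k :: "'w \<times> real \<Rightarrow> real"
  assumes t: "0 \<le> t" "x \<in> space K" and k: "integrable (PT t x) k"
  shows "AE w in P t x. integrable (time_measure t) (\<lambda>s. k (w, s))"
    "integrable (P t x) (\<lambda>w. \<integral>s. k (w, s) \<partial>time_measure t)"
    "(\<integral>w. (\<integral>s. k (w, s) \<partial>time_measure t) \<partial>P t x) = (\<integral>p. k p \<partial>PT t x)"
proof -
  interpret P: prob_space "P t x" using prob t by simp
  interpret TM: finite_measure "time_measure t" by (rule finite_time_measure)
  interpret pair_sigma_finite "P t x" "time_measure t" ..
  note k' = k[unfolded PT_def]
  show "AE w in P t x. integrable (time_measure t) (\<lambda>s. k (w, s))" by (rule AE_integrable_fst'[OF k'])
  show "integrable (P t x) (\<lambda>w. \<integral>s. k (w, s) \<partial>time_measure t)" by (rule integrable_fst'[OF k'])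
  show "(\<integral>w. (\<integral>s. k (w, s) \<partial>time_measure t) \<partial>P t x) = (\<integral>p. k p \<partial>PT t x)"
    unfolding PT_def by (rule integral_fst'[OF k'])
qed

lemma PT_rate_integrable:
  fixes H :: "('w \<times> real) \<times> 'k \<Rightarrow> real"
  assumes t: "0 \<le> t" "t \<le> T" and x: "x \<in> space K" and H: "H \<in> borel_measurable (PT t x \<Otimes>\<^sub>M K)"
    and fin: "(\<integral>\<^sup>+p. (\<integral>\<^sup>+y. ennreal \<bar>H (p, y)\<bar> \<partial>rate p) \<partial>PT t x) < \<infinity>"
  shows "AE p in PT t x. integrable (rate p) (\<lambda>y. H (p, y))"
    "integrable (PT t x) (\<lambda>p. LINT y|rate p. H (p, y))"
proof -
  let ?J = "\<lambda>p. \<integral>\<^sup>+y. ennreal \<bar>H (p, y)\<bar> \<partial>rate p"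
  have "(\<lambda>q. ennreal \<bar>H q\<bar>) \<in> borel_measurable (PT t x \<Otimes>\<^sub>M K)" using H by measurable
  from PT_nn_integral_rate[OF t x this] have J: "?J \<in> borel_measurable (PT t x)" by simp
  have "AE p in PT t x. ?J p \<noteq> \<infinity>" using J fin by (intro nn_integral_PInf_AE) auto
  then show AE: "AE p in PT t x. integrable (rate p) (\<lambda>y. H (p, y))"
    using AE_space
  proof eventually_elim
    case (elim p)
    then show ?case
      using PT_section_measurable[OF H elim(2) t(1) x] by (simp add: integrable_iff_bounded less_top)
  qed
  show "integrable (PT t x) (\<lambda>p. LINT y|rate p. H (p, y))"
  proof (rule integrableI_bounded)
    show "(\<lambda>p. LINT y|rate p. H (p, y)) \<in> borel_measurable (PT t x)"
      by (rule PT_integral_rate[OF t x H])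
    have "(\<integral>\<^sup>+p. ennreal (norm (LINT y|rate p. H (p, y))) \<partial>PT t x) \<le> (\<integral>\<^sup>+p. ?J p \<partial>PT t x)"
    proof (rule nn_integral_mono_AE)
      show "AE p in PT t x. ennreal (norm (LINT y|rate p. H (p, y))) \<le> ?J p"
        using AE by eventually_elim (use integral_norm_bound_ennreal in force)
    qed
    then show "(\<integral>\<^sup>+p. ennreal (norm (LINT y|rate p. H (p, y))) \<partial>PT t x) < \<infinity>"
      using fin by (rule le_less_trans)
  qed
qed

lemma compensator_nonneg:
  fixes H :: "('w \<times> real) \<times> 'k \<Rightarrow> real"
  assumes t: "0 \<le> t" "t \<le> T" and x: "x \<in> space K" and H: "H \<in> borel_measurable (Pred t \<Otimes>\<^sub>M K)"
    and nn: "\<And>q. 0 \<le> H q"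
    and fin: "(\<integral>\<^sup>+p. (\<integral>\<^sup>+y. ennreal (H (p, y)) \<partial>rate p) \<partial>PT t x) < \<infinity>"
  shows "integrable (P t x) (\<lambda>w. \<Sum>\<tau>\<in>jumps w \<inter> {t<..T}. H ((w, \<tau>), X \<tau> w))"
    "(\<integral>w. (\<Sum>\<tau>\<in>jumps w \<inter> {t<..T}. H ((w, \<tau>), X \<tau> w)) \<partial>P t x)
      = (\<integral>p. (LINT y|rate p. H (p, y)) \<partial>PT t x)"
proof -
  let ?S = "\<lambda>w. \<Sum>\<tau>\<in>jumps w \<inter> {t<..T}. H ((w, \<tau>), X \<tau> w)"
  have Hm: "H \<in> borel_measurable (PT t x \<Otimes>\<^sub>M K)" by (rule PT_measurable[OF H t x])
  have Sm: "?S \<in> borel_measurable (P t x)"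
    by (rule measurable_P[OF measurable_jump_sum[OF t order_refl H]]) (use t x in auto)
  have Snn: "0 \<le> ?S w" for w by (intro sum_nonneg nn)
  have "(\<lambda>q. ennreal (H q)) \<in> borel_measurable (Pred t \<Otimes>\<^sub>M K)" using H by measurable
  from compensator[OF t x this]
  have comp: "(\<integral>\<^sup>+w. ennreal (?S w) \<partial>P t x) = (\<integral>\<^sup>+p. (\<integral>\<^sup>+y. ennreal (H (p, y)) \<partial>rate p) \<partial>PT t x)"
    using nn by (simp add: sum_ennreal)
  show int: "integrable (P t x) ?S"
    using Snn Sm fin comp by (intro integrableI_nonneg) auto
  have fin': "(\<integral>\<^sup>+p. (\<integral>\<^sup>+y. ennreal \<bar>H (p, y)\<bar> \<partial>rate p) \<partial>PT t x) < \<infinity>"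
    using fin nn by simp
  note r = PT_rate_integrable[OF t x Hm fin']
  have "ennreal (\<integral>w. ?S w \<partial>P t x) = (\<integral>\<^sup>+w. ennreal (?S w) \<partial>P t x)"
    using int Snn by (simp add: nn_integral_eq_integral)
  also have "\<dots> = (\<integral>\<^sup>+p. ennreal (LINT y|rate p. H (p, y)) \<partial>PT t x)"
    unfolding comp
  proof (rule nn_integral_cong_AE)
    show "AE p in PT t x. (\<integral>\<^sup>+y. ennreal (H (p, y)) \<partial>rate p) = ennreal (LINT y|rate p. H (p, y))"
      using r(1) by eventually_elim (simp add: nn_integral_eq_integral nn)
  qed
  also have "\<dots> = ennreal (\<integral>p. (LINT y|rate p. H (p, y)) \<partial>PT t x)"
    using r(2) nn by (intro nn_integral_eq_integral) (auto intro: integral_nonneg)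
  finally show "(\<integral>w. ?S w \<partial>P t x) = (\<integral>p. (LINT y|rate p. H (p, y)) \<partial>PT t x)"
    using Snn nn by (simp add: integral_nonneg)
qed

lemma compensator_real:
  fixes H :: "('w \<times> real) \<times> 'k \<Rightarrow> real"
  assumes t: "0 \<le> t" "t \<le> T" and x: "x \<in> space K" and H: "H \<in> borel_measurable (Pred t \<Otimes>\<^sub>M K)"
    and fin: "(\<integral>\<^sup>+p. (\<integral>\<^sup>+y. ennreal \<bar>H (p, y)\<bar> \<partial>rate p) \<partial>PT t x) < \<infinity>"
  shows "integrable (P t x) (\<lambda>w. \<Sum>\<tau>\<in>jumps w \<inter> {t<..T}. H ((w, \<tau>), X \<tau> w))"
    "(\<integral>w. (\<Sum>\<tau>\<in>jumps w \<inter> {t<..T}. H ((w, \<tau>), X \<tau> w)) \<partial>P t x)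
      = (\<integral>p. (LINT y|rate p. H (p, y)) \<partial>PT t x)"
proof -
  let ?H1 = "\<lambda>q. max 0 (H q)" and ?H2 = "\<lambda>q. max 0 (- H q)"
  have m: "?H1 \<in> borel_measurable (Pred t \<Otimes>\<^sub>M K)" "?H2 \<in> borel_measurable (Pred t \<Otimes>\<^sub>M K)" using H by measurable
  have le: "(\<integral>\<^sup>+p. (\<integral>\<^sup>+y. ennreal (G (p, y)) \<partial>rate p) \<partial>PT t x) < \<infinity>"
    if "\<And>q. G q \<le> \<bar>H q\<bar>" for G
    by (rule le_less_trans[OF nn_integral_mono fin]) (intro nn_integral_mono ennreal_leI that)
  note c1 = compensator_nonneg[OF t x m(1) _ le]
  note c2 = compensator_nonneg[OF t x m(2) _ le]
  have i: "integrable (P t x) (\<lambda>w. \<Sum>\<tau>\<in>jumps w \<inter> {t<..T}. ?H1 ((w, \<tau>), X \<tau> w))"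
    "integrable (P t x) (\<lambda>w. \<Sum>\<tau>\<in>jumps w \<inter> {t<..T}. ?H2 ((w, \<tau>), X \<tau> w))"
    by (rule c1(1); simp) (rule c2(1); simp)
  have e: "(\<integral>w. (\<Sum>\<tau>\<in>jumps w \<inter> {t<..T}. ?H1 ((w, \<tau>), X \<tau> w)) \<partial>P t x)
      = (\<integral>p. (LINT y|rate p. ?H1 (p, y)) \<partial>PT t x)"
    "(\<integral>w. (\<Sum>\<tau>\<in>jumps w \<inter> {t<..T}. ?H2 ((w, \<tau>), X \<tau> w)) \<partial>P t x)
      = (\<integral>p. (LINT y|rate p. ?H2 (p, y)) \<partial>PT t x)"
    by (rule c1(2); simp) (rule c2(2); simp)
  have HH: "?H1 q - ?H2 q = H q" for q by (simp add: max_def)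
  have S: "(\<Sum>\<tau>\<in>jumps w \<inter> {t<..T}. H ((w, \<tau>), X \<tau> w)) = (\<Sum>\<tau>\<in>jumps w \<inter> {t<..T}. ?H1 ((w, \<tau>), X \<tau> w))
     - (\<Sum>\<tau>\<in>jumps w \<inter> {t<..T}. ?H2 ((w, \<tau>), X \<tau> w))" for w
    by (simp only: HH sum_subtractf[symmetric])
  show "integrable (P t x) (\<lambda>w. \<Sum>\<tau>\<in>jumps w \<inter> {t<..T}. H ((w, \<tau>), X \<tau> w))"
    unfolding S using i by (rule Bochner_Integration.integrable_diff)
  have mm: "?H1 \<in> borel_measurable (PT t x \<Otimes>\<^sub>M K)" "?H2 \<in> borel_measurable (PT t x \<Otimes>\<^sub>M K)" "H \<in> borel_measurable (PT t x \<Otimes>\<^sub>M K)"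
    using PT_measurable[OF m(1) t x] PT_measurable[OF m(2) t x] PT_measurable[OF H t x] by auto
  have f: "(\<integral>\<^sup>+p. (\<integral>\<^sup>+y. ennreal \<bar>?H1 (p, y)\<bar> \<partial>rate p) \<partial>PT t x) < \<infinity>"
    "(\<integral>\<^sup>+p. (\<integral>\<^sup>+y. ennreal \<bar>?H2 (p, y)\<bar> \<partial>rate p) \<partial>PT t x) < \<infinity>"
    using le[of "\<lambda>q. \<bar>?H1 q\<bar>"] le[of "\<lambda>q. \<bar>?H2 q\<bar>"] by simp_all
  note r1 = PT_rate_integrable[OF t x mm(1) f(1)] and r2 = PT_rate_integrable[OF t x mm(2) f(2)]
  have "(\<integral>p. (LINT y|rate p. H (p, y)) \<partial>PT t x)
    = (\<integral>p. (LINT y|rate p. ?H1 (p, y)) - (LINT y|rate p. ?H2 (p, y)) \<partial>PT t x)"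
  proof (rule integral_cong_AE)
    show "AE p in PT t x. (LINT y|rate p. H (p, y))
      = (LINT y|rate p. ?H1 (p, y)) - (LINT y|rate p. ?H2 (p, y))"
      using r1(1) r2(1)
      by eventually_elim (simp only: Bochner_Integration.integral_diff[symmetric] HH)
    show "(\<lambda>p. LINT y|rate p. H (p, y)) \<in> borel_measurable (PT t x)"
      by (rule PT_integral_rate[OF t x mm(3)])
    show "(\<lambda>p. (LINT y|rate p. ?H1 (p, y)) - (LINT y|rate p. ?H2 (p, y))) \<in> borel_measurable (PT t x)"
      using r1(2) r2(2) by (intro borel_measurable_diff borel_measurable_integrable)
  qed
  also have "\<dots> = (\<integral>p. (LINT y|rate p. ?H1 (p, y)) \<partial>PT t x) - (\<integral>p. (LINT y|rate p. ?H2 (p, y)) \<partial>PT t x)"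
    by (rule Bochner_Integration.integral_diff[OF r1(2) r2(2)])
  finally show "(\<integral>w. (\<Sum>\<tau>\<in>jumps w \<inter> {t<..T}. H ((w, \<tau>), X \<tau> w)) \<partial>P t x)
      = (\<integral>p. (LINT y|rate p. H (p, y)) \<partial>PT t x)"
    unfolding S Bochner_Integration.integral_diff[OF i] e by simp
qed

lemma predictable_snd:
  assumes t: "0 \<le> t" "t \<le> T"
  shows "snd \<in> borel_measurable (Pred t)"
proof -
  have "(\<lambda>(w, s). s) \<in> borel_measurable (Pred t)"
    by (rule predictable_left_limit[OF t, of "\<lambda>s _. s"]) auto
  then show ?thesis by (simp add: case_prod_beta')
qed

lemma measurable_value:
  assumes v: "hjb_solution T K \<nu> X P g f v" and s: "s \<in> borel_measurable N" and w: "w \<in> N \<rightarrow>\<^sub>M K"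
    and b: "\<And>q. q \<in> space N \<Longrightarrow> 0 \<le> s q \<and> s q \<le> T"
  shows "(\<lambda>q. v (s q) (w q)) \<in> borel_measurable N"
proof -
  have "(\<lambda>(t, x). v t x) \<in> borel_measurable (restrict_space borel {0..T} \<Otimes>\<^sub>M K)"
    using v by (simp add: hjb_solution_def)
  moreover have "s \<in> N \<rightarrow>\<^sub>M restrict_space borel {0..T}"
    using s b by (intro measurable_restrict_space2) auto
  then have "(\<lambda>q. (s q, w q)) \<in> N \<rightarrow>\<^sub>M restrict_space borel {0..T} \<Otimes>\<^sub>M K" using w by measurable
  ultimately show ?thesis using measurable_compose by fastforce
qed

end

text \<open>Over a step shorter than 1 / \<kappa> the inequality forces \<open>G s = 0\<close> as
  soon as \<open>G s' = 0\<close>; such steps, glued together, lead from \<open>b\<close> back to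
  \<open>a\<close>.\<close>

lemma backward_gronwall:
  fixes G :: "real \<Rightarrow> real"
  assumes ab: "a \<le> b" and \<kappa>: "0 \<le> \<kappa>" and nn: "\<And>s. a \<le> s \<Longrightarrow> s \<le> b \<Longrightarrow> 0 \<le> G s"
    and le: "\<And>s s'. a \<le> s \<Longrightarrow> s \<le> s' \<Longrightarrow> s' \<le> b \<Longrightarrow> G s - G s' \<le> (s' - s) * \<kappa> * G s"
    and fin: "G b = 0"
  shows "G a = 0"
proof -
  have step: "G s = 0" if "G s' = 0" "a \<le> s" "s \<le> s'" "s' \<le> b" "(s' - s) * \<kappa> < 1" for s s'
  proof -
    have "G s * (1 - (s' - s) * \<kappa>) \<le> 0" using le[of s s'] that by (simp add: algebra_simps)
    then have "G s \<le> 0" using that(5) by (simp add: mult_le_0_iff)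
    then show ?thesis using nn[of s] that by simp
  qed
  \<comment> \<open>The length 1 / (\<kappa> + 1) also serves for \<kappa> = 0.\<close>
  have small: "d * \<kappa> < 1" if "d < 1 / (\<kappa> + 1)" "0 \<le> d" for d
  proof -
    have "d * (\<kappa> + 1) < 1" using that \<kappa> by (simp add: pos_less_divide_eq)
    then show ?thesis using that by (simp add: algebra_simps)
  qed
  have "G b = 0 \<longrightarrow> G a = 0" using ab
  proof (induct rule: interval_gluing)
    case (left p)
    show ?case
    proof (intro exI[of _ "1 / (\<kappa> + 1)"] conjI allI impI)
      fix s assume "a \<le> s \<and> p - 1 / (\<kappa> + 1) < s \<and> s < p" "G p = 0"
      then show "G s = 0" using step[of p s] small[of "p - s"] left by auto
    qed (use \<kappa> in simp)
  next
    case (right p)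
    show ?case
    proof (intro exI[of _ "1 / (\<kappa> + 1)"] conjI allI impI)
      fix s assume "p < s \<and> s < p + 1 / (\<kappa> + 1) \<and> s \<le> b" "G s = 0"
      then show "G p = 0" using step[of s p] small[of "s - p"] right by auto
    qed (use \<kappa> in simp)
  qed auto
  then show ?thesis using fin by simp
qed

lemma square_integrable_integrable:
  assumes N: "finite_measure N" and z: "z \<in> square_integrable N"
  shows "integrable N z" "integrable N (\<lambda>y. (z y)\<^sup>2)"
proof -
  interpret finite_measure N by (rule N)
  have [measurable]: "z \<in> borel_measurable N" using z by (simp add: square_integrable_def)
  show sq: "integrable N (\<lambda>y. (z y)\<^sup>2)"
    using z by (intro integrableI_nonneg) (auto simp: square_integrable_def)
  have "integrable N (\<lambda>y. 1 + (z y)\<^sup>2)" using sq by simp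
  then show "integrable N z"
  proof (rule Bochner_Integration.integrable_bound)
    have "\<bar>r\<bar> \<le> 1 + r\<^sup>2" for r :: real
      using sum_squares_bound[of 1 "\<bar>r\<bar>"] by (simp add: power2_eq_square)
    then show "AE y in N. norm (z y) \<le> norm (1 + (z y)\<^sup>2)" by (intro AE_I2) simp
  qed measurable
qed

context markov_jump_process
begin

lemma finite_measure_PT:
  assumes "0 \<le> t" "x \<in> space K"
  shows "finite_measure (PT t x)"
proof -
  interpret P: prob_space "P t x" using prob assms by simp
  interpret TM: finite_measure "time_measure t" by (rule finite_time_measure)
  show ?thesis
  proof (rule finite_measureI)
    have "emeasure (PT t x) (space (P t x) \<times> space (time_measure t)) = emeasure (P t x) (space (P t x)) * emeasure (time_measure t) (space (time_measure t))"
      unfolding PT_def by (rule TM.emeasure_pair_measure_Times[OF sets.top sets.top])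
    then show "emeasure (PT t x) (space (PT t x)) \<noteq> \<infinity>"
      by (simp add: PT_def space_pair_measure ennreal_mult_eq_top_iff P.emeasure_space_1 del: space_time_measure)
  qed
qed

lemma PT_section:
  assumes "k \<in> borel_measurable (PT t x)" "0 \<le> t" "x \<in> space K" "w \<in> \<Omega>"
  shows "(\<lambda>s. k (w, s)) \<in> borel_measurable (time_measure t)"
  using measurable_Pair2[OF assms(1)[unfolded PT_def], of w] assms by simp

text \<open>Used below to justify the compensator formula for real integrands: a majorant
  independent of the target state costs only the factor \<Lambda>, and the rest is measured by the
  rates themselves.\<close>

lemma PT_rate_finite:
  assumes t: "0 \<le> t" "t \<le> T" and x: "x \<in> space K"
    and k: "k \<in> borel_measurable (PT t x)" "(\<integral>\<^sup>+p. ennreal (k p) \<partial>PT t x) < \<infinity>"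
    and G: "G \<in> borel_measurable (PT t x \<Otimes>\<^sub>M K)" "(\<integral>\<^sup>+p. (\<integral>\<^sup>+y. ennreal (G (p, y)) \<partial>rate p) \<partial>PT t x) < \<infinity>"
    and le: "\<And>p y. p \<in> space (PT t x) \<Longrightarrow> y \<in> space K \<Longrightarrow> \<bar>H (p, y)\<bar> \<le> k p + G (p, y)"
    and nn: "\<And>p. 0 \<le> k p" "\<And>q. 0 \<le> G q"
  shows "(\<integral>\<^sup>+p. (\<integral>\<^sup>+y. ennreal \<bar>H (p, y)\<bar> \<partial>rate p) \<partial>PT t x) < \<infinity>"
proof -
  have Gm: "(\<lambda>q. ennreal (G q)) \<in> borel_measurable (PT t x \<Otimes>\<^sub>M K)" using G(1) by measurable
  have km: "(\<lambda>p. ennreal (k p)) \<in> borel_measurable (PT t x)" using k(1) by measurable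
  have "(\<integral>\<^sup>+p. (\<integral>\<^sup>+y. ennreal \<bar>H (p, y)\<bar> \<partial>rate p) \<partial>PT t x)
    \<le> (\<integral>\<^sup>+p. ennreal \<Lambda> * ennreal (k p) + (\<integral>\<^sup>+y. ennreal (G (p, y)) \<partial>rate p) \<partial>PT t x)"
  proof (rule nn_integral_mono)
    fix p assume p: "p \<in> space (PT t x)"
    let ?N = "rate p"
    have p': "0 \<le> snd p" "snd p \<le> T" "X (snd p) (fst p) \<in> space K" using p t x path_range by auto
    have "(\<integral>\<^sup>+y. ennreal \<bar>H (p, y)\<bar> \<partial>?N) \<le> (\<integral>\<^sup>+y. ennreal (k p) + ennreal (G (p, y)) \<partial>?N)"
      using le[OF p] nn p' by (intro nn_integral_mono) (simp add: space_rate flip: ennreal_plus)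
    also have "\<dots> = ennreal (k p) * emeasure ?N (space ?N) + (\<integral>\<^sup>+y. ennreal (G (p, y)) \<partial>?N)"
      using PT_section_measurable[OF Gm p t(1) x] by (simp add: nn_integral_add)
    also have "\<dots> \<le> ennreal (k p) * ennreal \<Lambda> + (\<integral>\<^sup>+y. ennreal (G (p, y)) \<partial>?N)"
      by (intro add_right_mono mult_left_mono rate_le_bound p') simp
    finally show "(\<integral>\<^sup>+y. ennreal \<bar>H (p, y)\<bar> \<partial>?N) \<le> ennreal \<Lambda> * ennreal (k p) + (\<integral>\<^sup>+y. ennreal (G (p, y)) \<partial>?N)"
      by (simp add: mult.commute)
  qed
  also have "\<dots> = ennreal \<Lambda> * (\<integral>\<^sup>+p. ennreal (k p) \<partial>PT t x) + (\<integral>\<^sup>+p. (\<integral>\<^sup>+y. ennreal (G (p, y)) \<partial>rate p) \<partial>PT t x)"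
    using PT_nn_integral_rate[OF t x Gm] km by (simp add: nn_integral_add nn_integral_cmult)
  also have "\<dots> < \<infinity>" using k(2) G(2) by (simp add: ennreal_mult_less_top)
  finally show ?thesis .
qed

lemma PT_sq_imp_abs_finite:
  fixes H :: "('w \<times> real) \<times> 'k \<Rightarrow> real"
  assumes t: "0 \<le> t" "t \<le> T" and x: "x \<in> space K" and H: "H \<in> borel_measurable (PT t x \<Otimes>\<^sub>M K)"
    and fin: "(\<integral>\<^sup>+p. (\<integral>\<^sup>+y. ennreal ((H (p, y))\<^sup>2) \<partial>rate p) \<partial>PT t x) < \<infinity>"
  shows "(\<integral>\<^sup>+p. (\<integral>\<^sup>+y. ennreal \<bar>H (p, y)\<bar> \<partial>rate p) \<partial>PT t x) < \<infinity>"
proof (rule PT_rate_finite[OF t x, where k = "\<lambda>_. 1" and G = "\<lambda>q. (H q)\<^sup>2"])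
  interpret finite_measure "PT t x" by (rule finite_measure_PT[OF t(1) x])
  show "(\<integral>\<^sup>+p. ennreal 1 \<partial>PT t x) < \<infinity>" by (simp add: less_top[symmetric])
  show "(\<lambda>q. (H q)\<^sup>2) \<in> borel_measurable (PT t x \<Otimes>\<^sub>M K)" using H by measurable
  have "\<bar>r\<bar> \<le> 1 + r\<^sup>2" for r :: real
    using sum_squares_bound[of 1 "\<bar>r\<bar>"] by (simp add: power2_eq_square)
  then show "\<bar>H (p, y)\<bar> \<le> 1 + (H (p, y))\<^sup>2" for p y .
qed (use fin in auto)

lemma bsde_measurable:
  assumes "bsde_solution T K \<nu> \<Omega> X P g f t x Y Z"
  shows "(\<lambda>(w, s). Y s w) \<in> borel_measurable (Prog t)"
    "(\<lambda>q. Z (snd (fst q)) (fst (fst q)) (snd q)) \<in> borel_measurable (Pred t \<Otimes>\<^sub>M K)"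
  using assms unfolding bsde_solution_def bsde_space_def by (auto simp: case_prod_beta')

lemma bsde_finite:
  assumes t: "0 \<le> t" "t \<le> T" and x: "x \<in> space K" and sol: "bsde_solution T K \<nu> \<Omega> X P g f t x Y Z"
  shows "(\<integral>\<^sup>+p. ennreal ((Y (snd p) (fst p))\<^sup>2) \<partial>PT t x) < \<infinity>"
    "(\<integral>\<^sup>+p. (\<integral>\<^sup>+y. ennreal ((Z (snd p) (fst p) y)\<^sup>2) \<partial>rate p) \<partial>PT t x) < \<infinity>"
proof -
  have fin: "bsde_norm_sq T \<nu> X P t x Y Z < \<infinity>" using sol by (simp add: bsde_solution_def bsde_space_def)
  have Ym: "(\<lambda>p. Y (snd p) (fst p)) \<in> borel_measurable (PT t x)"
    using measurable_compose[OF PT_to_progressive[OF t x] bsde_measurable(1)[OF sol]] by (simp add: case_prod_beta')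
  then have 1: "(\<lambda>p. ennreal ((Y (snd p) (fst p))\<^sup>2)) \<in> borel_measurable (PT t x)" by measurable
  have "(\<lambda>q. ennreal ((Z (snd (fst q)) (fst (fst q)) (snd q))\<^sup>2)) \<in> borel_measurable (PT t x \<Otimes>\<^sub>M K)"
    using PT_measurable[OF bsde_measurable(2)[OF sol] t x] by measurable
  from PT_nn_integral_rate[OF t x this]
  have 2: "(\<lambda>p. \<integral>\<^sup>+y. ennreal ((Z (snd p) (fst p) y)\<^sup>2) \<partial>rate p) \<in> borel_measurable (PT t x)" by simp
  show "(\<integral>\<^sup>+p. ennreal ((Y (snd p) (fst p))\<^sup>2) \<partial>PT t x) < \<infinity>"
    "(\<integral>\<^sup>+p. (\<integral>\<^sup>+y. ennreal ((Z (snd p) (fst p) y)\<^sup>2) \<partial>rate p) \<partial>PT t x) < \<infinity>"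
    using fin unfolding nn_integral_PT[OF 1] nn_integral_PT[OF 2] by (auto simp: bsde_norm_sq_def)
qed

text \<open>The jump part of the backward equation is thereby a finite sum over the jumps in (s, T].
  Jumps after \<open>T\<close> belong to the jump measure but lie outside the domain of
  integration.\<close>

lemma jump_measure_integral:
  assumes t: "0 \<le> t" "t \<le> T" and w: "w \<in> \<Omega>" and s: "t \<le> s"
    and H: "(H :: _ \<Rightarrow> real) \<in> borel_measurable (Pred t \<Otimes>\<^sub>M K)"
  shows "(LINT p:{s<..T} \<times> space K|jump_measure K X t w. H ((w, fst p), snd p))
    = (\<Sum>\<tau>\<in>jumps w \<inter> {s<..T}. H ((w, \<tau>), X \<tau> w))"
proof -
  let ?R = "restrict_space borel {t<..} \<Otimes>\<^sub>M K"
  let ?N = "{n. 1 \<le> n \<and> jump_time X t n w < \<infinity>}"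
  let ?G = "\<lambda>n. (real_of_ereal (jump_time X t n w), X (real_of_ereal (jump_time X t n w)) w)"
  let ?h = "\<lambda>p. indicator ({s<..T} \<times> space K) p *\<^sub>R H ((w, fst p), snd p)"
  have G: "?G \<in> count_space ?N \<rightarrow>\<^sub>M ?R"
  proof (subst measurable_count_space_eq1, rule Pi_I)
    fix n assume n: "n \<in> ?N"
    show "?G n \<in> space ?R"
      using n path_range[OF _ w] t
      by (cases rule: jump_time_finite_cases[OF w t(1), of n]) (auto simp: space_pair_measure space_restrict_space)
  qed
  have h: "?h \<in> borel_measurable ?R"
  proof -
    have S: "{s<..T} \<times> space K \<in> sets ?R" using s by (intro pair_measureI) (auto simp: sets_restrict_space_iff)
    have "(\<lambda>q. (w, clamp_to t T q)) \<in> borel \<rightarrow>\<^sub>M Pred t"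
      using measurable_compose[OF measurable_Pair1'[of w "\<F> {t..T}" borel] measurable_clamp_predictable[OF t(2) order_refl]] w by simp
    then have [measurable]: "(\<lambda>q. (w, clamp_to t T q)) \<in> restrict_space borel {t<..} \<rightarrow>\<^sub>M Pred t"
      by (rule measurable_restrict_space1)
    have "(\<lambda>p. ((w, clamp_to t T (fst p)), snd p)) \<in> ?R \<rightarrow>\<^sub>M Pred t \<Otimes>\<^sub>M K" by measurable
    from measurable_compose[OF this H] have "(\<lambda>p. indicator ({s<..T} \<times> space K) p *\<^sub>R H ((w, clamp_to t T (fst p)), snd p)) \<in> borel_measurable ?R"
      using S by measurable
    then show ?thesis
      by (rule measurable_cong[THEN iffD1, rotated]) (use s in \<open>auto simp: indicator_def\<close>)
  qed
  have hG: "?h (?G n) = (if jump_time X t n w \<le> ereal T \<and> s < real_of_ereal (jump_time X t n w) then H ((w, fst (?G n)), snd (?G n)) else 0)"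
    if "n \<in> ?N" for n
    using that path_range[OF _ w] t
    by (cases rule: jump_time_finite_cases[OF w t(1), of n]) (auto simp: indicator_def)
  have nz: "jump_time X t n w \<le> ereal T" if n: "n \<in> ?N" and "?h (?G n) \<noteq> 0" for n
  proof (rule ccontr)
    assume "\<not> jump_time X t n w \<le> ereal T"
    then have "?h (?G n) = 0" unfolding hG[OF n] by (simp only: simp_thms if_False)
    with that(2) show False by (rule notE)
  qed
  have fin: "finite {n. 1 \<le> n \<and> jump_time X t n w \<le> ereal T}" by (rule finite_jump_time[OF w t(1)])
  have sub: "{n. 1 \<le> n \<and> jump_time X t n w \<le> ereal T} \<subseteq> ?N" by (auto intro: le_less_trans)
  have "(LINT p:{s<..T} \<times> space K|jump_measure K X t w. H ((w, fst p), snd p)) = (\<integral>n. ?h (?G n) \<partial>count_space ?N)"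
    unfolding set_lebesgue_integral_def jump_measure_def by (rule integral_distr[OF G h])
  also have "\<dots> = (\<Sum>n | n \<in> ?N \<and> ?h (?G n) \<noteq> 0. ?h (?G n))"
  proof (rule lebesgue_integral_count_space_finite_support)
    show "finite {n \<in> ?N. ?h (?G n) \<noteq> 0}" by (rule finite_subset[OF _ fin]) (use nz in blast)
  qed
  also have "\<dots> = (\<Sum>n\<in>{n. 1 \<le> n \<and> jump_time X t n w \<le> ereal T}. ?h (?G n))"
    by (rule sum.mono_neutral_left[OF fin]) (use nz sub in blast)+
  also have "\<dots> = (\<Sum>\<tau>\<in>jumps w \<inter> {t<..T}. ?h (\<tau>, X \<tau> w))"
    by (rule sum_jump_time[OF w t(1), of "\<lambda>\<tau>. ?h (\<tau>, X \<tau> w)"])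
  also have "\<dots> = (\<Sum>\<tau>\<in>jumps w \<inter> {s<..T}. H ((w, \<tau>), X \<tau> w))"
    by (rule sum.mono_neutral_cong_right) (use w s t path_range in \<open>auto simp: indicator_def\<close>)
  finally show ?thesis .
qed

text \<open>The equation at \<open>s\<close> minus the one at \<open>t\<close> gives the increments
  of \<open>Y\<close>; the equation at \<open>T\<close> gives the terminal value.\<close>

lemma bsde_along_path:
  assumes t: "0 \<le> t" "t \<le> T" and x: "x \<in> space K" and sol: "bsde_solution T K \<nu> \<Omega> X P g f t x Y Z"
  shows "AE w in P t x. piecewise_ac t T (jumps w) (\<lambda>s. Y s w)
      (\<lambda>s. - ((LINT y|\<nu> s (X s w). Z s w y) + f s (X s w) (Z s w))) (\<lambda>\<tau>. Z \<tau> w (X \<tau> w))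
    \<and> Y T w = g (X T w)"
proof -
  let ?Z = "\<lambda>q. Z (snd (fst q)) (fst (fst q)) (snd q)"
  \<comment> \<open>Compensator density with the current state and with the left limit. The first is
    integrable by the norm condition on \<open>Z\<close>, the second is the one in the equation, and
    they agree for almost every time.\<close>
  let ?kX = "\<lambda>p. LINT y|rate p. Z (snd p) (fst p) y"
  let ?kL = "\<lambda>p. LINT y|\<nu> (snd p) (left_path t (snd p) (fst p)). Z (snd p) (fst p) y"
  note Zm = bsde_measurable(2)[OF sol]
  note Zm' = PT_measurable[OF Zm t x]
  have "(\<integral>\<^sup>+p. (\<integral>\<^sup>+y. ennreal \<bar>?Z (p, y)\<bar> \<partial>rate p) \<partial>PT t x) < \<infinity>"
    using bsde_finite(2)[OF t x sol] by (intro PT_sq_imp_abs_finite[OF t x Zm']) simp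
  from PT_rate_integrable(2)[OF t x Zm' this] have kX: "integrable (PT t x) ?kX" by simp
  have Lm: "(\<lambda>p. left_path t (snd p) (fst p)) \<in> PT t x \<rightarrow>\<^sub>M K"
    using measurable_compose[OF PT_to_predictable[OF t x] predictable_left_path[OF t]] by (simp add: case_prod_beta')
  have kL: "?kL \<in> borel_measurable (PT t x)"
    using measurable_integral_rate[OF PT_snd[OF t(1) x] Lm, of "\<lambda>p y. ?Z (p, y)"] Zm' t x by auto
  have "AE w in P t x. w \<in> \<Omega>" using t x by (intro AE_I2) simp
  moreover have "AE w in P t x. set_integrable lebesgue {t<..T} (\<lambda>q. f q (X q w) (Z q w)) \<and>
      (\<forall>s\<in>{t..T}. Y s w + compensated_integral K \<nu> X t s T (\<lambda>q. Z q w) w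
         = g (X T w) + (LINT q:{s<..T}|lebesgue. f q (X q w) (Z q w)))"
    using sol by (simp add: bsde_solution_def)
  moreover note PT_integrable_section(1)[OF t(1) x kX]
  ultimately show ?thesis
  proof eventually_elim
    case (elim w)
    let ?f = "\<lambda>q. f q (X q w) (Z q w)" and ?k = "\<lambda>s. ?kX (w, s)" and ?k' = "\<lambda>s. ?kL (w, s)"
    have w: "w \<in> \<Omega>" and fi: "set_integrable lebesgue {t<..T} ?f"
      and eq: "\<And>s. t \<le> s \<Longrightarrow> s \<le> T \<Longrightarrow> Y s w + compensated_integral K \<nu> X t s T (\<lambda>q. Z q w) w
         = g (X T w) + (LINT q:{s<..T}|lebesgue. ?f q)"
      and ki: "integrable (time_measure t) ?k" using elim by auto
    have AE: "AE s in time_measure t. ?k s = ?k' s"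
      unfolding AE_time_measure using left_lim_AE[OF w]
      by eventually_elim (use t in \<open>auto simp: left_path_def\<close>)
    have ms: "?k \<in> borel_measurable (time_measure t)" "?k' \<in> borel_measurable (time_measure t)"
      using PT_section[OF borel_measurable_integrable[OF kX] t(1) x w] PT_section[OF kL t(1) x w] by auto
    have ki': "integrable (time_measure t) ?k'"
      using integrable_cong_AE[OF ms AE] ki by simp
    have comp: "compensated_integral K \<nu> X t s T (\<lambda>q. Z q w) w
      = (\<Sum>\<tau>\<in>jumps w \<inter> {s<..T}. Z \<tau> w (X \<tau> w)) - (LINT q:{s<..T}|lebesgue. ?k q)" if s: "t \<le> s" "s \<le> T" for s
    proof -
      have "(LINT q:{s<..T}|lborel. LINT y|\<nu> q (left_lim X q w). Z q w y) = (LINT q:{s<..T}|lborel. ?k' q)"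
        using s by (intro set_lebesgue_integral_cong) (auto simp: left_path_def)
      also have "\<dots> = (\<integral>q. indicator {s<..T} q * ?k' q \<partial>time_measure t)"
        by (rule time_measure_set_integral(3)[OF ki' s(1) order_refl])
      also have "\<dots> = (\<integral>q. indicator {s<..T} q * ?k q \<partial>time_measure t)"
      proof (rule integral_cong_AE)
        have [measurable]: "(indicator {s<..T} :: real \<Rightarrow> real) \<in> borel_measurable (time_measure t)"
          by (rule measurable_time_measure) simp
        note [measurable] = ms
        show "(\<lambda>q. indicator {s<..T} q * ?k' q) \<in> borel_measurable (time_measure t)"
          "(\<lambda>q. indicator {s<..T} q * ?k q) \<in> borel_measurable (time_measure t)" by measurable
        show "AE q in time_measure t. indicator {s<..T} q * ?k' q = indicator {s<..T} q * ?k q"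
          using AE by eventually_elim simp
      qed
      also have "\<dots> = (LINT q:{s<..T}|lebesgue. ?k q)"
        by (rule time_measure_set_integral(2)[OF ki s(1) order_refl, symmetric])
      finally show ?thesis
        using jump_measure_integral[OF t w s(1) Zm] by (simp add: compensated_integral_def)
    qed
    have YT: "Y T w = g (X T w)"
      using eq[of T] comp[of T] t by (simp add: set_lebesgue_integral_def)
    have ks: "set_integrable lebesgue {t<..T} ?k" by (rule time_measure_set_integral(1)[OF ki])
    have sum: "set_integrable lebesgue {t<..T} (\<lambda>s. ?k s + ?f s)" using ks fi by simp
    have "piecewise_ac t T (jumps w) (\<lambda>s. Y s w) (\<lambda>s. - (?k s + ?f s)) (\<lambda>\<tau>. Z \<tau> w (X \<tau> w))"
    proof (rule piecewise_acI)
      show "finite (jumps w \<inter> {t<..T})" using w by simp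
      show "set_integrable lebesgue {t<..T} (\<lambda>s. - (?k s + ?f s))"
        using set_integrable_mult_right[of "-1" lebesgue "{t<..T}" "\<lambda>s. ?k s + ?f s"] sum by simp
      fix s assume s: "t \<le> s" "s \<le> T"
      have i: "set_integrable lebesgue {t<..s} ?k" "set_integrable lebesgue {t<..s} ?f"
        using set_integrable_Ioc_subset[OF ks, of t s] set_integrable_Ioc_subset[OF fi, of t s] s by auto
      have "(LINT q:{t<..s}|lebesgue. - (?k q + ?f q)) = - (LINT q:{t<..s}|lebesgue. ?k q + ?f q)"
        by (simp only: set_lebesgue_integral_def scaleR_minus_right Bochner_Integration.integral_minus)
      also have "\<dots> = - (LINT q:{t<..s}|lebesgue. ?k q) - (LINT q:{t<..s}|lebesgue. ?f q)"
        using i by (simp add: set_integral_add)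
      finally show "Y s w - Y t w = (LINT q:{t<..s}|lebesgue. - (?k q + ?f q)) + (\<Sum>\<tau>\<in>jumps w \<inter> {t<..s}. Z \<tau> w (X \<tau> w))"
        using eq[of s] eq[of t] comp[of s] comp[of t] s t
          set_integral_Ioc_split[OF ks, of t s T] set_integral_Ioc_split[OF fi, of t s T]
          sum_Ioc_split[of "jumps w" t T t s T "\<lambda>\<tau>. Z \<tau> w (X \<tau> w)"] w by simp
    qed
    then show ?case using YT by simp
  qed
qed

lemma left_value_measurable:
  assumes v: "hjb_solution T K \<nu> X P g f v" and t: "0 \<le> t" "t \<le> T"
  shows "(\<lambda>p. v (snd p) (left_path t (snd p) (fst p))) \<in> borel_measurable (Pred t)"
proof (rule measurable_value[OF v predictable_snd[OF t]])
  show "(\<lambda>p. left_path t (snd p) (fst p)) \<in> Pred t \<rightarrow>\<^sub>M K"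
    using predictable_left_path[OF t] by (simp add: case_prod_beta')
qed (use t in auto)

lemma value_pair_measurable:
  assumes v: "hjb_solution T K \<nu> X P g f v" and t: "0 \<le> t" "t \<le> T"
  shows "(\<lambda>q. v (snd (fst q)) (snd q)) \<in> borel_measurable (Pred t \<Otimes>\<^sub>M K)"
proof (rule measurable_value[OF v])
  show "(\<lambda>q. snd (fst q)) \<in> borel_measurable (Pred t \<Otimes>\<^sub>M K)"
    using predictable_snd[OF t] by measurable
qed (use t in \<open>auto simp: space_pair_measure\<close>)

lemma value_difference_measurable:
  assumes v: "hjb_solution T K \<nu> X P g f v" and t: "0 \<le> t" "t \<le> T" and x: "x \<in> space K"
  shows "(\<lambda>q. v (snd (fst q)) (snd q) - v (snd (fst q)) (X (snd (fst q)) (fst (fst q)))) \<in> borel_measurable (PT t x \<Otimes>\<^sub>M K)"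
    "(\<lambda>q. v (snd (fst q)) (snd q) - v (snd (fst q)) (left_path t (snd (fst q)) (fst (fst q)))) \<in> borel_measurable (Pred t \<Otimes>\<^sub>M K)"
proof -
  have [measurable]: "(\<lambda>p. v (snd p) (X (snd p) (fst p))) \<in> borel_measurable (PT t x)"
    by (rule measurable_value[OF v PT_snd PT_path]) (use t x in auto)
  have [measurable]: "(\<lambda>q. v (snd (fst q)) (snd q)) \<in> borel_measurable (PT t x \<Otimes>\<^sub>M K)"
    by (rule PT_measurable[OF value_pair_measurable[OF v t] t x])
  show "(\<lambda>q. v (snd (fst q)) (snd q) - v (snd (fst q)) (X (snd (fst q)) (fst (fst q)))) \<in> borel_measurable (PT t x \<Otimes>\<^sub>M K)"
    by measurable
  show "(\<lambda>q. v (snd (fst q)) (snd q) - v (snd (fst q)) (left_path t (snd (fst q)) (fst (fst q)))) \<in> borel_measurable (Pred t \<Otimes>\<^sub>M K)"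
    using left_value_measurable[OF v t] value_pair_measurable[OF v t] by measurable
qed

lemma value_difference_finite:
  assumes v: "hjb_solution T K \<nu> X P g f v" and t: "0 \<le> t" "t \<le> T" and x: "x \<in> space K"
  shows "(\<integral>\<^sup>+p. (\<integral>\<^sup>+y. ennreal ((v (snd p) y - v (snd p) (X (snd p) (fst p)))\<^sup>2) \<partial>rate p) \<partial>PT t x) < \<infinity>"
    "(\<integral>\<^sup>+p. (\<integral>\<^sup>+y. ennreal ((v (snd p) y - v (snd p) (left_path t (snd p) (fst p)))\<^sup>2) \<partial>rate p) \<partial>PT t x) < \<infinity>"
    "AE p in PT t x. (\<lambda>y. v (snd p) y - v (snd p) (X (snd p) (fst p))) \<in> square_integrable (rate p)"
proof -
  let ?V = "\<lambda>q. v (snd (fst q)) (snd q) - v (snd (fst q)) (X (snd (fst q)) (fst (fst q)))"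
  let ?V' = "\<lambda>q. v (snd (fst q)) (snd q) - v (snd (fst q)) (left_path t (snd (fst q)) (fst (fst q)))"
  note Vm = value_difference_measurable(1)[OF v t x]
  have "(\<lambda>q. ennreal ((?V q)\<^sup>2)) \<in> borel_measurable (PT t x \<Otimes>\<^sub>M K)" using Vm by measurable
  from PT_nn_integral_rate[OF t x this]
  have V2: "(\<lambda>p. \<integral>\<^sup>+y. ennreal ((?V (p, y))\<^sup>2) \<partial>rate p) \<in> borel_measurable (PT t x)" .
  have "(\<lambda>q. ennreal ((?V' q)\<^sup>2)) \<in> borel_measurable (PT t x \<Otimes>\<^sub>M K)"
    using PT_measurable[OF value_difference_measurable(2)[OF v t x] t x] by measurable
  from PT_nn_integral_rate[OF t x this]
  have V'2: "(\<lambda>p. \<integral>\<^sup>+y. ennreal ((?V' (p, y))\<^sup>2) \<partial>rate p) \<in> borel_measurable (PT t x)" .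
  have fin: "(\<integral>\<^sup>+p. (\<integral>\<^sup>+y. ennreal ((?V (p, y))\<^sup>2) \<partial>rate p) \<partial>PT t x) < \<infinity>"
    unfolding nn_integral_PT[OF V2] using v t x by (simp add: hjb_solution_def)
  then show "(\<integral>\<^sup>+p. (\<integral>\<^sup>+y. ennreal ((v (snd p) y - v (snd p) (X (snd p) (fst p)))\<^sup>2) \<partial>rate p) \<partial>PT t x) < \<infinity>" by simp
  have "(\<integral>\<^sup>+p. (\<integral>\<^sup>+y. ennreal ((?V (p, y))\<^sup>2) \<partial>rate p) \<partial>PT t x) = (\<integral>\<^sup>+p. (\<integral>\<^sup>+y. ennreal ((?V' (p, y))\<^sup>2) \<partial>rate p) \<partial>PT t x)"
    by (rule nn_integral_cong_AE[OF PT_AE_left_path[OF t(1) x V2 V'2]]) simp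
  then show "(\<integral>\<^sup>+p. (\<integral>\<^sup>+y. ennreal ((v (snd p) y - v (snd p) (left_path t (snd p) (fst p)))\<^sup>2) \<partial>rate p) \<partial>PT t x) < \<infinity>"
    using fin by simp
  have "AE p in PT t x. (\<integral>\<^sup>+y. ennreal ((?V (p, y))\<^sup>2) \<partial>rate p) \<noteq> \<infinity>" using fin V2 by (intro nn_integral_PInf_AE) auto
  then show "AE p in PT t x. (\<lambda>y. v (snd p) y - v (snd p) (X (snd p) (fst p))) \<in> square_integrable (rate p)" using AE_space
  proof eventually_elim
    case (elim p)
    then show ?case using PT_section_measurable[OF Vm elim(2) t(1) x] by (simp add: square_integrable_def less_top)
  qed
qed

end

section \<open>Uniqueness for the backward equation\<close>

lemma diff_square_le: "(a - b)\<^sup>2 \<le> 2 * a\<^sup>2 + 2 * b\<^sup>2" for a b :: real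
proof -
  have "0 \<le> (a + b)\<^sup>2" by simp
  then show ?thesis by (simp add: power2_eq_square algebra_simps)
qed

locale bsde_comparison = markov_jump_process T K \<nu> \<Omega> X P
  for T :: real and K :: "'k measure" and \<nu> :: "real \<Rightarrow> 'k \<Rightarrow> 'k measure" and \<Omega> :: "'w set"
    and X :: "real \<Rightarrow> 'w \<Rightarrow> 'k" and P :: "real \<Rightarrow> 'k \<Rightarrow> 'w measure" +
  fixes t :: real and x :: 'k and g :: "'k \<Rightarrow> real" and f :: "real \<Rightarrow> 'k \<Rightarrow> ('k \<Rightarrow> real) \<Rightarrow> real"
    and v :: "real \<Rightarrow> 'k \<Rightarrow> real" and Y :: "real \<Rightarrow> 'w \<Rightarrow> real" and Z :: "real \<Rightarrow> 'w \<Rightarrow> 'k \<Rightarrow> real" and C :: real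
  assumes t: "0 \<le> t" "t \<le> T" and x: "x \<in> space K"
    and v: "hjb_solution T K \<nu> X P g f v"
    and sol: "bsde_solution T K \<nu> \<Omega> X P g f t x Y Z"
    and C: "0 \<le> C"
    and lip: "\<And>s y z z'. 0 \<le> s \<Longrightarrow> s \<le> T \<Longrightarrow> y \<in> space K \<Longrightarrow> z \<in> square_integrable (\<nu> s y) \<Longrightarrow>
      z' \<in> square_integrable (\<nu> s y) \<Longrightarrow> \<bar>f s y z - f s y z'\<bar> \<le> C * (LINT a|\<nu> s y. \<bar>z a - z' a\<bar>)"
begin

definition D :: "real \<Rightarrow> 'w \<Rightarrow> real" where
  "D s w = Y s w - v s (X s w)"

definition dY :: "'w \<times> real \<Rightarrow> real" where
  "dY p = D (snd p) (fst p)"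

definition dZ :: "('w \<times> real) \<times> 'k \<Rightarrow> real" where
  "dZ q = Z (snd (fst q)) (fst (fst q)) (snd q)
    - (v (snd (fst q)) (snd q) - v (snd (fst q)) (left_path t (snd (fst q)) (fst (fst q))))"

text \<open>The left limit of \<open>D\<close>. Taking \<open>lim\<close> along the grid defines it
  on every path, so it is predictable everywhere, while \<open>D\<close> is known to have left
  limits only almost surely.\<close>

definition W :: "'w \<times> real \<Rightarrow> real" where
  "W p = lim (\<lambda>n. D (grid_left t n (snd p)) (fst p))"

lemma PT_rate:
  assumes "p \<in> space (PT t x)"
  shows "0 \<le> snd p" "snd p \<le> T" "X (snd p) (fst p) \<in> space K" "finite_measure (rate p)" "space (rate p) = space K"
  using assms t x path_range finite_measure_rate[of "snd p" "X (snd p) (fst p)"] space_rate by auto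

lemma dY_measurable: "dY \<in> borel_measurable (PT t x)"
proof -
  have "(\<lambda>p. Y (snd p) (fst p)) \<in> borel_measurable (PT t x)"
    using measurable_compose[OF PT_to_progressive[OF t x] bsde_measurable(1)[OF sol]] by (simp add: case_prod_beta')
  moreover have "(\<lambda>p. v (snd p) (X (snd p) (fst p))) \<in> borel_measurable (PT t x)"
    by (rule measurable_value[OF v PT_snd PT_path]) (use t x in auto)
  ultimately show ?thesis unfolding dY_def D_def by measurable
qed

lemma dZ_measurable: "dZ \<in> borel_measurable (Pred t \<Otimes>\<^sub>M K)"
  using bsde_measurable(2)[OF sol] left_value_measurable[OF v t] value_pair_measurable[OF v t]
  unfolding dZ_def[abs_def] by measurable

lemmas dZ_measurable_PT = PT_measurable[OF dZ_measurable t x]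

lemma D_adapted:
  assumes s: "t \<le> s" "s \<le> T"
  shows "D s \<in> borel_measurable (\<F> {t..s})"
proof -
  have "(\<lambda>w. (w, s)) \<in> \<F> {t..s} \<rightarrow>\<^sub>M \<F> {t..s} \<Otimes>\<^sub>M borel" by simp
  from measurable_compose[OF measurable_compose[OF this measurable_clamp_progressive[OF s]] bsde_measurable(1)[OF sol]]
  have "(\<lambda>w. Y s w) \<in> borel_measurable (\<F> {t..s})" using s by simp
  moreover have "(\<lambda>w. v s (X s w)) \<in> borel_measurable (\<F> {t..s})"
    by (rule measurable_value[OF v _ measurable_path]) (use s t in auto)
  ultimately show ?thesis unfolding D_def[abs_def] by measurable
qed

lemma W_measurable: "W \<in> borel_measurable (Pred t)"
proof -
  have "(\<lambda>p. D (grid_left t n (snd p)) (fst p)) \<in> borel_measurable (Pred t)" for n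
    using predictable_grid[OF t D_adapted] by (simp add: case_prod_beta')
  then show ?thesis unfolding W_def[abs_def] by (rule borel_measurable_lim_metric)
qed

lemma W_measurable_PT: "W \<in> borel_measurable (PT t x)"
  using measurable_compose[OF PT_to_predictable[OF t x] W_measurable] by simp

lemma dY_finite: "(\<integral>\<^sup>+p. ennreal ((dY p)\<^sup>2) \<partial>PT t x) < \<infinity>"
proof -
  let ?V = "\<lambda>p. v (snd p) (X (snd p) (fst p))"
  have V[measurable]: "?V \<in> borel_measurable (PT t x)"
    by (rule measurable_value[OF v PT_snd PT_path]) (use t x in auto)
  have Ym[measurable]: "(\<lambda>p. Y (snd p) (fst p)) \<in> borel_measurable (PT t x)"
    using measurable_compose[OF PT_to_progressive[OF t x] bsde_measurable(1)[OF sol]] by (simp add: case_prod_beta')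
  have "(\<integral>\<^sup>+p. ennreal ((?V p)\<^sup>2) \<partial>PT t x) < \<infinity>"
    using v t x by (subst nn_integral_PT) (auto simp: hjb_solution_def)
  moreover have "(\<integral>\<^sup>+p. ennreal ((dY p)\<^sup>2) \<partial>PT t x)
      \<le> (\<integral>\<^sup>+p. ennreal 2 * ennreal ((Y (snd p) (fst p))\<^sup>2) + ennreal 2 * ennreal ((?V p)\<^sup>2) \<partial>PT t x)"
    using diff_square_le unfolding dY_def D_def
    by (intro nn_integral_mono) (simp flip: ennreal_mult ennreal_plus del: ennreal_numeral)
  moreover have "\<dots> = ennreal 2 * (\<integral>\<^sup>+p. ennreal ((Y (snd p) (fst p))\<^sup>2) \<partial>PT t x) + ennreal 2 * (\<integral>\<^sup>+p. ennreal ((?V p)\<^sup>2) \<partial>PT t x)"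
    by (simp add: nn_integral_add nn_integral_cmult del: ennreal_numeral)
  ultimately show ?thesis
    using bsde_finite(1)[OF t x sol] by (auto simp: ennreal_mult_less_top intro: le_less_trans simp del: ennreal_numeral)
qed

lemma dZ_finite: "(\<integral>\<^sup>+p. (\<integral>\<^sup>+y. ennreal ((dZ (p, y))\<^sup>2) \<partial>rate p) \<partial>PT t x) < \<infinity>"
proof -
  let ?V' = "\<lambda>q. v (snd (fst q)) (snd q) - v (snd (fst q)) (left_path t (snd (fst q)) (fst (fst q)))"
  let ?Z = "\<lambda>q. Z (snd (fst q)) (fst (fst q)) (snd q)"
  have V'm[measurable]: "?V' \<in> borel_measurable (PT t x \<Otimes>\<^sub>M K)"
    by (rule PT_measurable[OF value_difference_measurable(2)[OF v t x] t x])
  have Zm[measurable]: "?Z \<in> borel_measurable (PT t x \<Otimes>\<^sub>M K)" by (rule PT_measurable[OF bsde_measurable(2)[OF sol] t x])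
  have V'2: "(\<lambda>p. \<integral>\<^sup>+y. ennreal ((?V' (p, y))\<^sup>2) \<partial>rate p) \<in> borel_measurable (PT t x)"
    using PT_nn_integral_rate[OF t x, of "\<lambda>q. ennreal ((?V' q)\<^sup>2)"] by simp
  have Z2: "(\<lambda>p. \<integral>\<^sup>+y. ennreal ((?Z (p, y))\<^sup>2) \<partial>rate p) \<in> borel_measurable (PT t x)"
    using PT_nn_integral_rate[OF t x, of "\<lambda>q. ennreal ((?Z q)\<^sup>2)"] by simp
  have V'fin: "(\<integral>\<^sup>+p. (\<integral>\<^sup>+y. ennreal ((?V' (p, y))\<^sup>2) \<partial>rate p) \<partial>PT t x) < \<infinity>"
    using value_difference_finite(2)[OF v t x] by simp
  have Zfin: "(\<integral>\<^sup>+p. (\<integral>\<^sup>+y. ennreal ((?Z (p, y))\<^sup>2) \<partial>rate p) \<partial>PT t x) < \<infinity>"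
    using bsde_finite(2)[OF t x sol] by simp
  have "(\<integral>\<^sup>+p. (\<integral>\<^sup>+y. ennreal ((dZ (p, y))\<^sup>2) \<partial>rate p) \<partial>PT t x)
      \<le> (\<integral>\<^sup>+p. ennreal 2 * (\<integral>\<^sup>+y. ennreal ((?Z (p, y))\<^sup>2) \<partial>rate p) + ennreal 2 * (\<integral>\<^sup>+y. ennreal ((?V' (p, y))\<^sup>2) \<partial>rate p) \<partial>PT t x)"
  proof (rule nn_integral_mono)
    fix p assume p: "p \<in> space (PT t x)"
    have [measurable]: "(\<lambda>y. ?Z (p, y)) \<in> borel_measurable (rate p)" "(\<lambda>y. ?V' (p, y)) \<in> borel_measurable (rate p)"
      using PT_section_measurable[OF Zm p t(1) x] PT_section_measurable[OF V'm p t(1) x] by auto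
    have "(\<integral>\<^sup>+y. ennreal ((dZ (p, y))\<^sup>2) \<partial>rate p) \<le> (\<integral>\<^sup>+y. ennreal 2 * ennreal ((?Z (p, y))\<^sup>2) + ennreal 2 * ennreal ((?V' (p, y))\<^sup>2) \<partial>rate p)"
      using diff_square_le unfolding dZ_def
      by (intro nn_integral_mono) (simp flip: ennreal_mult ennreal_plus del: ennreal_numeral)
    also have "\<dots> = ennreal 2 * (\<integral>\<^sup>+y. ennreal ((?Z (p, y))\<^sup>2) \<partial>rate p) + ennreal 2 * (\<integral>\<^sup>+y. ennreal ((?V' (p, y))\<^sup>2) \<partial>rate p)"
    proof -
      have "(\<integral>\<^sup>+y. ennreal 2 * ennreal ((a y)\<^sup>2) + ennreal 2 * ennreal ((b y)\<^sup>2) \<partial>N)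
        = ennreal 2 * (\<integral>\<^sup>+y. ennreal ((a y)\<^sup>2) \<partial>N) + ennreal 2 * (\<integral>\<^sup>+y. ennreal ((b y)\<^sup>2) \<partial>N)"
        if [measurable]: "a \<in> borel_measurable N" "b \<in> borel_measurable N" for a b :: "'k \<Rightarrow> real" and N
        by (simp add: nn_integral_add nn_integral_cmult del: ennreal_numeral)
      from this[OF PT_section_measurable[OF Zm p t(1) x] PT_section_measurable[OF V'm p t(1) x]] show ?thesis .
    qed
    finally show "(\<integral>\<^sup>+y. ennreal ((dZ (p, y))\<^sup>2) \<partial>rate p) \<le> \<dots>" .
  qed
  also have "\<dots> = ennreal 2 * (\<integral>\<^sup>+p. (\<integral>\<^sup>+y. ennreal ((?Z (p, y))\<^sup>2) \<partial>rate p) \<partial>PT t x) + ennreal 2 * (\<integral>\<^sup>+p. (\<integral>\<^sup>+y. ennreal ((?V' (p, y))\<^sup>2) \<partial>rate p) \<partial>PT t x)"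
    using Z2 V'2 by (simp add: nn_integral_add nn_integral_cmult del: ennreal_numeral)
  also have "\<dots> < \<infinity>" using Zfin V'fin by (simp add: ennreal_mult_less_top del: ennreal_numeral)
  finally show ?thesis .
qed

definition drift :: "'w \<Rightarrow> real \<Rightarrow> real" where
  "drift w s = - ((LINT y|\<nu> s (X s w). Z s w y) + f s (X s w) (Z s w))
    + (generator \<nu> s (v s) (X s w) + f s (X s w) (\<lambda>y. v s y - v s (X s w)))"

lemma D_along_path:
  "AE w in P t x. w \<in> \<Omega> \<and> piecewise_ac t T (jumps w) (\<lambda>s. D s w) (drift w) (\<lambda>\<tau>. if t < \<tau> then dZ ((w, \<tau>), X \<tau> w) else 0) \<and> D T w = 0"
proof -
  have "AE w in P t x. w \<in> \<Omega>" using t x by (intro AE_I2) simp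
  then show ?thesis using bsde_along_path[OF t x sol]
  proof eventually_elim
    case (elim w)
    have w: "w \<in> \<Omega>" by fact
    let ?j = "\<lambda>\<tau>. Z \<tau> w (X \<tau> w) + - (v \<tau> (X \<tau> w) - v \<tau> (left_lim X \<tau> w))"
    have "piecewise_ac t T (jumps w) (\<lambda>s. Y s w + - v s (X s w))
      (\<lambda>s. - ((LINT y|\<nu> s (X s w). Z s w y) + f s (X s w) (Z s w))
        + - (- (generator \<nu> s (v s) (X s w) + f s (X s w) (\<lambda>y. v s y - v s (X s w))))) ?j"
      by (rule piecewise_ac_add[OF _ piecewise_ac_minus[OF value_along_path[OF v w t]]]) (use elim in simp)
    then have pw: "piecewise_ac t T (jumps w) (\<lambda>s. D s w) (drift w) ?j"
      by (simp add: D_def drift_def[abs_def] ac_simps)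
    have S: "(\<Sum>\<tau>\<in>jumps w \<inter> {t<..s}. ?j \<tau>) = (\<Sum>\<tau>\<in>jumps w \<inter> {t<..s}. if t < \<tau> then dZ ((w, \<tau>), X \<tau> w) else 0)" for s
      by (intro sum.cong) (auto simp: dZ_def left_path_def)
    have "piecewise_ac t T (jumps w) (\<lambda>s. D s w) (drift w) (\<lambda>\<tau>. if t < \<tau> then dZ ((w, \<tau>), X \<tau> w) else 0)"
      using pw unfolding piecewise_ac_def S .
    moreover have "v T (X T w) = g (X T w)"
      using v t path_range[OF _ w, of T] by (auto simp: hjb_solution_def set_lebesgue_integral_def)
    ultimately show ?case using w elim by (simp add: D_def)
  qed
qed

lemma W_eq:
  assumes "piecewise_ac t T (jumps w) (\<lambda>s. D s w) (drift w) (\<lambda>\<tau>. if t < \<tau> then dZ ((w, \<tau>), X \<tau> w) else 0)"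
    and s: "t < s" "s \<le> T"
  shows "W (w, s) = D s w - (if s \<in> jumps w then dZ ((w, s), X s w) else 0)"
proof -
  have "(\<lambda>n. D (grid_left t n s) w) \<longlonglongrightarrow> D s w - (if s \<in> jumps w then if t < s then dZ ((w, s), X s w) else 0 else 0)"
    by (rule piecewise_ac_left_limit[OF assms(1) s grid_left_ge grid_left_less[OF s(1)] grid_left_tendsto[OF s(1)]])
  from limI[OF this] show ?thesis using s by (simp add: W_def)
qed

lemma W_AE: "AE p in PT t x. W p = dY p"
proof (rule PT_AE_I[OF t(1) x])
  show "{p \<in> space (PT t x). W p = dY p} \<in> sets (PT t x)" using W_measurable_PT dY_measurable by measurable
  show "AE w in P t x. AE s in lborel. t < s \<longrightarrow> s \<le> T \<longrightarrow> W (w, s) = dY (w, s)"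
    using D_along_path
  proof eventually_elim
    case (elim w)
    then have "w \<in> \<Omega>" by simp
    have "AE s in lborel. s \<notin> jumps w \<inter> {..T}"
      by (intro AE_not_in finite_imp_null_set_lborel finite_jumps[OF \<open>w \<in> \<Omega>\<close>])
    then show ?case by eventually_elim (use W_eq elim in \<open>auto simp: dY_def\<close>)
  qed
qed

lemma dZ_abs_finite: "(\<integral>\<^sup>+p. (\<integral>\<^sup>+y. ennreal \<bar>dZ (p, y)\<bar> \<partial>rate p) \<partial>PT t x) < \<infinity>"
  by (rule PT_sq_imp_abs_finite[OF t x dZ_measurable_PT dZ_finite])

lemma dZ_integrable: "AE p in PT t x. integrable (rate p) (\<lambda>y. dZ (p, y)) \<and> integrable (rate p) (\<lambda>y. (dZ (p, y))\<^sup>2)"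
proof -
  have "(\<lambda>q. (dZ q)\<^sup>2) \<in> borel_measurable (PT t x \<Otimes>\<^sub>M K)" using dZ_measurable_PT by measurable
  from PT_rate_integrable(1)[OF t x this] PT_rate_integrable(1)[OF t x dZ_measurable_PT dZ_abs_finite] dZ_finite
  show ?thesis by (auto elim: eventually_elim2)
qed

lemma mult_dZ_finite:
  assumes k: "k \<in> borel_measurable (PT t x)" "(\<integral>\<^sup>+p. ennreal ((k p)\<^sup>2) \<partial>PT t x) < \<infinity>"
  shows "(\<integral>\<^sup>+p. (\<integral>\<^sup>+y. ennreal \<bar>k p * dZ (p, y)\<bar> \<partial>rate p) \<partial>PT t x) < \<infinity>"
proof -
  have "(\<integral>\<^sup>+p. (\<integral>\<^sup>+y. ennreal \<bar>(\<lambda>q. k (fst q) * dZ q) (p, y)\<bar> \<partial>rate p) \<partial>PT t x) < \<infinity>"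
  proof (rule PT_rate_finite[OF t x, where k = "\<lambda>p. (k p)\<^sup>2" and G = "\<lambda>q. (dZ q)\<^sup>2"])
    show "(\<lambda>p. (k p)\<^sup>2) \<in> borel_measurable (PT t x)" using k by measurable
    show "(\<lambda>q. (dZ q)\<^sup>2) \<in> borel_measurable (PT t x \<Otimes>\<^sub>M K)" using dZ_measurable_PT by measurable
    fix p y
    have "2 * (\<bar>k p\<bar> * \<bar>dZ (p, y)\<bar>) \<le> (k p)\<^sup>2 + (dZ (p, y))\<^sup>2"
      using sum_squares_bound[of "\<bar>k p\<bar>" "\<bar>dZ (p, y)\<bar>"] by simp
    moreover have "0 \<le> \<bar>k p\<bar> * \<bar>dZ (p, y)\<bar>" by simp
    ultimately show "\<bar>(\<lambda>q. k (fst q) * dZ q) (p, y)\<bar> \<le> (k p)\<^sup>2 + (dZ (p, y))\<^sup>2"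
      unfolding fst_conv abs_mult by linarith
  qed (use k dZ_finite in auto)
  then show ?thesis by simp
qed

definition mZ :: "'w \<times> real \<Rightarrow> real" where
  "mZ p = (LINT y|rate p. dZ (p, y))"

definition nZ :: "'w \<times> real \<Rightarrow> real" where
  "nZ p = (LINT y|rate p. \<bar>dZ (p, y)\<bar>)"

definition qZ :: "'w \<times> real \<Rightarrow> real" where
  "qZ p = (LINT y|rate p. (dZ (p, y))\<^sup>2)"

text \<open>A jointly measurable majorant of \<open>- 2 * D * drift\<close>, the rate at which the
  square of \<open>D\<close> decreases: the drift is \<open>- mZ\<close> up to an error of at most
  \<open>C * nZ\<close>.\<close>

definition bound :: "'w \<times> real \<Rightarrow> real" where
  "bound p = 2 * (dY p * mZ p) + 2 * C * (\<bar>dY p\<bar> * nZ p)"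

lemma qZ_integrable: "integrable (PT t x) qZ"
proof -
  have "(\<lambda>q. (dZ q)\<^sup>2) \<in> borel_measurable (PT t x \<Otimes>\<^sub>M K)" using dZ_measurable_PT by measurable
  from PT_rate_integrable(2)[OF t x this] dZ_finite show ?thesis by (simp add: qZ_def[abs_def])
qed

lemma bound_integrable: "integrable (PT t x) bound"
proof -
  have m: "(\<lambda>q. dY (fst q) * dZ q) \<in> borel_measurable (PT t x \<Otimes>\<^sub>M K)"
    "(\<lambda>q. \<bar>dY (fst q)\<bar> * \<bar>dZ q\<bar>) \<in> borel_measurable (PT t x \<Otimes>\<^sub>M K)"
    using dY_measurable dZ_measurable_PT by measurable
  note fin = mult_dZ_finite[OF dY_measurable dY_finite]
  have "integrable (PT t x) (\<lambda>p. dY p * mZ p)"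
    using PT_rate_integrable(2)[OF t x m(1)] fin by (simp add: mZ_def)
  moreover have "integrable (PT t x) (\<lambda>p. \<bar>dY p\<bar> * nZ p)"
    using PT_rate_integrable(2)[OF t x m(2)] fin by (simp add: nZ_def abs_mult)
  ultimately show ?thesis unfolding bound_def[abs_def] by (intro Bochner_Integration.integrable_add integrable_mult_right)
qed

text \<open>\<open>(W + dZ)\<^sup>2 - W\<^sup>2\<close>, the jump of the square of \<open>D\<close>,
  restricted to jumps after \<open>s\<close>.\<close>

definition jump_term :: "real \<Rightarrow> ('w \<times> real) \<times> 'k \<Rightarrow> real" where
  "jump_term s q = indicator {s<..T} (snd (fst q)) * (2 * W (fst q) * dZ q + (dZ q)\<^sup>2)"

lemma jump_term_measurable: "jump_term s \<in> borel_measurable (Pred t \<Otimes>\<^sub>M K)"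
  unfolding jump_term_def[abs_def] using W_measurable dZ_measurable predictable_snd[OF t] by measurable

lemma W_finite: "(\<integral>\<^sup>+p. ennreal ((W p)\<^sup>2) \<partial>PT t x) < \<infinity>"
proof -
  have "(\<integral>\<^sup>+p. ennreal ((W p)\<^sup>2) \<partial>PT t x) = (\<integral>\<^sup>+p. ennreal ((dY p)\<^sup>2) \<partial>PT t x)"
    by (rule nn_integral_cong_AE) (use W_AE in \<open>eventually_elim, simp\<close>)
  then show ?thesis using dY_finite by simp
qed

lemma jump_term_finite: "(\<integral>\<^sup>+p. (\<integral>\<^sup>+y. ennreal \<bar>jump_term s (p, y)\<bar> \<partial>rate p) \<partial>PT t x) < \<infinity>"
proof (rule PT_rate_finite[OF t x, where k = "\<lambda>p. (W p)\<^sup>2" and G = "\<lambda>q. 2 * (dZ q)\<^sup>2"])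
  show "(\<lambda>p. (W p)\<^sup>2) \<in> borel_measurable (PT t x)" using W_measurable_PT by measurable
  show "(\<lambda>q. 2 * (dZ q)\<^sup>2) \<in> borel_measurable (PT t x \<Otimes>\<^sub>M K)" using dZ_measurable_PT by measurable
  have Z2: "(\<lambda>q. ennreal ((dZ q)\<^sup>2)) \<in> borel_measurable (PT t x \<Otimes>\<^sub>M K)" using dZ_measurable_PT by measurable
  have "(\<integral>\<^sup>+p. (\<integral>\<^sup>+y. ennreal (2 * (dZ (p, y))\<^sup>2) \<partial>rate p) \<partial>PT t x) = (\<integral>\<^sup>+p. ennreal 2 * (\<integral>\<^sup>+y. ennreal ((dZ (p, y))\<^sup>2) \<partial>rate p) \<partial>PT t x)"
    using PT_section_measurable[OF Z2 _ t(1) x]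
    by (intro nn_integral_cong) (simp add: ennreal_mult nn_integral_cmult del: ennreal_numeral)
  also have "\<dots> = ennreal 2 * (\<integral>\<^sup>+p. (\<integral>\<^sup>+y. ennreal ((dZ (p, y))\<^sup>2) \<partial>rate p) \<partial>PT t x)"
    by (rule nn_integral_cmult[OF PT_nn_integral_rate[OF t x Z2]])
  finally show "(\<integral>\<^sup>+p. (\<integral>\<^sup>+y. ennreal (2 * (dZ (p, y))\<^sup>2) \<partial>rate p) \<partial>PT t x) < \<infinity>"
    using dZ_finite by (simp add: ennreal_mult_less_top del: ennreal_numeral)
  fix p y
  have "\<bar>2 * W p * dZ (p, y) + (dZ (p, y))\<^sup>2\<bar> \<le> 2 * \<bar>W p\<bar> * \<bar>dZ (p, y)\<bar> + (dZ (p, y))\<^sup>2"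
    by (rule order_trans[OF abs_triangle_ineq]) (simp add: abs_mult)
  also have "\<dots> \<le> (W p)\<^sup>2 + 2 * (dZ (p, y))\<^sup>2"
    using sum_squares_bound[of "\<bar>W p\<bar>" "\<bar>dZ (p, y)\<bar>"] by simp
  finally show "\<bar>jump_term s (p, y)\<bar> \<le> (W p)\<^sup>2 + 2 * (dZ (p, y))\<^sup>2"
    by (cases "snd p \<in> {s<..T}") (simp_all add: jump_term_def)
qed (use W_finite in auto)

lemma square_integrable_sections:
  "AE p in PT t x. (\<lambda>y. Z (snd p) (fst p) y) \<in> square_integrable (rate p)
    \<and> (\<lambda>y. v (snd p) y - v (snd p) (X (snd p) (fst p))) \<in> square_integrable (rate p)"
proof -
  let ?Z = "\<lambda>q. Z (snd (fst q)) (fst (fst q)) (snd q)"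
  have Zm[measurable]: "?Z \<in> borel_measurable (PT t x \<Otimes>\<^sub>M K)" by (rule PT_measurable[OF bsde_measurable(2)[OF sol] t x])
  have Z2: "(\<lambda>p. \<integral>\<^sup>+y. ennreal ((?Z (p, y))\<^sup>2) \<partial>rate p) \<in> borel_measurable (PT t x)"
    using PT_nn_integral_rate[OF t x, of "\<lambda>q. ennreal ((?Z q)\<^sup>2)"] by simp
  have "AE p in PT t x. (\<integral>\<^sup>+y. ennreal ((?Z (p, y))\<^sup>2) \<partial>rate p) \<noteq> \<infinity>"
    using bsde_finite(2)[OF t x sol] Z2 by (intro nn_integral_PInf_AE) auto
  then show ?thesis using value_difference_finite(3)[OF v t x] AE_space
  proof eventually_elim
    case (elim p)
    then show ?case using PT_section_measurable[OF Zm elim(3) t(1) x] by (simp add: square_integrable_def less_top)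
  qed
qed

text \<open>The generator of \<open>v\<close> and the compensator of \<open>Z\<close> combine to
  exactly \<open>- mZ\<close>; what remains is a difference of two values of the driver, to which
  \<open>lip\<close> applies.\<close>

lemma drift_bound:
  "AE w in P t x. AE s in lborel. t < s \<longrightarrow> s \<le> T \<longrightarrow> \<bar>drift w s + mZ (w, s)\<bar> \<le> C * nZ (w, s)"
proof -
  have "AE w in P t x. w \<in> \<Omega>" using t x by (intro AE_I2) simp
  then show ?thesis using PT_AE_D[OF t(1) x square_integrable_sections]
  proof eventually_elim
    case (elim w)
    have w: "w \<in> \<Omega>" by fact
    show ?case using elim(2) left_lim_AE[OF w]
    proof eventually_elim
      case (elim s)
      show ?case
      proof (intro impI)
        assume s: "t < s" "s \<le> T"
        let ?N = "\<nu> s (X s w)" and ?z = "\<lambda>y. Z s w y" and ?z' = "\<lambda>y. v s y - v s (X s w)"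
        have s0: "0 \<le> s" using s t by simp
        have Xs: "X s w \<in> space K" by (rule path_range[OF s0 w])
        have sq: "?z \<in> square_integrable ?N" "?z' \<in> square_integrable ?N" using elim s by auto
        have N: "finite_measure ?N" by (rule finite_measure_rate[OF s0 s(2) Xs])
        note i = square_integrable_integrable(1)[OF N sq(1)] square_integrable_integrable(1)[OF N sq(2)]
        have dz: "dZ ((w, s), y) = ?z y - ?z' y" for y
          using elim s s0 t by (simp add: dZ_def left_path_def)
        have "mZ (w, s) = (LINT y|?N. ?z y) - (LINT y|?N. ?z' y)"
          unfolding mZ_def dz snd_conv fst_conv using i by (rule Bochner_Integration.integral_diff)
        then have "drift w s + mZ (w, s) = f s (X s w) ?z' - f s (X s w) ?z"
          by (simp add: drift_def generator_def)
        moreover have "nZ (w, s) = (LINT y|?N. \<bar>?z' y - ?z y\<bar>)"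
          unfolding nZ_def dz snd_conv fst_conv by (simp only: abs_minus_commute)
        ultimately show "\<bar>drift w s + mZ (w, s)\<bar> \<le> C * nZ (w, s)"
          using lip[OF s0 s(2) Xs sq(2,1)] by simp
      qed
    qed
  qed
qed

text \<open>The product rule from \<open>s\<close> to \<open>T\<close> with
  \<open>D T w = 0\<close>. One null set serves all \<open>s\<close>, which later permits a
  statement for all times at once.\<close>

lemma square_along_path:
  "AE w in P t x. \<forall>s\<in>{t..T}. (D s w)\<^sup>2 \<le> (\<integral>q. indicator {s<..T} q * bound (w, q) \<partial>time_measure t)
    - (\<Sum>\<tau>\<in>jumps w \<inter> {t<..T}. jump_term s ((w, \<tau>), X \<tau> w))"
  using D_along_path drift_bound PT_integrable_section(1)[OF t(1) x bound_integrable]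
proof eventually_elim
  case (elim w)
  let ?j = "\<lambda>\<tau>. if t < \<tau> then dZ ((w, \<tau>), X \<tau> w) else 0"
  have w: "w \<in> \<Omega>" and pw: "piecewise_ac t T (jumps w) (\<lambda>s. D s w) (drift w) ?j" and DT: "D T w = 0"
    using elim by auto
  have bi: "integrable (time_measure t) (\<lambda>s. bound (w, s))" using elim by simp
  note bs = time_measure_set_integral(1)[OF bi]
  note pm = piecewise_ac_mult[OF pw pw t(2)]
  let ?\<psi> = "\<lambda>s. D s w * drift w s + D s w * drift w s"
  have \<psi>: "set_integrable lebesgue {t<..T} ?\<psi>" using pm by (simp add: piecewise_ac_def)
  have AE: "AE q in lebesgue. t < q \<longrightarrow> q \<le> T \<longrightarrow> - bound (w, q) \<le> ?\<psi> q"
  proof (rule AE_completion)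
    show "AE q in lborel. t < q \<longrightarrow> q \<le> T \<longrightarrow> - bound (w, q) \<le> ?\<psi> q"
      using elim(2)
    proof eventually_elim
      case (elim q)
      show ?case
      proof (intro impI)
        assume "t < q" "q \<le> T"
        then have "\<bar>D q w\<bar> * \<bar>drift w q + mZ (w, q)\<bar> \<le> \<bar>D q w\<bar> * (C * nZ (w, q))"
          using elim by (intro mult_left_mono) auto
        then have "\<bar>D q w * (drift w q + mZ (w, q))\<bar> \<le> \<bar>D q w\<bar> * (C * nZ (w, q))" by (simp add: abs_mult)
        then have "- (\<bar>D q w\<bar> * (C * nZ (w, q))) \<le> D q w * drift w q + D q w * mZ (w, q)"
          by (simp add: distrib_left abs_le_iff)
        then show "- bound (w, q) \<le> ?\<psi> q" by (simp add: bound_def dY_def algebra_simps)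
      qed
    qed
  qed
  show ?case
  proof
    fix s assume s: "s \<in> {t..T}"
    have "(LINT q:{s<..T}|lebesgue. - bound (w, q)) \<le> (LINT q:{s<..T}|lebesgue. ?\<psi> q)"
    proof (rule set_integral_mono_AE)
      have "set_integrable lebesgue {s<..T} (\<lambda>q. (-1) * bound (w, q))"
        using set_integrable_Ioc_subset[OF bs, of s T] s by (intro set_integrable_mult_right) auto
      then show "set_integrable lebesgue {s<..T} (\<lambda>q. - bound (w, q))" by simp
      show "set_integrable lebesgue {s<..T} ?\<psi>" using set_integrable_Ioc_subset[OF \<psi>, of s T] s by simp
      show "AE q\<in>{s<..T} in lebesgue. - bound (w, q) \<le> ?\<psi> q" using AE by eventually_elim (use s in auto)
    qed
    moreover have "(LINT q:{s<..T}|lebesgue. - bound (w, q)) = - (LINT q:{s<..T}|lebesgue. bound (w, q))"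
      by (simp only: set_lebesgue_integral_def scaleR_minus_right Bochner_Integration.integral_minus)
    moreover have "(LINT q:{s<..T}|lebesgue. bound (w, q)) = (\<integral>q. indicator {s<..T} q * bound (w, q) \<partial>time_measure t)"
      by (rule time_measure_set_integral(2)[OF bi]) (use s in auto)
    moreover have "D T w * D T w = D s w * D s w + (LINT q:{s<..T}|lebesgue. ?\<psi> q)
      + (\<Sum>\<tau>\<in>jumps w \<inter> {s<..T}. D \<tau> w * D \<tau> w - (D \<tau> w - ?j \<tau>) * (D \<tau> w - ?j \<tau>))"
      by (rule piecewise_ac_increment[OF pm]) (use s in auto)
    moreover have "(\<Sum>\<tau>\<in>jumps w \<inter> {s<..T}. D \<tau> w * D \<tau> w - (D \<tau> w - ?j \<tau>) * (D \<tau> w - ?j \<tau>))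
      = (\<Sum>\<tau>\<in>jumps w \<inter> {t<..T}. jump_term s ((w, \<tau>), X \<tau> w))"
    proof (rule sum.mono_neutral_cong_left)
      show "finite (jumps w \<inter> {t<..T})" using w by simp
      show "jumps w \<inter> {s<..T} \<subseteq> jumps w \<inter> {t<..T}" using s by auto
      show "\<forall>\<tau>\<in>jumps w \<inter> {t<..T} - jumps w \<inter> {s<..T}. jump_term s ((w, \<tau>), X \<tau> w) = 0"
        by (auto simp: jump_term_def indicator_def)
      fix \<tau> assume \<tau>: "\<tau> \<in> jumps w \<inter> {s<..T}"
      then have "D \<tau> w = W (w, \<tau>) + dZ ((w, \<tau>), X \<tau> w)" using W_eq[OF pw, of \<tau>] s by auto
      then show "D \<tau> w * D \<tau> w - (D \<tau> w - ?j \<tau>) * (D \<tau> w - ?j \<tau>) = jump_term s ((w, \<tau>), X \<tau> w)"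
        using \<tau> s by (simp add: jump_term_def power2_eq_square algebra_simps)
    qed
    ultimately show "(D s w)\<^sup>2 \<le> (\<integral>q. indicator {s<..T} q * bound (w, q) \<partial>time_measure t)
      - (\<Sum>\<tau>\<in>jumps w \<inter> {t<..T}. jump_term s ((w, \<tau>), X \<tau> w))"
      using DT by (simp add: power2_eq_square)
  qed
qed

text \<open>What is left of \<open>bound\<close> after the mean of the jump term is subtracted: the
  terms with \<open>mZ\<close> cancel because \<open>W = dY\<close> almost everywhere, and the jumps
  contribute the favourable term \<open>- qZ\<close>.\<close>

definition energy :: "real \<Rightarrow> 'w \<times> real \<Rightarrow> real" where
  "energy s p = indicator {s<..T} (snd p) * (2 * C * (\<bar>dY p\<bar> * nZ p) - qZ p)"

lemma indicator_mult_integrable: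
  assumes "integrable (PT t x) (k :: _ \<Rightarrow> real)"
  shows "integrable (PT t x) (\<lambda>p. indicator {s<..T} (snd p) * k p)"
proof (rule Bochner_Integration.integrable_bound[OF assms])
  show "(\<lambda>p. indicator {s<..T} (snd p) * k p) \<in> borel_measurable (PT t x)"
    using borel_measurable_integrable[OF assms] PT_snd[OF t(1) x] by measurable
  show "AE p in PT t x. norm (indicator {s<..T} (snd p) * k p) \<le> norm (k p)"
    by (intro AE_I2) (simp add: indicator_def)
qed

text \<open>Expectations in \<open>square_along_path\<close>, with the jump sum replaced by its
  compensator. The second claim holds because the pathwise right-hand side dominates a square; it is
  the source of \<open>dZ_zero\<close>.\<close>

lemma energy_bound:
  assumes s: "t \<le> s" "s \<le> T"
  shows "(\<integral>\<^sup>+w. ennreal ((D s w)\<^sup>2) \<partial>P t x) \<le> ennreal (\<integral>p. energy s p \<partial>PT t x)"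
    "0 \<le> (\<integral>p. energy s p \<partial>PT t x)"
proof -
  let ?b = "\<lambda>p. indicator {s<..T} (snd p) * bound p"
  let ?J = "\<lambda>w. \<Sum>\<tau>\<in>jumps w \<inter> {t<..T}. jump_term s ((w, \<tau>), X \<tau> w)"
  let ?jt = "\<lambda>p. LINT y|rate p. jump_term s (p, y)"
  have bi: "integrable (PT t x) ?b" by (rule indicator_mult_integrable[OF bound_integrable])
  note bsec = PT_integrable_section[OF t(1) x bi]
  note J = compensator_real[OF t x jump_term_measurable jump_term_finite, of s]
  have ji: "integrable (PT t x) ?jt"
    by (rule PT_rate_integrable(2)[OF t x PT_measurable[OF jump_term_measurable t x] jump_term_finite])
  let ?R = "\<lambda>w. (\<integral>q. ?b (w, q) \<partial>time_measure t) - ?J w"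
  have Ri: "integrable (P t x) ?R" by (rule Bochner_Integration.integrable_diff[OF bsec(2) J(1)])
  have le: "AE w in P t x. (D s w)\<^sup>2 \<le> ?R w"
    using square_along_path by eventually_elim (use s in auto)
  have nn: "AE w in P t x. 0 \<le> ?R w" using le
  proof eventually_elim
    case (elim w)
    then show ?case using zero_le_power2[of "D s w"] by linarith
  qed
  have 1: "(\<integral>\<^sup>+w. ennreal ((D s w)\<^sup>2) \<partial>P t x) \<le> (\<integral>\<^sup>+w. ennreal (?R w) \<partial>P t x)"
    by (rule nn_integral_mono_AE) (use le in \<open>eventually_elim, simp add: ennreal_leI\<close>)
  have 2: "(\<integral>\<^sup>+w. ennreal (?R w) \<partial>P t x) = ennreal (\<integral>w. ?R w \<partial>P t x)"
    by (rule nn_integral_eq_integral[OF Ri nn])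
  have 3: "0 \<le> (\<integral>w. ?R w \<partial>P t x)" by (rule integral_nonneg_AE[OF nn])
  have "(\<integral>w. ?R w \<partial>P t x) = (\<integral>p. ?b p \<partial>PT t x) - (\<integral>p. ?jt p \<partial>PT t x)"
    unfolding Bochner_Integration.integral_diff[OF bsec(2) J(1)] bsec(3) J(2) ..
  also have "\<dots> = (\<integral>p. ?b p - ?jt p \<partial>PT t x)"
    by (rule Bochner_Integration.integral_diff[OF bi ji, symmetric])
  also have "\<dots> = (\<integral>p. energy s p \<partial>PT t x)"
  proof (rule integral_cong_AE)
    show "(\<lambda>p. ?b p - ?jt p) \<in> borel_measurable (PT t x)"
      using bi ji by (intro borel_measurable_diff borel_measurable_integrable)
    have m: "(\<lambda>q. \<bar>dZ q\<bar>) \<in> borel_measurable (PT t x \<Otimes>\<^sub>M K)" using dZ_measurable_PT by measurable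
    have "nZ \<in> borel_measurable (PT t x)" using PT_integral_rate[OF t x m] by (simp add: nZ_def[abs_def])
    then show "energy s \<in> borel_measurable (PT t x)"
      unfolding energy_def[abs_def] using dY_measurable borel_measurable_integrable[OF qZ_integrable] PT_snd[OF t(1) x] by measurable
    show "AE p in PT t x. ?b p - ?jt p = energy s p"
      using W_AE dZ_integrable
    proof eventually_elim
      case (elim p)
      have "?jt p = indicator {s<..T} (snd p) * (LINT y|rate p. 2 * W p * dZ (p, y) + (dZ (p, y))\<^sup>2)"
        by (simp add: jump_term_def)
      also have "(LINT y|rate p. 2 * W p * dZ (p, y) + (dZ (p, y))\<^sup>2) = 2 * W p * mZ p + qZ p"
        using elim(2) by (subst Bochner_Integration.integral_add) (auto simp: mZ_def qZ_def)
      finally show ?case using elim(1) by (simp add: energy_def bound_def algebra_simps)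
    qed
  qed
  finally have "(\<integral>w. ?R w \<partial>P t x) = (\<integral>p. energy s p \<partial>PT t x)" .
  then show "(\<integral>\<^sup>+w. ennreal ((D s w)\<^sup>2) \<partial>P t x) \<le> ennreal (\<integral>p. energy s p \<partial>PT t x)"
    "0 \<le> (\<integral>p. energy s p \<partial>PT t x)" using 1 2 3 by simp_all
qed

text \<open>Completing the square: the integral of the square of
  \<open>C * \<bar>dY p\<bar> - \<bar>dZ (p, y)\<bar>\<close> over the rates is nonnegative. The
  bound \<Lambda> of the total rate then gives the constant \<open>C\<^sup>2 * \<Lambda>\<close>,
  and \<open>dZ\<close> disappears.\<close>

lemma energy_le: "AE p in PT t x. energy s p \<le> indicator {s<..T} (snd p) * (C\<^sup>2 * \<Lambda> * (dY p)\<^sup>2)"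
  using dZ_integrable AE_space
proof eventually_elim
  case (elim p)
  note r = PT_rate[OF elim(2)]
  interpret N: finite_measure "rate p" by (rule r(4))
  let ?c = "C * \<bar>dY p\<bar>"
  have i: "integrable (rate p) (\<lambda>y. \<bar>dZ (p, y)\<bar>)" "integrable (rate p) (\<lambda>y. (dZ (p, y))\<^sup>2)" using elim by auto
  have "0 \<le> (LINT y|rate p. (?c - \<bar>dZ (p, y)\<bar>)\<^sup>2)" by (rule Bochner_Integration.integral_nonneg) simp
  also have "\<dots> = (LINT y|rate p. (?c\<^sup>2 - 2 * ?c * \<bar>dZ (p, y)\<bar>) + (dZ (p, y))\<^sup>2)"
    by (simp add: power2_diff algebra_simps)
  also have "\<dots> = (?c\<^sup>2 * measure (rate p) (space (rate p)) - 2 * ?c * nZ p) + qZ p"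
    using i by (simp add: nZ_def qZ_def)
  finally have "2 * ?c * nZ p - qZ p \<le> ?c\<^sup>2 * measure (rate p) (space (rate p))" by simp
  also have "\<dots> \<le> ?c\<^sup>2 * \<Lambda>"
  proof (rule mult_left_mono)
    show "measure (rate p) (space (rate p)) \<le> \<Lambda>"
      using rate_le_bound[OF r(1-3), of "space (rate p)"] rate_bound_pos
      by (simp add: N.emeasure_eq_measure)
  qed simp
  finally show ?case
    by (cases "snd p \<in> {s<..T}") (simp_all add: energy_def power_mult_distrib mult.assoc mult.left_commute mult.commute)
qed

lemma dY_sq_integrable: "integrable (PT t x) (\<lambda>p. (dY p)\<^sup>2)"
  using dY_measurable dY_finite by (intro integrableI_nonneg) auto

definition G :: "real \<Rightarrow> real" where
  "G s = (\<integral>p. indicator {s<..T} (snd p) * (dY p)\<^sup>2 \<partial>PT t x)"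

lemma D_sq_le_G:
  assumes s: "t \<le> s" "s \<le> T"
  shows "(\<integral>\<^sup>+w. ennreal ((D s w)\<^sup>2) \<partial>P t x) \<le> ennreal (C\<^sup>2 * \<Lambda> * G s)"
proof -
  note i = indicator_mult_integrable[OF integrable_mult_right[OF dY_sq_integrable], of s "C\<^sup>2 * \<Lambda>"]
  have "(\<integral>p. energy s p \<partial>PT t x) \<le> (\<integral>p. indicator {s<..T} (snd p) * (C\<^sup>2 * \<Lambda> * (dY p)\<^sup>2) \<partial>PT t x)"
  proof (cases "integrable (PT t x) (energy s)")
    case True then show ?thesis by (rule integral_mono_AE[OF _ i energy_le])
  next
    \<comment> \<open>A non-integrable \<open>energy s\<close> would have integral 0, which is still
      below the nonnegative right-hand side.\<close>
    case False
    have "0 \<le> (\<integral>p. indicator {s<..T} (snd p) * (C\<^sup>2 * \<Lambda> * (dY p)\<^sup>2) \<partial>PT t x)"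
      using rate_bound_pos by (intro Bochner_Integration.integral_nonneg) simp
    then show ?thesis using False by (simp add: not_integrable_integral_eq)
  qed
  also have "\<dots> = C\<^sup>2 * \<Lambda> * G s"
    unfolding G_def by (subst integral_mult_right_zero[symmetric]) (simp add: mult_ac)
  finally show ?thesis using energy_bound(1)[OF s] by (meson ennreal_leI order_trans)
qed

lemma G_nonneg: "0 \<le> G s"
  unfolding G_def by (rule Bochner_Integration.integral_nonneg) simp

lemma G_antimono: "s \<le> s' \<Longrightarrow> G s' \<le> G s"
  unfolding G_def by (intro integral_mono indicator_mult_integrable dY_sq_integrable) (auto simp: indicator_def)

text \<open>By Fubini \<open>G a - G b\<close> is the integral of the second moment of
  \<open>D s\<close> over (a, b], and \<open>D_sq_le_G\<close> with the monotonicity of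
  \<open>G\<close> bounds it as \<open>backward_gronwall\<close> requires.\<close>

lemma G_zero: "G t = 0"
proof (rule backward_gronwall[OF t(2), where G = G and \<kappa> = "C\<^sup>2 * \<Lambda>"])
  show "0 \<le> C\<^sup>2 * \<Lambda>" using rate_bound_pos by simp
  show "G T = 0" by (simp add: G_def)
  fix a b assume ab: "t \<le> a" "a \<le> b" "b \<le> T"
  interpret P: prob_space "P t x" using prob t x by simp
  interpret TM: finite_measure "time_measure t" by (rule finite_time_measure)
  interpret pair_sigma_finite "P t x" "time_measure t" ..
  let ?k = "\<lambda>p. indicator {a<..b} (snd p) * (dY p)\<^sup>2"
  have km: "?k \<in> borel_measurable (PT t x)" using dY_measurable PT_snd[OF t(1) x] by measurable
  have ki: "integrable (PT t x) ?k"
    by (rule Bochner_Integration.integrable_bound[OF dY_sq_integrable km]) (auto simp: indicator_def)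
  have "G a - G b = (\<integral>p. indicator {a<..T} (snd p) * (dY p)\<^sup>2 - indicator {b<..T} (snd p) * (dY p)\<^sup>2 \<partial>PT t x)"
    unfolding G_def
    by (rule Bochner_Integration.integral_diff[symmetric]; rule indicator_mult_integrable[OF dY_sq_integrable])
  also have "\<dots> = (\<integral>p. ?k p \<partial>PT t x)"
    by (rule Bochner_Integration.integral_cong) (use ab in \<open>auto simp: indicator_def\<close>)
  finally have "G a - G b = (\<integral>p. ?k p \<partial>PT t x)" .
  then have "ennreal (G a - G b) = (\<integral>\<^sup>+p. ennreal (?k p) \<partial>PT t x)"
    using ki by (simp add: nn_integral_eq_integral)
  also have "\<dots> = (\<integral>\<^sup>+s. (\<integral>\<^sup>+w. ennreal (?k (w, s)) \<partial>P t x) \<partial>time_measure t)"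
    unfolding PT_def
    by (rule nn_integral_snd[OF measurable_compose[OF km[unfolded PT_def] measurable_ennreal], symmetric])
  also have "\<dots> \<le> (\<integral>\<^sup>+s. ennreal (C\<^sup>2 * \<Lambda> * G a) * indicator {a<..b} s \<partial>time_measure t)"
  proof (rule nn_integral_mono)
    fix s assume s: "s \<in> space (time_measure t)"
    show "(\<integral>\<^sup>+w. ennreal (?k (w, s)) \<partial>P t x) \<le> ennreal (C\<^sup>2 * \<Lambda> * G a) * indicator {a<..b} s"
    proof (cases "s \<in> {a<..b}")
      case True
      have "(\<integral>\<^sup>+w. ennreal (?k (w, s)) \<partial>P t x) \<le> ennreal (C\<^sup>2 * \<Lambda> * G s)"
        using D_sq_le_G[of s] True s by (simp add: dY_def)
      also have "\<dots> \<le> ennreal (C\<^sup>2 * \<Lambda> * G a)"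
        using True G_antimono[of a s] rate_bound_pos by (intro ennreal_leI mult_left_mono) auto
      finally show ?thesis using True by simp
    qed simp
  qed
  also have "\<dots> = ennreal (C\<^sup>2 * \<Lambda> * G a) * emeasure lborel ({a<..b} \<inter> {t<..T})"
    unfolding nn_integral_time_measure by (simp add: nn_integral_cmult_indicator indicator_inter_arith[symmetric] mult.assoc)
  also have "{a<..b} \<inter> {t<..T} = {a<..b}" using ab by auto
  also have "ennreal (C\<^sup>2 * \<Lambda> * G a) * emeasure lborel {a<..b} = ennreal ((b - a) * (C\<^sup>2 * \<Lambda>) * G a)"
    using ab G_nonneg rate_bound_pos by (simp add: mult_ac flip: ennreal_mult)
  finally show "G a - G b \<le> (b - a) * (C\<^sup>2 * \<Lambda>) * G a"
    using ab G_nonneg[of a] rate_bound_pos by (simp add: ennreal_le_iff)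
qed (rule G_nonneg)

lemma dY_zero: "AE p in PT t x. dY p = 0"
proof -
  have "(\<integral>p. indicator {t<..T} (snd p) * (dY p)\<^sup>2 \<partial>PT t x) = 0" using G_zero by (simp add: G_def)
  then have "AE p in PT t x. indicator {t<..T} (snd p) * (dY p)\<^sup>2 = 0"
    using integral_nonneg_eq_0_iff_AE[OF indicator_mult_integrable[OF dY_sq_integrable]] by simp
  then show ?thesis using AE_space
  proof eventually_elim
    case (elim p)
    then have "snd p \<in> {t<..T}" using t x by auto
    then show ?case using elim by simp
  qed
qed

text \<open>Once \<open>dY\<close> vanishes, \<open>energy t\<close> equals \<open>- qZ\<close>
  almost everywhere, whereas its integral is nonnegative by \<open>energy_bound\<close>.\<close>

lemma dZ_zero: "(\<integral>\<^sup>+p. (\<integral>\<^sup>+y. ennreal ((dZ (p, y))\<^sup>2) \<partial>rate p) \<partial>PT t x) = 0"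
proof -
  have "(\<integral>p. energy t p \<partial>PT t x) = (\<integral>p. - qZ p \<partial>PT t x)"
  proof (rule integral_cong_AE)
    have m: "(\<lambda>q. \<bar>dZ q\<bar>) \<in> borel_measurable (PT t x \<Otimes>\<^sub>M K)" using dZ_measurable_PT by measurable
    have "nZ \<in> borel_measurable (PT t x)" using PT_integral_rate[OF t x m] by (simp add: nZ_def[abs_def])
    then show "energy t \<in> borel_measurable (PT t x)"
      unfolding energy_def[abs_def] using dY_measurable borel_measurable_integrable[OF qZ_integrable] PT_snd[OF t(1) x] by measurable
    show "(\<lambda>p. - qZ p) \<in> borel_measurable (PT t x)" using borel_measurable_integrable[OF qZ_integrable] by measurable
    show "AE p in PT t x. energy t p = - qZ p"
      using dY_zero AE_space by eventually_elim (use t x in \<open>auto simp: energy_def\<close>)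
  qed
  then have "(\<integral>p. qZ p \<partial>PT t x) \<le> 0" using energy_bound(2)[OF order_refl t(2)] by simp
  moreover have "0 \<le> (\<integral>p. qZ p \<partial>PT t x)" unfolding qZ_def by (intro Bochner_Integration.integral_nonneg) simp
  ultimately have q0: "(\<integral>p. qZ p \<partial>PT t x) = 0" by simp
  have "(\<integral>\<^sup>+p. (\<integral>\<^sup>+y. ennreal ((dZ (p, y))\<^sup>2) \<partial>rate p) \<partial>PT t x) = (\<integral>\<^sup>+p. ennreal (qZ p) \<partial>PT t x)"
  proof (rule nn_integral_cong_AE)
    show "AE p in PT t x. (\<integral>\<^sup>+y. ennreal ((dZ (p, y))\<^sup>2) \<partial>rate p) = ennreal (qZ p)"
      using dZ_integrable by eventually_elim (simp add: qZ_def nn_integral_eq_integral)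
  qed
  also have "\<dots> = ennreal (\<integral>p. qZ p \<partial>PT t x)"
    by (rule nn_integral_eq_integral[OF qZ_integrable]) (simp add: qZ_def)
  finally show ?thesis using q0 by simp
qed

text \<open>Passage from almost every time to all times: by the compensator the values of
  \<open>dZ\<close> at the jumps vanish almost surely, \<open>bound\<close> vanishes for almost
  every time, and \<open>square_along_path\<close> leaves nothing for any \<open>s\<close>.\<close>

lemma D_zero: "AE w in P t x. \<forall>s\<in>{t..T}. D s w = 0"
proof -
  have "(\<lambda>q. ennreal ((dZ q)\<^sup>2)) \<in> borel_measurable (Pred t \<Otimes>\<^sub>M K)" using dZ_measurable by measurable
  note c = compensator[OF t x this] and m = measurable_jump_sum[OF t order_refl this]
  have "(\<integral>\<^sup>+w. (\<Sum>\<tau>\<in>jumps w \<inter> {t<..T}. ennreal ((dZ ((w, \<tau>), X \<tau> w))\<^sup>2)) \<partial>P t x) = 0"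
    unfolding c using dZ_zero by simp
  moreover have "(\<lambda>w. \<Sum>\<tau>\<in>jumps w \<inter> {t<..T}. ennreal ((dZ ((w, \<tau>), X \<tau> w))\<^sup>2)) \<in> borel_measurable (P t x)"
    by (rule measurable_P[OF m]) (use t x in auto)
  ultimately have jz: "AE w in P t x. (\<Sum>\<tau>\<in>jumps w \<inter> {t<..T}. ennreal ((dZ ((w, \<tau>), X \<tau> w))\<^sup>2)) = 0"
    using nn_integral_0_iff_AE by blast
  have "AE w in P t x. w \<in> \<Omega>" using t x by (intro AE_I2) simp
  then show ?thesis using jz square_along_path PT_AE_D[OF t(1) x dY_zero]
  proof eventually_elim
    case (elim w)
    then have fin: "finite (jumps w \<inter> {t<..T})" by simp
    have z: "dZ ((w, \<tau>), X \<tau> w) = 0" if "\<tau> \<in> jumps w \<inter> {t<..T}" for \<tau>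
    proof -
      have "ennreal ((dZ ((w, \<tau>), X \<tau> w))\<^sup>2) = 0" using elim(2) that unfolding sum_eq_0_iff[OF fin] by blast
      then show ?thesis by (simp add: ennreal_eq_0_iff)
    qed
    show ?case
    proof
      fix s assume s: "s \<in> {t..T}"
      have "(\<Sum>\<tau>\<in>jumps w \<inter> {t<..T}. jump_term s ((w, \<tau>), X \<tau> w)) = 0"
        using z by (intro sum.neutral ballI) (simp add: jump_term_def)
      moreover have "(\<integral>q. indicator {s<..T} q * bound (w, q) \<partial>time_measure t) = 0"
      proof (rule integral_eq_zero_AE)
        have "AE q in time_measure t. dY (w, q) = 0" using elim(4) by (simp add: AE_time_measure)
        then show "AE q in time_measure t. indicator {s<..T} q * bound (w, q) = 0"
          by eventually_elim (simp add: bound_def)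
      qed
      ultimately have "(D s w)\<^sup>2 \<le> 0" using elim(3) s by fastforce
      then show "D s w = 0" by simp
    qed
  qed
qed

end

section \<open>Exponential moments of the number of jumps\<close>

context markov_jump_process
begin

text \<open>The construction of \<open>W\<close> for a general adapted process: its left limit
  whenever that exists, and predictable in any case.\<close>

definition grid_limit :: "real \<Rightarrow> (real \<Rightarrow> 'w \<Rightarrow> real) \<Rightarrow> 'w \<times> real \<Rightarrow> real" where
  "grid_limit t h p = lim (\<lambda>n. h (grid_left t n (snd p)) (fst p))"

lemma grid_limit_measurable:
  assumes "0 \<le> t" "t \<le> T" "\<And>s. t \<le> s \<Longrightarrow> s \<le> T \<Longrightarrow> h s \<in> borel_measurable (\<F> {t..s})"
  shows "grid_limit t h \<in> borel_measurable (Pred t)"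
proof -
  have "(\<lambda>p. h (grid_left t n (snd p)) (fst p)) \<in> borel_measurable (Pred t)" for n
    using predictable_grid[OF assms(1,2), of h] assms(3) by (simp add: case_prod_beta')
  then show ?thesis unfolding grid_limit_def[abs_def] by (rule borel_measurable_lim_metric)
qed

lemma grid_limit_eq:
  assumes "piecewise_ac t T (jumps w) (\<lambda>s. h s w) \<psi> j" and s: "t < s" "s \<le> T"
  shows "grid_limit t h (w, s) = h s w - (if s \<in> jumps w then j s else 0)"
proof -
  have "(\<lambda>n. h (grid_left t n s) w) \<longlonglongrightarrow> h s w - (if s \<in> jumps w then j s else 0)"
    by (rule piecewise_ac_left_limit[OF assms(1) s grid_left_ge grid_left_less[OF s(1)] grid_left_tendsto[OF s(1)]])
  from limI[OF this] show ?thesis by (simp add: grid_limit_def)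
qed

lemma nn_integral_PT_fst:
  assumes "0 \<le> t" "t \<le> T" "x \<in> space K" and h: "h \<in> borel_measurable (P t x)"
  shows "(\<integral>\<^sup>+p. h (fst p) \<partial>PT t x) = ennreal (T - t) * (\<integral>\<^sup>+w. h w \<partial>P t x)"
proof -
  have "(\<lambda>p. h (fst p)) \<in> borel_measurable (PT t x)" by (rule measurable_compose[OF PT_fst h])
  from nn_integral_PT[OF this]
  have "(\<integral>\<^sup>+p. h (fst p) \<partial>PT t x) = (\<integral>\<^sup>+w. h w * ennreal (T - t) \<partial>P t x)"
    using assms(2) by (simp add: nn_integral_cmult_indicator)
  then show ?thesis using h by (simp add: nn_integral_multc mult.commute)
qed

lemma floor_measurable: "(\<lambda>x :: real. f (nat \<lfloor>x\<rfloor>) :: real) \<in> borel_measurable borel"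
  by (rule measurable_compose[where N = "count_space UNIV"]) measurable

lemma jump_count_grid_limit:
  assumes w: "w \<in> \<Omega>" and s: "t < s" "s \<le> T"
  shows "grid_limit t (\<lambda>s w. real (card (jumps w \<inter> {t<..s}) choose n)) (w, s) = real (card (jumps w \<inter> {t<..<s}) choose n)"
proof -
  let ?G = "\<lambda>S :: real set. real (card S choose n)"
  have eq: "jumps w \<inter> {t<..s} = jumps w \<inter> {t<..<s}" if "s \<notin> jumps w"
  proof (rule set_eqI)
    show "q \<in> jumps w \<inter> {t<..s} \<longleftrightarrow> q \<in> jumps w \<inter> {t<..<s}" for q using that by (cases "q = s") auto
  qed
  have "piecewise_ac t T (jumps w) (\<lambda>s. ?G (jumps w \<inter> {t<..s})) (\<lambda>_. 0) (\<lambda>\<tau>. ?G (jumps w \<inter> {t<..\<tau>}) - ?G (jumps w \<inter> {t<..<\<tau>}))"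
    by (rule piecewise_constant) (use w in simp)
  from grid_limit_eq[where h = "\<lambda>s w. real (card (jumps w \<inter> {t<..s}) choose n)", OF this s] eq
  show ?thesis by (cases "s \<in> jumps w") simp_all
qed

text \<open>At each jump Pascal's rule makes the coefficient of order n + 1 grow by the one of order
  n just before the jump. With rates at most \<Lambda> the compensator turns this into an iterated
  time integral; the bound is the binomial moment of a Poisson variable with mean
  \<open>\<Lambda> * (s - t)\<close>.\<close>

lemma jump_count_factorial_moment:
  assumes t: "0 \<le> t" "t \<le> T" and x: "x \<in> space K" and s: "t \<le> s" "s \<le> T"
  shows "(\<integral>\<^sup>+w. ennreal (real (card (jumps w \<inter> {t<..s}) choose n)) \<partial>P t x) \<le> ennreal ((\<Lambda> * (s - t)) ^ n / fact n)"
  using s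
proof (induct n arbitrary: s)
  case 0
  interpret P: prob_space "P t x" using prob t x by simp
  show ?case by (simp add: P.emeasure_space_1)
next
  case (Suc n)
  interpret P: prob_space "P t x" using prob t x by simp
  interpret TM: finite_measure "time_measure t" by (rule finite_time_measure)
  interpret pair_sigma_finite "P t x" "time_measure t" ..
  let ?h = "\<lambda>s w. real (card (jumps w \<inter> {t<..s}) choose n)"
  let ?L = "\<lambda>p. indicator {t<..s} (snd p) * ennreal (grid_limit t ?h p)"
  have "?h q \<in> borel_measurable (\<F> {t..q})" if "t \<le> q" "q \<le> T" for q
  proof -
    have "(\<lambda>w. \<Sum>\<tau>\<in>jumps w \<inter> {t<..q}. 1 :: real) \<in> borel_measurable (\<F> {t..q})"
      by (rule measurable_jump_sum[OF t(1) that, of "\<lambda>_. 1"]) simp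
    from measurable_compose[OF this floor_measurable] show ?thesis by simp
  qed
  from grid_limit_measurable[OF t this] have L: "?L \<in> borel_measurable (Pred t)"
    using predictable_snd[OF t] by measurable
  have "(\<integral>\<^sup>+w. ennreal (real (card (jumps w \<inter> {t<..s}) choose Suc n)) \<partial>P t x)
    = (\<integral>\<^sup>+w. (\<Sum>\<tau>\<in>jumps w \<inter> {t<..T}. ?L (w, \<tau>)) \<partial>P t x)"
  proof (rule nn_integral_cong)
    fix w assume "w \<in> space (P t x)"
    then have w: "w \<in> \<Omega>" using t x by simp
    let ?J = "jumps w \<inter> {t<..s}" and ?G = "\<lambda>S :: real set. real (card S choose Suc n)"
    have "?G ?J = ?G {} + (\<Sum>\<tau>\<in>?J. ?G (?J \<inter> {..\<tau>}) - ?G (?J \<inter> {..<\<tau>}))"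
      by (rule sum_increments_finite) (use w in simp)
    also have "(\<Sum>\<tau>\<in>?J. ?G (?J \<inter> {..\<tau>}) - ?G (?J \<inter> {..<\<tau>})) = (\<Sum>\<tau>\<in>?J. real (card (jumps w \<inter> {t<..<\<tau>}) choose n))"
    proof (rule sum.cong)
      fix \<tau> assume \<tau>: "\<tau> \<in> ?J"
      then have "?J \<inter> {..\<tau>} = insert \<tau> (jumps w \<inter> {t<..<\<tau>})" "?J \<inter> {..<\<tau>} = jumps w \<inter> {t<..<\<tau>}" by auto
      then show "?G (?J \<inter> {..\<tau>}) - ?G (?J \<inter> {..<\<tau>}) = real (card (jumps w \<inter> {t<..<\<tau>}) choose n)" using w by simp
    qed simp
    finally have "ennreal (?G ?J) = (\<Sum>\<tau>\<in>?J. ennreal (real (card (jumps w \<inter> {t<..<\<tau>}) choose n)))" by (simp add: sum_ennreal)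
    also have "\<dots> = (\<Sum>\<tau>\<in>jumps w \<inter> {t<..T}. ?L (w, \<tau>))"
      by (rule sum.mono_neutral_cong_left) (use w Suc.prems jump_count_grid_limit[OF w] in auto)
    finally show "ennreal (?G ?J) = \<dots>" .
  qed
  also have "\<dots> = (\<integral>\<^sup>+p. (\<integral>\<^sup>+y. ?L p \<partial>rate p) \<partial>PT t x)"
    using compensator[OF t x measurable_compose[OF measurable_fst L]] by simp
  also have "\<dots> \<le> (\<integral>\<^sup>+p. ennreal \<Lambda> * ?L p \<partial>PT t x)"
    using t x path_range by (intro nn_integral_mono) (auto simp: mult.commute intro!: mult_right_mono rate_le_bound)
  also have "\<dots> = ennreal \<Lambda> * (\<integral>\<^sup>+p. ?L p \<partial>PT t x)"
    by (rule nn_integral_cmult[OF measurable_compose[OF PT_to_predictable[OF t x] L]])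
  also have "(\<integral>\<^sup>+p. ?L p \<partial>PT t x) = (\<integral>\<^sup>+q. (\<integral>\<^sup>+w. ?L (w, q) \<partial>P t x) \<partial>time_measure t)"
    unfolding PT_def by (rule nn_integral_snd[OF measurable_compose[OF PT_to_predictable[OF t x, unfolded PT_def] L], symmetric])
  also have "\<dots> \<le> (\<integral>\<^sup>+q. ennreal ((\<Lambda> * (q - t)) ^ n / fact n) * indicator {t<..s} q \<partial>time_measure t)"
  proof (rule nn_integral_mono)
    fix q assume q: "q \<in> space (time_measure t)"
    have "(\<integral>\<^sup>+w. ?L (w, q) \<partial>P t x) \<le> (\<integral>\<^sup>+w. ennreal (?h q w) * indicator {t<..s} q \<partial>P t x)"
    proof (rule nn_integral_mono)
      fix w assume "w \<in> space (P t x)"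
      then have w: "w \<in> \<Omega>" using t x by simp
      have "card (jumps w \<inter> {t<..<q}) \<le> card (jumps w \<inter> {t<..q})" using w by (intro card_mono) auto
      then show "?L (w, q) \<le> ennreal (?h q w) * indicator {t<..s} q"
        using jump_count_grid_limit[OF w, of t q n] q by (auto simp: indicator_def intro!: ennreal_leI binomial_right_mono)
    qed
    also have "\<dots> \<le> ennreal ((\<Lambda> * (q - t)) ^ n / fact n) * indicator {t<..s} q"
      using Suc.hyps[of q] q by (auto simp: indicator_def)
    finally show "(\<integral>\<^sup>+w. ?L (w, q) \<partial>P t x) \<le> \<dots>" .
  qed
  also have "\<dots> \<le> (\<integral>\<^sup>+q. ennreal ((\<Lambda> * (q - t)) ^ n / fact n) * indicator {t..s} q \<partial>lborel)"
    unfolding nn_integral_time_measure using Suc.prems by (intro nn_integral_mono) (auto simp: indicator_def)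
  also have "\<dots> = ennreal (\<Lambda> ^ n * (s - t) ^ Suc n / fact (Suc n) - \<Lambda> ^ n * (t - t) ^ Suc n / fact (Suc n))"
  proof (rule nn_integral_FTC_Icc[where F = "\<lambda>q. \<Lambda> ^ n * (q - t) ^ Suc n / fact (Suc n)"])
    fix q assume "q \<in> {t..s}"
    then show "0 \<le> (\<Lambda> * (q - t)) ^ n / fact n" using rate_bound_pos by simp
    have "DERIV (\<lambda>q. \<Lambda> ^ n * (q - t) ^ Suc n / fact (Suc n)) q :> \<Lambda> ^ n * (real (Suc n) * (q - t) ^ n) / fact (Suc n)"
      by (auto intro!: derivative_eq_intros simp del: power_Suc fact_Suc)
    then show "DERIV (\<lambda>q. \<Lambda> ^ n * (q - t) ^ Suc n / fact (Suc n)) q :> (\<Lambda> * (q - t)) ^ n / fact n"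
      by (simp add: power_mult_distrib divide_simps del: power_Suc)
  qed (use Suc.prems in auto)
  also have "ennreal \<Lambda> * \<dots> = ennreal ((\<Lambda> * (s - t)) ^ Suc n / fact (Suc n))"
    using rate_bound_pos Suc.prems by (simp add: power_mult_distrib mult_ac flip: ennreal_mult)
  finally show ?case by (simp add: mult_left_mono)
qed

text \<open>The binomial expansion of \<open>(1 + (c - 1)) ^ k\<close> reduces the exponential
  moment to the binomial moments; \<open>1 \<le> c\<close> keeps all terms nonnegative, and the
  resulting bound is an exponential series.\<close>

lemma jump_count_moment:
  assumes t: "0 \<le> t" "t \<le> T" and x: "x \<in> space K" and c: "1 \<le> c"
  shows "(\<lambda>w. c ^ card (jumps w \<inter> {t<..T})) \<in> borel_measurable (P t x)"
    "(\<integral>\<^sup>+w. ennreal (c ^ card (jumps w \<inter> {t<..T})) \<partial>P t x) < \<infinity>"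
proof -
  have "(\<lambda>w. \<Prod>\<tau>\<in>jumps w \<inter> {t<..T}. c) \<in> borel_measurable (P t x)"
    by (rule measurable_P[OF measurable_jump_prod[OF t order_refl, of "\<lambda>_. c"]]) (use t x in auto)
  then show "(\<lambda>w. c ^ card (jumps w \<inter> {t<..T})) \<in> borel_measurable (P t x)" by simp
  let ?N = "\<lambda>w. card (jumps w \<inter> {t<..T})"
  have "(\<lambda>w. \<Sum>\<tau>\<in>jumps w \<inter> {t<..T}. 1 :: real) \<in> borel_measurable (P t x)"
    by (rule measurable_P[OF measurable_jump_sum[OF t order_refl, of "\<lambda>_. 1"]]) (use t x in auto)
  from measurable_compose[OF this floor_measurable[of "\<lambda>k. real (k choose _)"]]
  have m: "(\<lambda>w. real (?N w choose n)) \<in> borel_measurable (P t x)" for n by simp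
  have binom: "ennreal (c ^ k) = (\<Sum>n. ennreal ((c - 1) ^ n) * ennreal (real (k choose n)))" for k
  proof -
    have "ennreal (c ^ k) = ennreal (\<Sum>n\<le>k. (c - 1) ^ n * real (k choose n))"
      using binomial_ring[of "c - 1" 1 k] by (simp add: mult.commute)
    also have "\<dots> = (\<Sum>n\<le>k. ennreal ((c - 1) ^ n) * ennreal (real (k choose n)))"
      using c by (simp add: sum_ennreal flip: ennreal_mult)
    also have "\<dots> = (\<Sum>n. ennreal ((c - 1) ^ n) * ennreal (real (k choose n)))"
      by (rule suminf_finite[symmetric]) auto
    finally show ?thesis .
  qed
  have "(\<integral>\<^sup>+w. ennreal (c ^ ?N w) \<partial>P t x) = (\<Sum>n. ennreal ((c - 1) ^ n) * (\<integral>\<^sup>+w. ennreal (real (?N w choose n)) \<partial>P t x))"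
    unfolding binom using m by (subst nn_integral_suminf) (auto simp: nn_integral_cmult borel_measurable_times_ennreal)
  also have "\<dots> \<le> (\<Sum>n. ennreal (((c - 1) * (\<Lambda> * (T - t))) ^ n / fact n))"
  proof (intro suminf_le summableI)
    fix n
    show "ennreal ((c - 1) ^ n) * (\<integral>\<^sup>+w. ennreal (real (?N w choose n)) \<partial>P t x) \<le> ennreal (((c - 1) * (\<Lambda> * (T - t))) ^ n / fact n)"
      using mult_left_mono[OF jump_count_factorial_moment[OF t x t(2) order_refl, of n], of "ennreal ((c - 1) ^ n)"] c
      by (simp add: power_mult_distrib[of "c - 1"] flip: ennreal_mult')
  qed
  also have "\<dots> < \<infinity>"
  proof (subst suminf_ennreal2)
    have "summable (\<lambda>n. z ^ n / fact n)" for z :: real using summable_exp[of z] by (simp add: field_simps)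
    then show "summable (\<lambda>n. ((c - 1) * (\<Lambda> * (T - t))) ^ n / fact n)" .
  qed (use c t rate_bound_pos in auto)
  finally show "(\<integral>\<^sup>+w. ennreal (c ^ card (jumps w \<inter> {t<..T})) \<partial>P t x) < \<infinity>" .
qed

end

section \<open>The Hamiltonian\<close>

locale control_problem = markov_jump_process T K \<nu> \<Omega> X P
  for T :: real and K :: "'k measure" and \<nu> :: "real \<Rightarrow> 'k \<Rightarrow> 'k measure" and \<Omega> :: "'w set"
    and X :: "real \<Rightarrow> 'w \<Rightarrow> 'k" and P :: "real \<Rightarrow> 'k \<Rightarrow> 'w measure" +
  fixes U :: "'u measure" and r :: "real \<Rightarrow> 'k \<Rightarrow> 'k \<Rightarrow> 'u \<Rightarrow> real" and g :: "'k \<Rightarrow> real"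
    and l :: "real \<Rightarrow> 'k \<Rightarrow> 'u \<Rightarrow> real" and C :: real and v :: "real \<Rightarrow> 'k \<Rightarrow> real"
  assumes r_measurable: "(\<lambda>(t, x, y, u). r t x y u)
        \<in> borel_measurable (restrict_space borel {0..T} \<Otimes>\<^sub>M K \<Otimes>\<^sub>M K \<Otimes>\<^sub>M U)"
    and C_pos: "0 < C"
    and r_bounds: "\<And>s x y u. 0 \<le> s \<Longrightarrow> s \<le> T \<Longrightarrow> x \<in> space K \<Longrightarrow> y \<in> space K \<Longrightarrow> u \<in> space U \<Longrightarrow>
        0 \<le> r s x y u \<and> r s x y u \<le> C"
    and l_measurable: "(\<lambda>(t, x, u). l t x u) \<in> borel_measurable (restrict_space borel {0..T} \<Otimes>\<^sub>M K \<Otimes>\<^sub>M U)"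
    and U_nonempty: "space U \<noteq> {}"
    and l_bdd_below: "\<And>s x. 0 \<le> s \<Longrightarrow> s \<le> T \<Longrightarrow> x \<in> space K \<Longrightarrow> bdd_below (l s x ` space U)"
    and v: "hjb_solution T K \<nu> X P g (hamiltonian U \<nu> r l) v"
begin

lemma measurable_r:
  assumes "s \<in> borel_measurable N" "a \<in> N \<rightarrow>\<^sub>M K" "b \<in> N \<rightarrow>\<^sub>M K" "w \<in> N \<rightarrow>\<^sub>M U"
    and s: "\<And>q. q \<in> space N \<Longrightarrow> 0 \<le> s q \<and> s q \<le> T"
  shows "(\<lambda>q. r (s q) (a q) (b q) (w q)) \<in> borel_measurable N"
proof -
  have "s \<in> N \<rightarrow>\<^sub>M restrict_space borel {0..T}" using assms(1) s by (intro measurable_restrict_space2) auto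
  then have "(\<lambda>q. (s q, a q, b q, w q)) \<in> N \<rightarrow>\<^sub>M restrict_space borel {0..T} \<Otimes>\<^sub>M K \<Otimes>\<^sub>M K \<Otimes>\<^sub>M U"
    using assms(2-4) by (intro measurable_Pair)
  from measurable_compose[OF this r_measurable] show ?thesis by simp
qed

lemma measurable_l:
  assumes "s \<in> borel_measurable N" "a \<in> N \<rightarrow>\<^sub>M K" "w \<in> N \<rightarrow>\<^sub>M U"
    and s: "\<And>q. q \<in> space N \<Longrightarrow> 0 \<le> s q \<and> s q \<le> T"
  shows "(\<lambda>q. l (s q) (a q) (w q)) \<in> borel_measurable N"
proof -
  have "s \<in> N \<rightarrow>\<^sub>M restrict_space borel {0..T}" using assms(1) s by (intro measurable_restrict_space2) auto
  then have "(\<lambda>q. (s q, a q, w q)) \<in> N \<rightarrow>\<^sub>M restrict_space borel {0..T} \<Otimes>\<^sub>M K \<Otimes>\<^sub>M U"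
    using assms(2,3) by (intro measurable_Pair)
  from measurable_compose[OF this l_measurable] show ?thesis by simp
qed

lemma r_section:
  assumes "0 \<le> s" "s \<le> T" "x \<in> space K" "u \<in> space U"
  shows "(\<lambda>y. r s x y u) \<in> borel_measurable (\<nu> s x)"
  by (rule rate_measurable_sets[OF measurable_r]) (use assms in auto)

lemma r_minus_one_bound:
  assumes "0 \<le> s" "s \<le> T" "x \<in> space K" "y \<in> space K" "u \<in> space U"
  shows "\<bar>r s x y u - 1\<bar> \<le> 1 + C"
  using r_bounds[OF assms] C_pos by auto

lemma drift_integrable:
  assumes s: "0 \<le> s" "s \<le> T" "x \<in> space K" "u \<in> space U" and z: "integrable (\<nu> s x) z"
  shows "integrable (\<nu> s x) (\<lambda>y. z y * (r s x y u - 1))"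
    "\<bar>LINT y|\<nu> s x. z y * (r s x y u - 1)\<bar> \<le> (1 + C) * (LINT y|\<nu> s x. \<bar>z y\<bar>)"
proof -
  have le: "\<bar>z y * (r s x y u - 1)\<bar> \<le> (1 + C) * \<bar>z y\<bar>" if "y \<in> space (\<nu> s x)" for y
    using mult_left_mono[OF r_minus_one_bound, of s x y u "\<bar>z y\<bar>"] that s
    by (simp add: abs_mult space_rate mult.commute)
  show i: "integrable (\<nu> s x) (\<lambda>y. z y * (r s x y u - 1))"
  proof (rule Bochner_Integration.integrable_bound)
    show "integrable (\<nu> s x) (\<lambda>y. (1 + C) * \<bar>z y\<bar>)" using z by simp
    show "(\<lambda>y. z y * (r s x y u - 1)) \<in> borel_measurable (\<nu> s x)"
      using r_section[OF s] borel_measurable_integrable[OF z] by measurable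
    show "AE y in \<nu> s x. norm (z y * (r s x y u - 1)) \<le> norm ((1 + C) * \<bar>z y\<bar>)"
      by (rule AE_I2) (use le C_pos in \<open>auto simp: abs_mult\<close>)
  qed
  have "\<bar>LINT y|\<nu> s x. z y * (r s x y u - 1)\<bar> \<le> (LINT y|\<nu> s x. \<bar>z y * (r s x y u - 1)\<bar>)"
    by (rule integral_abs_bound)
  also have "\<dots> \<le> (LINT y|\<nu> s x. (1 + C) * \<bar>z y\<bar>)" by (rule integral_mono) (use i z le in auto)
  finally show "\<bar>LINT y|\<nu> s x. z y * (r s x y u - 1)\<bar> \<le> (1 + C) * (LINT y|\<nu> s x. \<bar>z y\<bar>)" by simp
qed

lemma controlled_drift_bdd_below:
  assumes s: "0 \<le> s" "s \<le> T" "x \<in> space K" and z: "integrable (\<nu> s x) z"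
  shows "bdd_below (controlled_drift \<nu> r l s x z ` space U)"
proof -
  obtain m where m: "\<And>u. u \<in> space U \<Longrightarrow> m \<le> l s x u" using l_bdd_below[OF s] by (auto simp: bdd_below_def)
  show ?thesis
  proof (rule bdd_belowI2)
    fix u assume u: "u \<in> space U"
    show "m - (1 + C) * (LINT y|\<nu> s x. \<bar>z y\<bar>) \<le> controlled_drift \<nu> r l s x z u"
      using m[OF u] drift_integrable(2)[OF s u z] by (simp add: controlled_drift_def abs_le_iff)
  qed
qed

lemma hamiltonian_le:
  assumes "0 \<le> s" "s \<le> T" "x \<in> space K" "integrable (\<nu> s x) z" "u \<in> space U"
  shows "hamiltonian U \<nu> r l s x z \<le> controlled_drift \<nu> r l s x z u"
  unfolding hamiltonian_def by (rule cINF_lower[OF controlled_drift_bdd_below]) (use assms in auto)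

text \<open>For each control the minimised quantity is Lipschitz in \<open>z\<close> with constant
  \<open>1 + C\<close>, a bound for \<open>\<bar>r - 1\<bar>\<close>, and the infimum inherits the
  constant. One direction suffices by symmetry.\<close>

lemma hamiltonian_lipschitz:
  assumes s: "0 \<le> s" "s \<le> T" "x \<in> space K" and z: "z \<in> square_integrable (\<nu> s x)" "z' \<in> square_integrable (\<nu> s x)"
  shows "\<bar>hamiltonian U \<nu> r l s x z - hamiltonian U \<nu> r l s x z'\<bar> \<le> (1 + C) * (LINT a|\<nu> s x. \<bar>z a - z' a\<bar>)"
proof -
  note fin = finite_measure_rate[OF s]
  have i: "integrable (\<nu> s x) z" "integrable (\<nu> s x) z'"
    using square_integrable_integrable(1)[OF fin] z by auto
  have le: "hamiltonian U \<nu> r l s x z - (1 + C) * (LINT a|\<nu> s x. \<bar>z a - z' a\<bar>) \<le> hamiltonian U \<nu> r l s x z'"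
    if i: "integrable (\<nu> s x) z" "integrable (\<nu> s x) z'" for z z' :: "'k \<Rightarrow> real"
    unfolding hamiltonian_def[of _ _ _ _ _ _ z']
  proof (rule cINF_greatest[OF U_nonempty])
    fix u assume u: "u \<in> space U"
    have "controlled_drift \<nu> r l s x z u - controlled_drift \<nu> r l s x z' u
      = (LINT y|\<nu> s x. z y * (r s x y u - 1)) - (LINT y|\<nu> s x. z' y * (r s x y u - 1))"
      by (simp add: controlled_drift_def)
    also have "\<dots> = (LINT y|\<nu> s x. (z y - z' y) * (r s x y u - 1))"
      by (simp add: left_diff_distrib drift_integrable(1)[OF s u] i flip: Bochner_Integration.integral_diff)
    also have "\<dots> \<le> (1 + C) * (LINT a|\<nu> s x. \<bar>z a - z' a\<bar>)"
      using drift_integrable(2)[OF s u Bochner_Integration.integrable_diff[OF i]] by simp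
    finally show "hamiltonian U \<nu> r l s x z - (1 + C) * (LINT a|\<nu> s x. \<bar>z a - z' a\<bar>) \<le> controlled_drift \<nu> r l s x z' u"
      using hamiltonian_le[OF s i(1) u] by simp
  qed
  have sym: "(LINT a|\<nu> s x. \<bar>z' a - z a\<bar>) = (LINT a|\<nu> s x. \<bar>z a - z' a\<bar>)" by (simp only: abs_minus_commute)
  show ?thesis using le[OF i] le[OF i(2,1)] unfolding sym by (simp add: abs_le_iff)
qed

text \<open>\<open>Z\<close> is determined only up to null sets of the rates, so minimisers must not
  depend on the representative.\<close>

lemma minimizers_cong:
  assumes s: "0 \<le> s" "s \<le> T" "x \<in> space K"
    and z: "z \<in> borel_measurable (\<nu> s x)" "z' \<in> borel_measurable (\<nu> s x)" "AE y in \<nu> s x. z y = z' y"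
  shows "minimizers U \<nu> r l s x z = minimizers U \<nu> r l s x z'"
proof -
  have "controlled_drift \<nu> r l s x z u = controlled_drift \<nu> r l s x z' u" if u: "u \<in> space U" for u
    unfolding controlled_drift_def
    by (intro arg_cong2[where f = "(+)"] refl Bochner_Integration.integral_cong_AE)
      (use z r_section[OF s u] in auto)
  then show ?thesis by (auto simp: minimizers_def hamiltonian_def cong: INF_cong_simp)
qed

section \<open>Identification of the backward solution with \<open>v\<close> along the path\<close>

context
  fixes t x Y Z
  assumes t: "0 \<le> t" "t \<le> T" and x: "x \<in> space K"
    and sol: "bsde_solution T K \<nu> \<Omega> X P g (hamiltonian U \<nu> r l) t x Y Z"
begin

interpretation bsde_comparison T K \<nu> \<Omega> X P t x g "hamiltonian U \<nu> r l" v Y Z "1 + C"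
  by unfold_locales (use t x v sol C_pos hamiltonian_lipschitz in auto)

lemma bsde_solution_value: "AE w in P t x. \<forall>s\<in>{t..T}. Y s w = v s (X s w)"
  using D_zero by eventually_elim (simp add: D_def)

lemma dZ_sq_measurable: "(\<lambda>p. \<integral>\<^sup>+y. ennreal ((dZ (p, y))\<^sup>2) \<partial>rate p) \<in> borel_measurable (PT t x)"
proof -
  have "(\<lambda>q. ennreal ((dZ q)\<^sup>2)) \<in> borel_measurable (PT t x \<Otimes>\<^sub>M K)" using dZ_measurable_PT by measurable
  from PT_nn_integral_rate[OF t x this] show ?thesis .
qed

lemma bsde_solution_integrand:
  "(\<integral>\<^sup>+w. (\<integral>\<^sup>+s\<in>{t<..T}. (\<integral>\<^sup>+y. ennreal (\<bar>Z s w y - v s y + v s (left_lim X s w)\<bar>\<^sup>2)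
    \<partial>\<nu> s (left_lim X s w)) \<partial>lborel) \<partial>P t x) = 0"
proof -
  have "(\<integral>\<^sup>+w. (\<integral>\<^sup>+s\<in>{t<..T}. (\<integral>\<^sup>+y. ennreal (\<bar>Z s w y - v s y + v s (left_lim X s w)\<bar>\<^sup>2)
    \<partial>\<nu> s (left_lim X s w)) \<partial>lborel) \<partial>P t x)
    = (\<integral>\<^sup>+w. (\<integral>\<^sup>+s\<in>{t<..T}. (\<integral>\<^sup>+y. ennreal ((dZ ((w, s), y))\<^sup>2) \<partial>rate (w, s)) \<partial>lborel) \<partial>P t x)"
  proof (rule nn_integral_cong)
    fix w assume "w \<in> space (P t x)"
    then have w: "w \<in> \<Omega>" using t x by simp
    show "(\<integral>\<^sup>+s\<in>{t<..T}. (\<integral>\<^sup>+y. ennreal (\<bar>Z s w y - v s y + v s (left_lim X s w)\<bar>\<^sup>2) \<partial>\<nu> s (left_lim X s w)) \<partial>lborel)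
      = (\<integral>\<^sup>+s\<in>{t<..T}. (\<integral>\<^sup>+y. ennreal ((dZ ((w, s), y))\<^sup>2) \<partial>rate (w, s)) \<partial>lborel)"
    proof (rule nn_integral_cong_AE)
      show "AE s in lborel. (\<integral>\<^sup>+y. ennreal (\<bar>Z s w y - v s y + v s (left_lim X s w)\<bar>\<^sup>2) \<partial>\<nu> s (left_lim X s w)) * indicator {t<..T} s
        = (\<integral>\<^sup>+y. ennreal ((dZ ((w, s), y))\<^sup>2) \<partial>rate (w, s)) * indicator {t<..T} s"
        using left_lim_AE[OF w]
        by eventually_elim (use t in \<open>auto simp: dZ_def left_path_def indicator_def algebra_simps\<close>)
    qed
  qed
  also have "\<dots> = 0" using dZ_zero unfolding nn_integral_PT[OF dZ_sq_measurable] .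
  finally show ?thesis .
qed

text \<open>Vanishing of \<open>dZ\<close> in mean square gives, for almost every path and time,
  equality of the two integrands almost everywhere with respect to the rate measure, and
  \<open>minimizers_cong\<close> applies.\<close>

lemma bsde_solution_minimizers:
  "AE w in P t x. AE s in lborel. s \<in> {t..T} \<longrightarrow> minimizers U \<nu> r l s (left_lim X s w) (Z s w)
    = minimizers U \<nu> r l s (left_lim X s w) (\<lambda>y. v s y - v s (left_lim X s w))"
proof -
  have "AE p in PT t x. (\<integral>\<^sup>+y. ennreal ((dZ (p, y))\<^sup>2) \<partial>rate p) = 0"
    using dZ_zero by (subst nn_integral_0_iff_AE[symmetric]) (rule dZ_sq_measurable)
  with square_integrable_sections AE_space
  have "AE p in PT t x. p \<in> space (PT t x) \<and> (\<lambda>y. Z (snd p) (fst p) y) \<in> square_integrable (rate p)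
    \<and> (\<lambda>y. v (snd p) y - v (snd p) (X (snd p) (fst p))) \<in> square_integrable (rate p) \<and> (\<integral>\<^sup>+y. ennreal ((dZ (p, y))\<^sup>2) \<partial>rate p) = 0"
    by (auto elim!: AE_mp)
  from AE_conjI[OF PT_AE_D[OF t(1) x this] AE_space] show ?thesis
  proof eventually_elim
    case (elim w)
    then have w: "w \<in> \<Omega>" using t x by simp
    show ?case unfolding AE_time_measure_closed[symmetric] AE_time_measure using conjunct1[OF elim] left_lim_AE[OF w]
    proof eventually_elim
      case (elim s)
      show ?case
      proof (intro impI)
        assume s: "t < s" "s \<le> T"
        let ?N = "\<nu> s (X s w)"
        note e = elim(1)[rule_format, OF s, unfolded fst_conv snd_conv]
        have sq: "Z s w \<in> square_integrable ?N" "(\<lambda>y. v s y - v s (X s w)) \<in> square_integrable ?N" using e by auto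
        have ll: "left_lim X s w = X s w" and s0: "0 \<le> s" using elim(2) s t by auto
        have "AE y in ?N. ennreal ((dZ ((w, s), y))\<^sup>2) = 0"
          using e PT_section_measurable[OF dZ_measurable_PT, of "(w, s)"] t x
          by (subst nn_integral_0_iff_AE[symmetric]) auto
        then have "AE y in ?N. Z s w y = v s y - v s (X s w)"
          by eventually_elim (use s t ll in \<open>auto simp: dZ_def left_path_def\<close>)
        then show "minimizers U \<nu> r l s (left_lim X s w) (Z s w)
          = minimizers U \<nu> r l s (left_lim X s w) (\<lambda>y. v s y - v s (left_lim X s w))"
          unfolding ll by (intro minimizers_cong s0 s path_range[OF s0 w]) (use sq in \<open>auto simp: square_integrable_def\<close>)
      qed
    qed
  qed
qed

end

end

section \<open>The change of measure\<close>

lemma piecewise_ac_cong: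
  assumes h: "piecewise_ac a b J h \<psi> j" and "a \<le> b"
    and eq: "\<And>s. a \<le> s \<Longrightarrow> s \<le> b \<Longrightarrow> h s = h' s" "\<And>s. a < s \<Longrightarrow> s \<le> b \<Longrightarrow> \<psi> s = \<psi>' s"
      "\<And>\<tau>. \<tau> \<in> J \<Longrightarrow> a < \<tau> \<Longrightarrow> \<tau> \<le> b \<Longrightarrow> j \<tau> = j' \<tau>"
  shows "piecewise_ac a b J h' \<psi>' j'"
proof (rule piecewise_acI)
  show "finite (J \<inter> {a<..b})" using h by (simp add: piecewise_ac_def)
  have "set_integrable lebesgue {a<..b} \<psi> = set_integrable lebesgue {a<..b} \<psi>'"
    by (rule set_integrable_cong) (use eq(2) in auto)
  then show "set_integrable lebesgue {a<..b} \<psi>'" using h by (simp add: piecewise_ac_def)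
  fix s assume s: "a \<le> s" "s \<le> b"
  have "h s - h a = (LINT q:{a<..s}|lebesgue. \<psi> q) + (\<Sum>\<tau>\<in>J \<inter> {a<..s}. j \<tau>)"
    using piecewise_ac_increment[OF h order_refl s] by simp
  also have "(LINT q:{a<..s}|lebesgue. \<psi> q) = (LINT q:{a<..s}|lebesgue. \<psi>' q)"
    by (rule set_lebesgue_integral_cong) (use eq(2) s in auto)
  also have "(\<Sum>\<tau>\<in>J \<inter> {a<..s}. j \<tau>) = (\<Sum>\<tau>\<in>J \<inter> {a<..s}. j' \<tau>)"
    by (rule sum.cong) (use eq(3) s in auto)
  finally show "h' s - h' a = (LINT q:{a<..s}|lebesgue. \<psi>' q) + (\<Sum>\<tau>\<in>J \<inter> {a<..s}. j' \<tau>)"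
    using eq(1) s \<open>a \<le> b\<close> by simp
qed

lemma piecewise_ac_extend:
  assumes "piecewise_ac a b {} h \<psi> j" "finite (J \<inter> {a<..b})"
  shows "piecewise_ac a b J h \<psi> (\<lambda>_. 0)"
  using assms unfolding piecewise_ac_def Int_empty_left sum.empty sum.neutral_const by blast

context markov_jump_process
begin

lemma time_integral_ac:
  fixes k :: "real \<Rightarrow> real"
  assumes k: "integrable (time_measure t) k"
  shows "piecewise_ac t T {} (\<lambda>s. LINT q:{t<..s}|lborel. k q) k (\<lambda>_. 0)"
proof (rule piecewise_acI)
  show "set_integrable lebesgue {t<..T} k" by (rule time_measure_set_integral(1)[OF k])
  fix s assume s: "t \<le> s" "s \<le> T"
  show "(LINT q:{t<..s}|lborel. k q) - (LINT q:{t<..t}|lborel. k q) = (LINT q:{t<..s}|lebesgue. k q) + (\<Sum>\<tau>\<in>{} \<inter> {t<..s}. 0)"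
    using time_measure_set_integral(2,3)[OF k order_refl s(2)] by (simp add: set_lebesgue_integral_def)
qed simp

text \<open>Clamping the time makes the integrand depend only on the information at
  \<open>s\<close>, for every real time; on the domain of integration it changes nothing.\<close>

lemma adapted_time_integral:
  fixes k :: "'w \<times> real \<Rightarrow> real"
  assumes "(\<lambda>(w, q). k (w, clamp_to t s q)) \<in> borel_measurable (\<F> {t..s} \<Otimes>\<^sub>M borel)"
  shows "(\<lambda>w. LINT q:{t<..s}|lborel. k (w, q)) \<in> borel_measurable (\<F> {t..s})"
proof -
  have "(\<lambda>p. indicator {t<..s} (snd p) *\<^sub>R k (fst p, clamp_to t s (snd p))) \<in> borel_measurable (\<F> {t..s} \<Otimes>\<^sub>M lborel)"
    using assms by (simp add: case_prod_beta' cong: measurable_cong_sets) measurable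
  then have "(\<lambda>w. \<integral>q. indicator {t<..s} q *\<^sub>R k (w, clamp_to t s q) \<partial>lborel) \<in> borel_measurable (\<F> {t..s})"
    by (intro lborel.borel_measurable_lebesgue_integral) (simp add: case_prod_beta')
  moreover have "(\<integral>q. indicator {t<..s} q *\<^sub>R k (w, clamp_to t s q) \<partial>lborel) = (LINT q:{t<..s}|lborel. k (w, q))" for w
    unfolding set_lebesgue_integral_def by (intro Bochner_Integration.integral_cong) (auto simp: indicator_def)
  ultimately show ?thesis by simp
qed

lemma grid_limit_bounds:
  assumes pw: "piecewise_ac t T J (\<lambda>s. h s w) \<psi> j" and s: "t < s" "s \<le> T"
    and b: "\<And>q. t \<le> q \<Longrightarrow> q \<le> T \<Longrightarrow> a \<le> h q w \<and> h q w \<le> b"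
  shows "a \<le> grid_limit t h (w, s)" "grid_limit t h (w, s) \<le> b"
proof -
  have lim: "(\<lambda>n. h (grid_left t n s) w) \<longlonglongrightarrow> h s w - (if s \<in> J then j s else 0)"
    by (rule piecewise_ac_left_limit[OF pw s grid_left_ge grid_left_less[OF s(1)] grid_left_tendsto[OF s(1)]])
  have "a \<le> h (grid_left t n s) w \<and> h (grid_left t n s) w \<le> b" for n
    using grid_left_less[OF s(1), of n] s by (intro b grid_left_ge) simp
  then have "a \<le> h s w - (if s \<in> J then j s else 0)" "h s w - (if s \<in> J then j s else 0) \<le> b"
    using LIMSEQ_le_const[OF lim] LIMSEQ_le_const2[OF lim] by blast+
  then show "a \<le> grid_limit t h (w, s)" "grid_limit t h (w, s) \<le> b"
    using limI[OF lim] by (auto simp: grid_limit_def)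
qed

end

context control_problem
begin

text \<open>A majorant of the density process on all of [t, T], common to all controls: the exponent
  grows at rate at most \<Lambda>, and each jump contributes a factor at most \<open>C\<close>. The
  maximum with 1 makes the bound monotone in the number of jumps.\<close>

definition density_bound :: "real \<Rightarrow> 'w \<Rightarrow> real" where
  "density_bound t w = exp (\<Lambda> * (T - t)) * max 1 C ^ card (jumps w \<inter> {t<..T})"

lemma density_bound_pos: "0 < density_bound t w"
  by (simp add: density_bound_def)

lemma density_bound_moment:
  assumes t: "0 \<le> t" "t \<le> T" and x: "x \<in> space K" and \<beta>: "0 \<le> \<beta>"
  shows "density_bound t \<in> borel_measurable (P t x)"
    "(\<integral>\<^sup>+w. ennreal (density_bound t w powr \<beta>) \<partial>P t x) < \<infinity>"
proof -
  have c: "(1::real) \<le> max 1 C" by simp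
  show m: "density_bound t \<in> borel_measurable (P t x)"
    using jump_count_moment(1)[OF t x c] unfolding density_bound_def[abs_def] by measurable
  let ?c = "max 1 C powr \<beta>"
  have c': "1 \<le> ?c" using ge_one_powr_ge_zero[OF c \<beta>] .
  have "density_bound t w powr \<beta> = exp (\<Lambda> * (T - t)) powr \<beta> * ?c ^ card (jumps w \<inter> {t<..T})" for w
    by (simp add: density_bound_def powr_mult powr_powr mult.commute flip: powr_realpow)
  then have "(\<integral>\<^sup>+w. ennreal (density_bound t w powr \<beta>) \<partial>P t x)
    = (\<integral>\<^sup>+w. ennreal (exp (\<Lambda> * (T - t)) powr \<beta>) * ennreal (?c ^ card (jumps w \<inter> {t<..T})) \<partial>P t x)"
    using c' by (simp add: ennreal_mult)
  also have "\<dots> = ennreal (exp (\<Lambda> * (T - t)) powr \<beta>) * (\<integral>\<^sup>+w. ennreal (?c ^ card (jumps w \<inter> {t<..T})) \<partial>P t x)"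
    by (rule nn_integral_cmult[OF measurable_compose[OF jump_count_moment(1)[OF t x c'] measurable_ennreal]])
  also have "\<dots> < \<infinity>" using jump_count_moment(2)[OF t x c'] by (simp add: ennreal_mult_less_top)
  finally show "(\<integral>\<^sup>+w. ennreal (density_bound t w powr \<beta>) \<partial>P t x) < \<infinity>" .
qed

text \<open>Young's inequality with conjugate exponents. The exponent \<beta> is large when \<alpha>
  is close to 1, which is why moments of every order of the majorant were established.\<close>

lemma density_bound_mult_finite:
  assumes t: "0 \<le> t" "t \<le> T" and x: "x \<in> space K" and \<alpha>: "1 < \<alpha>"
    and N[measurable]: "N \<in> borel_measurable (P t x)" and fin: "(\<integral>\<^sup>+w. ennreal_powr (N w) \<alpha> \<partial>P t x) < \<infinity>"
  shows "(\<integral>\<^sup>+w. ennreal (density_bound t w) * N w \<partial>P t x) < \<infinity>"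
proof -
  define \<beta> where "\<beta> = \<alpha> / (\<alpha> - 1)"
  have \<beta>: "1 < \<beta>" "1 / \<alpha> + 1 / \<beta> = 1" using \<alpha> by (simp_all add: \<beta>_def field_simps)
  have [measurable]: "density_bound t \<in> borel_measurable (P t x)" by (rule density_bound_moment(1)[OF t x order_refl])
  have le: "ennreal (density_bound t w) * N w \<le> ennreal_powr (N w) \<alpha> + ennreal (density_bound t w powr \<beta>)" for w
  proof (cases "N w")
    case (real n)
    have "density_bound t w * n \<le> n powr \<alpha> / \<alpha> + density_bound t w powr \<beta> / \<beta>"
      using Youngs_inequality[OF \<alpha> \<beta> real(1), of "density_bound t w"] density_bound_pos[of t w] by (simp add: mult.commute)
    also have "\<dots> \<le> n powr \<alpha> / 1 + density_bound t w powr \<beta> / 1"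
      using \<alpha> \<beta> by (intro add_mono divide_left_mono) auto
    finally have "ennreal (density_bound t w * n) \<le> ennreal (n powr \<alpha> + density_bound t w powr \<beta>)" by (intro ennreal_leI) simp
    then show ?thesis using real density_bound_pos[of t w] by (simp add: ennreal_powr_def ennreal_mult ennreal_plus)
  qed (simp add: ennreal_powr_def)
  have "(\<integral>\<^sup>+w. ennreal (density_bound t w) * N w \<partial>P t x)
    \<le> (\<integral>\<^sup>+w. ennreal_powr (N w) \<alpha> + ennreal (density_bound t w powr \<beta>) \<partial>P t x)"
    by (intro nn_integral_mono le)
  also have "\<dots> = (\<integral>\<^sup>+w. ennreal_powr (N w) \<alpha> \<partial>P t x) + (\<integral>\<^sup>+w. ennreal (density_bound t w powr \<beta>) \<partial>P t x)"
    by (rule nn_integral_add) (simp_all add: ennreal_powr_def)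
  also have "\<dots> < \<infinity>" using fin density_bound_moment(2)[OF t x, of \<beta>] \<beta> by simp
  finally show ?thesis .
qed

end

locale admissible_control = control_problem T K \<nu> \<Omega> X P U r g l C v
  for T :: real and K :: "'k measure" and \<nu> :: "real \<Rightarrow> 'k \<Rightarrow> 'k measure" and \<Omega> :: "'w set"
    and X :: "real \<Rightarrow> 'w \<Rightarrow> 'k" and P :: "real \<Rightarrow> 'k \<Rightarrow> 'w measure"
    and U :: "'u measure" and r :: "real \<Rightarrow> 'k \<Rightarrow> 'k \<Rightarrow> 'u \<Rightarrow> real" and g :: "'k \<Rightarrow> real"
    and l :: "real \<Rightarrow> 'k \<Rightarrow> 'u \<Rightarrow> real" and C :: real and v :: "real \<Rightarrow> 'k \<Rightarrow> real" +
  fixes t :: real and x :: 'k and u :: "real \<Rightarrow> 'w \<Rightarrow> 'u" and \<alpha> :: real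
  assumes t: "0 \<le> t" "t \<le> T" and x: "x \<in> space K"
    and u: "u \<in> admissible T K \<Omega> X U t"
    and \<alpha>: "1 < \<alpha>"
    and l_moment: "(\<integral>\<^sup>+w. ennreal_powr (\<integral>\<^sup>+s\<in>{t<..T}. ennreal \<bar>l s (X s w) (u s w)\<bar> \<partial>lborel) \<alpha> \<partial>P t x) < \<infinity>"
begin

text \<open>The left state makes this predictable, as the compensator formula demands; at a jump it
  is the factor by which the density is multiplied.\<close>

definition factor :: "('w \<times> real) \<times> 'k \<Rightarrow> real" where
  "factor q = r (snd (fst q)) (left_path t (snd (fst q)) (fst (fst q))) (snd q) (u (snd (fst q)) (fst (fst q)))"

definition \<rho> :: "'w \<times> real \<Rightarrow> real" where
  "\<rho> p = (LINT y|rate p. 1 - r (snd p) (X (snd p) (fst p)) y (u (snd p) (fst p)))"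

definition run :: "'w \<times> real \<Rightarrow> real" where
  "run p = l (snd p) (X (snd p) (fst p)) (u (snd p) (fst p))"

definition L :: "real \<Rightarrow> 'w \<Rightarrow> real" where
  "L s w = exp (LINT q:{t<..s}|lborel. \<rho> (w, q)) * (\<Prod>\<tau>\<in>jumps w \<inter> {t<..s}. factor ((w, \<tau>), X \<tau> w))"

definition A :: "real \<Rightarrow> 'w \<Rightarrow> real" where
  "A s w = (LINT q:{t<..s}|lborel. run (w, q))"

abbreviation L' :: "'w \<times> real \<Rightarrow> real" where "L' \<equiv> grid_limit t L"

abbreviation A' :: "'w \<times> real \<Rightarrow> real" where "A' \<equiv> grid_limit t A"

lemma u_measurable: "(\<lambda>p. u (snd p) (fst p)) \<in> Pred t \<rightarrow>\<^sub>M U"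
  using u by (simp add: admissible_def case_prod_beta')

lemma u_space: "w \<in> \<Omega> \<Longrightarrow> t \<le> s \<Longrightarrow> s \<le> T \<Longrightarrow> u s w \<in> space U"
  using measurable_space[OF u_measurable, of "(w, s)"] t by simp

text \<open>The parameter \<open>\<phi>\<close> covers at once the product space of paths and time
  and the clamped times on which adaptedness is checked.\<close>

lemma composed_measurable:
  assumes \<phi>: "\<phi> \<in> N \<rightarrow>\<^sub>M Pred t" and X: "(\<lambda>q. X (snd (\<phi> q)) (fst (\<phi> q))) \<in> N \<rightarrow>\<^sub>M K"
  shows "(\<lambda>q. \<rho> (\<phi> q)) \<in> borel_measurable N" "(\<lambda>q. run (\<phi> q)) \<in> borel_measurable N"
proof -
  have s: "(\<lambda>q. snd (\<phi> q)) \<in> borel_measurable N" by (rule measurable_compose[OF \<phi> predictable_snd[OF t]])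
  have uu: "(\<lambda>q. u (snd (\<phi> q)) (fst (\<phi> q))) \<in> N \<rightarrow>\<^sub>M U" by (rule measurable_compose[OF \<phi> u_measurable])
  have b: "0 \<le> snd (\<phi> q) \<and> snd (\<phi> q) \<le> T" if "q \<in> space N" for q
    using measurable_space[OF \<phi> that] t by (auto simp: mem_Times_iff)
  show "(\<lambda>q. run (\<phi> q)) \<in> borel_measurable N" unfolding run_def by (rule measurable_l[OF s X uu b])
  have "(\<lambda>z. r (snd (\<phi> (fst z))) (X (snd (\<phi> (fst z))) (fst (\<phi> (fst z)))) (snd z) (u (snd (\<phi> (fst z))) (fst (\<phi> (fst z))))) \<in> borel_measurable (N \<Otimes>\<^sub>M K)"
    by (rule measurable_r[OF measurable_compose[OF measurable_fst s] measurable_compose[OF measurable_fst X] measurable_snd measurable_compose[OF measurable_fst uu]])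
      (use b in \<open>auto simp: space_pair_measure\<close>)
  then have "(\<lambda>(q, y). 1 - r (snd (\<phi> q)) (X (snd (\<phi> q)) (fst (\<phi> q))) y (u (snd (\<phi> q)) (fst (\<phi> q)))) \<in> borel_measurable (N \<Otimes>\<^sub>M K)"
    by (simp add: case_prod_beta')
  from measurable_integral_rate[OF s X _ _ this] b show "(\<lambda>q. \<rho> (\<phi> q)) \<in> borel_measurable N"
    unfolding \<rho>_def by simp
qed

lemma run_measurable: "run \<in> borel_measurable (PT t x)" and \<rho>_measurable: "\<rho> \<in> borel_measurable (PT t x)"
  using composed_measurable[OF PT_to_predictable[OF t x] PT_path[OF t x]] by auto

lemma left_path_space: "w \<in> \<Omega> \<Longrightarrow> t \<le> s \<Longrightarrow> s \<le> T \<Longrightarrow> left_path t s w \<in> space K"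
  using measurable_space[OF predictable_left_path[OF t], of "(w, s)"] t by simp

lemma factor_measurable: "factor \<in> borel_measurable (Pred t \<Otimes>\<^sub>M K)"
  unfolding factor_def[abs_def]
proof (rule measurable_r)
  show "(\<lambda>q. snd (fst q)) \<in> borel_measurable (Pred t \<Otimes>\<^sub>M K)" using predictable_snd[OF t] by measurable
  have "(\<lambda>p. left_path t (snd p) (fst p)) \<in> Pred t \<rightarrow>\<^sub>M K" using predictable_left_path[OF t] by (simp add: case_prod_beta')
  then show "(\<lambda>q. left_path t (snd (fst q)) (fst (fst q))) \<in> Pred t \<Otimes>\<^sub>M K \<rightarrow>\<^sub>M K" by (rule measurable_compose[OF measurable_fst])
  show "(\<lambda>q. u (snd (fst q)) (fst (fst q))) \<in> Pred t \<Otimes>\<^sub>M K \<rightarrow>\<^sub>M U" by (rule measurable_compose[OF measurable_fst u_measurable])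
qed (use t in \<open>auto simp: space_pair_measure\<close>)

lemma factor_bounds:
  assumes "w \<in> \<Omega>" "t \<le> s" "s \<le> T" "y \<in> space K"
  shows "0 \<le> factor ((w, s), y)" "factor ((w, s), y) \<le> C"
  using r_bounds[OF _ assms(3) left_path_space[OF assms(1-3)] assms(4) u_space[OF assms(1-3)]] assms t
  by (auto simp: factor_def)

lemma \<rho>_bounds:
  assumes p: "p \<in> \<Omega> \<times> {t..T}"
  shows "\<rho> p \<le> \<Lambda>" "\<bar>\<rho> p\<bar> \<le> (1 + C) * \<Lambda>" "integrable (rate p) (\<lambda>y. r (snd p) (X (snd p) (fst p)) y (u (snd p) (fst p)))"
    "\<rho> p = - (LINT y|rate p. r (snd p) (X (snd p) (fst p)) y (u (snd p) (fst p)) - 1)"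
proof -
  have s: "0 \<le> snd p" "snd p \<le> T" "X (snd p) (fst p) \<in> space K" "u (snd p) (fst p) \<in> space U"
    using p t u_space path_range by auto
  let ?r = "\<lambda>y. r (snd p) (X (snd p) (fst p)) y (u (snd p) (fst p))"
  interpret N: finite_measure "rate p" by (rule finite_measure_rate[OF s(1-3)])
  have \<Lambda>: "measure (rate p) (space (rate p)) \<le> \<Lambda>"
    using rate_le_bound[OF s(1-3), of "space (rate p)"] rate_bound_pos by (simp add: N.emeasure_eq_measure)
  have rb: "0 \<le> ?r y \<and> ?r y \<le> C" if "y \<in> space (rate p)" for y using r_bounds s that by (simp add: space_rate)
  show ri: "integrable (rate p) ?r"
    by (rule N.integrable_const_bound[where B = C, OF AE_I2 r_section[OF s]]) (use rb in auto)
  have "\<rho> p \<le> (LINT y|rate p. 1)" unfolding \<rho>_def using ri rb by (intro integral_mono) auto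
  then show 1: "\<rho> p \<le> \<Lambda>" using \<Lambda> by simp
  have "\<rho> p = (LINT y|rate p. 1) - (LINT y|rate p. ?r y)" unfolding \<rho>_def using ri by (subst Bochner_Integration.integral_diff) auto
  then show "\<rho> p = - (LINT y|rate p. ?r y - 1)" using ri by (subst Bochner_Integration.integral_diff) auto
  have "- (LINT y|rate p. C) \<le> \<rho> p"
    unfolding \<rho>_def Bochner_Integration.integral_minus[symmetric]
  proof (rule integral_mono)
    show "- C \<le> 1 - ?r y" if "y \<in> space (rate p)" for y using rb[OF that] by simp
  qed (use ri in auto)
  moreover have "(LINT y|rate p. C) \<le> C * \<Lambda>" using mult_left_mono[OF \<Lambda>, of C] C_pos by (simp add: mult.commute)
  ultimately have "- (C * \<Lambda>) \<le> \<rho> p" by linarith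
  then show "\<bar>\<rho> p\<bar> \<le> (1 + C) * \<Lambda>"
    using 1 rate_bound_pos mult_pos_pos[OF C_pos rate_bound_pos] by (simp only: abs_le_iff distrib_right) linarith
qed

lemma \<rho>_integrable: "w \<in> \<Omega> \<Longrightarrow> integrable (time_measure t) (\<lambda>s. \<rho> (w, s))"
  using \<rho>_bounds(2) PT_section[OF \<rho>_measurable t(1) x]
  by (intro finite_measure.integrable_const_bound[OF finite_time_measure, where B = "(1 + C) * \<Lambda>"] AE_I2) auto

lemma girsanov_eq:
  assumes w: "w \<in> \<Omega>"
  shows "girsanov \<nu> X r t u s w = L s w"
proof -
  have "(\<Prod>n\<in>{n. 1 \<le> n \<and> jump_time X t n w \<le> ereal s}.
          let \<tau> = real_of_ereal (jump_time X t n w) in r \<tau> (left_lim X \<tau> w) (X \<tau> w) (u \<tau> w))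
    = (\<Prod>\<tau>\<in>jumps w \<inter> {t<..s}. r \<tau> (left_lim X \<tau> w) (X \<tau> w) (u \<tau> w))"
    unfolding Let_def by (rule prod_jump_time[OF w t(1), of "\<lambda>\<tau>. r \<tau> (left_lim X \<tau> w) (X \<tau> w) (u \<tau> w)"])
  also have "\<dots> = (\<Prod>\<tau>\<in>jumps w \<inter> {t<..s}. factor ((w, \<tau>), X \<tau> w))"
    by (rule prod.cong) (auto simp: factor_def left_path_def)
  finally show ?thesis by (simp add: girsanov_def L_def \<rho>_def)
qed

lemma clamped_measurable:
  assumes s: "t \<le> s" "s \<le> T"
  shows "(\<lambda>(w, q). \<rho> (w, clamp_to t s q)) \<in> borel_measurable (\<F> {t..s} \<Otimes>\<^sub>M borel)"
    "(\<lambda>(w, q). run (w, clamp_to t s q)) \<in> borel_measurable (\<F> {t..s} \<Otimes>\<^sub>M borel)"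
  using composed_measurable[OF measurable_clamp_predictable[OF s]] measurable_joint_path[OF t(1) s(1)]
  by (simp_all add: case_prod_beta')

lemma L_adapted:
  assumes s: "t \<le> s" "s \<le> T"
  shows "L s \<in> borel_measurable (\<F> {t..s})"
  using adapted_time_integral[OF clamped_measurable(1)[OF s]] measurable_jump_prod[OF t(1) s factor_measurable]
  unfolding L_def[abs_def] by measurable

lemma A_adapted:
  assumes s: "t \<le> s" "s \<le> T"
  shows "A s \<in> borel_measurable (\<F> {t..s})"
  using adapted_time_integral[OF clamped_measurable(2)[OF s]] unfolding A_def[abs_def] .

lemma L_bounds:
  assumes w: "w \<in> \<Omega>" and s: "t \<le> s" "s \<le> T"
  shows "0 \<le> L s w" "L s w \<le> density_bound t w"
proof -
  let ?J = "\<lambda>s. jumps w \<inter> {t<..s}"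
  have f: "0 \<le> factor ((w, \<tau>), X \<tau> w) \<and> factor ((w, \<tau>), X \<tau> w) \<le> max 1 C" if "\<tau> \<in> ?J s" for \<tau>
    using factor_bounds[OF w, of \<tau> "X \<tau> w"] that s t path_range[OF _ w, of \<tau>] by fastforce
  then have p0: "0 \<le> (\<Prod>\<tau>\<in>?J s. factor ((w, \<tau>), X \<tau> w))" by (intro prod_nonneg) auto
  then show "0 \<le> L s w" by (simp add: L_def)
  have "(\<Prod>\<tau>\<in>?J s. factor ((w, \<tau>), X \<tau> w)) \<le> (\<Prod>\<tau>\<in>?J s. max 1 C)" using f by (intro prod_mono) auto
  also have "\<dots> \<le> max 1 C ^ card (?J T)"
    using w s by (simp only: prod_constant) (intro power_increasing card_mono, auto)
  finally have P: "(\<Prod>\<tau>\<in>?J s. factor ((w, \<tau>), X \<tau> w)) \<le> max 1 C ^ card (?J T)" .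
  have "(LINT q:{t<..s}|lborel. \<rho> (w, q)) = (\<integral>q. indicator {t<..s} q * \<rho> (w, q) \<partial>time_measure t)"
    by (rule time_measure_set_integral(3)[OF \<rho>_integrable[OF w] order_refl s(2)])
  also have "\<dots> \<le> (\<integral>q. \<Lambda> \<partial>time_measure t)"
  proof (rule integral_mono')
    show "integrable (time_measure t) (\<lambda>_. \<Lambda>)" by (rule finite_measure.integrable_const[OF finite_time_measure])
    show "indicator {t<..s} q * \<rho> (w, q) \<le> \<Lambda>" if "q \<in> space (time_measure t)" for q
      using \<rho>_bounds(1)[of "(w, q)"] w that rate_bound_pos by (auto simp: indicator_def)
  qed (use rate_bound_pos in simp)
  also have "\<dots> = \<Lambda> * (T - t)"
    using emeasure_time_measure[OF t(2)] t by (simp add: measure_def mult.commute)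
  finally show "L s w \<le> density_bound t w" unfolding L_def density_bound_def
    using P p0 by (intro mult_mono) auto
qed

text \<open>The linear equation of a stochastic exponential: \<open>L\<close> is a jump-free
  exponential times the piecewise constant product of factors, and a jump multiplies the left limit
  \<open>L'\<close> by the factor.\<close>

lemma L_ac:
  assumes w: "w \<in> \<Omega>"
  shows "piecewise_ac t T (jumps w) (\<lambda>s. L s w) (\<lambda>s. L s w * \<rho> (w, s)) (\<lambda>\<tau>. L' (w, \<tau>) * (factor ((w, \<tau>), X \<tau> w) - 1))"
    (is "piecewise_ac t T ?J ?L ?\<psi> ?j")
proof -
  let ?E = "\<lambda>s. exp (LINT q:{t<..s}|lborel. \<rho> (w, q))" and ?f = "\<lambda>\<tau>. factor ((w, \<tau>), X \<tau> w)"
  have fin: "finite (?J \<inter> {t<..T})" using w by simp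
  have E: "piecewise_ac t T ?J ?E (\<lambda>s. ?E s * \<rho> (w, s)) (\<lambda>_. 0)"
    by (rule piecewise_ac_extend[OF exp_ac[OF time_integral_ac[OF \<rho>_integrable[OF w]] t(2)] fin])
  have "piecewise_ac t T ?J ?L (\<lambda>s. ?E s * 0 + prod ?f (?J \<inter> {t<..s}) * (?E s * \<rho> (w, s)))
    (\<lambda>\<tau>. ?E \<tau> * prod ?f (?J \<inter> {t<..\<tau>})
      - (?E \<tau> - 0) * (prod ?f (?J \<inter> {t<..\<tau>}) - (prod ?f (?J \<inter> {t<..\<tau>}) - prod ?f (?J \<inter> {t<..<\<tau>}))))"
    unfolding L_def by (rule piecewise_ac_mult[OF E piecewise_constant[OF fin] t(2)])
  then have pw: "piecewise_ac t T ?J ?L ?\<psi> (\<lambda>\<tau>. L \<tau> w - ?E \<tau> * prod ?f (?J \<inter> {t<..<\<tau>}))"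
    by (rule piecewise_ac_cong[OF _ t(2)]) (auto simp: L_def)
  show ?thesis
  proof (rule piecewise_ac_cong[OF pw t(2) refl refl])
    fix \<tau> assume \<tau>: "\<tau> \<in> ?J" "t < \<tau>" "\<tau> \<le> T"
    then have "?J \<inter> {t<..\<tau>} = insert \<tau> (?J \<inter> {t<..<\<tau>})" by auto
    then have "L \<tau> w = ?E \<tau> * prod ?f (?J \<inter> {t<..<\<tau>}) * ?f \<tau>" using w by (simp add: L_def)
    moreover have "L' (w, \<tau>) = ?E \<tau> * prod ?f (?J \<inter> {t<..<\<tau>})" using grid_limit_eq[where h = L, OF pw \<tau>(2,3)] \<tau>(1) by simp
    ultimately show "L \<tau> w - ?E \<tau> * prod ?f (?J \<inter> {t<..<\<tau>}) = ?j \<tau>" by (simp add: algebra_simps)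
  qed
qed

lemma L'_eq:
  assumes "w \<in> \<Omega>" "t < s" "s \<le> T"
  shows "L' (w, s) = L s w - (if s \<in> jumps w then L' (w, s) * (factor ((w, s), X s w) - 1) else 0)"
  by (rule grid_limit_eq[where h = L, OF L_ac[OF assms(1)] assms(2,3)])

lemma L'_bounds:
  assumes "w \<in> \<Omega>" "t < s" "s \<le> T"
  shows "0 \<le> L' (w, s)" "L' (w, s) \<le> density_bound t w"
  using grid_limit_bounds[where h = L, OF L_ac[OF assms(1)] assms(2,3), of 0 "density_bound t w"] L_bounds[OF assms(1)] by auto

lemma run_norm:
  "(\<lambda>w. \<integral>\<^sup>+s. ennreal \<bar>run (w, s)\<bar> \<partial>time_measure t) \<in> borel_measurable (P t x)"
  "(\<integral>\<^sup>+w. ennreal (density_bound t w) * (\<integral>\<^sup>+s. ennreal \<bar>run (w, s)\<bar> \<partial>time_measure t) \<partial>P t x) < \<infinity>"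
proof -
  have "(\<lambda>p. ennreal \<bar>run p\<bar>) \<in> borel_measurable (PT t x)" using run_measurable by measurable
  then show Nm: "(\<lambda>w. \<integral>\<^sup>+s. ennreal \<bar>run (w, s)\<bar> \<partial>time_measure t) \<in> borel_measurable (P t x)"
    by (intro sigma_finite_measure.borel_measurable_nn_integral)
      (auto simp: PT_def case_prod_beta' intro: finite_measure.sigma_finite_measure finite_time_measure)
  show "(\<integral>\<^sup>+w. ennreal (density_bound t w) * (\<integral>\<^sup>+s. ennreal \<bar>run (w, s)\<bar> \<partial>time_measure t) \<partial>P t x) < \<infinity>"
    by (rule density_bound_mult_finite[OF t x \<alpha> Nm]) (use l_moment in \<open>simp add: run_def nn_integral_time_measure\<close>)
qed

lemma run_finite: "(\<integral>\<^sup>+p. ennreal (density_bound t (fst p)) * ennreal \<bar>run p\<bar> \<partial>PT t x) < \<infinity>"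
proof -
  have rm: "(\<lambda>p. ennreal \<bar>run p\<bar>) \<in> borel_measurable (PT t x)" using run_measurable by measurable
  have dm: "(\<lambda>p. ennreal (density_bound t (fst p))) \<in> borel_measurable (PT t x)"
    using measurable_compose[OF PT_fst density_bound_moment(1)[OF t x order_refl]] by simp
  have "(\<integral>\<^sup>+p. ennreal (density_bound t (fst p)) * ennreal \<bar>run p\<bar> \<partial>PT t x)
    = (\<integral>\<^sup>+w. (\<integral>\<^sup>+s. ennreal (density_bound t w) * ennreal \<bar>run (w, s)\<bar> \<partial>time_measure t) \<partial>P t x)"
    using nn_integral_PT[of "\<lambda>p. ennreal (density_bound t (fst p)) * ennreal \<bar>run p\<bar>" t x] rm dm
    by (simp add: borel_measurable_times_ennreal nn_integral_time_measure)
  also have "\<dots> = (\<integral>\<^sup>+w. ennreal (density_bound t w) * (\<integral>\<^sup>+s. ennreal \<bar>run (w, s)\<bar> \<partial>time_measure t) \<partial>P t x)"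
    by (rule nn_integral_cong, rule nn_integral_cmult, rule PT_section[OF rm t(1) x]) (use t x in simp)
  also have "\<dots> < \<infinity>" by (rule run_norm(2))
  finally show ?thesis .
qed

end

section \<open>The cost of a control\<close>

context admissible_control
begin

lemma PT_rate:
  assumes "p \<in> space (PT t x)"
  shows "fst p \<in> \<Omega>" "t < snd p" "snd p \<le> T" "0 \<le> snd p" "X (snd p) (fst p) \<in> space K" "u (snd p) (fst p) \<in> space U"
    "finite_measure (rate p)" "space (rate p) = space K"
  using assms t x path_range finite_measure_rate space_rate u_space by auto

lemma density_bound_measurable: "density_bound t \<in> borel_measurable (P t x)"
  by (rule density_bound_moment(1)[OF t x order_refl])

lemma density_bound_ge_1: "1 \<le> density_bound t w"
proof -
  have "1 * 1 \<le> density_bound t w" unfolding density_bound_def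
    using t rate_bound_pos by (intro mult_mono one_le_power) auto
  then show ?thesis by simp
qed

lemma density_bound_measurable_PT: "(\<lambda>p. density_bound t (fst p)) \<in> borel_measurable (PT t x)"
  by (rule measurable_compose[OF PT_fst density_bound_measurable])

lemma density_bound_sq_finite: "(\<integral>\<^sup>+p. ennreal ((density_bound t (fst p))\<^sup>2) \<partial>PT t x) < \<infinity>"
proof -
  have "(\<lambda>w. ennreal ((density_bound t w)\<^sup>2)) \<in> borel_measurable (P t x)" using density_bound_measurable by measurable
  from nn_integral_PT_fst[OF t x this] density_bound_moment(2)[OF t x, of 2] show ?thesis
    by (simp add: ennreal_mult_less_top less_imp_le[OF density_bound_pos])
qed

lemma density_bound_sq_integrable: "integrable (PT t x) (\<lambda>p. (density_bound t (fst p))\<^sup>2)"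
  using density_bound_sq_finite density_bound_measurable_PT by (intro integrableI_nonneg) auto

lemma run_integrable: "integrable (PT t x) (\<lambda>p. density_bound t (fst p) * run p)"
  using run_finite run_measurable density_bound_measurable_PT less_imp_le[OF density_bound_pos]
  by (intro integrableI_bounded) (auto simp: abs_mult ennreal_mult)

lemma run_path_integrable: "AE w in P t x. w \<in> \<Omega> \<and> integrable (time_measure t) (\<lambda>s. run (w, s))"
proof -
  have "integrable (PT t x) run"
    by (rule Bochner_Integration.integrable_bound[OF run_integrable run_measurable])
      (use mult_right_mono[OF density_bound_ge_1] in \<open>auto intro!: AE_I2 simp: abs_mult less_imp_le[OF density_bound_pos]\<close>)
  from PT_integrable_section(1)[OF t(1) x this] AE_space show ?thesis by eventually_elim (use t x in simp)
qed

lemma A_ac: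
  assumes w: "w \<in> \<Omega>" and i: "integrable (time_measure t) (\<lambda>s. run (w, s))"
  shows "piecewise_ac t T (jumps w) (\<lambda>s. A s w) (\<lambda>s. run (w, s)) (\<lambda>_. 0)"
  unfolding A_def using w by (intro piecewise_ac_extend[OF time_integral_ac[OF i]]) simp

lemma A'_eq:
  assumes "w \<in> \<Omega>" "integrable (time_measure t) (\<lambda>s. run (w, s))" "t < s" "s \<le> T"
  shows "A' (w, s) = A s w"
  using grid_limit_eq[where h = A, OF A_ac[OF assms(1,2)] assms(3,4)] by simp

lemma A_abs_le:
  assumes i: "integrable (time_measure t) (\<lambda>s. run (w, s))" and s: "s \<le> T"
  shows "\<bar>A s w\<bar> \<le> (\<integral>q. \<bar>run (w, q)\<bar> \<partial>time_measure t)"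
proof -
  have "A s w = (\<integral>q. indicator {t<..s} q * run (w, q) \<partial>time_measure t)"
    unfolding A_def by (rule time_measure_set_integral(3)[OF i order_refl s])
  then have "\<bar>A s w\<bar> \<le> (\<integral>q. \<bar>indicator {t<..s} q * run (w, q)\<bar> \<partial>time_measure t)"
    using integral_abs_bound by simp
  also have "\<dots> \<le> (\<integral>q. \<bar>run (w, q)\<bar> \<partial>time_measure t)"
    by (rule integral_mono') (use i in \<open>auto simp: indicator_def\<close>)
  finally show ?thesis .
qed

definition left_value :: "'w \<times> real \<Rightarrow> real" where
  "left_value p = v (snd p) (left_path t (snd p) (fst p))"

text \<open>The jump of \<open>L * (v + A)\<close> when the state moves to the second component of
  \<open>q\<close>: the density is multiplied by \<open>factor\<close> and \<open>v\<close> is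
  evaluated at the new state, while the accumulated cost is continuous, so that \<open>A'\<close>
  occurs before and after.\<close>

definition jump_term :: "('w \<times> real) \<times> 'k \<Rightarrow> real" where
  "jump_term q = L' (fst q) * (factor q * (v (snd (fst q)) (snd q) + A' (fst q)) - (left_value (fst q) + A' (fst q)))"

definition jump_mean :: "'w \<times> real \<Rightarrow> real" where
  "jump_mean p = (LINT y|rate p. jump_term (p, y))"

definition drift_cost :: "'w \<times> real \<Rightarrow> real" where
  "drift_cost p = controlled_drift \<nu> r l (snd p) (X (snd p) (fst p))
     (\<lambda>y. v (snd p) y - v (snd p) (X (snd p) (fst p))) (u (snd p) (fst p))"

lemma L'_measurable: "L' \<in> borel_measurable (Pred t)" and A'_measurable: "A' \<in> borel_measurable (Pred t)"
  using grid_limit_measurable[OF t L_adapted] grid_limit_measurable[OF t A_adapted] by auto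

lemma left_value_measurable': "left_value \<in> borel_measurable (Pred t)"
  unfolding left_value_def[abs_def] by (rule left_value_measurable[OF v t])

lemma predictable_PT: "h \<in> borel_measurable (Pred t) \<Longrightarrow> h \<in> borel_measurable (PT t x)"
  by (drule measurable_compose[OF PT_to_predictable[OF t x]])

lemma jump_term_measurable: "jump_term \<in> borel_measurable (Pred t \<Otimes>\<^sub>M K)"
  using L'_measurable A'_measurable left_value_measurable' factor_measurable value_pair_measurable[OF v t]
  unfolding jump_term_def[abs_def] by measurable

lemma left_value_sq_integrable: "integrable (PT t x) (\<lambda>p. (left_value p)\<^sup>2)"
proof -
  have m: "(\<lambda>p. v (snd p) (X (snd p) (fst p))) \<in> borel_measurable (PT t x)"
    by (rule measurable_value[OF v PT_snd PT_path]) (use t x in auto)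
  note m' = predictable_PT[OF left_value_measurable']
  have V2: "(\<lambda>p. ennreal ((v (snd p) (X (snd p) (fst p)))\<^sup>2)) \<in> borel_measurable (PT t x)" using m by measurable
  have V'2: "(\<lambda>p. ennreal ((left_value p)\<^sup>2)) \<in> borel_measurable (PT t x)" using m' by measurable
  have "(\<integral>\<^sup>+p. ennreal ((v (snd p) (X (snd p) (fst p)))\<^sup>2) \<partial>PT t x) < \<infinity>"
    unfolding nn_integral_PT[OF V2] using v t x by (simp add: hjb_solution_def)
  also have "(\<integral>\<^sup>+p. ennreal ((v (snd p) (X (snd p) (fst p)))\<^sup>2) \<partial>PT t x) = (\<integral>\<^sup>+p. ennreal ((left_value p)\<^sup>2) \<partial>PT t x)"
    by (rule nn_integral_cong_AE[OF PT_AE_left_path[OF t(1) x V2 V'2]]) (simp add: left_value_def)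
  finally show ?thesis using m' by (intro integrableI_nonneg) auto
qed

text \<open>The accumulated cost is at most the integral of the absolute running cost, and
  \<open>density_bound\<close> does not depend on time. Integration over time therefore only adds
  the factor \<open>T - t\<close>, and \<open>run_norm\<close> applies.\<close>

lemma L'A'_integrable: "integrable (PT t x) (\<lambda>p. L' p * \<bar>A' p\<bar>)"
proof (rule integrableI_bounded)
  let ?N = "\<lambda>w. \<integral>\<^sup>+s. ennreal \<bar>run (w, s)\<bar> \<partial>time_measure t"
  show m: "(\<lambda>p. L' p * \<bar>A' p\<bar>) \<in> borel_measurable (PT t x)"
    using predictable_PT[OF L'_measurable] predictable_PT[OF A'_measurable] by measurable
  then have "(\<integral>\<^sup>+p. ennreal (norm (L' p * \<bar>A' p\<bar>)) \<partial>PT t x)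
    = (\<integral>\<^sup>+w. (\<integral>\<^sup>+s. ennreal (norm (L' (w, s) * \<bar>A' (w, s)\<bar>)) \<partial>time_measure t) \<partial>P t x)"
    by (subst nn_integral_PT) (auto simp: nn_integral_time_measure)
  also have "\<dots> \<le> (\<integral>\<^sup>+w. ennreal (T - t) * (ennreal (density_bound t w) * ?N w) \<partial>P t x)"
  proof (rule nn_integral_mono_AE, use run_path_integrable in eventually_elim)
    case (elim w)
    let ?n = "\<integral>q. \<bar>run (w, q)\<bar> \<partial>time_measure t"
    have "(\<integral>\<^sup>+s. ennreal (norm (L' (w, s) * \<bar>A' (w, s)\<bar>)) \<partial>time_measure t) \<le> (\<integral>\<^sup>+s. ennreal (density_bound t w * ?n) \<partial>time_measure t)"
    proof (intro nn_integral_mono ennreal_leI)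
      fix s assume "s \<in> space (time_measure t)"
      then show "norm (L' (w, s) * \<bar>A' (w, s)\<bar>) \<le> density_bound t w * ?n"
        using L'_bounds[of w s] A'_eq[of w s] A_abs_le[of w s] elim less_imp_le[OF density_bound_pos]
        by (simp add: abs_mult mult_mono)
    qed
    also have "\<dots> = ennreal (T - t) * (ennreal (density_bound t w) * ennreal ?n)"
      using emeasure_time_measure[OF t(2)] less_imp_le[OF density_bound_pos, of t w]
      by (simp add: ennreal_mult Bochner_Integration.integral_nonneg mult_ac)
    also have "ennreal ?n = ?N w" using elim by (intro nn_integral_eq_integral[symmetric]) auto
    finally show ?case .
  qed
  also have "\<dots> = ennreal (T - t) * (\<integral>\<^sup>+w. ennreal (density_bound t w) * ?N w \<partial>P t x)"
    using run_norm(1) density_bound_measurable by (intro nn_integral_cmult) (simp add: borel_measurable_times_ennreal)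
  also have "\<dots> < \<infinity>" using run_norm(2) by (simp add: ennreal_mult_less_top)
  finally show "(\<integral>\<^sup>+p. ennreal (norm (L' p * \<bar>A' p\<bar>)) \<partial>PT t x) < \<infinity>" .
qed

lemma jump_term_finite: "(\<integral>\<^sup>+p. (\<integral>\<^sup>+y. ennreal \<bar>jump_term (p, y)\<bar> \<partial>rate p) \<partial>PT t x) < \<infinity>"
proof -
  let ?d = "\<lambda>p. density_bound t (fst p)"
  let ?z = "\<lambda>q. v (snd (fst q)) (snd q) - v (snd (fst q)) (left_path t (snd (fst q)) (fst (fst q)))"
  let ?k = "\<lambda>p. C * (?d p)\<^sup>2 + (1 + C) * ((?d p)\<^sup>2 + (left_value p)\<^sup>2 + \<bar>L' p * \<bar>A' p\<bar>\<bar>)"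
  let ?G = "\<lambda>q. C * (?z q)\<^sup>2"
  have k: "integrable (PT t x) ?k"
    by (intro Bochner_Integration.integrable_add integrable_mult_right density_bound_sq_integrable left_value_sq_integrable integrable_abs L'A'_integrable)
  have zm: "?z \<in> borel_measurable (PT t x \<Otimes>\<^sub>M K)" by (rule PT_measurable[OF value_difference_measurable(2)[OF v t x] t x])
  show ?thesis
  proof (rule PT_rate_finite[OF t x borel_measurable_integrable[OF k], of ?G])
    have "(\<integral>\<^sup>+p. ennreal (?k p) \<partial>PT t x) = ennreal (\<integral>p. ?k p \<partial>PT t x)"
      by (rule nn_integral_eq_integral[OF k AE_I2]) (use C_pos in simp)
    then show "(\<integral>\<^sup>+p. ennreal (?k p) \<partial>PT t x) < \<infinity>" by simp
    show "?G \<in> borel_measurable (PT t x \<Otimes>\<^sub>M K)" using zm by measurable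
    have "(\<integral>\<^sup>+p. (\<integral>\<^sup>+y. ennreal (?G (p, y)) \<partial>rate p) \<partial>PT t x) = (\<integral>\<^sup>+p. ennreal C * (\<integral>\<^sup>+y. ennreal ((?z (p, y))\<^sup>2) \<partial>rate p) \<partial>PT t x)"
    proof (rule nn_integral_cong)
      fix p assume p: "p \<in> space (PT t x)"
      have "(\<lambda>y. ennreal ((?z (p, y))\<^sup>2)) \<in> borel_measurable (rate p)"
        using PT_section_measurable[OF zm p t(1) x] by measurable
      from nn_integral_cmult[OF this, of "ennreal C"] show "(\<integral>\<^sup>+y. ennreal (?G (p, y)) \<partial>rate p) = ennreal C * (\<integral>\<^sup>+y. ennreal ((?z (p, y))\<^sup>2) \<partial>rate p)"
        using C_pos by (simp add: ennreal_mult)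
    qed
    also have "\<dots> = ennreal C * (\<integral>\<^sup>+p. (\<integral>\<^sup>+y. ennreal ((?z (p, y))\<^sup>2) \<partial>rate p) \<partial>PT t x)"
    proof (rule nn_integral_cmult)
      have "(\<lambda>q. ennreal ((?z q)\<^sup>2)) \<in> borel_measurable (PT t x \<Otimes>\<^sub>M K)" using zm by measurable
      from PT_nn_integral_rate[OF t x this] show "(\<lambda>p. \<integral>\<^sup>+y. ennreal ((?z (p, y))\<^sup>2) \<partial>rate p) \<in> borel_measurable (PT t x)" .
    qed
    also have "\<dots> < \<infinity>" using value_difference_finite(2)[OF v t x] by (simp add: ennreal_mult_less_top)
    finally show "(\<integral>\<^sup>+p. (\<integral>\<^sup>+y. ennreal (?G (p, y)) \<partial>rate p) \<partial>PT t x) < \<infinity>" .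
    fix p y assume p: "p \<in> space (PT t x)" and y: "y \<in> space K"
    note p' = PT_rate[OF p]
    have f: "0 \<le> factor (p, y)" "factor (p, y) \<le> C" using factor_bounds[of "fst p" "snd p" y] p' y by auto
    have L: "0 \<le> L' p" "L' p \<le> ?d p" using L'_bounds[of "fst p" "snd p"] p' by auto
    have young: "a * b \<le> a\<^sup>2 + b\<^sup>2" if "0 \<le> a" "0 \<le> b" for a b :: real
      using sum_squares_bound[of a b] mult_nonneg_nonneg[OF that] by simp
    let ?Z = "\<bar>?z (p, y)\<bar>" and ?V = "\<bar>left_value p\<bar>"
    have Lsq: "(L' p)\<^sup>2 \<le> (?d p)\<^sup>2" using L by (intro power_mono) auto
    \<comment> \<open>In this form the increment of \<open>v\<close>, square integrable against the
      rates, is separated from \<open>left_value p + A' p\<close>, which does not depend on the new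
      state and has a bounded coefficient.\<close>
    have jt: "jump_term (p, y) = L' p * (factor (p, y) * ?z (p, y) + (factor (p, y) - 1) * (left_value p + A' p))"
      by (simp add: jump_term_def left_value_def algebra_simps)
    have "\<bar>jump_term (p, y)\<bar> \<le> L' p * (C * ?Z + (1 + C) * (?V + \<bar>A' p\<bar>))"
    proof -
      have "\<bar>factor (p, y) * ?z (p, y) + (factor (p, y) - 1) * (left_value p + A' p)\<bar>
        \<le> \<bar>factor (p, y)\<bar> * ?Z + \<bar>factor (p, y) - 1\<bar> * \<bar>left_value p + A' p\<bar>"
        by (rule order_trans[OF abs_triangle_ineq]) (simp only: abs_mult order_refl)
      also have "\<dots> \<le> C * ?Z + (1 + C) * (?V + \<bar>A' p\<bar>)"
        using f C_pos by (intro add_mono mult_mono abs_triangle_ineq) auto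
      finally show ?thesis unfolding jt abs_mult[of "L' p"] abs_of_nonneg[OF L(1)] using L(1) by (rule mult_left_mono)
    qed
    also have "\<dots> = C * (L' p * ?Z) + (1 + C) * (L' p * ?V + L' p * \<bar>A' p\<bar>)" by (simp add: algebra_simps)
    also have "\<dots> \<le> C * ((?d p)\<^sup>2 + (?z (p, y))\<^sup>2) + (1 + C) * (((?d p)\<^sup>2 + (left_value p)\<^sup>2) + L' p * \<bar>A' p\<bar>)"
      using young[OF L(1), of ?Z] young[OF L(1), of ?V] Lsq C_pos L(1) by (intro add_mono mult_left_mono) auto
    also have "\<dots> = ?k p + ?G (p, y)" using L(1) by (simp add: abs_mult algebra_simps)
    finally show "\<bar>jump_term (p, y)\<bar> \<le> ?k p + ?G (p, y)" .
  qed (use C_pos in auto)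
qed

text \<open>The running cost is covered by \<open>run_integrable\<close>; the integral term is split
  by Young's inequality into squares of the majorant and of the increment of
  \<open>v\<close>.\<close>

lemma drift_cost_integrable: "integrable (PT t x) (\<lambda>p. density_bound t (fst p) * drift_cost p)"
  and drift_cost_measurable: "drift_cost \<in> borel_measurable (PT t x)"
proof -
  let ?d = "\<lambda>p. density_bound t (fst p)"
  let ?z = "\<lambda>q. v (snd (fst q)) (snd q) - v (snd (fst q)) (X (snd (fst q)) (fst (fst q)))"
  let ?r = "\<lambda>q. r (snd (fst q)) (X (snd (fst q)) (fst (fst q))) (snd q) (u (snd (fst q)) (fst (fst q)))"
  let ?H = "\<lambda>q. ?d (fst q) * (?z q * (?r q - 1))"
  have zm: "?z \<in> borel_measurable (PT t x \<Otimes>\<^sub>M K)" by (rule value_difference_measurable(1)[OF v t x])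
  have rm: "?r \<in> borel_measurable (PT t x \<Otimes>\<^sub>M K)"
  proof (rule measurable_r)
    show "(\<lambda>q. snd (fst q)) \<in> borel_measurable (PT t x \<Otimes>\<^sub>M K)" using PT_snd[OF t(1) x] by measurable
    show "(\<lambda>q. X (snd (fst q)) (fst (fst q))) \<in> PT t x \<Otimes>\<^sub>M K \<rightarrow>\<^sub>M K" by (rule measurable_compose[OF measurable_fst PT_path[OF t x]])
    show "(\<lambda>q. u (snd (fst q)) (fst (fst q))) \<in> PT t x \<Otimes>\<^sub>M K \<rightarrow>\<^sub>M U"
      by (rule measurable_compose[OF measurable_fst measurable_compose[OF PT_to_predictable[OF t x] u_measurable]])
  qed (use t x in \<open>auto simp: space_pair_measure\<close>)
  have zr: "(\<lambda>q. ?z q * (?r q - 1)) \<in> borel_measurable (PT t x \<Otimes>\<^sub>M K)" using zm rm by measurable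
  have Hm: "?H \<in> borel_measurable (PT t x \<Otimes>\<^sub>M K)" using zr measurable_compose[OF measurable_fst density_bound_measurable_PT] by measurable
  have eq: "drift_cost p = run p + (LINT y|rate p. ?z (p, y) * (?r (p, y) - 1))" for p
    by (simp add: drift_cost_def controlled_drift_def run_def)
  show "drift_cost \<in> borel_measurable (PT t x)"
    using run_measurable PT_integral_rate[OF t x zr] unfolding eq[abs_def] by measurable
  have fin: "(\<integral>\<^sup>+p. (\<integral>\<^sup>+y. ennreal \<bar>?H (p, y)\<bar> \<partial>rate p) \<partial>PT t x) < \<infinity>"
  proof (rule PT_rate_finite[OF t x, of "\<lambda>p. (1 + C) * (?d p)\<^sup>2" "\<lambda>q. (1 + C) * (?z q)\<^sup>2"])
    show "(\<lambda>p. (1 + C) * (?d p)\<^sup>2) \<in> borel_measurable (PT t x)" using density_bound_measurable_PT by measurable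
    have "(\<integral>\<^sup>+p. ennreal ((1 + C) * (?d p)\<^sup>2) \<partial>PT t x) = ennreal (\<integral>p. (1 + C) * (?d p)\<^sup>2 \<partial>PT t x)"
      by (rule nn_integral_eq_integral[OF integrable_mult_right[OF density_bound_sq_integrable] AE_I2]) (use C_pos in simp)
    then show "(\<integral>\<^sup>+p. ennreal ((1 + C) * (?d p)\<^sup>2) \<partial>PT t x) < \<infinity>" by simp
    show "(\<lambda>q. (1 + C) * (?z q)\<^sup>2) \<in> borel_measurable (PT t x \<Otimes>\<^sub>M K)" using zm by measurable
    have sq: "(\<lambda>q. ennreal ((?z q)\<^sup>2)) \<in> borel_measurable (PT t x \<Otimes>\<^sub>M K)" using zm by measurable
    have "(\<integral>\<^sup>+p. (\<integral>\<^sup>+y. ennreal ((1 + C) * (?z (p, y))\<^sup>2) \<partial>rate p) \<partial>PT t x) = (\<integral>\<^sup>+p. ennreal (1 + C) * (\<integral>\<^sup>+y. ennreal ((?z (p, y))\<^sup>2) \<partial>rate p) \<partial>PT t x)"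
    proof (rule nn_integral_cong)
      fix p assume p: "p \<in> space (PT t x)"
      from nn_integral_cmult[OF PT_section_measurable[OF sq p t(1) x], of "ennreal (1 + C)"]
      show "(\<integral>\<^sup>+y. ennreal ((1 + C) * (?z (p, y))\<^sup>2) \<partial>rate p) = ennreal (1 + C) * (\<integral>\<^sup>+y. ennreal ((?z (p, y))\<^sup>2) \<partial>rate p)"
        using C_pos by (simp add: ennreal_mult)
    qed
    also have "\<dots> = ennreal (1 + C) * (\<integral>\<^sup>+p. (\<integral>\<^sup>+y. ennreal ((?z (p, y))\<^sup>2) \<partial>rate p) \<partial>PT t x)"
      by (rule nn_integral_cmult[OF PT_nn_integral_rate[OF t x sq]])
    also have "\<dots> < \<infinity>" using value_difference_finite(1)[OF v t x] by (simp add: ennreal_mult_less_top)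
    finally show "(\<integral>\<^sup>+p. (\<integral>\<^sup>+y. ennreal ((1 + C) * (?z (p, y))\<^sup>2) \<partial>rate p) \<partial>PT t x) < \<infinity>" .
    fix p y assume p: "p \<in> space (PT t x)" and y: "y \<in> space K"
    note p' = PT_rate[OF p]
    have d: "0 \<le> ?d p" using less_imp_le[OF density_bound_pos] .
    have "\<bar>?H (p, y)\<bar> = (?d p * \<bar>?z (p, y)\<bar>) * \<bar>?r (p, y) - 1\<bar>" using d by (simp add: abs_mult)
    also have "\<dots> \<le> ((?d p)\<^sup>2 + (?z (p, y))\<^sup>2) * (1 + C)"
    proof (rule mult_mono)
      show "?d p * \<bar>?z (p, y)\<bar> \<le> (?d p)\<^sup>2 + (?z (p, y))\<^sup>2"
        using sum_squares_bound[of "?d p" "\<bar>?z (p, y)\<bar>"] mult_nonneg_nonneg[OF d abs_ge_zero[of "?z (p, y)"]] by simp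
      show "\<bar>?r (p, y) - 1\<bar> \<le> 1 + C" using r_minus_one_bound[OF p'(4,3,5) y p'(6)] by simp
    qed auto
    also have "\<dots> = (1 + C) * (?d p)\<^sup>2 + (1 + C) * (?z (p, y))\<^sup>2" by (simp add: algebra_simps)
    finally show "\<bar>?H (p, y)\<bar> \<le> (1 + C) * (?d p)\<^sup>2 + (1 + C) * (?z (p, y))\<^sup>2" by simp
  qed (use C_pos in auto)
  from Bochner_Integration.integrable_add[OF run_integrable PT_rate_integrable(2)[OF t x Hm fin]]
  show "integrable (PT t x) (\<lambda>p. ?d p * drift_cost p)" by (simp add: eq distrib_left)
qed

lemma L'_mult_integrable:
  assumes b: "b \<in> borel_measurable (PT t x)" "integrable (PT t x) (\<lambda>p. density_bound t (fst p) * b p)"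
  shows "integrable (PT t x) (\<lambda>p. L' p * b p)"
proof (rule Bochner_Integration.integrable_bound[OF b(2)])
  show "(\<lambda>p. L' p * b p) \<in> borel_measurable (PT t x)" using predictable_PT[OF L'_measurable] b(1) by measurable
  show "AE p in PT t x. norm (L' p * b p) \<le> norm (density_bound t (fst p) * b p)"
  proof (rule AE_I2)
    fix p assume "p \<in> space (PT t x)"
    note p = PT_rate[OF this]
    have "0 \<le> L' p" "L' p \<le> density_bound t (fst p)" using L'_bounds[of "fst p" "snd p"] p by auto
    then show "norm (L' p * b p) \<le> norm (density_bound t (fst p) * b p)" by (simp add: abs_mult mult_right_mono)
  qed
qed

definition product_drift :: "'w \<Rightarrow> real \<Rightarrow> real" where
  "product_drift w s = L s w * (- (generator \<nu> s (v s) (X s w) + hamiltonian U \<nu> r l s (X s w) (\<lambda>y. v s y - v s (X s w))) + run (w, s))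
    + (v s (X s w) + A s w) * (L s w * \<rho> (w, s))"

lemma product_along_path:
  assumes w: "w \<in> \<Omega>" and i: "integrable (time_measure t) (\<lambda>s. run (w, s))"
  shows "piecewise_ac t T (jumps w) (\<lambda>s. L s w * (v s (X s w) + A s w)) (product_drift w) (\<lambda>\<tau>. jump_term ((w, \<tau>), X \<tau> w))"
proof (rule piecewise_ac_cong[OF piecewise_ac_mult[OF L_ac[OF w] piecewise_ac_add[OF value_along_path[OF v w t] A_ac[OF w i]] t(2)] t(2) refl])
  fix \<tau> assume \<tau>: "\<tau> \<in> jumps w" "t < \<tau>" "\<tau> \<le> T"
  have "left_value (w, \<tau>) = v \<tau> (left_lim X \<tau> w)" using \<tau> by (simp add: left_value_def left_path_def)
  moreover have "L \<tau> w = L' (w, \<tau>) * factor ((w, \<tau>), X \<tau> w)" using L'_eq[OF w \<tau>(2,3)] \<tau>(1) by (simp add: algebra_simps)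
  moreover have "A' (w, \<tau>) = A \<tau> w" by (rule A'_eq[OF w i \<tau>(2,3)])
  ultimately show "L \<tau> w * (v \<tau> (X \<tau> w) + A \<tau> w)
      - (L \<tau> w - L' (w, \<tau>) * (factor ((w, \<tau>), X \<tau> w) - 1)) * (v \<tau> (X \<tau> w) + A \<tau> w - (v \<tau> (X \<tau> w) - v \<tau> (left_lim X \<tau> w) + 0))
    = jump_term ((w, \<tau>), X \<tau> w)"
    by (simp add: jump_term_def algebra_simps)
qed (simp add: product_drift_def)

text \<open>The mean of the jump term contains the generator of \<open>v\<close>, the drift of
  \<open>L\<close> and a term in \<open>r - 1\<close>. The first two cancel against
  \<open>product_drift\<close>; the last completes the running cost to the quantity minimised in the
  Hamiltonian.\<close>

lemma drift_identity:
  "AE w in P t x. AE s in lborel. t < s \<longrightarrow> s \<le> T \<longrightarrow> product_drift w s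
    = L' (w, s) * (drift_cost (w, s) - hamiltonian U \<nu> r l s (X s w) (\<lambda>y. v s y - v s (X s w))) - jump_mean (w, s)"
  using run_path_integrable PT_AE_D[OF t(1) x value_difference_finite(3)[OF v t x]]
proof eventually_elim
  case (elim w)
  then have w: "w \<in> \<Omega>" and i: "integrable (time_measure t) (\<lambda>s. run (w, s))" by auto
  show ?case using elim(2) left_lim_AE[OF w]
  proof eventually_elim
    case (elim s)
    show ?case
    proof (intro impI)
      assume s: "t < s" "s \<le> T"
      then have s0: "0 \<le> s" and ll: "left_lim X s w = X s w" using t elim(2) by auto
      have nj: "s \<notin> jumps w" by (simp add: jumps_def ll)
      let ?N = "\<nu> s (X s w)" and ?z = "\<lambda>y. v s y - v s (X s w)" and ?R = "\<lambda>y. r s (X s w) y (u s w)"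
      let ?h = "hamiltonian U \<nu> r l s (X s w) ?z" and ?B = "v s (X s w) + A s w"
      have Xs: "X s w \<in> space K" by (rule path_range[OF s0 w])
      have us: "u s w \<in> space U" using u_space[OF w] s by simp
      interpret N: finite_measure ?N by (rule finite_measure_rate[OF s0 s(2) Xs])
      have z: "integrable ?N ?z"
        using square_integrable_integrable(1)[OF N.finite_measure_axioms, of ?z] elim(1) s by simp
      note zr = drift_integrable(1)[OF s0 s(2) Xs us z]
      have R: "integrable ?N ?R" "\<rho> (w, s) = - (LINT y|?N. ?R y - 1)"
        using \<rho>_bounds(3,4)[of "(w, s)"] w s by auto
      have L's: "L' (w, s) = L s w" using L'_eq[OF w s] nj by simp
      have "jump_term ((w, s), y) = L s w * (?z y * (?R y - 1) + ?z y + ?B * (?R y - 1))" for y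
        using s ll by (simp add: jump_term_def left_value_def factor_def left_path_def A'_eq[OF w i s] L's algebra_simps)
      then have "jump_mean (w, s) = L s w * (LINT y|?N. ?z y * (?R y - 1) + ?z y + ?B * (?R y - 1))"
        by (simp add: jump_mean_def)
      also have "(LINT y|?N. ?z y * (?R y - 1) + ?z y + ?B * (?R y - 1)) = (LINT y|?N. ?z y * (?R y - 1)) + (LINT y|?N. ?z y) + ?B * (LINT y|?N. ?R y - 1)"
      proof -
        have R1: "integrable ?N (\<lambda>y. ?R y - 1)" using R(1) by simp
        have "(LINT y|?N. ?z y * (?R y - 1) + ?z y + ?B * (?R y - 1)) = (LINT y|?N. ?z y * (?R y - 1) + ?z y) + (LINT y|?N. ?B * (?R y - 1))"
          by (rule Bochner_Integration.integral_add[OF Bochner_Integration.integrable_add[OF zr z] integrable_mult_right[OF R1]])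
        also have "(LINT y|?N. ?z y * (?R y - 1) + ?z y) = (LINT y|?N. ?z y * (?R y - 1)) + (LINT y|?N. ?z y)"
          by (rule Bochner_Integration.integral_add[OF zr z])
        also have "(LINT y|?N. ?B * (?R y - 1)) = ?B * (LINT y|?N. ?R y - 1)" by (rule Bochner_Integration.integral_mult_right[OF R1])
        finally show ?thesis .
      qed
      finally have jm: "jump_mean (w, s) = L s w * ((LINT y|?N. ?z y * (?R y - 1)) + (LINT y|?N. ?z y) - ?B * \<rho> (w, s))"
        by (simp add: R(2))
      have dc: "drift_cost (w, s) = run (w, s) + (LINT y|?N. ?z y * (?R y - 1))"
        by (simp add: drift_cost_def controlled_drift_def run_def)
      show "product_drift w s = L' (w, s) * (drift_cost (w, s) - ?h) - jump_mean (w, s)"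
        unfolding product_drift_def generator_def L's jm dc by (simp add: algebra_simps)
    qed
  qed
qed

text \<open>\<open>b\<close> is a jointly measurable substitute for the Hamiltonian along the path.
  The expected sum of jump terms is the integral of \<open>jump_mean\<close>, which cancels the one
  subtracted in the drift, so only the excess of the control over the Hamiltonian remains.\<close>

theorem cost_identity:
  assumes b: "b \<in> borel_measurable (PT t x)" "integrable (PT t x) (\<lambda>p. density_bound t (fst p) * b p)"
    and hb: "AE w in P t x. AE s in lborel. t < s \<longrightarrow> s \<le> T \<longrightarrow>
      hamiltonian U \<nu> r l s (X s w) (\<lambda>y. v s y - v s (X s w)) = b (w, s)"
  shows "cost T \<nu> X P r l g t x u = v t x + (\<integral>p. L' p * (drift_cost p - b p) \<partial>PT t x)"
    "integrable (PT t x) (\<lambda>p. L' p * (drift_cost p - b p))"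
proof -
  interpret P: prob_space "P t x" using prob t x by simp
  let ?\<delta> = "\<lambda>p. L' p * (drift_cost p - b p)"
  let ?\<kappa> = "\<lambda>p. ?\<delta> p - jump_mean p"
  let ?S = "\<lambda>w. \<Sum>\<tau>\<in>jumps w \<inter> {t<..T}. jump_term ((w, \<tau>), X \<tau> w)"
  let ?G = "\<lambda>w. L T w * (A T w + g (X T w))"
  show di: "integrable (PT t x) ?\<delta>"
  proof (rule L'_mult_integrable)
    show "(\<lambda>p. drift_cost p - b p) \<in> borel_measurable (PT t x)" using drift_cost_measurable b(1) by measurable
    show "integrable (PT t x) (\<lambda>p. density_bound t (fst p) * (drift_cost p - b p))"
      using Bochner_Integration.integrable_diff[OF drift_cost_integrable b(2)] by (simp add: right_diff_distrib)
  qed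
  have jm: "integrable (PT t x) jump_mean"
    unfolding jump_mean_def[abs_def]
    by (rule PT_rate_integrable(2)[OF t x PT_measurable[OF jump_term_measurable t x] jump_term_finite])
  note \<kappa> = Bochner_Integration.integrable_diff[OF di jm]
  note S = compensator_real[OF t x jump_term_measurable jump_term_finite, folded jump_mean_def]
  have gT: "g (X T w) = v T (X T w)" if "w \<in> \<Omega>" for w
    using v t path_range[OF _ that, of T] by (auto simp: hjb_solution_def set_lebesgue_integral_def)
  have LT: "L T \<in> borel_measurable (P t x)" and AT: "A T \<in> borel_measurable (P t x)"
    using measurable_P[OF L_adapted[OF t(2) order_refl]] measurable_P[OF A_adapted[OF t(2) order_refl]] t x by auto
  have vT: "(\<lambda>w. v T (X T w)) \<in> borel_measurable (P t x)"
    by (rule measurable_value[OF v measurable_const measurable_P[OF measurable_path[of T "{t..T}"]]]) (use t x in auto)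
  have gm: "(\<lambda>w. A T w + g (X T w)) \<in> borel_measurable (P t x)"
    using AT vT gT t x by (subst measurable_cong[of _ _ "\<lambda>w. A T w + v T (X T w)"]) auto
  \<comment> \<open>The product rule on [t, T], with \<open>L t w = 1\<close>,
    \<open>A t w = 0\<close> and \<open>g\<close> as the terminal value of \<open>v\<close>.\<close>
  have path: "AE w in P t x. ?G w = v t x + (\<integral>s. ?\<kappa> (w, s) \<partial>time_measure t) + ?S w"
    using run_path_integrable drift_identity hb PT_integrable_section(1)[OF t(1) x \<kappa>] AE_start[OF t(1) x]
  proof eventually_elim
    case (elim w)
    then have w: "w \<in> \<Omega>" and i: "integrable (time_measure t) (\<lambda>s. run (w, s))" by auto
    note pw = product_along_path[OF w i]
    have ki: "integrable (time_measure t) (\<lambda>s. ?\<kappa> (w, s))" by fact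
    have ae: "AE s in lebesgue. t < s \<longrightarrow> s \<le> T \<longrightarrow> product_drift w s = ?\<kappa> (w, s)"
      by (rule AE_completion) (use elim(2,3) in eventually_elim, simp)
    have "(LINT s:{t<..T}|lebesgue. product_drift w s) = (LINT s:{t<..T}|lebesgue. ?\<kappa> (w, s))"
      unfolding set_lebesgue_integral_def
    proof (rule Bochner_Integration.integral_cong_AE)
      show "(\<lambda>s. indicator {t<..T} s *\<^sub>R product_drift w s) \<in> borel_measurable lebesgue"
        using pw by (simp add: piecewise_ac_def set_integrable_def borel_measurable_integrable)
      show "(\<lambda>s. indicator {t<..T} s *\<^sub>R ?\<kappa> (w, s)) \<in> borel_measurable lebesgue"
        using time_measure_set_integral(1)[OF ki] by (simp add: set_integrable_def borel_measurable_integrable)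
      show "AE s in lebesgue. indicator {t<..T} s *\<^sub>R product_drift w s = indicator {t<..T} s *\<^sub>R ?\<kappa> (w, s)"
        using ae by eventually_elim (simp add: indicator_def)
    qed
    also have "\<dots> = (\<integral>s. indicator {t<..T} s * ?\<kappa> (w, s) \<partial>time_measure t)"
      by (rule time_measure_set_integral(2)[OF ki]) auto
    also have "\<dots> = (\<integral>s. ?\<kappa> (w, s) \<partial>time_measure t)"
      by (rule Bochner_Integration.integral_cong) auto
    finally have d: "(LINT s:{t<..T}|lebesgue. product_drift w s) = (\<integral>s. ?\<kappa> (w, s) \<partial>time_measure t)" .
    have "L T w * (v T (X T w) + A T w) = L t w * (v t (X t w) + A t w) + (LINT s:{t<..T}|lebesgue. product_drift w s) + ?S w"
      by (rule piecewise_ac_increment[OF pw order_refl t(2) order_refl])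
    moreover have "L t w = 1" "A t w = 0" by (simp_all add: L_def A_def set_lebesgue_integral_def)
    ultimately show ?case using d elim(5) gT[OF w] by (simp add: add.commute)
  qed
  have "cost T \<nu> X P r l g t x u = (LINT w|density (P t x) (\<lambda>w. ennreal (L T w)). A T w + g (X T w))"
  proof -
    have "density (P t x) (\<lambda>w. ennreal (girsanov \<nu> X r t u T w)) = density (P t x) (\<lambda>w. ennreal (L T w))"
    proof (rule density_cong)
      show "(\<lambda>w. ennreal (girsanov \<nu> X r t u T w)) \<in> borel_measurable (P t x)"
        using LT girsanov_eq t x by (subst measurable_cong[of _ _ "\<lambda>w. ennreal (L T w)"]) auto
    qed (use LT girsanov_eq t x in \<open>auto intro: AE_I2\<close>)
    then show ?thesis by (simp add: cost_def controlled_prob_def A_def run_def)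
  qed
  also have "\<dots> = (LINT w|P t x. L T w *\<^sub>R (A T w + g (X T w)))"
    using L_bounds(1)[OF _ t(2) order_refl] t x by (intro integral_density gm LT AE_I2) auto
  also have "\<dots> = (LINT w|P t x. v t x + (\<integral>s. ?\<kappa> (w, s) \<partial>time_measure t) + ?S w)"
  proof (rule Bochner_Integration.integral_cong_AE)
    show "(\<lambda>w. L T w *\<^sub>R (A T w + g (X T w))) \<in> borel_measurable (P t x)" using LT gm by measurable
    show "(\<lambda>w. v t x + (\<integral>s. ?\<kappa> (w, s) \<partial>time_measure t) + ?S w) \<in> borel_measurable (P t x)"
      using borel_measurable_integrable[OF PT_integrable_section(2)[OF t(1) x \<kappa>]] borel_measurable_integrable[OF S(1)] by measurable
  qed (use path in simp)
  also have "\<dots> = (LINT w|P t x. v t x + (\<integral>s. ?\<kappa> (w, s) \<partial>time_measure t)) + (LINT w|P t x. ?S w)"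
    by (rule Bochner_Integration.integral_add[OF Bochner_Integration.integrable_add[OF P.integrable_const PT_integrable_section(2)[OF t(1) x \<kappa>]] S(1)])
  also have "(LINT w|P t x. v t x + (\<integral>s. ?\<kappa> (w, s) \<partial>time_measure t)) = v t x + (\<integral>p. ?\<kappa> p \<partial>PT t x)"
    by (subst Bochner_Integration.integral_add[OF P.integrable_const PT_integrable_section(2)[OF t(1) x \<kappa>]])
      (simp only: PT_integrable_section(3)[OF t(1) x \<kappa>] P.prob_space lebesgue_integral_const scaleR_one)
  also have "(LINT w|P t x. ?S w) = (\<integral>p. jump_mean p \<partial>PT t x)" by (rule S(2))
  also have "v t x + (\<integral>p. ?\<kappa> p \<partial>PT t x) + (\<integral>p. jump_mean p \<partial>PT t x) = v t x + (\<integral>p. ?\<delta> p \<partial>PT t x)"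
    by (subst Bochner_Integration.integral_diff[OF di jm]) simp
  finally show "cost T \<nu> X P r l g t x u = v t x + (\<integral>p. ?\<delta> p \<partial>PT t x)" .
qed

end

section \<open>Verification\<close>

text \<open>Along a minimising control the Hamiltonian coincides with a jointly measurable function;
  this is how the substitute \<open>b\<close> of \<open>cost_identity\<close> is found.\<close>

lemma (in admissible_control) drift_cost_minimal:
  assumes "AE w in P t x. AE s in lborel. s \<in> {t..T} \<longrightarrow>
    u s w \<in> minimizers U \<nu> r l s (left_lim X s w) (\<lambda>y. v s y - v s (left_lim X s w))"
  shows "AE w in P t x. AE s in lborel. t < s \<longrightarrow> s \<le> T \<longrightarrow>
    hamiltonian U \<nu> r l s (X s w) (\<lambda>y. v s y - v s (X s w)) = drift_cost (w, s)"
  using assms AE_space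
proof eventually_elim
  case (elim w)
  then have w: "w \<in> \<Omega>" using t x by simp
  show ?case using elim(1) left_lim_AE[OF w]
    by eventually_elim (use t in \<open>auto simp: minimizers_def drift_cost_def\<close>)
qed

context control_problem
begin

lemma admissible_controlI:
  assumes "0 \<le> t" "t \<le> T" "x \<in> space K" "u \<in> admissible T K \<Omega> X U t" "1 < \<alpha>"
    and "(\<integral>\<^sup>+w. ennreal_powr (\<integral>\<^sup>+s\<in>{t<..T}. ennreal \<bar>l s (X s w) (u s w)\<bar> \<partial>lborel) \<alpha> \<partial>P t x) < \<infinity>"
  shows "admissible_control T K \<nu> \<Omega> X P U r g l C v t x u \<alpha>"
  by unfold_locales (use assms in auto)

text \<open>With its own drift cost as \<open>b\<close>, the excess integrand in
  \<open>cost_identity\<close> is identically 0.\<close>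

lemma cost_minimizer:
  assumes "admissible_control T K \<nu> \<Omega> X P U r g l C v t x u \<alpha>"
    and min: "AE w in P t x. AE s in lborel. s \<in> {t..T} \<longrightarrow>
      u s w \<in> minimizers U \<nu> r l s (left_lim X s w) (\<lambda>y. v s y - v s (left_lim X s w))"
  shows "cost T \<nu> X P r l g t x u = v t x"
proof -
  interpret admissible_control T K \<nu> \<Omega> X P U r g l C v t x u \<alpha> by fact
  show ?thesis
    using cost_identity(1)[OF drift_cost_measurable drift_cost_integrable drift_cost_minimal[OF min]] by simp
qed

text \<open>The Hamiltonian is represented by the drift cost of the minimising control
  \<open>u'\<close>. Its integrability carries over to the control \<open>u\<close> because
  \<open>density_bound\<close> is the same for both.\<close>

lemma cost_lower_bound:
  assumes "admissible_control T K \<nu> \<Omega> X P U r g l C v t x u \<alpha>" "admissible_control T K \<nu> \<Omega> X P U r g l C v t x u' \<alpha>"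
    and min: "AE w in P t x. AE s in lborel. s \<in> {t..T} \<longrightarrow>
      u' s w \<in> minimizers U \<nu> r l s (left_lim X s w) (\<lambda>y. v s y - v s (left_lim X s w))"
  shows "v t x \<le> cost T \<nu> X P r l g t x u"
proof -
  interpret admissible_control T K \<nu> \<Omega> X P U r g l C v t x u \<alpha> by fact
  interpret S: admissible_control T K \<nu> \<Omega> X P U r g l C v t x u' \<alpha> by fact
  note m = S.drift_cost_minimal[OF min]
  note cost = cost_identity[OF S.drift_cost_measurable S.drift_cost_integrable m]
  have "AE p in PT t x. S.drift_cost p \<le> drift_cost p"
  proof (rule PT_AE_I[OF t(1) x])
    show "{p \<in> space (PT t x). S.drift_cost p \<le> drift_cost p} \<in> sets (PT t x)"
      using S.drift_cost_measurable drift_cost_measurable by measurable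
    show "AE w in P t x. AE s in lborel. t < s \<longrightarrow> s \<le> T \<longrightarrow> S.drift_cost (w, s) \<le> drift_cost (w, s)"
      using m PT_AE_D[OF t(1) x value_difference_finite(3)[OF v t x]] AE_space
    proof eventually_elim
      case (elim w)
      then have w: "w \<in> \<Omega>" using t x by simp
      show ?case using elim(1,2)
      proof eventually_elim
        case (elim s)
        show ?case
        proof (intro impI)
          assume s: "t < s" "s \<le> T"
          then have s0: "0 \<le> s" using t by simp
          have Xs: "X s w \<in> space K" by (rule path_range[OF s0 w])
          have "integrable (\<nu> s (X s w)) (\<lambda>y. v s y - v s (X s w))"
            using elim(2) s by (intro square_integrable_integrable(1)[OF finite_measure_rate[OF s0 s(2) Xs]]) simp
          from hamiltonian_le[OF s0 s(2) Xs this u_space[OF w]] s elim(1)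
          show "S.drift_cost (w, s) \<le> drift_cost (w, s)" by (simp add: drift_cost_def)
        qed
      qed
    qed
  qed
  with AE_space have "AE p in PT t x. 0 \<le> L' p * (drift_cost p - S.drift_cost p)"
  proof eventually_elim
    case (elim p)
    have "0 \<le> L' p" using L'_bounds(1)[of "fst p" "snd p"] PT_rate[OF elim(1)] by simp
    then show ?case using elim(2) by simp
  qed
  then have "0 \<le> (\<integral>p. L' p * (drift_cost p - S.drift_cost p) \<partial>PT t x)" by (rule integral_nonneg_AE)
  then show ?thesis using cost(1) by simp
qed

end

theorem corollary5p8:
  fixes T :: real
    and K :: "'k measure"
    and \<nu> :: "real \<Rightarrow> 'k \<Rightarrow> 'k measure"
    and \<Omega> :: "'w set"
    and X :: "real \<Rightarrow> 'w \<Rightarrow> 'k"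
    and P :: "real \<Rightarrow> 'k \<Rightarrow> 'w measure"
    and U :: "'u measure"
    and r :: "real \<Rightarrow> 'k \<Rightarrow> 'k \<Rightarrow> 'u \<Rightarrow> real"
    and g :: "'k \<Rightarrow> real"
    and l :: "real \<Rightarrow> 'k \<Rightarrow> 'u \<Rightarrow> real"
    and C\<^sub>r \<alpha> :: real
    and v :: "real \<Rightarrow> 'k \<Rightarrow> real"
    and ustar :: "real \<Rightarrow> 'k \<Rightarrow> real \<Rightarrow> 'w \<Rightarrow> 'u"
    and Y :: "real \<Rightarrow> 'k \<Rightarrow> real \<Rightarrow> 'w \<Rightarrow> real"
    and Z :: "real \<Rightarrow> 'k \<Rightarrow> real \<Rightarrow> 'w \<Rightarrow> 'k \<Rightarrow> real"
  assumes setting: "markov_jump_process T K \<nu> \<Omega> X P"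
    and r_measurable: "(\<lambda>(t, x, y, u). r t x y u)
          \<in> borel_measurable (restrict_space borel {0..T} \<Otimes>\<^sub>M K \<Otimes>\<^sub>M K \<Otimes>\<^sub>M U)"
    and C\<^sub>r_pos: "C\<^sub>r > 0"
    and r_bounds: "\<forall>t\<in>{0..T}. \<forall>x\<in>space K. \<forall>y\<in>space K. \<forall>u\<in>space U.
          0 \<le> r t x y u \<and> r t x y u \<le> C\<^sub>r"
    and g_measurable: "g \<in> borel_measurable K"
    and g_moment: "\<forall>t\<in>{0..T}. \<forall>x\<in>space K.
          (\<integral>\<^sup>+\<omega>. ennreal (\<bar>g (X T \<omega>)\<bar>\<^sup>2) \<partial>P t x) < \<infinity>"
    and l_measurable: "(\<lambda>(t, x, u). l t x u)
          \<in> borel_measurable (restrict_space borel {0..T} \<Otimes>\<^sub>M K \<Otimes>\<^sub>M U)"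
    and \<alpha>_gt_1: "\<alpha> > 1"
    and l_conditions: "\<forall>t\<in>{0..T}. \<forall>x\<in>space K. \<forall>u\<in>admissible T K \<Omega> X U t.
          bdd_below (l t x ` space U)
          \<and> (\<integral>\<^sup>+\<omega>. (\<integral>\<^sup>+s\<in>{t<..T}. ennreal (\<bar>INF a\<in>space U. l s (X s \<omega>) a\<bar>\<^sup>2) \<partial>lebesgue) \<partial>P t x)
              < \<infinity>
          \<and> (\<integral>\<^sup>+\<omega>. ennreal_powr (\<integral>\<^sup>+s\<in>{t<..T}. ennreal \<bar>l s (X s \<omega>) (u s \<omega>)\<bar> \<partial>lborel) \<alpha> \<partial>P t x)
              < \<infinity>"
    and v_solution: "hjb_solution T K \<nu> X P g (hamiltonian U \<nu> r l) v"
    and minimizers_nonempty: "\<forall>s\<in>{0..T}. \<forall>x\<in>space K. \<forall>z\<in>square_integrable (\<nu> s x).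
          minimizers U \<nu> r l s x z \<noteq> {}"
    and ustar: "\<forall>t\<in>{0..T}. \<forall>x\<in>space K.
          ustar t x \<in> admissible T K \<Omega> X U t
          \<and> (AE \<omega> in P t x. AE s in lborel. s \<in> {t..T} \<longrightarrow>
               ustar t x s \<omega> \<in> minimizers U \<nu> r l s (left_lim X s \<omega>)
                                 (\<lambda>y. v s y - v s (left_lim X s \<omega>)))"
    and YZ_solution: "\<forall>t\<in>{0..T}. \<forall>x\<in>space K.
          bsde_solution T K \<nu> \<Omega> X P g (hamiltonian U \<nu> r l) t x (Y t x) (Z t x)"
  shows "\<forall>t\<in>{0..T}. \<forall>x\<in>space K.
      (AE \<omega> in P t x. \<forall>s\<in>{t..T}. Y t x s \<omega> = v s (X s \<omega>))
    \<and> (\<integral>\<^sup>+\<omega>. (\<integral>\<^sup>+s\<in>{t<..T}.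
         (\<integral>\<^sup>+y. ennreal (\<bar>Z t x s \<omega> y - v s y + v s (left_lim X s \<omega>)\<bar>\<^sup>2)
            \<partial>\<nu> s (left_lim X s \<omega>)) \<partial>lborel) \<partial>P t x) = 0
    \<and> (AE \<omega> in P t x. v t x = Y t x t \<omega>)
    \<and> value_fun T K \<nu> \<Omega> X P U r l g t x = ereal (v t x)
    \<and> (AE \<omega> in P t x. AE s in lborel. s \<in> {t..T} \<longrightarrow>
         ustar t x s \<omega> \<in> minimizers U \<nu> r l s (left_lim X s \<omega>) (Z t x s \<omega>))
    \<and> optimal_control T K \<nu> \<Omega> X P U r l g t x (ustar t x)
    \<and> (\<forall>u\<in>admissible T K \<Omega> X U t.
         (AE \<omega> in P t x. AE s in lborel. s \<in> {t..T} \<longrightarrow>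
            u s \<omega> \<in> minimizers U \<nu> r l s (left_lim X s \<omega>) (Z t x s \<omega>))
         \<longrightarrow> optimal_control T K \<nu> \<Omega> X P U r l g t x u)"
proof (intro ballI)
  fix t x assume tT: "t \<in> {0..T}" and x: "x \<in> space K"
  then have t: "0 \<le> t" "t \<le> T" by auto
  interpret markov_jump_process T K \<nu> \<Omega> X P by (rule setting)
  let ?us = "ustar t x"
  have us: "?us \<in> admissible T K \<Omega> X U t" using ustar tT x by blast
  have us_min: "AE w in P t x. AE s in lborel. s \<in> {t..T} \<longrightarrow>
      ?us s w \<in> minimizers U \<nu> r l s (left_lim X s w) (\<lambda>y. v s y - v s (left_lim X s w))"
    using ustar tT x by blast
  obtain w\<^sub>0 where "w\<^sub>0 \<in> \<Omega>" using space_nonempty[OF t(1) x] by blast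
  \<comment> \<open>An admissible control is given, and any of its values lies in
    \<open>U\<close>.\<close>
  then have U: "space U \<noteq> {}"
    using us measurable_space[of "\<lambda>(w, s). ?us s w" "Pred t" U "(w\<^sub>0, t)"] t by (auto simp: admissible_def)
  \<comment> \<open>\<open>l_conditions\<close> is stated for admissible controls; for the pair
    \<open>(s, y)\<close> the control \<open>ustar s y\<close> provides the required
    instance.\<close>
  have bdd: "bdd_below (l s y ` space U)" if "0 \<le> s" "s \<le> T" "y \<in> space K" for s y
    using l_conditions ustar that by (meson atLeastAtMost_iff)
  interpret control_problem T K \<nu> \<Omega> X P U r g l C\<^sub>r v
    by unfold_locales (use r_measurable C\<^sub>r_pos r_bounds l_measurable U bdd v_solution in auto)
  have sol: "bsde_solution T K \<nu> \<Omega> X P g (hamiltonian U \<nu> r l) t x (Y t x) (Z t x)"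
    using YZ_solution tT x by blast
  note Y_eq = bsde_solution_value[OF t x sol]
  have adm: "admissible_control T K \<nu> \<Omega> X P U r g l C\<^sub>r v t x u \<alpha>" if "u \<in> admissible T K \<Omega> X U t" for u
    using l_conditions tT x that by (intro admissible_controlI t x that \<alpha>_gt_1) blast
  have value_eq: "value_fun T K \<nu> \<Omega> X P U r l g t x = ereal (v t x)"
    unfolding value_fun_def
  proof (rule antisym)
    show "(INF u\<in>admissible T K \<Omega> X U t. ereal (cost T \<nu> X P r l g t x u)) \<le> ereal (v t x)"
      using cost_minimizer[OF adm[OF us] us_min] by (intro INF_lower2[OF us]) simp
    show "ereal (v t x) \<le> (INF u\<in>admissible T K \<Omega> X U t. ereal (cost T \<nu> X P r l g t x u))"
      using cost_lower_bound[OF adm adm[OF us] us_min] by (intro INF_greatest) simp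
  qed
  have optimal: "optimal_control T K \<nu> \<Omega> X P U r l g t x u"
    if u: "u \<in> admissible T K \<Omega> X U t" and "AE w in P t x. AE s in lborel. s \<in> {t..T} \<longrightarrow>
      u s w \<in> minimizers U \<nu> r l s (left_lim X s w) (\<lambda>y. v s y - v s (left_lim X s w))" for u
    using cost_minimizer[OF adm[OF u] that(2)] u value_eq by (simp add: optimal_control_def)
  \<comment> \<open>Minimisers for \<open>Z\<close> and for the increments of \<open>v\<close>
    coincide for almost every path and time, so each of the two conditions on a control can replace
    the other.\<close>
  have transfer: "(AE w in P t x. AE s in lborel. s \<in> {t..T} \<longrightarrow> u s w \<in> minimizers U \<nu> r l s (left_lim X s w) (Z t x s w))
    \<longleftrightarrow> (AE w in P t x. AE s in lborel. s \<in> {t..T} \<longrightarrow>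
      u s w \<in> minimizers U \<nu> r l s (left_lim X s w) (\<lambda>y. v s y - v s (left_lim X s w)))" for u
  proof -
    have "AE w in P t x. (AE s in lborel. s \<in> {t..T} \<longrightarrow> u s w \<in> minimizers U \<nu> r l s (left_lim X s w) (Z t x s w))
      \<longleftrightarrow> (AE s in lborel. s \<in> {t..T} \<longrightarrow> u s w \<in> minimizers U \<nu> r l s (left_lim X s w) (\<lambda>y. v s y - v s (left_lim X s w)))"
      using bsde_solution_minimizers[OF t x sol]
    proof eventually_elim
      case (elim w)
      show ?case by (rule eventually_subst, use elim in eventually_elim) simp
    qed
    then show ?thesis by (rule eventually_subst)
  qed
  show "(AE w in P t x. \<forall>s\<in>{t..T}. Y t x s w = v s (X s w))
    \<and> (\<integral>\<^sup>+w. (\<integral>\<^sup>+s\<in>{t<..T}.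
         (\<integral>\<^sup>+y. ennreal (\<bar>Z t x s w y - v s y + v s (left_lim X s w)\<bar>\<^sup>2)
            \<partial>\<nu> s (left_lim X s w)) \<partial>lborel) \<partial>P t x) = 0
    \<and> (AE w in P t x. v t x = Y t x t w)
    \<and> value_fun T K \<nu> \<Omega> X P U r l g t x = ereal (v t x)
    \<and> (AE w in P t x. AE s in lborel. s \<in> {t..T} \<longrightarrow>
         ustar t x s w \<in> minimizers U \<nu> r l s (left_lim X s w) (Z t x s w))
    \<and> optimal_control T K \<nu> \<Omega> X P U r l g t x (ustar t x)
    \<and> (\<forall>u\<in>admissible T K \<Omega> X U t.
         (AE w in P t x. AE s in lborel. s \<in> {t..T} \<longrightarrow>
            u s w \<in> minimizers U \<nu> r l s (left_lim X s w) (Z t x s w))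
         \<longrightarrow> optimal_control T K \<nu> \<Omega> X P U r l g t x u)"
  proof (intro conjI ballI impI)
    show "AE w in P t x. v t x = Y t x t w"
      using Y_eq AE_start[OF t(1) x] by eventually_elim (use t in auto)
  qed (use Y_eq bsde_solution_integrand[OF t x sol] value_eq transfer us us_min optimal in auto)
qed

end
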